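(* Let $n,d,p,r$ be positive integers, with $p$ prime and $d\geq 3$. Let $a=(a_0,\ldots,a_{n+1})\in\mathbf{Z}_{>0}^{n+2}$ with $\gcd(a_0,\ldots,a_{n+1})=1$, with $\mathbf{P}^{n+1}_a$ well-formed and $a_i\neq d$ for all $i$. Assume that $p$ does not divide $d$, and that $a_ip$ does not divide $d-a_j$ for all $i\neq j$ in $\{0,1,\ldots,n+1\}$. Assume further that either $n\geq 3$, or $n=2$ and $a_0+a_1+a_2+a_3\neq d$. Suppose that, after possibly reordering the weights $a=(a_0,a_1,\ldots,a_{n+1})$, there exists $\ell\in\{1,2,\ldots,n+1\}$ such that the following conditions are satisfied: (i) $d\equiv a_0\pmod{a_\ell}$, and $d\equiv a_{i+1}\pmod{a_i}$ for all $0\leq i<\ell$; (ii) $\displaystyle (-1)^{\ell+1}\prod_{t=0}^{\ell}\left(\frac{d-a_t}{a_t}\right)\equiv 1\pmod{p^r}$; and (iii) there exists a well-formed quasi-smooth hypersurface $X=V(F)$ of degree $d$ in $\mathbf{P}^{n+1}_a$ with $F=F_1+F_2$, where $F_1\in\mathbf{C}[x_0,\ldots,x_\ell]$ and $F_2\in\mathbf{C}[x_{\ell+1},\ldots,x_{n+1}]$. Then $p^r$ is the order of an automorphism of some well-formed quasi-smooth hypersurface of degree $d$ in $\mathbf{P}^{n+1}_a$.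
   Context: The base field is $\mathbf{C}$. For $a=(a_0,\ldots,a_{n+1})\in\mathbf{Z}_{>0}^{n+2}$ with $\gcd(a_0,\ldots,a_{n+1})=1$, grade $\mathbf{C}[x_0,\ldots,x_{n+1}]$ by $\deg x_i=a_i$ and let $\mathbf{P}^{n+1}_a=\operatorname{Proj}\mathbf{C}[x_0,\ldots,x_{n+1}]$ be the weighted projective space. A hypersurface of degree $d$ in $\mathbf{P}^{n+1}_a$ is $X=V(F)$ with $F$ an irreducible homogeneous polynomial of degree $d$ for this grading. $X$ is quasi-smooth if the affine cone $\{F=0\}\subset\mathbf{A}^{n+2}$ is smooth away from the origin. $\mathbf{P}^{n+1}_a$ is well-formed if any $n+1$ of the $n+2$ weights have greatest common divisor $1$; $X$ is well-formed if $\mathbf{P}^{n+1}_a$ is well-formed and the intersection of $X$ with the singular locus of $\mathbf{P}^{n+1}_a$ has codimension at least two in $X$. $X$ is a linear cone if $d=a_i$ for some $i$. An automorphism of $X$ is an element of $\operatorname{Aut}(X)$. When $\ell=n+1$, the ring $\mathbf{C}[x_{\ell+1},\ldots,x_{n+1}]$ is $\mathbf{C}$ and $F_2=0$. *)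

theory Defs
  imports
    Complex_Main
    "HOL-Library.Poly_Mapping"
    "HOL-Library.Extended_Nat"
    "HOL-Combinatorics.Permutations"
    "HOL-Number_Theory.Cong"
    "HOL-Algebra.Bij"
    "HOL-Algebra.Multiplicative_Group"
    "HOL-Analysis.Abstract_Topology"
begin

section \<open>Complex polynomials in the variables \<open>x_0, x_1, \<dots>\<close>\<close>

text \<open>A monomial is its finitely supported exponent vector.  All polynomials live in one ring with
  countably many variables; \<open>C[x_i | i \<in> I]\<close> is the subring \<open>polys_in I\<close>.\<close>

type_synonym cpoly = "(nat \<Rightarrow>\<^sub>0 nat) \<Rightarrow>\<^sub>0 complex"

definition vars :: "cpoly \<Rightarrow> nat set" where
  "vars F = (\<Union>m\<in>Poly_Mapping.keys F. Poly_Mapping.keys m)"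

definition polys_in :: "nat set \<Rightarrow> cpoly set" where
  "polys_in I = {F. vars F \<subseteq> I}"

definition peval :: "cpoly \<Rightarrow> (nat \<Rightarrow> complex) \<Rightarrow> complex" where
  "peval F x = (\<Sum>m\<in>Poly_Mapping.keys F. Poly_Mapping.lookup F m *
     (\<Prod>i\<in>Poly_Mapping.keys m. x i ^ Poly_Mapping.lookup m i))"

definition partial_deriv :: "nat \<Rightarrow> cpoly \<Rightarrow> cpoly" where
  "partial_deriv i F = (\<Sum>m\<in>Poly_Mapping.keys F.
     Poly_Mapping.single (m - Poly_Mapping.single i 1)
       (of_nat (Poly_Mapping.lookup m i) * Poly_Mapping.lookup F m))"

definition wdegree :: "(nat \<Rightarrow> nat) \<Rightarrow> (nat \<Rightarrow>\<^sub>0 nat) \<Rightarrow> nat" where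
  "wdegree a m = (\<Sum>i\<in>Poly_Mapping.keys m. a i * Poly_Mapping.lookup m i)"

text \<open>Throughout, \<open>N\<close> is the dimension of the weighted projective space \<open>P(a_0,\<dots>,a_N)\<close>; only the
  values \<open>a i\<close> for \<open>i \<le> N\<close> matter.  As usual, \<open>0\<close> is homogeneous of every degree.\<close>

definition whomogeneous :: "nat \<Rightarrow> (nat \<Rightarrow> nat) \<Rightarrow> nat \<Rightarrow> cpoly \<Rightarrow> bool" where
  "whomogeneous N a k F \<longleftrightarrow>
     F \<in> polys_in {..N} \<and> (\<forall>m\<in>Poly_Mapping.keys F. wdegree a m = k)"

section \<open>Weighted projective space as a classical variety\<close>

text \<open>Since the base field is algebraically closed and everything below is reduced, varieties are
  rendered by their closed points, Zariski topology and sheaf of regular functions.  A point of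
  \<open>P(a_0,\<dots>,a_N)\<close> is an orbit of the weighted action of \<open>C\<^sup>*\<close> on \<open>C\<^bsup>N+1\<^esup> - {0}\<close>;
  vectors of \<open>C\<^bsup>N+1\<^esup>\<close> are functions on \<open>nat\<close> vanishing beyond \<open>N\<close>.\<close>

definition punctured_space :: "nat \<Rightarrow> (nat \<Rightarrow> complex) set" where
  "punctured_space N = {x. (\<forall>i>N. x i = 0) \<and> (\<exists>i. x i \<noteq> 0)}"

definition worbit_rel :: "nat \<Rightarrow> (nat \<Rightarrow> nat) \<Rightarrow> ((nat \<Rightarrow> complex) \<times> (nat \<Rightarrow> complex)) set" where
  "worbit_rel N a = {(x, y). x \<in> punctured_space N \<and> y \<in> punctured_space N \<and>
     (\<exists>t. t \<noteq> 0 \<and> (\<forall>i\<le>N. y i = t ^ a i * x i))}"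

type_synonym wpoint = "(nat \<Rightarrow> complex) set"

definition wproj :: "nat \<Rightarrow> (nat \<Rightarrow> nat) \<Rightarrow> wpoint set" where
  "wproj N a = punctured_space N // worbit_rel N a"

text \<open>The sets \<open>D_+(f)\<close> and \<open>V(f)\<close>; used for homogeneous \<open>f\<close> only, where vanishing does not depend
  on the representative.\<close>

definition basic_open :: "nat \<Rightarrow> (nat \<Rightarrow> nat) \<Rightarrow> cpoly \<Rightarrow> wpoint set" where
  "basic_open N a f = {P \<in> wproj N a. \<forall>x\<in>P. peval f x \<noteq> 0}"

definition zero_locus :: "nat \<Rightarrow> (nat \<Rightarrow> nat) \<Rightarrow> cpoly \<Rightarrow> wpoint set" where
  "zero_locus N a f = {P \<in> wproj N a. \<forall>x\<in>P. peval f x = 0}"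

definition zariski :: "nat \<Rightarrow> (nat \<Rightarrow> nat) \<Rightarrow> wpoint topology" where
  "zariski N a = topology_generated_by {basic_open N a f | f k. whomogeneous N a k f}"

abbreviation zariski_on :: "nat \<Rightarrow> (nat \<Rightarrow> nat) \<Rightarrow> wpoint set \<Rightarrow> wpoint topology" where
  "zariski_on N a X \<equiv> subtopology (zariski N a) X"

text \<open>\<open>regular_on N a X U f\<close>: \<open>f\<close> is a regular function on the open subset \<open>U\<close> of the closed
  subvariety \<open>X\<close>, i.e. locally a quotient of homogeneous polynomials of equal degree.\<close>

definition regular_on ::
  "nat \<Rightarrow> (nat \<Rightarrow> nat) \<Rightarrow> wpoint set \<Rightarrow> wpoint set \<Rightarrow> (wpoint \<Rightarrow> complex) \<Rightarrow> bool" where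
  "regular_on N a X U f \<longleftrightarrow> openin (zariski_on N a X) U \<and>
     (\<forall>P\<in>U. \<exists>W k g h. openin (zariski_on N a X) W \<and> P \<in> W \<and> W \<subseteq> U \<and>
        whomogeneous N a k g \<and> whomogeneous N a k h \<and>
        (\<forall>Q\<in>W. \<forall>x\<in>Q. peval h x \<noteq> 0 \<and> f Q = peval g x / peval h x))"

definition var_morphism ::
  "nat \<Rightarrow> (nat \<Rightarrow> nat) \<Rightarrow> wpoint set \<Rightarrow> wpoint set \<Rightarrow> (wpoint \<Rightarrow> wpoint) \<Rightarrow> bool" where
  "var_morphism N a X Y \<phi> \<longleftrightarrow> \<phi> \<in> X \<rightarrow> Y \<and>
     continuous_map (zariski_on N a X) (zariski_on N a Y) \<phi> \<and>
     (\<forall>V f. regular_on N a Y V f \<longrightarrow> regular_on N a X {P \<in> X. \<phi> P \<in> V} (f \<circ> \<phi>))"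

text \<open>\<open>Aut(X)\<close>, as a subgroup of the group of permutations of the closed points of \<open>X\<close>.\<close>

definition var_Aut :: "nat \<Rightarrow> (nat \<Rightarrow> nat) \<Rightarrow> wpoint set \<Rightarrow> (wpoint \<Rightarrow> wpoint) monoid" where
  "var_Aut N a X = (BijGroup X)\<lparr>carrier :=
     {\<phi> \<in> Bij X. var_morphism N a X X \<phi> \<and> var_morphism N a X X (inv_into X \<phi>)}\<rparr>"

section \<open>Codimension and singular points\<close>

definition irreducible_closed :: "'a topology \<Rightarrow> 'a set \<Rightarrow> bool" where
  "irreducible_closed T Z \<longleftrightarrow> closedin T Z \<and> Z \<noteq> {} \<and>
     (\<forall>A B. closedin T A \<and> closedin T B \<and> Z \<subseteq> A \<union> B \<longrightarrow> Z \<subseteq> A \<or> Z \<subseteq> B)"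

text \<open>Codimension of an irreducible closed set: supremum of the lengths \<open>k\<close> of chains
  \<open>Z = c 0 \<subset> c 1 \<subset> \<dots> \<subset> c k\<close> of irreducible closed sets.  For a general closed set, the infimum over
  its irreducible closed subsets (so the empty set has codimension \<open>\<infinity>\<close>).\<close>

definition irreducible_codim :: "'a topology \<Rightarrow> 'a set \<Rightarrow> enat" where
  "irreducible_codim T Z = (SUP k \<in> {k. \<exists>c. c 0 = Z \<and> (\<forall>i\<le>k. irreducible_closed T (c i)) \<and>
     (\<forall>i<k. c i \<subset> c (Suc i))}. enat k)"

definition codim :: "'a topology \<Rightarrow> 'a set \<Rightarrow> enat" where
  "codim T Z = (INF Z' \<in> {Z'. irreducible_closed T Z' \<and> Z' \<subseteq> Z}. irreducible_codim T Z')"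

text \<open>A point \<open>P\<close> of the \<open>N\<close>-dimensional variety \<open>P(a_0,\<dots>,a_N)\<close> is nonsingular if its local ring,
  which has dimension \<open>N\<close>, is regular: its maximal ideal is generated by \<open>N\<close> elements.  Spelled out
  on representatives of germs: there are \<open>N\<close> regular functions near \<open>P\<close>, vanishing at \<open>P\<close>, such that
  every regular function near \<open>P\<close> vanishing at \<open>P\<close> is, near \<open>P\<close>, a combination of them with regular
  coefficients.\<close>

definition nonsingular_point :: "nat \<Rightarrow> (nat \<Rightarrow> nat) \<Rightarrow> wpoint \<Rightarrow> bool" where
  "nonsingular_point N a P \<longleftrightarrow>
     (\<exists>U t. P \<in> U \<and> (\<forall>i<N. regular_on N a (wproj N a) U (t i) \<and> t i P = 0) \<and>
        openin (zariski N a) U \<and>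
        (\<forall>V f. P \<in> V \<and> regular_on N a (wproj N a) V f \<and> f P = 0 \<longrightarrow>
          (\<exists>W u. P \<in> W \<and> W \<subseteq> U \<inter> V \<and> openin (zariski N a) W \<and>
             (\<forall>i<N. regular_on N a (wproj N a) W (u i)) \<and>
             (\<forall>Q\<in>W. f Q = (\<Sum>i<N. u i Q * t i Q)))))"

definition singular_locus :: "nat \<Rightarrow> (nat \<Rightarrow> nat) \<Rightarrow> wpoint set" where
  "singular_locus N a = {P \<in> wproj N a. \<not> nonsingular_point N a P}"

section \<open>Hypersurfaces\<close>

text \<open>A divisor of a nonzero polynomial involves only variables of that polynomial, so irreducibility
  in the ring with countably many variables is irreducibility in \<open>C[x_0,\<dots>,x_N]\<close>.\<close>

definition hypersurface_eq :: "nat \<Rightarrow> (nat \<Rightarrow> nat) \<Rightarrow> nat \<Rightarrow> cpoly \<Rightarrow> bool" where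
  "hypersurface_eq N a d F \<longleftrightarrow> whomogeneous N a d F \<and> Factorial_Ring.irreducible F"

text \<open>Smoothness of the affine cone away from the origin is the Jacobian criterion for the
  generator \<open>F\<close> of its (prime) ideal.\<close>

definition quasi_smooth :: "nat \<Rightarrow> cpoly \<Rightarrow> bool" where
  "quasi_smooth N F \<longleftrightarrow>
     (\<forall>x\<in>punctured_space N. peval F x = 0 \<longrightarrow> (\<exists>i\<le>N. peval (partial_deriv i F) x \<noteq> 0))"

definition well_formed_space :: "nat \<Rightarrow> (nat \<Rightarrow> nat) \<Rightarrow> bool" where
  "well_formed_space N a \<longleftrightarrow> (\<forall>i\<le>N. Gcd (a ` ({..N} - {i})) = 1)"

definition well_formed_hypersurface :: "nat \<Rightarrow> (nat \<Rightarrow> nat) \<Rightarrow> cpoly \<Rightarrow> bool" where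
  "well_formed_hypersurface N a F \<longleftrightarrow> well_formed_space N a \<and>
     2 \<le> codim (zariski_on N a (zero_locus N a F)) (zero_locus N a F \<inter> singular_locus N a)"

definition wf_qs_hypersurface :: "nat \<Rightarrow> (nat \<Rightarrow> nat) \<Rightarrow> nat \<Rightarrow> cpoly \<Rightarrow> bool" where
  "wf_qs_hypersurface N a d F \<longleftrightarrow>
     hypersurface_eq N a d F \<and> quasi_smooth N F \<and> well_formed_hypersurface N a F"

section \<open>\<open>Aut(X)\<close> is a group\<close>

lemma regular_on_cong:
  assumes "regular_on N a X U f" "\<And>P. P \<in> U \<Longrightarrow> f P = g P"
  shows "regular_on N a X U g"
  unfolding regular_on_def
proof (intro conjI ballI)
  show "openin (zariski_on N a X) U" using assms(1) by (simp add: regular_on_def)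
next
  fix P assume "P \<in> U"
  then obtain W k p q where W: "openin (zariski_on N a X) W" "P \<in> W" "W \<subseteq> U"
      "whomogeneous N a k p" "whomogeneous N a k q"
      "\<forall>Q\<in>W. \<forall>x\<in>Q. peval q x \<noteq> 0 \<and> f Q = peval p x / peval q x"
    using assms(1) unfolding regular_on_def by meson
  then show "\<exists>W k p q. openin (zariski_on N a X) W \<and> P \<in> W \<and> W \<subseteq> U \<and>
        whomogeneous N a k p \<and> whomogeneous N a k q \<and>
        (\<forall>Q\<in>W. \<forall>x\<in>Q. peval q x \<noteq> 0 \<and> g Q = peval p x / peval q x)"
    using assms(2) by (metis subsetD)
qed

lemma regular_on_subset: "regular_on N a X U f \<Longrightarrow> U \<subseteq> X"
  unfolding regular_on_def using openin_subset[of "zariski_on N a X" U] by auto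

lemma var_morphism_cong:
  assumes "var_morphism N a X Y \<phi>" "\<And>P. P \<in> X \<Longrightarrow> \<phi> P = \<psi> P"
  shows "var_morphism N a X Y \<psi>"
  unfolding var_morphism_def
proof (intro conjI allI impI)
  have "\<phi> \<in> X \<rightarrow> Y" using assms(1) by (simp add: var_morphism_def)
  then show "\<psi> \<in> X \<rightarrow> Y" using assms(2) by (metis Pi_cong)
  show "continuous_map (zariski_on N a X) (zariski_on N a Y) \<psi>"
    using assms by (auto simp: var_morphism_def intro: continuous_map_eq)
  fix V f assume "regular_on N a Y V f"
  then have "regular_on N a X {P \<in> X. \<phi> P \<in> V} (f \<circ> \<phi>)"
    using assms(1) by (simp add: var_morphism_def)
  moreover have "{P \<in> X. \<phi> P \<in> V} = {P \<in> X. \<psi> P \<in> V}" using assms(2) by auto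
  ultimately show "regular_on N a X {P \<in> X. \<psi> P \<in> V} (f \<circ> \<psi>)"
    using assms(2) by (auto intro: regular_on_cong)
qed

lemma var_morphism_id: "var_morphism N a X X (\<lambda>P. P)"
proof -
  have "regular_on N a X {P \<in> X. P \<in> V} (f \<circ> (\<lambda>P. P))" if "regular_on N a X V f" for V f
  proof -
    have "{P \<in> X. P \<in> V} = V" using regular_on_subset[OF that] by auto
    then show ?thesis using that by (simp add: o_def)
  qed
  then show ?thesis by (auto simp: var_morphism_def)
qed

lemma var_morphism_compose:
  assumes "var_morphism N a X Y \<phi>" "var_morphism N a Y Z \<psi>"
  shows "var_morphism N a X Z (\<psi> \<circ> \<phi>)"
  unfolding var_morphism_def
proof (intro conjI allI impI)
  show "\<psi> \<circ> \<phi> \<in> X \<rightarrow> Z" using assms by (auto simp: var_morphism_def)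
  show "continuous_map (zariski_on N a X) (zariski_on N a Z) (\<psi> \<circ> \<phi>)"
    using assms by (auto simp: var_morphism_def intro: continuous_map_compose)
  fix V f assume "regular_on N a Z V f"
  then have "regular_on N a X {P \<in> X. \<phi> P \<in> {Q \<in> Y. \<psi> Q \<in> V}} ((f \<circ> \<psi>) \<circ> \<phi>)"
    using assms unfolding var_morphism_def by blast
  moreover have "{P \<in> X. \<phi> P \<in> {Q \<in> Y. \<psi> Q \<in> V}} = {P \<in> X. (\<psi> \<circ> \<phi>) P \<in> V}"
    using assms(1) by (auto simp: var_morphism_def)
  ultimately show "regular_on N a X {P \<in> X. (\<psi> \<circ> \<phi>) P \<in> V} (f \<circ> (\<psi> \<circ> \<phi>))"
    by (simp add: o_assoc)
qed

lemma subgroup_var_Aut: "subgroup (carrier (var_Aut N a X)) (BijGroup X)"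
proof -
  let ?H = "carrier (var_Aut N a X)"
  have H: "\<phi> \<in> ?H \<longleftrightarrow> \<phi> \<in> Bij X \<and> var_morphism N a X X \<phi> \<and> var_morphism N a X X (inv_into X \<phi>)"
    for \<phi> by (simp add: var_Aut_def)
  show ?thesis
  proof (rule group.subgroupI[OF group_BijGroup])
    show "?H \<subseteq> carrier (BijGroup X)" by (auto simp: H BijGroup_def)
    have "inv_into X (\<lambda>P\<in>X. P) P = P" if "P \<in> X" for P
      using that by (intro inv_into_f_eq) (auto simp: inj_on_def)
    then have "(\<lambda>P\<in>X. P) \<in> ?H"
      using id_Bij[of X] var_morphism_id[of N a X] by (auto simp: H intro: var_morphism_cong)
    then show "?H \<noteq> {}" by blast
  next
    fix \<phi> assume \<phi>: "\<phi> \<in> ?H"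
    then have B: "\<phi> \<in> Bij X" and bij: "bij_betw \<phi> X X" by (auto simp: H Bij_def)
    have inv: "inv\<^bsub>BijGroup X\<^esub> \<phi> = restrict (inv_into X \<phi>) X"
      using B by (rule inv_BijGroup)
    have R: "restrict (inv_into X \<phi>) X \<in> Bij X" using B by (rule restrict_inv_into_Bij)
    have "inv_into X (restrict (inv_into X \<phi>) X) P = \<phi> P" if "P \<in> X" for P
    proof (rule inv_into_f_eq)
      show "inj_on (restrict (inv_into X \<phi>) X) X" using R by (auto simp: Bij_def bij_betw_def)
      show "\<phi> P \<in> X" using bij that by (auto simp: bij_betw_def)
      then show "restrict (inv_into X \<phi>) X (\<phi> P) = P"
        using bij that by (simp add: bij_betw_def)
    qed
    then show "inv\<^bsub>BijGroup X\<^esub> \<phi> \<in> ?H"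
      unfolding inv using R \<phi> unfolding H
      by (metis (no_types, lifting) restrict_apply' var_morphism_cong)
  next
    fix \<phi> \<psi> assume *: "\<phi> \<in> ?H" "\<psi> \<in> ?H"
    then have B: "\<phi> \<in> Bij X" "\<psi> \<in> Bij X"
      and bij: "bij_betw \<phi> X X" "bij_betw \<psi> X X" by (auto simp: H Bij_def)
    have C: "compose X \<phi> \<psi> \<in> Bij X" using B by (rule compose_Bij)
    have "inv_into X (compose X \<phi> \<psi>) P = (inv_into X \<psi> \<circ> inv_into X \<phi>) P" if "P \<in> X" for P
    proof (rule inv_into_f_eq)
      show "inj_on (compose X \<phi> \<psi>) X" using C by (auto simp: Bij_def bij_betw_def)
      have 1: "inv_into X \<phi> P \<in> X" using bij that by (metis bij_betw_def inv_into_into)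
      then have 2: "inv_into X \<psi> (inv_into X \<phi> P) \<in> X" using bij by (metis bij_betw_def inv_into_into)
      then show "(inv_into X \<psi> \<circ> inv_into X \<phi>) P \<in> X" by simp
      show "compose X \<phi> \<psi> ((inv_into X \<psi> \<circ> inv_into X \<phi>) P) = P"
        using 1 2 bij that by (simp add: compose_def bij_betw_inv_into_right)
    qed
    moreover have "var_morphism N a X X (inv_into X \<psi> \<circ> inv_into X \<phi>)"
      "var_morphism N a X X (\<phi> \<circ> \<psi>)"
      using * by (auto simp: H intro: var_morphism_compose)
    ultimately have "compose X \<phi> \<psi> \<in> ?H"
      unfolding H using C by (auto simp: compose_def intro: var_morphism_cong)
    then show "\<phi> \<otimes>\<^bsub>BijGroup X\<^esub> \<psi> \<in> ?H" using B by (simp add: BijGroup_def)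
  qed
qed

lemma group_var_Aut: "group (var_Aut N a X)"
  using group.subgroup_imp_group[OF group_BijGroup subgroup_var_Aut[of N a X]]
  by (simp add: var_Aut_def)

end

(* With m_t = (d - a_{t+1}) / a_t (cyclic indices 0, ..., l), replace F_1 by the cyclic polynomial
   sum_t x_t^{m_t} x_{t+1}, or by sum_s x_{2s} x_{2s+1} when all m_t are 1 and l is odd.  Multiplying x_t by
   xi^{e_t}, with xi a primitive p^r-th root of unity and e_{t+1} = - m_t e_t, preserves it, because the product of
   the -m_t is 1 modulo p^r.  The new polynomial F is quasi-smooth, hence irreducible: two factors would have a
   common zero away from the origin.  The singular locus of the weighted projective space lies in coordinate
   subspaces of codimension at least two, and none of them lies in V(F): for n >= 3 by quasi-smoothness, for n = 2
   because the existence of a well-formed hypersurface forces the gcd of any two weights to divide d.  Continuity of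
   roots then provides chains of closed irreducible sets which show that V(F) is well-formed.  The order of the
   automorphism is read off at a point of V(F) with nonzero coordinates. *)
theory Submission
  imports Defs "HOL-Complex_Analysis.Complex_Analysis" "Subresultants.Subresultant_Gcd"
    "HOL-Computational_Algebra.Fundamental_Theorem_Algebra" "HOL-Computational_Algebra.Field_as_Ring"
begin

text \<open>Codimension and nonsingularity are defined by chains and by germs, so dimension counts
  are replaced by constructions: a larger irreducible set comes from nearby points off a hyperplane
  and the finite decomposition into irreducible sets; regularity comes from representatives
  normalized by a relation between two monomials of consecutive degrees; singularity comes from more
  point derivations than local parameters.

  The case n = 2 is separate because two partial derivatives are certain to have a common zero on a
  coordinate subspace only when three coordinates remain. There the given hypersurface is used
  beyond supplying F_2: if g = gcd(a_k, a_m) did not divide d, the line joining the two vertices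
  would lie in it, would be singular in the weighted projective space, and would have codimension
  one. Divisibility by g concerns the weights alone, so it passes to the new polynomial.

  The two blocks of variables never meet in a monomial, so the equations of a singular point
  separate, and the diagonal map may be taken trivial on the second block.\<close>

section \<open>Evaluation of polynomials in commutative rings\<close>

lemma prod_pow_superset:
  fixes x :: "nat \<Rightarrow> 'r::comm_semiring_1"
  assumes "finite A" "Poly_Mapping.keys m \<subseteq> A"
  shows "(\<Prod>i\<in>Poly_Mapping.keys m. x i ^ Poly_Mapping.lookup m i) = (\<Prod>i\<in>A. x i ^ Poly_Mapping.lookup m i)"
  using assms by (intro prod.mono_neutral_left) (auto simp: in_keys_iff)

definition mono_val :: "(nat \<Rightarrow> 'r::comm_semiring_1) \<Rightarrow> (nat \<Rightarrow>\<^sub>0 nat) \<Rightarrow> 'r" where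
  "mono_val x m = (\<Prod>i\<in>Poly_Mapping.keys m. x i ^ Poly_Mapping.lookup m i)"

lemma mono_val_superset:
  assumes "finite A" "Poly_Mapping.keys m \<subseteq> A"
  shows "mono_val x m = (\<Prod>i\<in>A. x i ^ Poly_Mapping.lookup m i)"
  unfolding mono_val_def by (rule prod_pow_superset[OF assms])

lemma mono_val_0 [simp]: "mono_val x 0 = 1"
  by (simp add: mono_val_def)

lemma mono_val_add: "mono_val x (m + m') = mono_val x m * mono_val x m'"
proof -
  let ?A = "Poly_Mapping.keys m \<union> Poly_Mapping.keys m'"
  have "mono_val x (m + m') = (\<Prod>i\<in>?A. x i ^ Poly_Mapping.lookup (m+m') i)"
    by (rule mono_val_superset) (simp_all add: Poly_Mapping.keys_add)
  also have "\<dots> = (\<Prod>i\<in>?A. x i ^ Poly_Mapping.lookup m i) * (\<Prod>i\<in>?A. x i ^ Poly_Mapping.lookup m' i)"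
    by (simp add: lookup_add power_add prod.distrib)
  finally show ?thesis by (simp add: mono_val_superset[of ?A])
qed

lemma mono_val_single [simp]: "mono_val x (Poly_Mapping.single i k) = x i ^ k"
  by (cases "k = 0") (auto simp: mono_val_def)

lemma mono_val_times: "mono_val (\<lambda>i. x i * y i) m = mono_val x m * mono_val y m"
  by (simp add: mono_val_def power_mult_distrib prod.distrib)

lemma mono_val_cong: "(\<And>i. i \<in> Poly_Mapping.keys m \<Longrightarrow> x i = y i) \<Longrightarrow> mono_val x m = mono_val y m"
  by (simp add: mono_val_def)

lemma mono_val_eq_0_iff: "mono_val x m = (0::complex) \<longleftrightarrow> (\<exists>i\<in>Poly_Mapping.keys m. x i = 0)"
  by (auto simp: mono_val_def in_keys_iff)

text \<open>The target ring is arbitrary: with \<open>h\<close> the identity this is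
  \<open>peval\<close>, and with polynomial values it performs substitutions such as renaming
  variables, freezing some of them, or passing to iterated polynomial rings.\<close>

definition ring_eval :: "('a::comm_ring_1 \<Rightarrow> 'r::comm_ring_1) \<Rightarrow> (nat \<Rightarrow> 'r) \<Rightarrow> ((nat \<Rightarrow>\<^sub>0 nat) \<Rightarrow>\<^sub>0 'a) \<Rightarrow> 'r" where
  "ring_eval h x F = (\<Sum>m\<in>Poly_Mapping.keys F. h (Poly_Mapping.lookup F m) * mono_val x m)"

lemma peval_mono_val: "peval F x = (\<Sum>m\<in>Poly_Mapping.keys F. Poly_Mapping.lookup F m * mono_val x m)"
  by (simp add: peval_def mono_val_def)

lemma peval_ring_eval: "peval F x = ring_eval (\<lambda>c. c) x F"
  by (simp add: peval_mono_val ring_eval_def)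

lemma poly_mapping_sum_single: "F = (\<Sum>m\<in>Poly_Mapping.keys F. Poly_Mapping.single m (Poly_Mapping.lookup F m))"
proof (rule poly_mapping_eqI)
  fix k
  have "Poly_Mapping.lookup (\<Sum>m\<in>Poly_Mapping.keys F. Poly_Mapping.single m (Poly_Mapping.lookup F m)) k
    = (\<Sum>m\<in>Poly_Mapping.keys F. if k = m then Poly_Mapping.lookup F m else 0)"
    by (auto simp: lookup_sum lookup_single when_def intro!: sum.cong)
  also have "\<dots> = Poly_Mapping.lookup F k"
    by (simp add: in_keys_iff)
  finally show "Poly_Mapping.lookup F k = Poly_Mapping.lookup (\<Sum>m\<in>Poly_Mapping.keys F. Poly_Mapping.single m (Poly_Mapping.lookup F m)) k"
    by simp
qed

context comm_ring_hom
begin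

lemma ring_eval_superset:
  assumes "finite A" "Poly_Mapping.keys F \<subseteq> A"
  shows "ring_eval hom x F = (\<Sum>m\<in>A. hom (Poly_Mapping.lookup F m) * mono_val x m)"
  unfolding ring_eval_def using assms by (intro sum.mono_neutral_left) (auto simp: in_keys_iff)

lemma ring_eval_add: "ring_eval hom x (F + G) = ring_eval hom x F + ring_eval hom x G"
proof -
  let ?A = "Poly_Mapping.keys F \<union> Poly_Mapping.keys G"
  have "ring_eval hom x (F + G) = (\<Sum>m\<in>?A. hom (Poly_Mapping.lookup (F+G) m) * mono_val x m)"
    by (rule ring_eval_superset) (simp_all add: Poly_Mapping.keys_add)
  then show ?thesis
    by (simp add: ring_eval_superset[of ?A] lookup_add hom_add distrib_right sum.distrib)
qed

lemma ring_eval_0 [simp]: "ring_eval hom x 0 = 0"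
  by (simp add: ring_eval_def)

lemma ring_eval_single [simp]: "ring_eval hom x (Poly_Mapping.single m c) = hom c * mono_val x m"
  by (cases "c = 0") (auto simp: ring_eval_def)

lemma ring_eval_1 [simp]: "ring_eval hom x 1 = 1"
  using ring_eval_single[of x 0 1] by simp

lemma ring_eval_sum: "ring_eval hom x (sum f S) = (\<Sum>s\<in>S. ring_eval hom x (f s))"
  by (induction S rule: infinite_finite_induct) (auto simp: ring_eval_add)

lemma ring_eval_mult: "ring_eval hom x (F * G) = ring_eval hom x F * ring_eval hom x G"
proof -
  let ?s = "\<lambda>(F::(nat \<Rightarrow>\<^sub>0 nat) \<Rightarrow>\<^sub>0 'a) m. Poly_Mapping.single m (Poly_Mapping.lookup F m)"
  have "F * G = (\<Sum>m\<in>Poly_Mapping.keys F. \<Sum>k\<in>Poly_Mapping.keys G. ?s F m * ?s G k)"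
    by (subst poly_mapping_sum_single[of F], subst poly_mapping_sum_single[of G])
      (simp add: sum_product)
  then have "ring_eval hom x (F * G) = (\<Sum>m\<in>Poly_Mapping.keys F. \<Sum>k\<in>Poly_Mapping.keys G.
      hom (Poly_Mapping.lookup F m * Poly_Mapping.lookup G k) * mono_val x (m + k))"
    by (simp add: ring_eval_sum mult_single)
  also have "\<dots> = ring_eval hom x F * ring_eval hom x G"
    unfolding ring_eval_def sum_product by (simp add: hom_mult mono_val_add mult_ac)
  finally show ?thesis .
qed

end

lemma comm_ring_hom_id: "comm_ring_hom (\<lambda>c::complex. c)"
  by unfold_locales auto

lemmas id_ring_eval = comm_ring_hom.ring_eval_superset[OF comm_ring_hom_id]
  comm_ring_hom.ring_eval_add[OF comm_ring_hom_id] comm_ring_hom.ring_eval_mult[OF comm_ring_hom_id]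
  comm_ring_hom.ring_eval_sum[OF comm_ring_hom_id] comm_ring_hom.ring_eval_0[OF comm_ring_hom_id]
  comm_ring_hom.ring_eval_1[OF comm_ring_hom_id] comm_ring_hom.ring_eval_single[OF comm_ring_hom_id]

lemma peval_superset:
  assumes "finite A" "Poly_Mapping.keys F \<subseteq> A"
  shows "peval F x = (\<Sum>m\<in>A. Poly_Mapping.lookup F m * mono_val x m)"
  unfolding peval_ring_eval by (rule id_ring_eval(1)[OF assms])

lemma peval_add [simp]: "peval (F + G) x = peval F x + peval G x"
  and peval_mult [simp]: "peval (F * G) x = peval F x * peval G x"
  and peval_0 [simp]: "peval 0 x = 0"
  and peval_1 [simp]: "peval 1 x = 1"
  and peval_single [simp]: "peval (Poly_Mapping.single m c) x = c * mono_val x m"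
  and peval_sum: "peval (sum f S) x = (\<Sum>s\<in>S. peval (f s) x)"
  by (simp_all add: peval_ring_eval id_ring_eval)

lemma peval_uminus [simp]: "peval (- F) x = - peval F x"
  by (metis add.right_inverse add_eq_0_iff peval_0 peval_add)

lemma peval_diff [simp]: "peval (F - G) x = peval F x - peval G x"
  by (metis add_uminus_conv_diff peval_add peval_uminus)

lemma peval_power [simp]: "peval (F ^ k) x = peval F x ^ k"
  by (induction k) auto

lemma peval_prod: "peval (prod f S) x = (\<Prod>s\<in>S. peval (f s) x)"
  by (induction S rule: infinite_finite_induct) auto

lemma peval_cong: "(\<And>i. i \<in> vars F \<Longrightarrow> x i = y i) \<Longrightarrow> peval F x = peval F y"
  unfolding peval_mono_val vars_def
  by (intro sum.cong refl arg_cong2[of _ _ _ _ "(*)"] mono_val_cong) auto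

lemma peval_unit: "F dvd 1 \<Longrightarrow> peval F x \<noteq> 0"
  by (metis dvd_def mult_zero_left peval_1 peval_mult zero_neq_one)

abbreviation Var :: "nat \<Rightarrow> cpoly" where
  "Var i \<equiv> Poly_Mapping.single (Poly_Mapping.single i (Suc 0)) 1"

abbreviation Const :: "complex \<Rightarrow> cpoly" where
  "Const c \<equiv> Poly_Mapping.single 0 c"

section \<open>Weighted degree\<close>

lemma wdegree_superset:
  assumes "finite A" "Poly_Mapping.keys m \<subseteq> A"
  shows "wdegree a m = (\<Sum>i\<in>A. a i * Poly_Mapping.lookup m i)"
  unfolding wdegree_def using assms by (intro sum.mono_neutral_left) (auto simp: in_keys_iff)

lemma wdegree_0 [simp]: "wdegree a 0 = 0"
  by (simp add: wdegree_def)

lemma wdegree_single [simp]: "wdegree a (Poly_Mapping.single i k) = a i * k"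
  by (cases "k = 0") (auto simp: wdegree_def)

lemma wdegree_add: "wdegree a (m + m') = wdegree a m + wdegree a m'"
proof -
  let ?A = "Poly_Mapping.keys m \<union> Poly_Mapping.keys m'"
  have "wdegree a (m + m') = (\<Sum>i\<in>?A. a i * Poly_Mapping.lookup (m+m') i)"
    by (rule wdegree_superset) (simp_all add: Poly_Mapping.keys_add)
  then show ?thesis
    by (simp add: wdegree_superset[of ?A] lookup_add distrib_left sum.distrib)
qed

lemma mono_val_scale: "mono_val (\<lambda>i. t ^ a i) m = (t::'r::comm_semiring_1) ^ wdegree a m"
  by (simp add: mono_val_def wdegree_def power_mult[symmetric] power_sum)

lemma whomogeneous_iff:
  "whomogeneous N a k F \<longleftrightarrow> (\<forall>m\<in>Poly_Mapping.keys F. Poly_Mapping.keys m \<subseteq> {..N} \<and> wdegree a m = k)"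
  unfolding whomogeneous_def polys_in_def vars_def by auto

lemma whomogeneous_0 [simp]: "whomogeneous N a k 0"
  by (simp add: whomogeneous_iff)

lemma whomogeneous_single: "Poly_Mapping.keys m \<subseteq> {..N} \<Longrightarrow> wdegree a m = k \<Longrightarrow> whomogeneous N a k (Poly_Mapping.single m c)"
  by (auto simp: whomogeneous_iff)

lemma whomogeneous_Const: "whomogeneous N a 0 (Const c)"
  by (rule whomogeneous_single) auto

lemma whomogeneous_1: "whomogeneous N a 0 1"
  using whomogeneous_Const[of N a 1] by simp

lemma whomogeneous_Var: "i \<le> N \<Longrightarrow> whomogeneous N a (a i) (Var i)"
  by (rule whomogeneous_single) auto

lemma whomogeneous_add: "whomogeneous N a k F \<Longrightarrow> whomogeneous N a k G \<Longrightarrow> whomogeneous N a k (F + G)"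
  using Poly_Mapping.keys_add[of F G] unfolding whomogeneous_iff by auto

lemma whomogeneous_uminus: "whomogeneous N a k F \<Longrightarrow> whomogeneous N a k (- F)"
  unfolding whomogeneous_iff in_keys_iff by simp

lemma whomogeneous_diff: "whomogeneous N a k F \<Longrightarrow> whomogeneous N a k G \<Longrightarrow> whomogeneous N a k (F - G)"
  using whomogeneous_add[of N a k F "-G"] whomogeneous_uminus[of N a k G] by simp

lemma whomogeneous_sum: "(\<And>s. s \<in> S \<Longrightarrow> whomogeneous N a k (f s)) \<Longrightarrow> whomogeneous N a k (sum f S)"
  by (induction S rule: infinite_finite_induct) (auto intro: whomogeneous_add)

lemma whomogeneous_mult:
  assumes "whomogeneous N a k F" "whomogeneous N a j G"
  shows "whomogeneous N a (k + j) (F * G)"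
  unfolding whomogeneous_iff
proof
  fix m assume "m \<in> Poly_Mapping.keys (F * G)"
  then obtain p q where "m = p + q" "p \<in> Poly_Mapping.keys F" "q \<in> Poly_Mapping.keys G"
    using keys_mult[of F G] by blast
  then show "Poly_Mapping.keys m \<subseteq> {..N} \<and> wdegree a m = k + j"
    using assms Poly_Mapping.keys_add[of p q] unfolding whomogeneous_iff
    by (simp add: wdegree_add) blast
qed

lemma whomogeneous_power: "whomogeneous N a k F \<Longrightarrow> whomogeneous N a (e * k) (F ^ e)"
  by (induction e) (auto intro: whomogeneous_mult whomogeneous_1)

lemma whomogeneous_prod:
  "(\<And>s. s \<in> S \<Longrightarrow> whomogeneous N a (k s) (f s)) \<Longrightarrow> whomogeneous N a (sum k S) (prod f S)"
  by (induction S rule: infinite_finite_induct) (auto intro: whomogeneous_mult whomogeneous_1)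

lemma whomogeneous_vars: "whomogeneous N a k F \<Longrightarrow> vars F \<subseteq> {..N}"
  by (simp add: whomogeneous_def polys_in_def)

lemma whomogeneous_peval_cong:
  "whomogeneous N a k F \<Longrightarrow> (\<And>i. i \<le> N \<Longrightarrow> x i = y i) \<Longrightarrow> peval F x = peval F y"
  using whomogeneous_vars[of N a k F] by (intro peval_cong) auto

lemma whomogeneous_scale:
  assumes "whomogeneous N a k F" "\<And>i. i \<le> N \<Longrightarrow> y i = t ^ a i * x i"
  shows "peval F y = t ^ k * peval F x"
proof -
  have "peval F y = peval F (\<lambda>i. t ^ a i * x i)"
    using assms by (intro whomogeneous_peval_cong[OF assms(1)])
  also have "\<dots> = (\<Sum>m\<in>Poly_Mapping.keys F. t ^ k * (Poly_Mapping.lookup F m * mono_val x m))"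
    unfolding peval_mono_val mono_val_times mono_val_scale
    using assms(1) by (intro sum.cong) (auto simp: whomogeneous_iff)
  finally show ?thesis by (simp add: peval_mono_val sum_distrib_left)
qed

text \<open>The pullback of \<open>F\<close> along the diagonal map with entries \<open>u i\<close>.
  It rescales coefficients only, so degrees are preserved.\<close>

definition twist :: "(nat \<Rightarrow> complex) \<Rightarrow> cpoly \<Rightarrow> cpoly" where
  "twist u F = Poly_Mapping.mapp (\<lambda>m c. c * mono_val u m) F"

lemma keys_twist: "Poly_Mapping.keys (twist u F) \<subseteq> Poly_Mapping.keys F"
  unfolding twist_def by (rule keys_mapp_subset)

lemma peval_twist: "peval (twist u F) x = peval F (\<lambda>i. u i * x i)"
  unfolding peval_superset[OF finite_keys keys_twist] peval_mono_val[of F] mono_val_times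
  by (intro sum.cong) (auto simp: twist_def lookup_mapp)

lemma whomogeneous_twist: "whomogeneous N a k F \<Longrightarrow> whomogeneous N a k (twist u F)"
  using keys_twist unfolding whomogeneous_iff by blast

section \<open>One variable at a time\<close>

text \<open>The restriction of \<open>F\<close> to the line through \<open>x\<close> parallel to the
  i-th axis. Setting \<open>x(i := 1)\<close> strips the power of x_i from each monomial, so nothing
  depends on \<open>x i\<close>.\<close>

definition upoly :: "nat \<Rightarrow> cpoly \<Rightarrow> (nat \<Rightarrow> complex) \<Rightarrow> complex poly" where
  "upoly i F x = (\<Sum>m\<in>Poly_Mapping.keys F.
     monom (Poly_Mapping.lookup F m * mono_val (x(i := 1)) m) (Poly_Mapping.lookup m i))"

lemma mono_val_upd: "mono_val (x(i := t)) m = t ^ Poly_Mapping.lookup m i * mono_val (x(i := 1)) m"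
proof -
  let ?A = "insert i (Poly_Mapping.keys m)"
  have *: "mono_val z m = z i ^ Poly_Mapping.lookup m i * (\<Prod>j\<in>?A - {i}. z j ^ Poly_Mapping.lookup m j)" for z :: "nat \<Rightarrow> 'a"
    by (subst mono_val_superset[of ?A]) (auto simp: prod.remove[of ?A i])
  show ?thesis by (subst (1 2) *) (auto intro!: arg_cong2[of _ _ _ _ "(*)"] prod.cong)
qed

lemma poly_upoly: "poly (upoly i F x) t = peval F (x(i := t))"
  unfolding upoly_def peval_mono_val poly_sum poly_monom mono_val_upd[of x i t]
  by (simp add: mult_ac)

text \<open>The truncated subtraction of exponents is exact here, since only monomials with exponent
  \<open>k\<close> at \<open>i\<close> are summed.\<close>

definition coeff_in :: "nat \<Rightarrow> nat \<Rightarrow> cpoly \<Rightarrow> cpoly" where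
  "coeff_in i k F = (\<Sum>m\<in>{m\<in>Poly_Mapping.keys F. Poly_Mapping.lookup m i = k}.
     Poly_Mapping.single (m - Poly_Mapping.single i k) (Poly_Mapping.lookup F m))"

lemma lookup_split: "m = Poly_Mapping.single i (Poly_Mapping.lookup m i) + (m - Poly_Mapping.single i (Poly_Mapping.lookup m i))"
  by (rule poly_mapping_eqI) (auto simp: lookup_add lookup_minus lookup_single when_def)

lemma lookup_coeff_in:
  "Poly_Mapping.lookup (coeff_in i k F) m =
    (if Poly_Mapping.lookup m i = 0 then Poly_Mapping.lookup F (m + Poly_Mapping.single i k) else 0)"
proof -
  let ?S = "{m\<in>Poly_Mapping.keys F. Poly_Mapping.lookup m i = k}"
  have eq: "m' - Poly_Mapping.single i k = m \<longleftrightarrow> Poly_Mapping.lookup m i = 0 \<and> m' = m + Poly_Mapping.single i k"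
    if "m' \<in> ?S" for m'
  proof
    assume h: "m' - Poly_Mapping.single i k = m"
    have "Poly_Mapping.lookup m i = 0" using that unfolding h[symmetric] by (simp add: lookup_minus)
    moreover have "m' = m + Poly_Mapping.single i k"
      using lookup_split[of m' i] that h by (simp add: add.commute)
    ultimately show "Poly_Mapping.lookup m i = 0 \<and> m' = m + Poly_Mapping.single i k" by simp
  qed auto
  have "Poly_Mapping.lookup (coeff_in i k F) m = (\<Sum>m'\<in>?S. if m' - Poly_Mapping.single i k = m then Poly_Mapping.lookup F m' else 0)"
    by (auto simp: coeff_in_def lookup_sum lookup_single when_def intro!: sum.cong)
  also have "\<dots> = (\<Sum>m'\<in>?S. if m' = m + Poly_Mapping.single i k then (if Poly_Mapping.lookup m i = 0 then Poly_Mapping.lookup F m' else 0) else 0)"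
    by (intro sum.cong refl) (auto simp: eq)
  also have "\<dots> = (if Poly_Mapping.lookup m i = 0 then Poly_Mapping.lookup F (m + Poly_Mapping.single i k) else 0)"
    by (auto simp: lookup_add in_keys_iff)
  finally show ?thesis .
qed

lemma coeff_in_nonzero: "m \<in> Poly_Mapping.keys F \<Longrightarrow> coeff_in i (Poly_Mapping.lookup m i) F \<noteq> 0"
proof
  assume m: "m \<in> Poly_Mapping.keys F" and 0: "coeff_in i (Poly_Mapping.lookup m i) F = 0"
  have "Poly_Mapping.lookup (coeff_in i (Poly_Mapping.lookup m i) F) (m - Poly_Mapping.single i (Poly_Mapping.lookup m i)) = Poly_Mapping.lookup F m"
    unfolding lookup_coeff_in using lookup_split[of m i] by (simp add: lookup_minus add.commute)
  with m 0 show False by (simp add: in_keys_iff)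
qed

lemma keys_coeff_in: "m \<in> Poly_Mapping.keys (coeff_in i k F) \<Longrightarrow> Poly_Mapping.lookup m i = 0 \<and> m + Poly_Mapping.single i k \<in> Poly_Mapping.keys F"
  unfolding in_keys_iff lookup_coeff_in by (auto split: if_splits)

lemma vars_coeff_in: "vars (coeff_in i k F) \<subseteq> vars F - {i}"
proof
  fix j assume "j \<in> vars (coeff_in i k F)"
  then obtain m where m: "m \<in> Poly_Mapping.keys (coeff_in i k F)" "j \<in> Poly_Mapping.keys m" by (auto simp: vars_def)
  note k = keys_coeff_in[OF m(1)]
  have "j \<noteq> i" using k m(2) by (auto simp: in_keys_iff)
  moreover have "j \<in> Poly_Mapping.keys (m + Poly_Mapping.single i k)"
    using m(2) by (auto simp: in_keys_iff lookup_add)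
  ultimately show "j \<in> vars F - {i}" using k by (auto simp: vars_def)
qed

lemma coeff_upoly: "coeff (upoly i F x) k = peval (coeff_in i k F) x"
proof -
  let ?S = "{m\<in>Poly_Mapping.keys F. Poly_Mapping.lookup m i = k}"
  have "coeff (upoly i F x) k = (\<Sum>m\<in>Poly_Mapping.keys F. if Poly_Mapping.lookup m i = k then Poly_Mapping.lookup F m * mono_val (x(i := 1)) m else 0)"
    unfolding upoly_def coeff_sum by (intro sum.cong) auto
  also have "\<dots> = (\<Sum>m\<in>?S. Poly_Mapping.lookup F m * mono_val (x(i := 1)) m)"
    by (simp add: sum.If_cases Int_def)
  also have "\<dots> = (\<Sum>m\<in>?S. Poly_Mapping.lookup F m * mono_val x (m - Poly_Mapping.single i k))"
  proof (intro sum.cong refl, goal_cases)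
    case (1 m)
    then have k: "Poly_Mapping.lookup m i = k" by simp
    have "mono_val (x(i := 1)) m = mono_val (x(i := 1)) (m - Poly_Mapping.single i k)"
      using mono_val_add[of "x(i := 1)" "Poly_Mapping.single i k" "m - Poly_Mapping.single i k"]
        lookup_split[of m i] k by simp
    also have "\<dots> = mono_val x (m - Poly_Mapping.single i k)"
      by (rule mono_val_cong) (use k in \<open>auto simp: in_keys_iff lookup_minus\<close>)
    finally show ?case by simp
  qed
  finally show ?thesis by (simp add: coeff_in_def peval_sum)
qed

lemma nonzero_poly_nonroot:
  assumes "p \<noteq> (0::complex poly)"
  shows "\<exists>t. t \<noteq> 0 \<and> poly p t \<noteq> 0"
proof -
  have "finite ({t. poly p t = 0} \<union> {0})" using poly_roots_finite[OF assms] by simp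
  then have "\<exists>t. t \<notin> {t. poly p t = 0} \<union> {0}" by (rule ex_new_if_finite[OF infinite_UNIV_char_0])
  then show ?thesis by auto
qed

text \<open>Induction on the variables: a nonzero coefficient with respect to one variable is made
  nonzero at a point of the torus, and the remaining univariate polynomial has only finitely many
  roots to avoid besides 0.\<close>

lemma nonzero_on_torus:
  assumes "F \<noteq> 0"
  shows "\<exists>x. (\<forall>i. x i \<noteq> 0) \<and> peval F x \<noteq> 0"
proof -
  have "finite A \<Longrightarrow> vars F \<subseteq> A \<Longrightarrow> F \<noteq> 0 \<Longrightarrow> \<exists>x. (\<forall>i. x i \<noteq> 0) \<and> peval F x \<noteq> 0" for A and F :: cpoly
  proof (induction A arbitrary: F rule: finite_induct)
    case empty
    then have "Poly_Mapping.keys F \<subseteq> {0}" by (auto simp: vars_def)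
    with empty have "Poly_Mapping.keys F = {0}" by (metis keys_eq_empty subset_singletonD)
    then have "peval F (\<lambda>i. 1) \<noteq> 0" by (simp add: peval_mono_val in_keys_iff[symmetric])
    then show ?case by (intro exI[of _ "\<lambda>i. 1"]) auto
  next
    case (insert i A)
    then obtain m where m: "m \<in> Poly_Mapping.keys F" by (metis equals0I keys_eq_empty)
    let ?k = "Poly_Mapping.lookup m i"
    obtain x where x: "\<forall>i. x i \<noteq> 0" "peval (coeff_in i ?k F) x \<noteq> 0"
      using insert.IH[of "coeff_in i ?k F"] insert.prems vars_coeff_in[of i ?k F] coeff_in_nonzero[OF m] by blast
    then have "upoly i F x \<noteq> 0" by (metis coeff_0 coeff_upoly)
    then obtain t where "t \<noteq> 0" "poly (upoly i F x) t \<noteq> 0" using nonzero_poly_nonroot by blast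
    then have "\<forall>j. (x(i := t)) j \<noteq> 0" "peval F (x(i := t)) \<noteq> 0"
      using x(1) by (simp_all add: poly_upoly)
    then show ?case by blast
  qed
  moreover have "finite (vars F)" by (auto simp: vars_def)
  ultimately show ?thesis using assms by blast
qed

lemma peval_eq_0: "(\<And>x. (\<forall>i. x i \<noteq> 0) \<Longrightarrow> peval F x = 0) \<Longrightarrow> F = 0"
  using nonzero_on_torus by blast

text \<open>After splitting off the power of the variable, a complex polynomial without nonzero
  roots is constant; so only monomials lack a nonzero root, and two nonzero coefficients exclude a
  monomial.\<close>

lemma poly_root_nonzero:
  fixes p :: "complex poly"
  assumes "coeff p j \<noteq> 0" "coeff p k \<noteq> 0" "j \<noteq> k"
  shows "\<exists>t. t \<noteq> 0 \<and> poly p t = 0"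
proof (rule ccontr)
  assume no: "\<not> ?thesis"
  have p: "p \<noteq> 0" using assms by auto
  obtain e q where q: "p = [:-0, 1:] ^ e * q" "\<not> [:-0, 1:] dvd q"
    using order_decomp[OF p, of 0] by blast
  have q0: "poly q 0 \<noteq> 0" using q(2) by (simp add: poly_eq_0_iff_dvd)
  have r: "poly p t = t ^ e * poly q t" for t
    by (simp add: q(1))
  have "poly q t \<noteq> 0" for t
    using no q0 r[of t] by (metis mult_zero_right)
  then have "degree q = 0" using alg_closed_imp_poly_has_root[of q] by blast
  then obtain c where "q = [:c:]" by (rule degree_eq_zeroE)
  then have "p = monom c e" using q(1) by (simp add: monom_altdef)
  then have "coeff p n = 0" if "n \<noteq> e" for n using that by (metis coeff_monom)
  with assms show False by metis
qed

text \<open>The other coordinates are chosen nonzero and outside the zeros of two coefficients with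
  respect to x_i; what remains in x_i is not a monomial and so has a nonzero root.\<close>

lemma torus_point:
  assumes m: "m \<in> Poly_Mapping.keys F" "m' \<in> Poly_Mapping.keys F" "Poly_Mapping.lookup m i \<noteq> Poly_Mapping.lookup m' i"
  shows "\<exists>x. (\<forall>i. x i \<noteq> 0) \<and> peval F x = 0"
proof -
  let ?A = "coeff_in i (Poly_Mapping.lookup m i) F" and ?B = "coeff_in i (Poly_Mapping.lookup m' i) F"
  have "?A * ?B \<noteq> 0" using coeff_in_nonzero m by simp
  then obtain x where x: "\<forall>i. x i \<noteq> 0" "peval (?A * ?B) x \<noteq> 0" using nonzero_on_torus by blast
  then obtain t where "t \<noteq> 0" "poly (upoly i F x) t = 0"
    using poly_root_nonzero[of "upoly i F x"] m(3) by (metis coeff_upoly mult_eq_0_iff peval_mult)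
  then have "\<forall>j. (x(i := t)) j \<noteq> 0" "peval F (x(i := t)) = 0"
    using x(1) by (simp_all add: poly_upoly)
  then show ?thesis by blast
qed

lemma peval_partial_deriv_pderiv:
  "peval (partial_deriv i F) x = poly (pderiv (upoly i F x)) (x i)"
proof -
  have key: "of_nat (Poly_Mapping.lookup m i) * mono_val x (m - Poly_Mapping.single i 1)
     = of_nat (Poly_Mapping.lookup m i) * (x i ^ (Poly_Mapping.lookup m i - 1) * mono_val (x(i := 1)) m)" for m
  proof (cases "Poly_Mapping.lookup m i")
    case (Suc e)
    have l: "Poly_Mapping.lookup (m - Poly_Mapping.single i 1) i = e" using Suc by (simp add: lookup_minus)
    have m: "m = Poly_Mapping.single i 1 + (m - Poly_Mapping.single i 1)"
      using Suc by (intro poly_mapping_eqI) (auto simp: lookup_add lookup_minus lookup_single when_def)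
    have "mono_val (x(i := 1)) m = mono_val (x(i := 1)) (m - Poly_Mapping.single i 1)"
      by (subst m, subst mono_val_add) simp
    moreover have "mono_val x (m - Poly_Mapping.single i 1) = x i ^ e * mono_val (x(i := 1)) (m - Poly_Mapping.single i 1)"
      using mono_val_upd[of x i "x i" "m - Poly_Mapping.single i 1"] l by simp
    ultimately show ?thesis using Suc by simp
  qed simp
  have "peval (partial_deriv i F) x = (\<Sum>m\<in>Poly_Mapping.keys F. Poly_Mapping.lookup F m *
      (of_nat (Poly_Mapping.lookup m i) * mono_val x (m - Poly_Mapping.single i 1)))"
    unfolding partial_deriv_def by (simp add: peval_sum mult_ac)
  also have "\<dots> = poly (pderiv (upoly i F x)) (x i)"
    unfolding key upoly_def by (simp add: pderiv_sum poly_sum pderiv_monom poly_monom mult_ac)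
  finally show ?thesis .
qed

lemma peval_partial_deriv:
  "((\<lambda>t. peval F (x(i := t))) has_field_derivative peval (partial_deriv i F) x) (at (x i))"
  unfolding peval_partial_deriv_pderiv poly_upoly[symmetric] by (rule poly_DERIV)

text \<open>Uniqueness of the complex derivative lets the formal rules below (sum, product,
  renaming, two-variable monomials) be read off from calculus.\<close>

lemma peval_partial_derivI:
  "((\<lambda>t. peval F (x(i := t))) has_field_derivative D) (at (x i)) \<Longrightarrow> peval (partial_deriv i F) x = D"
  using peval_partial_deriv DERIV_unique by blast

lemma partial_deriv_add: "peval (partial_deriv i (F + G)) x = peval (partial_deriv i F) x + peval (partial_deriv i G) x"
  by (rule peval_partial_derivI) (auto intro!: derivative_eq_intros peval_partial_deriv)

lemma partial_deriv_mult:
  "peval (partial_deriv i (F * G)) x = peval (partial_deriv i F) x * peval G x + peval F x * peval (partial_deriv i G) x"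
  by (rule peval_partial_derivI) (auto intro!: derivative_eq_intros peval_partial_deriv)

lemma partial_deriv_notin:
  assumes "i \<notin> vars F"
  shows "peval (partial_deriv i F) x = 0"
proof (rule peval_partial_derivI)
  have "peval F (x(i := t)) = peval F x" for t by (rule peval_cong) (use assms in auto)
  then show "((\<lambda>t. peval F (x(i := t))) has_field_derivative 0) (at (x i))" by simp
qed

text \<open>Truncation in \<open>k - a i\<close> does no harm: if \<open>a i > k\<close>, no
  monomial of degree \<open>k\<close> contains x_i, and the derivative is 0, which is homogeneous of
  every degree.\<close>

lemma whomogeneous_partial_deriv:
  assumes "whomogeneous N a k F"
  shows "whomogeneous N a (k - a i) (partial_deriv i F)"
  unfolding partial_deriv_def
proof (rule whomogeneous_sum)
  fix m assume m: "m \<in> Poly_Mapping.keys F"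
  show "whomogeneous N a (k - a i) (Poly_Mapping.single (m - Poly_Mapping.single i 1) (of_nat (Poly_Mapping.lookup m i) * Poly_Mapping.lookup F m))"
  proof (cases "Poly_Mapping.lookup m i = 0")
    case False
    then have eq: "m = Poly_Mapping.single i 1 + (m - Poly_Mapping.single i 1)"
      by (intro poly_mapping_eqI) (auto simp: lookup_add lookup_minus lookup_single when_def)
    have "wdegree a m = a i + wdegree a (m - Poly_Mapping.single i 1)"
      by (subst eq, subst wdegree_add) simp
    moreover have "Poly_Mapping.keys (m - Poly_Mapping.single i 1) \<subseteq> Poly_Mapping.keys m"
      by (auto simp: in_keys_iff lookup_minus)
    ultimately show ?thesis using assms m by (intro whomogeneous_single) (auto simp: whomogeneous_iff)
  qed simp
qed

section \<open>Points and closed sets of weighted projective space\<close>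

definition orbit_of :: "nat \<Rightarrow> (nat \<Rightarrow> nat) \<Rightarrow> (nat \<Rightarrow> complex) \<Rightarrow> wpoint" where
  "orbit_of N a x = worbit_rel N a `` {x}"

lemma equiv_worbit: "equiv (punctured_space N) (worbit_rel N a)"
proof (rule equivI)
  show "worbit_rel N a \<subseteq> punctured_space N \<times> punctured_space N"
    by (auto simp: worbit_rel_def)
  show "refl_on (punctured_space N) (worbit_rel N a)"
    by (auto simp: refl_on_def worbit_rel_def intro!: exI[of _ 1])
  show "sym (worbit_rel N a)"
  proof (rule symI)
    fix x y assume "(x, y) \<in> worbit_rel N a"
    then obtain t where t: "x \<in> punctured_space N" "y \<in> punctured_space N" "t \<noteq> 0" "\<forall>i\<le>N. y i = t ^ a i * x i"
      by (auto simp: worbit_rel_def)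
    then show "(y, x) \<in> worbit_rel N a"
      unfolding worbit_rel_def
      by (auto intro!: exI[of _ "inverse t"] simp: power_inverse field_simps)
  qed
  show "trans (worbit_rel N a)"
  proof (rule transI)
    fix x y z assume "(x, y) \<in> worbit_rel N a" "(y, z) \<in> worbit_rel N a"
    then obtain t s where "x \<in> punctured_space N" "z \<in> punctured_space N"
      "t \<noteq> 0" "\<forall>i\<le>N. y i = t ^ a i * x i" "s \<noteq> 0" "\<forall>i\<le>N. z i = s ^ a i * y i"
      by (auto simp: worbit_rel_def)
    then show "(x, z) \<in> worbit_rel N a"
      unfolding worbit_rel_def
      by (auto intro!: exI[of _ "s * t"] simp: power_mult_distrib mult_ac)
  qed
qed

lemma orbit_of_mem: "x \<in> punctured_space N \<Longrightarrow> x \<in> orbit_of N a x"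
  using equiv_worbit unfolding orbit_of_def by (rule equiv_class_self)

lemma orbit_of_in_wproj: "x \<in> punctured_space N \<Longrightarrow> orbit_of N a x \<in> wproj N a"
  unfolding orbit_of_def wproj_def by (rule quotientI)

lemma wproj_nonempty: "P \<in> wproj N a \<Longrightarrow> \<exists>x. x \<in> P"
  unfolding wproj_def using in_quotient_imp_non_empty[OF equiv_worbit] by blast

lemma wproj_mem_punctured: "P \<in> wproj N a \<Longrightarrow> x \<in> P \<Longrightarrow> x \<in> punctured_space N"
  unfolding wproj_def using in_quotient_imp_subset[OF equiv_worbit] by blast

lemma wproj_mem_orbit: "P \<in> wproj N a \<Longrightarrow> x \<in> P \<Longrightarrow> P = orbit_of N a x"
  unfolding wproj_def orbit_of_def
  by (auto elim!: quotientE) (use equiv_worbit in \<open>auto simp: equiv_def dest: symD transD\<close>)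

lemma wproj_same_point:
  assumes "P \<in> wproj N a" "x \<in> P" "y \<in> P"
  shows "\<exists>t. t \<noteq> 0 \<and> (\<forall>i\<le>N. y i = t ^ a i * x i)"
proof -
  have "y \<in> orbit_of N a x" using wproj_mem_orbit[OF assms(1,2)] assms(3) by simp
  then show ?thesis by (auto simp: orbit_of_def worbit_rel_def)
qed

lemma orbit_of_memI:
  assumes "P \<in> wproj N a" "x \<in> P" "t \<noteq> 0" "\<And>i. i \<le> N \<Longrightarrow> y i = t ^ a i * x i" "\<And>i. i > N \<Longrightarrow> y i = 0"
  shows "y \<in> P"
proof -
  have x: "x \<in> punctured_space N" using wproj_mem_punctured assms by blast
  then obtain i where "x i \<noteq> 0" "i \<le> N" by (auto simp: punctured_space_def) (meson not_le)
  then have "y i \<noteq> 0" using assms(3,4) by simp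
  then have "y \<in> punctured_space N" using assms(5) by (auto simp: punctured_space_def)
  then have "y \<in> orbit_of N a x" using x assms(3-4) by (auto simp: orbit_of_def worbit_rel_def)
  then show ?thesis using wproj_mem_orbit[OF assms(1,2)] by simp
qed

lemma vanish_indep:
  assumes "whomogeneous N a k F" "P \<in> wproj N a" "x \<in> P" "y \<in> P"
  shows "peval F x = 0 \<longleftrightarrow> peval F y = 0"
proof -
  obtain t where "t \<noteq> 0" "\<forall>i\<le>N. y i = t ^ a i * x i" using wproj_same_point[OF assms(2-4)] by blast
  then show ?thesis using whomogeneous_scale[OF assms(1), of y t x] by simp
qed

lemma zero_locus_iff:
  "whomogeneous N a k F \<Longrightarrow> P \<in> wproj N a \<Longrightarrow> x \<in> P \<Longrightarrow> P \<in> zero_locus N a F \<longleftrightarrow> peval F x = 0"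
  unfolding zero_locus_def using vanish_indep by blast

lemma basic_open_iff:
  "whomogeneous N a k F \<Longrightarrow> P \<in> wproj N a \<Longrightarrow> x \<in> P \<Longrightarrow> P \<in> basic_open N a F \<longleftrightarrow> peval F x \<noteq> 0"
  unfolding basic_open_def using vanish_indep by blast

lemma orbit_zero_locus_iff:
  "whomogeneous N a k F \<Longrightarrow> x \<in> punctured_space N \<Longrightarrow> orbit_of N a x \<in> zero_locus N a F \<longleftrightarrow> peval F x = 0"
  by (rule zero_locus_iff) (simp_all add: orbit_of_mem orbit_of_in_wproj)

lemma zero_locus_subset: "zero_locus N a F \<subseteq> wproj N a"
  by (auto simp: zero_locus_def)

lemma basic_open_subset: "basic_open N a F \<subseteq> wproj N a"
  by (auto simp: basic_open_def)

lemma basic_open_eq: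
  assumes F: "whomogeneous N a k F"
  shows "basic_open N a F = wproj N a - zero_locus N a F"
proof (rule Set.set_eqI)
  fix P
  show "P \<in> basic_open N a F \<longleftrightarrow> P \<in> wproj N a - zero_locus N a F"
  proof (cases "P \<in> wproj N a")
    case True
    then obtain x where "x \<in> P" using wproj_nonempty by blast
    then show ?thesis using basic_open_iff[OF F True] zero_locus_iff[OF F True] True by auto
  qed (use basic_open_subset in blast)
qed

lemma zero_locus_mult:
  assumes "whomogeneous N a k F" "whomogeneous N a j G"
  shows "zero_locus N a (F * G) = zero_locus N a F \<union> zero_locus N a G"
proof -
  have "P \<in> zero_locus N a (F * G) \<longleftrightarrow> P \<in> zero_locus N a F \<union> zero_locus N a G" if P: "P \<in> wproj N a" for P
  proof -
    obtain x where "x \<in> P" using wproj_nonempty[OF P] by blast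
    then show ?thesis
      using zero_locus_iff[OF whomogeneous_mult[OF assms] P] zero_locus_iff[OF assms(1) P] zero_locus_iff[OF assms(2) P]
      by auto
  qed
  then show ?thesis using zero_locus_subset by blast
qed

text \<open>The sets D_+(f) form a base and not merely a subbase, because D_+(f) \<inter> D_+(g) =
  D_+(f g).\<close>

lemma openin_zariski_iff:
  "openin (zariski N a) U \<longleftrightarrow> U \<subseteq> wproj N a \<and>
    (\<forall>P\<in>U. \<exists>k f. whomogeneous N a k f \<and> P \<in> basic_open N a f \<and> basic_open N a f \<subseteq> U)"
proof
  assume "openin (zariski N a) U"
  then have "generate_topology_on {basic_open N a f | f k. whomogeneous N a k f} U"
    unfolding zariski_def openin_topology_generated_by_iff .
  then show "U \<subseteq> wproj N a \<and> (\<forall>P\<in>U. \<exists>k f. whomogeneous N a k f \<and> P \<in> basic_open N a f \<and> basic_open N a f \<subseteq> U)"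
  proof (induction rule: generate_topology_on.induct)
    case (Int A B)
    show ?case
    proof (intro conjI ballI)
      show "A \<inter> B \<subseteq> wproj N a" using Int by blast
      fix P assume P: "P \<in> A \<inter> B"
      obtain k f where f: "whomogeneous N a k f" "P \<in> basic_open N a f" "basic_open N a f \<subseteq> A"
        using Int P by blast
      obtain j g where g: "whomogeneous N a j g" "P \<in> basic_open N a g" "basic_open N a g \<subseteq> B"
        using Int P by blast
      have "basic_open N a (f * g) = basic_open N a f \<inter> basic_open N a g"
        unfolding basic_open_eq[OF whomogeneous_mult[OF f(1) g(1)]] basic_open_eq[OF f(1)] basic_open_eq[OF g(1)]
          zero_locus_mult[OF f(1) g(1)] by blast
      then show "\<exists>k f. whomogeneous N a k f \<and> P \<in> basic_open N a f \<and> basic_open N a f \<subseteq> A \<inter> B"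
        using whomogeneous_mult[OF f(1) g(1)] f g by blast
    qed
  next
    case (UN K)
    then show ?case by (meson Sup_least UnionE Union_upper order_trans)
  next
    case (Basis S)
    then show ?case using basic_open_subset by blast
  qed simp
next
  assume U: "U \<subseteq> wproj N a \<and> (\<forall>P\<in>U. \<exists>k f. whomogeneous N a k f \<and> P \<in> basic_open N a f \<and> basic_open N a f \<subseteq> U)"
  have "openin (zariski N a) (basic_open N a f)" if "whomogeneous N a k f" for k f
    unfolding zariski_def by (rule topology_generated_by_Basis) (use that in blast)
  then show "openin (zariski N a) U"
    using U by (subst openin_subopen) blast
qed

lemma openin_basic_open: "whomogeneous N a k f \<Longrightarrow> openin (zariski N a) (basic_open N a f)"
  unfolding openin_zariski_iff using basic_open_subset by blast

lemma topspace_zariski: "topspace (zariski N a) = wproj N a"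
proof -
  have "basic_open N a 1 = wproj N a" by (auto simp: basic_open_def)
  then have "openin (zariski N a) (wproj N a)" using openin_basic_open[OF whomogeneous_1] by metis
  moreover have "topspace (zariski N a) \<subseteq> wproj N a"
    using openin_zariski_iff openin_topspace by blast
  ultimately show ?thesis using openin_subset by blast
qed

lemma zariski_on_wproj: "zariski_on N a (wproj N a) = zariski N a"
  by (metis subtopology_topspace topspace_zariski)

lemma closedin_zariski_iff:
  "closedin (zariski N a) C \<longleftrightarrow> C \<subseteq> wproj N a \<and>
    (\<forall>P\<in>wproj N a - C. \<exists>k f. whomogeneous N a k f \<and> C \<subseteq> zero_locus N a f \<and> P \<notin> zero_locus N a f)"
proof -
  have *: "P \<in> basic_open N a f \<and> basic_open N a f \<subseteq> wproj N a - C \<longleftrightarrow> C \<subseteq> zero_locus N a f \<and> P \<notin> zero_locus N a f"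
    if "whomogeneous N a k f" "P \<in> wproj N a - C" "C \<subseteq> wproj N a" for k f P
    unfolding basic_open_eq[OF that(1)] using that by blast
  show ?thesis
    unfolding closedin_def topspace_zariski openin_zariski_iff using * by (metis Diff_subset)
qed

lemma closedin_zero_locus: "whomogeneous N a k f \<Longrightarrow> closedin (zariski N a) (zero_locus N a f)"
  unfolding closedin_zariski_iff using zero_locus_subset by blast

lemma irreducible_closed_subtopology:
  assumes "closedin (zariski N a) X"
  shows "irreducible_closed (zariski_on N a X) Z \<longleftrightarrow> irreducible_closed (zariski N a) Z \<and> Z \<subseteq> X"
proof -
  have cl: "closedin (zariski_on N a X) C \<longleftrightarrow> closedin (zariski N a) C \<and> C \<subseteq> X" for C
    using closedin_closed_subtopology[OF assms] by blast
  show ?thesis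
  proof
    assume h: "irreducible_closed (zariski_on N a X) Z"
    have "Z \<subseteq> A \<or> Z \<subseteq> B" if "closedin (zariski N a) A" "closedin (zariski N a) B" "Z \<subseteq> A \<union> B" for A B
    proof -
      have "Z \<subseteq> (A \<inter> X) \<union> (B \<inter> X)" using h that(3) by (auto simp: irreducible_closed_def cl)
      moreover have "closedin (zariski_on N a X) (A \<inter> X)" "closedin (zariski_on N a X) (B \<inter> X)"
        using that assms by (auto simp: cl)
      ultimately have "Z \<subseteq> A \<inter> X \<or> Z \<subseteq> B \<inter> X" using h unfolding irreducible_closed_def by blast
      then show ?thesis by blast
    qed
    then show "irreducible_closed (zariski N a) Z \<and> Z \<subseteq> X"
      using h unfolding irreducible_closed_def cl by blast
  qed (auto simp: irreducible_closed_def cl)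
qed

lemma irreducible_closed_Union:
  assumes "irreducible_closed T Z" "finite \<C>" "\<And>C. C \<in> \<C> \<Longrightarrow> closedin T C" "Z \<subseteq> \<Union>\<C>"
  shows "\<exists>C\<in>\<C>. Z \<subseteq> C"
  using assms(2-4)
proof (induction \<C> rule: finite_induct)
  case empty
  then show ?case using assms(1) by (auto simp: irreducible_closed_def)
next
  case (insert C \<C>)
  have "closedin T (\<Union>\<C>)" using insert by (intro closedin_Union) auto
  then have "Z \<subseteq> C \<or> Z \<subseteq> \<Union>\<C>"
    using assms(1) insert.prems unfolding irreducible_closed_def by simp
  then show ?case using insert by blast
qed

lemma irreducible_zero_locus:
  assumes "irreducible_closed (zariski N a) Z" "whomogeneous N a k f" "whomogeneous N a j g"
    "Z \<subseteq> zero_locus N a (f * g)"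
  shows "Z \<subseteq> zero_locus N a f \<or> Z \<subseteq> zero_locus N a g"
  using assms(1,4) closedin_zero_locus[OF assms(2)] closedin_zero_locus[OF assms(3)]
  unfolding irreducible_closed_def zero_locus_mult[OF assms(2,3)] by simp

section \<open>The Zariski topology is Noetherian\<close>

lemma nat_seq_incseq_subseq: "\<exists>r::nat \<Rightarrow> nat. strict_mono r \<and> incseq (\<lambda>k. (f::nat \<Rightarrow> nat) (r k))"
proof -
  obtain r :: "nat \<Rightarrow> nat" where r: "strict_mono r" "monoseq (\<lambda>k. f (r k))" using seq_monosub[of f] by blast
  show ?thesis
  proof (cases "incseq (\<lambda>k. f (r k))")
    case False
    then have dec: "decseq (\<lambda>k. f (r k))" using r(2) monoseq_iff by blast
    \<comment> \<open>A decreasing sequence of natural numbers is constant once it attains its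
      minimum, and this tail is weakly increasing.\<close>
    obtain n where n: "\<forall>k. f (r n) \<le> f (r k)"
      using ex_has_least_nat[of "\<lambda>_. True" 0 "\<lambda>k. f (r k)"] by auto
    have "f (r (n + k)) = f (r n)" for k
      using n dec by (simp add: antimono_def eq_iff)
    then have "incseq (\<lambda>k. f (r (n + k)))" by (simp add: incseq_def)
    moreover have "strict_mono (\<lambda>k. r (n + k))" using r(1) by (simp add: strict_mono_def)
    ultimately show ?thesis by blast
  qed (use r in blast)
qed

text \<open>Passing to subsequences, one variable after the other, makes all exponents weakly
  increasing; the first two terms of the final subsequence then divide one another.\<close>

lemma Dickson:
  fixes m :: "nat \<Rightarrow> (nat \<Rightarrow>\<^sub>0 nat)"
  assumes "\<And>k. Poly_Mapping.keys (m k) \<subseteq> {..N}"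
  shows "\<exists>i j e. i < j \<and> m j = m i + e"
proof -
  have "finite A \<Longrightarrow> \<exists>r::nat \<Rightarrow> nat. strict_mono r \<and> (\<forall>i\<in>A. incseq (\<lambda>k. Poly_Mapping.lookup (m (r k)) i))" for A :: "nat set"
  proof (induction A rule: finite_induct)
    case empty
    then show ?case by (intro exI[of _ id]) (auto simp: strict_mono_def)
  next
    case (insert i A)
    then obtain r :: "nat \<Rightarrow> nat" where r: "strict_mono r" "\<forall>i\<in>A. incseq (\<lambda>k. Poly_Mapping.lookup (m (r k)) i)" by blast
    obtain s :: "nat \<Rightarrow> nat" where s: "strict_mono s" "incseq (\<lambda>k. Poly_Mapping.lookup (m (r (s k))) i)"
      using nat_seq_incseq_subseq[of "\<lambda>k. Poly_Mapping.lookup (m (r k)) i"] by blast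
    have "strict_mono (r \<circ> s)" using r(1) s(1) by (rule strict_mono_o)
    moreover have "incseq (\<lambda>k. Poly_Mapping.lookup (m (r (s k))) j)" if "j \<in> A" for j
    proof (rule monoI)
      fix x y :: nat assume "x \<le> y"
      then have "s x \<le> s y" using s(1) by (simp add: strict_mono_less_eq)
      then show "Poly_Mapping.lookup (m (r (s x))) j \<le> Poly_Mapping.lookup (m (r (s y))) j"
        using r(2) that by (auto simp: incseq_def)
    qed
    ultimately have "strict_mono (r \<circ> s) \<and> (\<forall>j\<in>insert i A. incseq (\<lambda>k. Poly_Mapping.lookup (m ((r \<circ> s) k)) j))"
      using s(2) unfolding o_def ball_simps by blast
    then show ?case by (rule exI[of _ "r \<circ> s"])
  qed
  from this[OF finite_atMost[of N]]
  obtain r :: "nat \<Rightarrow> nat" where r: "strict_mono r" "\<forall>i\<in>{..N}. incseq (\<lambda>k. Poly_Mapping.lookup (m (r k)) i)"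
    by blast
  have le: "Poly_Mapping.lookup (m (r 0)) i \<le> Poly_Mapping.lookup (m (r 1)) i" for i
  proof (cases "i \<le> N")
    case False
    then have "Poly_Mapping.lookup (m (r 0)) i = 0" using assms[of "r 0"] by (metis atMost_iff in_keys_iff subsetD)
    then show ?thesis by simp
  qed (use r(2) in \<open>auto simp: incseq_def\<close>)
  have "m (r 1) = m (r 0) + (m (r 1) - m (r 0))"
    using le by (intro poly_mapping_eqI) (simp add: lookup_add lookup_minus)
  moreover have "r 0 < r 1" using r(1) by (simp add: strict_mono_def)
  ultimately show ?thesis by blast
qed

lemma monomial_nonneg: "(0 :: nat \<Rightarrow>\<^sub>0 nat) \<le> e"
proof (rule ccontr)
  assume "\<not> 0 \<le> e"
  then have "e < 0" by simp
  then show False by transfer (auto simp: less_fun_def)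
qed

text \<open>The order is lexicographic, and with infinitely many variables x_0 > x_1 > x_2 > ...
  descends forever; hence the bound \<open>N\<close> on the variables. With it, some later term of a
  descending chain is a multiple of an earlier one and cannot be smaller.\<close>

lemma wf_monomials:
  "wf {(m, m'). m < (m' :: nat \<Rightarrow>\<^sub>0 nat) \<and> Poly_Mapping.keys m \<subseteq> {..N} \<and> Poly_Mapping.keys m' \<subseteq> {..N}}"
  unfolding wf_iff_no_infinite_down_chain
proof
  assume "\<exists>m. \<forall>i. (m (Suc i), m i) \<in> {(m, m'). m < (m' :: nat \<Rightarrow>\<^sub>0 nat) \<and> Poly_Mapping.keys m \<subseteq> {..N} \<and> Poly_Mapping.keys m' \<subseteq> {..N}}"
  then obtain m :: "nat \<Rightarrow> (nat \<Rightarrow>\<^sub>0 nat)" where m: "\<And>i. m (Suc i) < m i" "\<And>i. Poly_Mapping.keys (m i) \<subseteq> {..N}" by blast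
  obtain i j e where ij: "i < j" "m j = m i + e" using Dickson[OF m(2)] by blast
  have "m j < m i" using ij(1)
  proof (induction j rule: less_Suc_induct)
    case (1 k)
    show ?case by (rule m(1))
  next
    case (2 i j k)
    then show ?case by (meson order.strict_trans)
  qed
  moreover have "m i \<le> m j" unfolding ij(2) using add_left_mono[OF monomial_nonneg[of e], of "m i"] by simp
  ultimately show False by simp
qed

definition lead_mono :: "cpoly \<Rightarrow> (nat \<Rightarrow>\<^sub>0 nat)" where
  "lead_mono F = Max (Poly_Mapping.keys F)"

lemma lead_mono_in_keys: "F \<noteq> 0 \<Longrightarrow> lead_mono F \<in> Poly_Mapping.keys F"
  unfolding lead_mono_def by (intro Max_in) auto

text \<open>One division step: the order is compatible with multiplication, so the subtracted
  multiple of \<open>F\<close> has the leading term of \<open>G\<close>, which cancels.\<close>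

lemma lead_mono_reduce:
  assumes "F \<noteq> 0" "G \<noteq> 0" "lead_mono G = lead_mono F + e"
  defines "H \<equiv> G - Poly_Mapping.single e (Poly_Mapping.lookup G (lead_mono G) / Poly_Mapping.lookup F (lead_mono F)) * F"
  shows "H = 0 \<or> lead_mono H < lead_mono G"
proof (cases "H = 0")
  case False
  let ?c = "Poly_Mapping.lookup G (lead_mono G) / Poly_Mapping.lookup F (lead_mono F)"
  have keys: "Poly_Mapping.keys (Poly_Mapping.single e ?c * F) \<subseteq> {m + e | m. m \<in> Poly_Mapping.keys F}"
    using keys_mult[of "Poly_Mapping.single e ?c" F] by (auto split: if_splits simp: add.commute)
  have "m \<le> lead_mono G" if "m \<in> Poly_Mapping.keys H" for m
  proof -
    have "m \<in> Poly_Mapping.keys G \<or> m \<in> Poly_Mapping.keys (Poly_Mapping.single e ?c * F)"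
      using that keys_diff[of G "Poly_Mapping.single e ?c * F"] by (auto simp: H_def)
    then show ?thesis
    proof
      assume "m \<in> Poly_Mapping.keys (Poly_Mapping.single e ?c * F)"
      then obtain m' where "m = m' + e" "m' \<in> Poly_Mapping.keys F" using keys by blast
      moreover from this have "m' \<le> lead_mono F" by (simp add: lead_mono_def)
      ultimately show ?thesis by (simp add: assms(3) add_right_mono)
    qed (simp add: lead_mono_def)
  qed
  moreover have "Poly_Mapping.lookup (Poly_Mapping.single e ?c * F) (lead_mono G) = Poly_Mapping.lookup G (lead_mono G)"
  proof -
    have "Poly_Mapping.lookup (Poly_Mapping.single e ?c * F) (lead_mono F + e)
       = (\<Sum>m\<in>Poly_Mapping.keys F. Poly_Mapping.lookup (Poly_Mapping.single e ?c * Poly_Mapping.single m (Poly_Mapping.lookup F m)) (lead_mono F + e))"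
      by (subst poly_mapping_sum_single[of F]) (simp add: sum_distrib_left lookup_sum)
    also have "\<dots> = (\<Sum>m\<in>Poly_Mapping.keys F. if m = lead_mono F then ?c * Poly_Mapping.lookup F m else 0)"
      by (intro sum.cong refl) (auto simp: mult_single lookup_single when_def add.commute[of e])
    also have "\<dots> = Poly_Mapping.lookup G (lead_mono G)"
      using lead_mono_in_keys[OF assms(1)] by (simp add: in_keys_iff)
    finally show ?thesis using assms(3) by simp
  qed
  then have "lead_mono G \<notin> Poly_Mapping.keys H" by (simp add: H_def in_keys_iff lookup_minus)
  ultimately have "lead_mono H \<noteq> lead_mono G" "lead_mono H \<le> lead_mono G"
    using lead_mono_in_keys[OF False] by metis+
  then have "lead_mono H < lead_mono G" by (simp add: order_less_le)
  then show ?thesis by simp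
qed simp

lemma keys_lead_mono: "F \<noteq> 0 \<Longrightarrow> vars F \<subseteq> A \<Longrightarrow> Poly_Mapping.keys (lead_mono F) \<subseteq> A"
  using lead_mono_in_keys by (auto simp: vars_def)

lemma vars_add: "vars (F + G) \<subseteq> vars F \<union> vars G"
  using Poly_Mapping.keys_add[of F G] by (auto simp: vars_def)

lemma vars_uminus: "vars (- F) = vars F"
  by (simp add: vars_def in_keys_iff set_eq_iff)

lemma vars_diff: "vars (F - G) \<subseteq> vars F \<union> vars G"
  using vars_add[of F "-G"] vars_uminus[of G] by simp

lemma vars_mult: "vars (F * G) \<subseteq> vars F \<union> vars G"
proof
  fix i assume "i \<in> vars (F * G)"
  then obtain m where m: "m \<in> Poly_Mapping.keys (F * G)" "i \<in> Poly_Mapping.keys m" by (auto simp: vars_def)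
  then obtain p q where "m = p + q" "p \<in> Poly_Mapping.keys F" "q \<in> Poly_Mapping.keys G"
    using keys_mult[of F G] by blast
  then show "i \<in> vars F \<union> vars G" using m(2) Poly_Mapping.keys_add[of p q] by (auto simp: vars_def)
qed

text \<open>The Hilbert basis theorem for the ideals of polynomials vanishing on the common zeros of
  \<open>f 0, \<dots>, f (k - 1)\<close>.\<close>

lemma no_strict_vanishing_chain:
  fixes f :: "nat \<Rightarrow> cpoly"
  assumes vars: "\<And>k. vars (f k) \<subseteq> {..N}"
    and nz: "\<And>k. peval (f k) (x k) \<noteq> 0" and z: "\<And>j k. j < k \<Longrightarrow> peval (f j) (x k) = 0"
  shows False
proof -
  \<comment> \<open>The vanishing ideals of the common zeros of f 0, ..., f (k - 1). They grow
    strictly: \<open>f k\<close> belongs to the next one, but \<open>x k\<close> witnesses that it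
    is not in \<open>J k\<close>.\<close>
  define J where "J k = {p. vars p \<subseteq> {..N} \<and> (\<forall>y. (\<forall>j<k. peval (f j) y = 0) \<longrightarrow> peval p y = 0)}" for k :: nat
  have fJ: "f k \<in> J (Suc k) - J k" for k
    using vars nz[of k] z[of _ k] unfolding J_def by blast
  have "\<exists>p. p \<in> J (Suc k) - J k \<and> (\<forall>q\<in>J (Suc k) - J k. \<not> lead_mono q < lead_mono p)" for k
  proof -
    let ?R = "{(m, m'). m < (m' :: nat \<Rightarrow>\<^sub>0 nat) \<and> Poly_Mapping.keys m \<subseteq> {..N} \<and> Poly_Mapping.keys m' \<subseteq> {..N}}"
    obtain m where m: "m \<in> lead_mono ` (J (Suc k) - J k)"
        "\<And>m'. (m', m) \<in> ?R \<Longrightarrow> m' \<notin> lead_mono ` (J (Suc k) - J k)"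
      using wfE_min[OF wf_monomials[of N], of "lead_mono (f k)" "lead_mono ` (J (Suc k) - J k)"] fJ by blast
    have "Poly_Mapping.keys (lead_mono p) \<subseteq> {..N}" if "p \<in> J (Suc k) - J k" for p
    proof (rule keys_lead_mono)
      show "p \<noteq> 0" using that by (auto simp: J_def vars_def)
      show "vars p \<subseteq> {..N}" using that by (auto simp: J_def)
    qed
    note sub = this
    obtain p where p: "p \<in> J (Suc k) - J k" "m = lead_mono p" using m(1) by blast
    have "\<not> lead_mono q < lead_mono p" if q: "q \<in> J (Suc k) - J k" for q
    proof
      assume "lead_mono q < lead_mono p"
      then have "(lead_mono q, m) \<in> ?R" using sub[OF q] sub[OF p(1)] p(2) by simp
      then show False using m(2) q by blast
    qed
    then show ?thesis using p(1) by blast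
  qed
  then obtain p where p: "\<And>k. p k \<in> J (Suc k) - J k"
      "\<And>k q. q \<in> J (Suc k) - J k \<Longrightarrow> \<not> lead_mono q < lead_mono (p k)" by metis
  have p0: "p k \<noteq> 0" for k using p(1)[of k] by (auto simp: J_def vars_def)
  have pv: "vars (p k) \<subseteq> {..N}" for k using p(1)[of k] by (auto simp: J_def)
  \<comment> \<open>The \<open>p k\<close> have minimal leading monomials among the new elements of
    \<open>J (Suc k)\<close>. When one leading monomial divides a later one, reduction gives a new
    element with a smaller leading monomial, a contradiction.\<close>
  obtain i j e where ij: "i < j" "lead_mono (p j) = lead_mono (p i) + e"
    using Dickson[of "\<lambda>k. lead_mono (p k)" N] keys_lead_mono[OF p0 pv] by blast
  let ?M = "Poly_Mapping.single e (Poly_Mapping.lookup (p j) (lead_mono (p j)) / Poly_Mapping.lookup (p i) (lead_mono (p i)))"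
  let ?H = "p j - ?M * p i"
  have mono: "k \<le> l \<Longrightarrow> J k \<subseteq> J l" for k l unfolding J_def by fastforce
  have pi: "p i \<in> J j" using p(1)[of i] mono[of "Suc i" j] ij(1) by auto
  have "Poly_Mapping.keys e \<subseteq> Poly_Mapping.keys (lead_mono (p j))"
    unfolding ij(2) by (auto simp: in_keys_iff lookup_add)
  then have "Poly_Mapping.keys e \<subseteq> {..N}" using keys_lead_mono[OF p0 pv] by blast
  then have "vars ?M \<subseteq> {..N}" by (auto simp: vars_def split: if_splits)
  then have MJ: "?M * p i \<in> J j"
    using pi vars_mult[of ?M "p i"] unfolding J_def by auto
  have "?H \<in> J (Suc j)"
    using MJ mono[of j "Suc j"] p(1)[of j] vars_diff[of "p j" "?M * p i"] unfolding J_def by fastforce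
  moreover have "?H \<notin> J j"
  proof
    assume h: "?H \<in> J j"
    have "p j \<in> J j" unfolding J_def
    proof (intro CollectI conjI allI impI)
      show "vars (p j) \<subseteq> {..N}" by (rule pv)
      fix y assume y: "\<forall>k<j. peval (f k) y = 0"
      have "peval ?H y = 0" "peval (?M * p i) y = 0" using h MJ y unfolding J_def by blast+
      then show "peval (p j) y = 0" by simp
    qed
    then show False using p(1) by blast
  qed
  ultimately have "\<not> lead_mono ?H < lead_mono (p j)"
    using p(2)[of ?H j] by blast
  moreover have "0 \<in> J j" by (auto simp: J_def vars_def)
  then have "?H \<noteq> 0" using \<open>?H \<notin> J j\<close> by metis
  ultimately show False using lead_mono_reduce[OF p0 p0 ij(2)] by blast
qed

text \<open>A closed set without such a decomposition is reducible, and one of its two pieces is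
  again without one. The resulting descending chain provides polynomials vanishing on each member
  but not on the preceding one, which the Hilbert basis argument excludes.\<close>

lemma closed_finite_union_irreducible:
  assumes "closedin (zariski N a) C"
  shows "\<exists>\<C>. finite \<C> \<and> (\<forall>Z\<in>\<C>. irreducible_closed (zariski N a) Z) \<and> C = \<Union>\<C>"
proof (rule ccontr)
  define good where "good C \<longleftrightarrow> (\<exists>\<C>. finite \<C> \<and> (\<forall>Z\<in>\<C>. irreducible_closed (zariski N a) Z) \<and> C = \<Union>\<C>)" for C
  assume "\<not> ?thesis"
  then have ng: "\<not> good C" by (simp add: good_def)
  define bad where "bad C \<longleftrightarrow> closedin (zariski N a) C \<and> \<not> good C" for C
  have step: "\<exists>D. bad D \<and> D \<subset> C" if "bad C" for C
  proof -
    have C: "closedin (zariski N a) C" "\<not> good C" using that by (auto simp: bad_def)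
    have "good {}" unfolding good_def by (intro exI[of _ "{}"]) auto
    then have "C \<noteq> {}" using C by blast
    moreover have "\<not> irreducible_closed (zariski N a) C"
      using C(2) unfolding good_def by (metis cSup_singleton finite.emptyI finite.insertI singletonD)
    ultimately obtain A B where AB: "closedin (zariski N a) A" "closedin (zariski N a) B" "C \<subseteq> A \<union> B" "\<not> C \<subseteq> A" "\<not> C \<subseteq> B"
      using C(1) unfolding irreducible_closed_def by blast
    have "\<not> (good (C \<inter> A) \<and> good (C \<inter> B))"
    proof
      assume "good (C \<inter> A) \<and> good (C \<inter> B)"
      then obtain \<A> \<B> where "finite \<A>" "\<forall>Z\<in>\<A>. irreducible_closed (zariski N a) Z" "C \<inter> A = \<Union>\<A>"
        "finite \<B>" "\<forall>Z\<in>\<B>. irreducible_closed (zariski N a) Z" "C \<inter> B = \<Union>\<B>" unfolding good_def by metis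
      then have "finite (\<A> \<union> \<B>) \<and> (\<forall>Z\<in>\<A> \<union> \<B>. irreducible_closed (zariski N a) Z) \<and> C \<inter> A \<union> C \<inter> B = \<Union>(\<A> \<union> \<B>)"
        by (simp add: Union_Un_distrib ball_Un)
      then have "good (C \<inter> A \<union> C \<inter> B)" unfolding good_def by (rule exI)
      moreover have "C \<inter> A \<union> C \<inter> B = C" using AB(3) by blast
      ultimately show False using C(2) by simp
    qed
    then have "bad (C \<inter> A) \<or> bad (C \<inter> B)" using C(1) AB(1,2) by (auto simp: bad_def)
    moreover have "C \<inter> A \<subset> C" "C \<inter> B \<subset> C" using AB by auto
    ultimately show ?thesis by blast
  qed
  have "bad C" using assms ng by (simp add: bad_def)
  then obtain D where D: "D 0 = C" "\<And>k. bad (D k)" "\<And>k. D (Suc k) \<subset> D k"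
    using dependent_nat_choice[of "\<lambda>k D. bad D \<and> (k = 0 \<longrightarrow> D = C)" "\<lambda>k D D'. D' \<subset> D"] step by (metis nat.distinct(1))
  have "\<exists>f P. vars f \<subseteq> {..N} \<and> P \<in> D k \<and> D (Suc k) \<subseteq> zero_locus N a f \<and> (\<exists>x\<in>P. peval f x \<noteq> 0)" for k
  proof -
    obtain P where P: "P \<in> D k" "P \<notin> D (Suc k)" using D(3)[of k] by blast
    have "P \<in> wproj N a" using D(2)[of k] P(1) unfolding bad_def closedin_zariski_iff by blast
    then obtain j f where f: "whomogeneous N a j f" "D (Suc k) \<subseteq> zero_locus N a f" "P \<notin> zero_locus N a f"
      using D(2)[of "Suc k"] P(2) unfolding bad_def closedin_zariski_iff by blast
    then show ?thesis using P \<open>P \<in> wproj N a\<close> whomogeneous_vars[OF f(1)] by (auto simp: zero_locus_def)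
  qed
  then obtain f P x where f: "\<And>k. vars (f k) \<subseteq> {..N}" "\<And>k. P k \<in> D k" "\<And>k. D (Suc k) \<subseteq> zero_locus N a (f k)"
      "\<And>k. x k \<in> P k" "\<And>k. peval (f k) (x k) \<noteq> 0" by metis
  have mono: "j \<le> k \<Longrightarrow> D k \<subseteq> D j" for j k
    using D(3) by (metis lift_Suc_antimono_le psubset_imp_subset)
  have "peval (f j) (x k) = 0" if "j < k" for j k
  proof -
    have "P k \<in> zero_locus N a (f j)" using f(2)[of k] f(3)[of j] mono[of "Suc j" k] that by auto
    then show ?thesis using f(4)[of k] by (auto simp: zero_locus_def)
  qed
  with no_strict_vanishing_chain[of f N x] f(1,5) show False by blast
qed

text \<open>A germ of points of \<open>T\<close> outside the zeros of \<open>g\<close> near one point of \<open>Z\<close> outside the other components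
  of \<open>T\<close> shows that \<open>Z\<close> is not a component of \<open>T\<close>.\<close>

lemma larger_irreducible:
  assumes T: "closedin (zariski N a) T" and Z: "irreducible_closed (zariski N a) Z" "Z \<subseteq> T"
    and g: "whomogeneous N a k g" "Z \<subseteq> zero_locus N a g"
    and near: "\<And>P x j h. P \<in> Z \<Longrightarrow> x \<in> P \<Longrightarrow> whomogeneous N a j h \<Longrightarrow> peval h x \<noteq> 0 \<Longrightarrow>
      \<exists>Q\<in>T. \<exists>y\<in>Q. peval h y \<noteq> 0 \<and> peval g y \<noteq> 0"
  shows "\<exists>Y. irreducible_closed (zariski N a) Y \<and> Z \<subset> Y \<and> Y \<subseteq> T"
proof (rule ccontr)
  assume no: "\<not> ?thesis"
  obtain \<C> where C: "finite \<C>" "\<forall>Z\<in>\<C>. irreducible_closed (zariski N a) Z" "T = \<Union>\<C>"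
    using closed_finite_union_irreducible[OF T] by blast
  let ?T' = "\<Union>(\<C> - {Z})"
  have cl: "closedin (zariski N a) Y" if "Y \<in> \<C>" for Y using C that by (auto simp: irreducible_closed_def)
  have T': "closedin (zariski N a) ?T'" using C(1) cl by (intro closedin_Union) auto
  \<comment> \<open>Otherwise the irreducible \<open>Z\<close> would lie in a single component
    \<open>Y\<close> different from \<open>Z\<close>, and \<open>Y\<close> would be the larger set
    sought.\<close>
  have "\<not> Z \<subseteq> ?T'"
  proof
    assume "Z \<subseteq> ?T'"
    then obtain Y where "Y \<in> \<C> - {Z}" "Z \<subseteq> Y"
      using irreducible_closed_Union[OF Z(1), of "\<C> - {Z}"] C(1) cl by blast
    then show False using no C by blast
  qed
  then obtain P where P: "P \<in> Z" "P \<notin> ?T'" by blast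
  have Pw: "P \<in> wproj N a" using P(1) g(2) zero_locus_subset by blast
  then obtain j h where h: "whomogeneous N a j h" "?T' \<subseteq> zero_locus N a h" "P \<notin> zero_locus N a h"
    using T' P(2) unfolding closedin_zariski_iff by blast
  obtain x where x: "x \<in> P" using wproj_nonempty[OF Pw] by blast
  then obtain Q y where Q: "Q \<in> T" "y \<in> Q" "peval h y \<noteq> 0" "peval g y \<noteq> 0"
    using near[OF P(1) x h(1)] zero_locus_iff[OF h(1) Pw x] h(3) by blast
  have "Q \<notin> ?T'" using h(2) Q(2,3) by (auto simp: zero_locus_def)
  then have "Q \<in> Z" using Q(1) C(3) by blast
  then show False using g(2) Q(2,4) by (auto simp: zero_locus_def)
qed

section \<open>Regular functions\<close>

abbreviation regular :: "nat \<Rightarrow> (nat \<Rightarrow> nat) \<Rightarrow> wpoint set \<Rightarrow> (wpoint \<Rightarrow> complex) \<Rightarrow> bool" where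
  "regular N a \<equiv> regular_on N a (wproj N a)"

lemma regular_iff:
  "regular N a U f \<longleftrightarrow> openin (zariski N a) U \<and>
     (\<forall>P\<in>U. \<exists>W k g h. openin (zariski N a) W \<and> P \<in> W \<and> W \<subseteq> U \<and>
        whomogeneous N a k g \<and> whomogeneous N a k h \<and>
        (\<forall>Q\<in>W. \<forall>x\<in>Q. peval h x \<noteq> 0 \<and> f Q = peval g x / peval h x))"
  unfolding regular_on_def zariski_on_wproj ..

lemma regular_openin: "regular N a U f \<Longrightarrow> openin (zariski N a) U"
  by (simp add: regular_iff)

lemma regularE:
  assumes "regular N a U f" "P \<in> U"
  shows "\<exists>W k g h. openin (zariski N a) W \<and> P \<in> W \<and> W \<subseteq> U \<and>
    whomogeneous N a k g \<and> whomogeneous N a k h \<and>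
    (\<forall>Q\<in>W. \<forall>x\<in>Q. peval h x \<noteq> 0) \<and> (\<forall>Q\<in>W. \<forall>x\<in>Q. f Q = peval g x / peval h x)"
proof -
  obtain W k g h where "openin (zariski N a) W" "P \<in> W" "W \<subseteq> U"
    "whomogeneous N a k g" "whomogeneous N a k h"
    "\<forall>Q\<in>W. \<forall>x\<in>Q. peval h x \<noteq> 0 \<and> f Q = peval g x / peval h x"
    using assms unfolding regular_iff by meson
  then show ?thesis by (intro exI[of _ W] exI[of _ k] exI[of _ g] exI[of _ h]) simp
qed

lemma regular_quotient:
  assumes "openin (zariski N a) U" "whomogeneous N a k g" "whomogeneous N a k h"
    "\<And>Q x. Q \<in> U \<Longrightarrow> x \<in> Q \<Longrightarrow> peval h x \<noteq> 0 \<and> f Q = peval g x / peval h x"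
  shows "regular N a U f"
  unfolding regular_iff using assms by blast

lemma regular_const: "openin (zariski N a) U \<Longrightarrow> regular N a U (\<lambda>_. c)"
  by (rule regular_quotient[of _ _ _ 0 "Const c" 1]) (auto simp: whomogeneous_Const whomogeneous_1)

lemma regular_subset:
  assumes "regular N a U f" "openin (zariski N a) V" "V \<subseteq> U"
  shows "regular N a V f"
  unfolding regular_iff
proof (intro conjI ballI)
  fix P assume P: "P \<in> V"
  obtain W k g h where W: "openin (zariski N a) W" "P \<in> W" "W \<subseteq> U"
    "whomogeneous N a k g" "whomogeneous N a k h"
    "\<forall>Q\<in>W. \<forall>x\<in>Q. peval h x \<noteq> 0"
    "\<forall>Q\<in>W. \<forall>x\<in>Q. f Q = peval g x / peval h x"
    using regularE[OF assms(1) subsetD[OF assms(3) P]] by blast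
  show "\<exists>W k g h. openin (zariski N a) W \<and> P \<in> W \<and> W \<subseteq> V \<and>
        whomogeneous N a k g \<and> whomogeneous N a k h \<and>
        (\<forall>Q\<in>W. \<forall>x\<in>Q. peval h x \<noteq> 0 \<and> f Q = peval g x / peval h x)"
    by (rule exI[of _ "W \<inter> V"], rule exI[of _ k], rule exI[of _ g], rule exI[of _ h])
      (use W assms(2) P in auto)
qed (rule assms(2))

text \<open>A common pattern for sums, products and quotients: local fractions are combined on the
  intersection of their domains. The predicate \<open>ok\<close> restricts the values, as division
  requires a nonzero one.\<close>

lemma regular_binary:
  assumes "regular N a U f1" "regular N a U f2"
    and comb: "\<And>k1 k2 g1 h1 g2 h2. whomogeneous N a k1 g1 \<Longrightarrow> whomogeneous N a k1 h1 \<Longrightarrow>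
      whomogeneous N a k2 g2 \<Longrightarrow> whomogeneous N a k2 h2 \<Longrightarrow>
      \<exists>k g h. whomogeneous N a k g \<and> whomogeneous N a k h \<and> (\<forall>x. peval h1 x \<noteq> 0 \<longrightarrow> peval h2 x \<noteq> 0 \<longrightarrow>
        ok (peval g1 x / peval h1 x) (peval g2 x / peval h2 x) \<longrightarrow>
        peval h x \<noteq> 0 \<and> op (peval g1 x / peval h1 x) (peval g2 x / peval h2 x) = peval g x / peval h x)"
    and ok: "\<And>Q. Q \<in> U \<Longrightarrow> ok (f1 Q) (f2 Q)"
  shows "regular N a U (\<lambda>Q. op (f1 Q) (f2 Q))"
  unfolding regular_iff
proof (intro conjI ballI)
  fix P assume P: "P \<in> U"
  obtain W1 k1 g1 h1 where W1: "openin (zariski N a) W1" "P \<in> W1" "W1 \<subseteq> U"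
    "whomogeneous N a k1 g1" "whomogeneous N a k1 h1"
    "\<forall>Q\<in>W1. \<forall>x\<in>Q. peval h1 x \<noteq> 0"
    "\<forall>Q\<in>W1. \<forall>x\<in>Q. f1 Q = peval g1 x / peval h1 x"
    using regularE[OF assms(1) P] by blast
  obtain W2 k2 g2 h2 where W2: "openin (zariski N a) W2" "P \<in> W2" "W2 \<subseteq> U"
    "whomogeneous N a k2 g2" "whomogeneous N a k2 h2"
    "\<forall>Q\<in>W2. \<forall>x\<in>Q. peval h2 x \<noteq> 0"
    "\<forall>Q\<in>W2. \<forall>x\<in>Q. f2 Q = peval g2 x / peval h2 x"
    using regularE[OF assms(2) P] by blast
  obtain k g h where gh: "whomogeneous N a k g" "whomogeneous N a k h"
    "\<And>x. peval h1 x \<noteq> 0 \<Longrightarrow> peval h2 x \<noteq> 0 \<Longrightarrow> ok (peval g1 x / peval h1 x) (peval g2 x / peval h2 x) \<Longrightarrow>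
        peval h x \<noteq> 0 \<and> op (peval g1 x / peval h1 x) (peval g2 x / peval h2 x) = peval g x / peval h x"
    using comb[OF W1(4,5) W2(4,5)] by blast
  show "\<exists>W k g h. openin (zariski N a) W \<and> P \<in> W \<and> W \<subseteq> U \<and>
        whomogeneous N a k g \<and> whomogeneous N a k h \<and>
        (\<forall>Q\<in>W. \<forall>x\<in>Q. peval h x \<noteq> 0 \<and> op (f1 Q) (f2 Q) = peval g x / peval h x)"
  proof (rule exI[of _ "W1 \<inter> W2"], rule exI[of _ k], rule exI[of _ g], rule exI[of _ h], intro conjI ballI)
    fix Q x assume Q: "Q \<in> W1 \<inter> W2" "x \<in> Q"
    then have "f1 Q = peval g1 x / peval h1 x" "f2 Q = peval g2 x / peval h2 x"
      "peval h1 x \<noteq> 0" "peval h2 x \<noteq> 0" using W1(6,7) W2(6,7) by blast+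
    then show "peval h x \<noteq> 0" "op (f1 Q) (f2 Q) = peval g x / peval h x"
      using gh(3)[of x] ok[of Q] Q(1) W1(3) by auto
  qed (use W1 W2 gh in auto)
qed (rule regular_openin[OF assms(1)])

lemma regular_add:
  assumes "regular N a U f" "regular N a U g"
  shows "regular N a U (\<lambda>Q. f Q + g Q)"
proof (rule regular_binary[where ok = "\<lambda>_ _. True", OF assms], goal_cases)
  case (1 k1 k2 g1 h1 g2 h2)
  have "whomogeneous N a (k1 + k2) (g1 * h2 + h1 * g2)" "whomogeneous N a (k1 + k2) (h1 * h2)"
    using whomogeneous_mult[OF 1(1,4)] whomogeneous_mult[OF 1(2,3)] whomogeneous_mult[OF 1(2,4)]
    by (auto intro: whomogeneous_add)
  then show ?case
    by (intro exI[of _ "k1 + k2"] exI[of _ "g1 * h2 + h1 * g2"] exI[of _ "h1 * h2"]) (auto simp: add_frac_eq mult.commute)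
qed simp

lemma regular_mult:
  assumes "regular N a U f" "regular N a U g"
  shows "regular N a U (\<lambda>Q. f Q * g Q)"
proof (rule regular_binary[where ok = "\<lambda>_ _. True", OF assms], goal_cases)
  case (1 k1 k2 g1 h1 g2 h2)
  have "whomogeneous N a (k1 + k2) (g1 * g2)" "whomogeneous N a (k1 + k2) (h1 * h2)"
    using whomogeneous_mult[OF 1(1,3)] whomogeneous_mult[OF 1(2,4)] by auto
  then show ?case
    by (intro exI[of _ "k1 + k2"] exI[of _ "g1 * g2"] exI[of _ "h1 * h2"]) auto
qed simp

lemma regular_divide:
  assumes "regular N a U f" "regular N a U g" "\<And>Q. Q \<in> U \<Longrightarrow> g Q \<noteq> 0"
  shows "regular N a U (\<lambda>Q. f Q / g Q)"
proof (rule regular_binary[where ok = "\<lambda>_ z. z \<noteq> 0", OF assms(1,2)], goal_cases)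
  case (1 k1 k2 g1 h1 g2 h2)
  have "whomogeneous N a (k1 + k2) (h1 * g2)" using 1 by (intro whomogeneous_mult)
  moreover have "whomogeneous N a (k1 + k2) (g1 * h2)" using 1 by (intro whomogeneous_mult)
  ultimately show ?case
    by (intro exI[of _ "k1 + k2"] exI[of _ "g1 * h2"] exI[of _ "h1 * g2"]) auto
qed (use assms(3) in auto)

lemma regular_diff:
  assumes "regular N a U f" "regular N a U g"
  shows "regular N a U (\<lambda>Q. f Q - g Q)"
  using regular_add[OF assms(1) regular_mult[OF regular_const[OF regular_openin[OF assms(2)], of "-1"] assms(2)]] by simp

lemma regular_power: "regular N a U f \<Longrightarrow> regular N a U (\<lambda>Q. f Q ^ k)"
  by (induction k) (auto intro: regular_mult regular_const regular_openin)

lemma regular_sum: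
  "openin (zariski N a) U \<Longrightarrow> (\<And>s. s \<in> S \<Longrightarrow> regular N a U (f s)) \<Longrightarrow> regular N a U (\<lambda>Q. \<Sum>s\<in>S. f s Q)"
  by (induction S rule: infinite_finite_induct) (auto intro: regular_add regular_const)

lemma regular_prod:
  "openin (zariski N a) U \<Longrightarrow> (\<And>s. s \<in> S \<Longrightarrow> regular N a U (f s)) \<Longrightarrow> regular N a U (\<lambda>Q. \<Prod>s\<in>S. f s Q)"
  by (induction S rule: infinite_finite_induct) (auto intro: regular_mult regular_const)

lemma regular_peval:
  assumes "openin (zariski N a) U" "\<And>i. regular N a U (\<lambda>Q. y Q i)"
  shows "regular N a U (\<lambda>Q. peval F (y Q))"
  unfolding peval_mono_val mono_val_def
  using assms by (intro regular_sum regular_mult regular_prod regular_power regular_const) auto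

lemma regular_nonzero_open:
  assumes "regular N a U f"
  shows "openin (zariski N a) {Q \<in> U. f Q \<noteq> 0}"
proof (subst openin_subopen, intro ballI)
  fix P assume P: "P \<in> {Q \<in> U. f Q \<noteq> 0}"
  then obtain W k g h where W: "openin (zariski N a) W" "P \<in> W" "W \<subseteq> U"
    "whomogeneous N a k g" "whomogeneous N a k h"
    "\<forall>Q\<in>W. \<forall>x\<in>Q. peval h x \<noteq> 0"
    "\<forall>Q\<in>W. \<forall>x\<in>Q. f Q = peval g x / peval h x"
    using regularE[OF assms, of P] by blast
  have Ww: "W \<subseteq> wproj N a" using W(1) by (simp add: openin_zariski_iff)
  have "f Q \<noteq> 0 \<longleftrightarrow> Q \<in> basic_open N a g" if "Q \<in> W" for Q
  proof -
    have Qw: "Q \<in> wproj N a" using that Ww by blast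
    obtain x where x: "x \<in> Q" using wproj_nonempty[OF Qw] by blast
    show ?thesis using basic_open_iff[OF W(4) _ x] W(6,7)[rule_format, OF that x] that Ww by auto
  qed
  then have "P \<in> W \<inter> basic_open N a g" "W \<inter> basic_open N a g \<subseteq> {Q \<in> U. f Q \<noteq> 0}"
    using P W(2,3) by auto
  then show "\<exists>T. openin (zariski N a) T \<and> P \<in> T \<and> T \<subseteq> {Q \<in> U. f Q \<noteq> 0}"
    using openin_Int[OF W(1) openin_basic_open[OF W(4)]] by blast
qed

section \<open>Points with trivial stabilizer are nonsingular\<close>

lemma single_eq_prod_Var:
  "Poly_Mapping.single m c = Const c * (\<Prod>i\<in>Poly_Mapping.keys m. Var i ^ Poly_Mapping.lookup m i)"
proof -
  have pow: "Var i ^ k = Poly_Mapping.single (Poly_Mapping.single i k) 1" for i k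
    by (induction k) (simp_all add: mult_single single_add[symmetric])
  have "(\<Prod>i\<in>A. Var i ^ Poly_Mapping.lookup m i) = Poly_Mapping.single (\<Sum>i\<in>A. Poly_Mapping.single i (Poly_Mapping.lookup m i)) 1" for A
    unfolding pow by (induction A rule: infinite_finite_induct) (simp_all add: mult_single)
  then show ?thesis
    by (simp add: mult_single poly_mapping_sum_single[of m, symmetric])
qed

text \<open>Constants and variables generate the ring C[x_i | i \<in> I]; identities compatible with
  sums and products need be checked on these only.\<close>

lemma cpoly_induct [consumes 1, case_names Const Var add mult]:
  assumes "vars F \<subseteq> I"
    and "\<And>c. Q (Const c)" "\<And>i. i \<in> I \<Longrightarrow> Q (Var i)"
    and add: "\<And>F G. Q F \<Longrightarrow> Q G \<Longrightarrow> Q (F + G)" and mult: "\<And>F G. Q F \<Longrightarrow> Q G \<Longrightarrow> Q (F * G)"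
  shows "Q F"
proof -
  have 0: "Q 0" and 1: "Q 1" using assms(2)[of 0] assms(2)[of 1] by simp_all
  have pow: "Q G \<Longrightarrow> Q (G ^ k)" for G k by (induction k) (auto intro: mult 1)
  have prod: "(\<And>s. s \<in> S \<Longrightarrow> Q (f s)) \<Longrightarrow> Q (prod f S)" for S :: "nat set" and f
    by (induction S rule: infinite_finite_induct) (auto intro: mult 1)
  have mon: "Q (Poly_Mapping.single m (Poly_Mapping.lookup F m))" if "m \<in> Poly_Mapping.keys F" for m
    unfolding single_eq_prod_Var[of m]
    using assms(1) that by (intro mult prod pow assms) (auto simp: vars_def)
  have sum: "(\<And>s. s \<in> S \<Longrightarrow> Q (f s)) \<Longrightarrow> Q (sum f S)" for S :: "(nat \<Rightarrow>\<^sub>0 nat) set" and f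
    by (induction S rule: infinite_finite_induct) (auto intro: add 0)
  have "Q (\<Sum>m\<in>Poly_Mapping.keys F. Poly_Mapping.single m (Poly_Mapping.lookup F m))"
    by (rule sum) (rule mon)
  then show ?thesis by (subst poly_mapping_sum_single)
qed

text \<open>First-order Taylor expansion with polynomial coefficients, by FG - F(c)G(c) = (F - F(c))
  G + F(c) (G - G(c)). It shows that the coordinate differences generate the functions vanishing at
  \<open>c\<close>.\<close>

lemma Hadamard:
  assumes "vars F \<subseteq> {..N}"
  shows "\<exists>U. (\<forall>y. peval F y - peval F c = (\<Sum>j\<le>N. (y j - c j) * peval (U j) y))"
  using assms
proof (induction F rule: cpoly_induct)
  case (Const c)
  show ?case by (intro exI[of _ "\<lambda>_. 0"]) simp
next
  case (Var i)
  show ?case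
  proof (intro exI[of _ "\<lambda>j. if j = i then 1 else 0"] allI)
    fix y
    have "(\<Sum>j\<le>N. (y j - c j) * peval (if j = i then 1 else 0) y) = (\<Sum>j\<le>N. if j = i then y j - c j else 0)"
      by (intro sum.cong) auto
    also have "\<dots> = y i - c i" using Var by simp
    finally show "peval (Var i) y - peval (Var i) c = (\<Sum>j\<le>N. (y j - c j) * peval (if j = i then 1 else 0) y)"
      by simp
  qed
next
  case (add F G)
  then obtain U V where U: "\<And>y. peval F y - peval F c = (\<Sum>j\<le>N. (y j - c j) * peval (U j) y)"
    "\<And>y. peval G y - peval G c = (\<Sum>j\<le>N. (y j - c j) * peval (V j) y)" by blast
  have "peval (F + G) y - peval (F + G) c = (\<Sum>j\<le>N. (y j - c j) * peval (U j + V j) y)" for y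
  proof -
    have "peval (F + G) y - peval (F + G) c = (peval F y - peval F c) + (peval G y - peval G c)" by simp
    then show ?thesis unfolding U by (simp add: sum.distrib distrib_left)
  qed
  then show ?case by (intro exI[of _ "\<lambda>j. U j + V j"] allI)
next
  case (mult F G)
  then obtain U V where U: "\<And>y. peval F y - peval F c = (\<Sum>j\<le>N. (y j - c j) * peval (U j) y)"
    "\<And>y. peval G y - peval G c = (\<Sum>j\<le>N. (y j - c j) * peval (V j) y)" by blast
  have "peval (F * G) y - peval (F * G) c = (\<Sum>j\<le>N. (y j - c j) * peval (U j * G + Const (peval F c) * V j) y)" for y
  proof -
    have "peval (F * G) y - peval (F * G) c
      = (peval F y - peval F c) * peval G y + peval F c * (peval G y - peval G c)" by (simp add: algebra_simps)
    then show ?thesis unfolding U by (simp add: sum.distrib distrib_left sum_distrib_left sum_distrib_right mult_ac)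
  qed
  then show ?case by (intro exI[of _ "\<lambda>j. U j * G + Const (peval F c) * V j"] allI)
qed

lemma Hadamard_deriv:
  assumes U: "\<And>y. peval F y - peval F c = (\<Sum>j\<le>N. (y j - c j) * peval (U j) y)" and i: "i \<le> N"
  shows "peval (U i) c = peval (partial_deriv i F) c"
proof -
  have F: "peval F (c(i := t)) = peval F c + (t - c i) * poly (upoly i (U i) c) t" for t
  proof -
    have "(\<Sum>j\<le>N. ((c(i := t)) j - c j) * peval (U j) (c(i := t))) =
      (\<Sum>j\<le>N. if j = i then (t - c i) * peval (U i) (c(i := t)) else 0)"
      by (intro sum.cong) auto
    then show ?thesis using U[of "c(i := t)"] i by (simp add: poly_upoly algebra_simps)
  qed
  have "((\<lambda>t. peval F (c(i := t))) has_field_derivative peval (U i) c) (at (c i))"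
    unfolding F by (rule derivative_eq_intros poly_DERIV refl | simp add: poly_upoly)+
  then show ?thesis by (rule peval_partial_derivI[symmetric])
qed

text \<open>The factor \<open>x i\<close> restores the lowered exponent, so that exponent zero needs
  no separate formula.\<close>

lemma partial_deriv_monomial:
  "peval (partial_deriv i (Poly_Mapping.single m c)) x * x i = of_nat (Poly_Mapping.lookup m i) * c * mono_val x m"
proof (cases "c = 0")
  case True
  then show ?thesis by (simp add: partial_deriv_def)
next
  case False
  show ?thesis
  proof (cases "Poly_Mapping.lookup m i = 0")
    case False
    then have "m = Poly_Mapping.single i 1 + (m - Poly_Mapping.single i 1)"
      by (intro poly_mapping_eqI) (auto simp: lookup_add lookup_minus lookup_single when_def)
    then have "mono_val x m = x i * mono_val x (m - Poly_Mapping.single i 1)"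
      by (metis mono_val_add mono_val_single power_one_right)
    then show ?thesis using \<open>c \<noteq> 0\<close> by (simp add: partial_deriv_def mult_ac)
  qed (use False in \<open>simp add: partial_deriv_def\<close>)
qed

lemma exists_wdegree_multiple:
  "\<exists>m'. Poly_Mapping.keys m' \<subseteq> Poly_Mapping.keys m \<and> wdegree a m' = c * wdegree a m"
proof (induction c)
  case 0
  show ?case by (intro exI[of _ 0]) auto
next
  case (Suc c)
  then obtain m' where "Poly_Mapping.keys m' \<subseteq> Poly_Mapping.keys m" "wdegree a m' = c * wdegree a m" by blast
  then show ?case using Poly_Mapping.keys_add[of m m']
    by (intro exI[of _ "m + m'"]) (auto simp: wdegree_add)
qed

text \<open>Bezout's identity with the negative coefficients moved to the other side: the gcd of the
  weights is the difference of the degrees of two honest monomials.\<close>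

lemma Bezout_monomials:
  fixes a :: "nat \<Rightarrow> nat"
  assumes "finite S" "\<And>i. i \<in> S \<Longrightarrow> a i > 0"
  shows "\<exists>p q. Poly_Mapping.keys p \<subseteq> S \<and> Poly_Mapping.keys q \<subseteq> S \<and> wdegree a p = wdegree a q + Gcd (a ` S)"
  using assms
proof (induction S rule: finite_induct)
  case empty
  then show ?case by (intro exI[of _ 0]) auto
next
  case (insert i S)
  obtain p q where pq: "Poly_Mapping.keys p \<subseteq> S" "Poly_Mapping.keys q \<subseteq> S" "wdegree a p = wdegree a q + Gcd (a ` S)"
    using insert.IH insert.prems by blast
  have "a i \<noteq> 0" using insert.prems[of i] by simp
  then obtain x y where xy: "a i * x = Gcd (a ` S) * y + gcd (a i) (Gcd (a ` S))"
    using bezout_nat by blast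
  obtain p' q' where p': "Poly_Mapping.keys p' \<subseteq> Poly_Mapping.keys p" "wdegree a p' = y * wdegree a p"
    and q': "Poly_Mapping.keys q' \<subseteq> Poly_Mapping.keys q" "wdegree a q' = y * wdegree a q"
    using exists_wdegree_multiple by metis
  have "wdegree a (Poly_Mapping.single i x + q') = wdegree a p' + Gcd (a ` insert i S)"
    using xy pq(3) by (simp add: wdegree_add p' q' algebra_simps)
  moreover have "Poly_Mapping.keys (Poly_Mapping.single i x + q') \<subseteq> insert i S" "Poly_Mapping.keys p' \<subseteq> insert i S"
    using Poly_Mapping.keys_add[of "Poly_Mapping.single i x" q'] p' q' pq by (auto split: if_splits)
  ultimately show ?case by blast
qed

text \<open>The order-preserving enumeration of the indices other than \<open>i\<close>; it numbers
  the local parameters left after one coordinate is eliminated.\<close>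

lemma skip_bij: "i \<le> N \<Longrightarrow> bij_betw (\<lambda>j. if j < i then j else Suc j) {..<N} ({..N} - {i})"
proof (rule bij_betw_byWitness[where f' = "\<lambda>j. if j < i then j else j - 1"])
qed auto

text \<open>Where the monomials \<open>p\<close> and \<open>q\<close> of degrees \<open>D + 1\<close> and \<open>D\<close> do not vanish, every point has a unique
  representative \<open>y\<close> with \<open>p y = q y\<close>; its coordinates are regular functions, and one of them can be
  eliminated by means of this relation.\<close>

lemma nonsingular_pointI:
  assumes a: "\<And>i. i \<le> N \<Longrightarrow> a i > 0" and P: "P \<in> wproj N a" and x0: "x0 \<in> P"
    and gcd: "Gcd (a ` {i. i \<le> N \<and> x0 i \<noteq> 0}) = 1"
  shows "nonsingular_point N a P"
proof -
  define S where "S = {i. i \<le> N \<and> x0 i \<noteq> 0}"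
  have S: "finite S" "S \<subseteq> {..N}" unfolding S_def by auto
  obtain p q where pq: "Poly_Mapping.keys p \<subseteq> S" "Poly_Mapping.keys q \<subseteq> S" "wdegree a p = wdegree a q + 1"
    using Bezout_monomials[OF S(1), of a] a gcd unfolding S_def by auto
  let ?D = "wdegree a q"
  have wp: "whomogeneous N a (Suc ?D) (Poly_Mapping.single p 1)" and wq: "whomogeneous N a ?D (Poly_Mapping.single q 1)"
    using pq S(2) by (auto intro!: whomogeneous_single)
  define U where "U = basic_open N a (\<Prod>i\<in>S. Var i)"
  have wS: "whomogeneous N a (sum a S) (\<Prod>i\<in>S. Var i)"
    using S(2) by (intro whomogeneous_prod whomogeneous_Var) auto
  have Uopen: "openin (zariski N a) U" unfolding U_def by (rule openin_basic_open[OF wS])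
  have Uw: "U \<subseteq> wproj N a" unfolding U_def by (rule basic_open_subset)
  have nzS: "x i \<noteq> 0" if "Q \<in> U" "x \<in> Q" "i \<in> S" for Q x i
    using that S(1) unfolding U_def basic_open_def by (auto simp: peval_prod)
  have nzm: "mono_val x m \<noteq> 0" if "Q \<in> U" "x \<in> Q" "Poly_Mapping.keys m \<subseteq> S" for Q x m
    using that nzS[OF that(1,2)] by (auto simp: mono_val_eq_0_iff)
  have PU: "P \<in> U" unfolding U_def basic_open_iff[OF wS P x0] using S(1) by (simp add: peval_prod S_def)
  \<comment> \<open>The ratio q(x)/p(x) has degree -1, so scaling by it cancels the choice of the
    representative \<open>x\<close>, and it makes the two monomials equal.\<close>
  define Y where "Y x = (\<lambda>i. (mono_val x q / mono_val x p) ^ a i * x i)" for x :: "nat \<Rightarrow> complex"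
  have YQ: "Y x \<in> Q" if "Q \<in> U" "x \<in> Q" for Q x
  proof (rule orbit_of_memI[OF _ that(2), of N a "mono_val x q / mono_val x p"])
    show "Q \<in> wproj N a" using that Uw by blast
    show "mono_val x q / mono_val x p \<noteq> 0" using nzm[OF that] pq by simp
    fix i assume "N < i"
    then have "x i = 0" using wproj_mem_punctured[of Q N a x] that Uw by (auto simp: punctured_space_def)
    then show "Y x i = 0" by (simp add: Y_def)
  qed (simp add: Y_def)
  have Yindep: "Y x' = Y x" if Q: "Q \<in> U" "x \<in> Q" "x' \<in> Q" for Q x x'
  proof
    fix i
    have Qw: "Q \<in> wproj N a" using Q(1) Uw by blast
    obtain t where t: "t \<noteq> 0" "\<forall>i\<le>N. x' i = t ^ a i * x i" using wproj_same_point[OF Qw Q(2,3)] by blast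
    have "mono_val x' p = t ^ Suc ?D * mono_val x p" "mono_val x' q = t ^ ?D * mono_val x q"
      using whomogeneous_scale[OF wp, of x' t x] whomogeneous_scale[OF wq, of x' t x] t by simp_all
    then have *: "mono_val x' q / mono_val x' p = (mono_val x q / mono_val x p) / t" using t(1) by simp
    show "Y x' i = Y x i"
    proof (cases "i \<le> N")
      case True
      then show ?thesis unfolding Y_def * using t by (simp add: power_divide power_mult_distrib)
    next
      case False
      then have "x i = 0" "x' i = 0" using wproj_mem_punctured[OF Qw] Q by (auto simp: punctured_space_def)
      then show ?thesis by (simp add: Y_def)
    qed
  qed
  define y where "y Q = Y (SOME x. x \<in> Q)" for Q :: wpoint
  have y: "y Q = Y x" if "Q \<in> U" "x \<in> Q" for Q x
    unfolding y_def using Yindep[OF that] someI[of "\<lambda>x. x \<in> Q" x] that by metis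
  have yQ: "y Q \<in> Q" if "Q \<in> U" for Q using y YQ that wproj_nonempty[of Q] Uw by (metis subsetD)
  have yreg: "regular N a U (\<lambda>Q. y Q i)" for i
  proof (cases "i \<le> N")
    case True
    have deg: "a i * ?D + a i = Suc ?D * a i" by simp
    show ?thesis
    proof (rule regular_quotient[OF Uopen, of "Suc ?D * a i" "Poly_Mapping.single q 1 ^ a i * Var i" "Poly_Mapping.single p 1 ^ a i"])
      show "whomogeneous N a (Suc ?D * a i) (Poly_Mapping.single q 1 ^ a i * Var i)"
        using whomogeneous_mult[OF whomogeneous_power[OF wq, of "a i"] whomogeneous_Var[OF True]]
        unfolding deg .
      show "whomogeneous N a (Suc ?D * a i) (Poly_Mapping.single p 1 ^ a i)"
        using whomogeneous_power[OF wp, of "a i"] by (simp add: mult.commute)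
      fix Q x assume Q: "Q \<in> U" "x \<in> Q"
      show "peval (Poly_Mapping.single p 1 ^ a i) x \<noteq> 0 \<and>
         y Q i = peval (Poly_Mapping.single q 1 ^ a i * Var i) x / peval (Poly_Mapping.single p 1 ^ a i) x"
        using nzm[OF Q pq(1)] by (simp add: y[OF Q] Y_def power_divide)
    qed
  next
    case False
    then have "y Q i = 0" if "Q \<in> U" for Q
      using wproj_mem_punctured[of Q N a "y Q"] that Uw yQ[OF that] by (auto simp: punctured_space_def)
    then show ?thesis using regular_on_cong[OF regular_const[OF Uopen, of 0]] by metis
  qed
  define c where "c = y P"
  have cS: "c i \<noteq> 0" if "i \<in> S" for i using nzS[OF PU yQ[OF PU] that] by (simp add: c_def)
  define R where "R = Poly_Mapping.single p 1 - (Poly_Mapping.single q 1 :: cpoly)"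
  have Ry: "peval R (y Q) = 0" if "Q \<in> U" for Q
  proof -
    have Qw: "Q \<in> wproj N a" using that Uw by blast
    obtain x where x: "x \<in> Q" using wproj_nonempty[OF Qw] by blast
    let ?t = "mono_val x q / mono_val x p"
    have "mono_val (Y x) p = ?t ^ Suc ?D * mono_val x p" "mono_val (Y x) q = ?t ^ ?D * mono_val x q"
      using whomogeneous_scale[OF wp, of "Y x" ?t x] whomogeneous_scale[OF wq, of "Y x" ?t x] by (simp_all add: Y_def)
    then show ?thesis using nzm[OF that x pq(1)] by (simp add: R_def y[OF that x])
  qed
  have "p \<noteq> q" using pq(3) by auto
  \<comment> \<open>At \<open>c\<close> both monomials have the same nonzero value, so a difference
    of their exponents of x_i0 makes the derivative of \<open>R\<close> in this direction
    nonzero.\<close>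
  then obtain i0 where i0: "Poly_Mapping.lookup p i0 \<noteq> Poly_Mapping.lookup q i0" by (meson poly_mapping_eqI)
  have i0S: "i0 \<in> S" using i0 pq(1,2) by (metis in_keys_iff subsetD)
  then have i0N: "i0 \<le> N" using S(2) by auto
  have dR: "peval (partial_deriv i0 R) c \<noteq> 0"
  proof -
    have "peval (partial_deriv i0 R) c * c i0 =
      of_nat (Poly_Mapping.lookup p i0) * mono_val c p - of_nat (Poly_Mapping.lookup q i0) * mono_val c q"
      using partial_deriv_add[of i0 R "Poly_Mapping.single q 1" c]
        partial_deriv_monomial[of i0 p 1 c] partial_deriv_monomial[of i0 q 1 c]
      by (simp add: R_def algebra_simps)
    also have "\<dots> = (of_nat (Poly_Mapping.lookup p i0) - of_nat (Poly_Mapping.lookup q i0)) * mono_val c p"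
      using Ry[OF PU] by (simp add: R_def c_def algebra_simps)
    also have "\<dots> \<noteq> 0" using i0 nzm[OF PU yQ[OF PU] pq(1)] by (simp add: c_def)
    finally show ?thesis by auto
  qed
  have "vars R \<subseteq> {..N}"
    using whomogeneous_vars[OF wp] whomogeneous_vars[OF wq] vars_diff unfolding R_def by blast
  \<comment> \<open>\<open>R\<close> vanishes at every normalized representative, so this expansion
    is a linear relation between the coordinate differences; it can be solved for the difference at
    \<open>i0\<close> wherever \<open>V i0\<close> is nonzero.\<close>
  then obtain V where V: "\<And>z. peval R z - peval R c = (\<Sum>j\<le>N. (z j - c j) * peval (V j) z)"
    using Hadamard by blast
  have Vc: "peval (V i0) c \<noteq> 0" using Hadamard_deriv[OF V i0N] dR by simp
  let ?\<iota> = "\<lambda>j. if j < i0 then j else Suc j"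
  show ?thesis unfolding nonsingular_point_def
  proof (rule exI[of _ U], rule exI[of _ "\<lambda>j Q. y Q (?\<iota> j) - c (?\<iota> j)"], intro conjI allI impI)
    show "P \<in> U" "openin (zariski N a) U" by fact+
    fix j
    show "regular N a U (\<lambda>Q. y Q (?\<iota> j) - c (?\<iota> j))"
      by (intro regular_diff yreg regular_const[OF Uopen])
    show "y P (?\<iota> j) - c (?\<iota> j) = 0" by (simp add: c_def)
  next
    fix O' f assume h: "P \<in> O' \<and> regular N a O' f \<and> f P = 0"
    then obtain W k g h where W: "openin (zariski N a) W" "P \<in> W" "W \<subseteq> O'"
      "whomogeneous N a k g" "whomogeneous N a k h"
      "\<forall>Q\<in>W. \<forall>x\<in>Q. peval h x \<noteq> 0"
      "\<forall>Q\<in>W. \<forall>x\<in>Q. f Q = peval g x / peval h x"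
      using regularE[of N a O' f P] by blast
    have gc: "peval g c = 0" using W(6,7)[rule_format, OF W(2) yQ[OF PU]] h by (simp add: c_def)
    obtain G where G: "\<And>z. peval g z - peval g c = (\<Sum>j\<le>N. (z j - c j) * peval (G j) z)"
      using Hadamard[OF whomogeneous_vars[OF W(4)]] by blast
    define W' where "W' = W \<inter> {Q \<in> U. peval (V i0) (y Q) \<noteq> 0}"
    have W'o: "openin (zariski N a) W'" unfolding W'_def
      by (intro openin_Int W(1) regular_nonzero_open regular_peval Uopen yreg)
    have W'U: "W' \<subseteq> U" by (auto simp: W'_def)
    have yreg': "regular N a W' (\<lambda>Q. peval F (y Q))" for F
      by (intro regular_peval W'o regular_subset[OF yreg W'o W'U])
    have hnz: "peval h (y Q) \<noteq> 0" "peval (V i0) (y Q) \<noteq> 0" if "Q \<in> W'" for Q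
      using that W(6)[rule_format, of Q "y Q"] yQ[of Q] by (auto simp: W'_def)
    \<comment> \<open>The coefficients found by expanding the numerator \<open>g\<close> at
      \<open>c\<close>, eliminating the difference at \<open>i0\<close>, and dividing by
      \<open>h\<close>.\<close>
    define u where "u j Q = (peval (G (?\<iota> j)) (y Q) - peval (G i0) (y Q) * peval (V (?\<iota> j)) (y Q) / peval (V i0) (y Q)) / peval h (y Q)" for j Q
    have ureg: "regular N a W' (u j)" for j
      unfolding u_def by (intro regular_divide regular_diff regular_mult yreg' hnz)
    have f: "f Q = (\<Sum>j<N. u j Q * (y Q (?\<iota> j) - c (?\<iota> j)))" if Q: "Q \<in> W'" for Q
    proof -
      have QU: "Q \<in> U" and QW: "Q \<in> W" using Q by (auto simp: W'_def)
      have split: "(\<Sum>j\<le>N. F j) = F i0 + (\<Sum>j<N. F (?\<iota> j))" for F :: "nat \<Rightarrow> complex"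
      proof -
        have "(\<Sum>j<N. F (?\<iota> j)) = (\<Sum>j\<in>{..N} - {i0}. F j)"
          by (rule sum.reindex_bij_betw[OF skip_bij[OF i0N]])
        then show ?thesis using i0N by (simp add: sum.remove[of "{..N}" i0])
      qed
      let ?e = "\<lambda>j. y Q j - c j" and ?v = "\<lambda>j. peval (V j) (y Q)" and ?g = "\<lambda>j. peval (G j) (y Q)"
      have "?e i0 * ?v i0 = - (\<Sum>j<N. ?e (?\<iota> j) * ?v (?\<iota> j))"
        using V[of "y Q"] Ry[OF QU] Ry[OF PU] split[of "\<lambda>j. ?e j * ?v j"] by (simp add: c_def eq_neg_iff_add_eq_0)
      then have e0: "?e i0 = - (\<Sum>j<N. ?e (?\<iota> j) * ?v (?\<iota> j)) / ?v i0"
        using hnz[OF Q] by (simp add: field_simps)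
      have "peval g (y Q) = ?e i0 * ?g i0 + (\<Sum>j<N. ?e (?\<iota> j) * ?g (?\<iota> j))"
        using G[of "y Q"] gc split[of "\<lambda>j. ?e j * ?g j"] by simp
      also have "\<dots> = (\<Sum>j<N. ?e (?\<iota> j) * ?g (?\<iota> j)) - (\<Sum>j<N. ?e (?\<iota> j) * ?v (?\<iota> j)) * (?g i0 / ?v i0)"
        unfolding e0 by simp
      also have "\<dots> = (\<Sum>j<N. (?g (?\<iota> j) - ?g i0 * ?v (?\<iota> j) / ?v i0) * ?e (?\<iota> j))"
        unfolding sum_distrib_right sum_subtractf[symmetric] by (intro sum.cong refl) (simp add: algebra_simps diff_divide_distrib)
      finally have "f Q = (\<Sum>j<N. (?g (?\<iota> j) - ?g i0 * ?v (?\<iota> j) / ?v i0) * ?e (?\<iota> j)) / peval h (y Q)"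
        using W(7)[rule_format, OF QW yQ[OF QU]] by simp
      then show ?thesis unfolding u_def sum_divide_distrib by simp
    qed
    have "P \<in> W'" using W(2) PU Vc by (simp add: W'_def c_def)
    then show "\<exists>W u. P \<in> W \<and> W \<subseteq> U \<inter> O' \<and> openin (zariski N a) W \<and>
             (\<forall>i<N. regular N a W (u i)) \<and> (\<forall>Q\<in>W. f Q = (\<Sum>i<N. u i Q * (y Q (?\<iota> i) - c (?\<iota> i))))"
      using W'o W'U W(3) ureg f by (intro exI[of _ W'] exI[of _ u]) (auto simp: W'_def)
  qed
qed

section \<open>Singular loci of codimension two\<close>

lemma continuous_on_peval:
  "(\<And>i. continuous_on S (\<lambda>z. y z i)) \<Longrightarrow> continuous_on S (\<lambda>z. peval F (y z))"
  unfolding peval_mono_val mono_val_def by (intro continuous_intros) auto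

lemma holomorphic_on_peval:
  "(\<And>i. (\<lambda>z. y z i) holomorphic_on S) \<Longrightarrow> (\<lambda>z. peval F (y z)) holomorphic_on S"
  unfolding peval_mono_val mono_val_def by (intro holomorphic_intros) auto

text \<open>Continuity of roots, in the form of Hurwitz's theorem: a zero of \<open>F\<close> on the hyperplane
  \<open>x j = 0\<close> deforms to the parallel hyperplanes, unless \<open>F\<close> vanishes on that hyperplane.\<close>

lemma nearby_zero:
  assumes Fx: "peval F x = 0" and hx: "peval h x \<noteq> 0" and Fv: "peval F v \<noteq> 0" and j: "x j = 0" "v j = 0"
  shows "\<exists>y. peval F y = 0 \<and> peval h y \<noteq> 0 \<and> y j \<noteq> 0 \<and> (\<forall>s. s \<noteq> j \<longrightarrow> x s = 0 \<longrightarrow> v s = 0 \<longrightarrow> y s = 0)"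
proof -
  \<comment> \<open>The first parameter moves from \<open>x\<close> to \<open>v\<close> inside the
    hyperplane; the second is the value of the j-th coordinate.\<close>
  define y where "y p = (\<lambda>s. if s = j then snd p else x s + fst p * (v s - x s))" for p :: "complex \<times> complex"
  have cy: "continuous_on UNIV (\<lambda>p. y p i)" for i
    unfolding y_def by (cases "i = j") (auto intro!: continuous_intros)
  have y0: "y (0, 0) = x" and y1: "y (1, 0) = v" using j by (auto simp: y_def)
  have cF: "continuous_on UNIV (\<lambda>p. peval F (y p))" and ch: "continuous_on UNIV (\<lambda>p. peval h (y p))"
    using cy by (auto intro: continuous_on_peval)
  have "open {p. peval h (y p) \<noteq> 0}"
    using ch by (intro open_Collect_neq continuous_on_const)
  then obtain e where e: "e > 0" "ball (0, 0) e \<subseteq> {p. peval h (y p) \<noteq> 0}"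
    using hx y0 open_contains_ball[of "{p. peval h (y p) \<noteq> 0}"] by (metis (mono_tags, lifting) mem_Collect_eq)
  have near: "peval h (y (z, u)) \<noteq> 0" if "norm z < e / 2" "norm u < e / 2" for z u
  proof -
    have "norm (z, u) < e" using norm_Pair_le[of z u] that by linarith
    then have "(z, u) \<in> ball (0, 0) e" by (simp add: dist_norm norm_Pair)
    then show ?thesis using e(2) by blast
  qed
  obtain n0 :: nat where n0: "inverse (real (Suc n0)) < e / 2" using reals_Archimedean[of "e/2"] e(1) by auto
  define u where "u n = (of_real (inverse (real (Suc (n0 + n)))) :: complex)" for n
  have u: "u n \<noteq> 0" "norm (u n) < e / 2" for n
  proof -
    show "u n \<noteq> 0" by (simp add: u_def del: of_nat_Suc)
    have "inverse (real (Suc (n0 + n))) \<le> inverse (real (Suc n0))" by (simp add: field_simps)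
    moreover have "0 < inverse (real (Suc (n0 + n)))" by simp
    ultimately have "\<bar>inverse (real (Suc (n0 + n)))\<bar> < e / 2" using n0 by linarith
    then show "norm (u n) < e / 2" unfolding u_def norm_of_real .
  qed
  have ulim: "u \<longlonglongrightarrow> 0"
  proof -
    have "(\<lambda>n. inverse (real (Suc (n + n0)))) \<longlonglongrightarrow> 0"
      using LIMSEQ_ignore_initial_segment[OF LIMSEQ_inverse_real_of_nat, of n0] .
    then have "(\<lambda>n. of_real (inverse (real (Suc (n0 + n)))) :: complex) \<longlonglongrightarrow> of_real 0"
      by (intro tendsto_of_real) (simp add: add.commute)
    then show ?thesis by (simp add: u_def[abs_def])
  qed
  define g where "g z = peval F (y (z, 0))" for z
  have hol: "(\<lambda>z. peval F (y (z, w))) holomorphic_on S" for w S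
  proof (rule holomorphic_on_peval)
    show "(\<lambda>z. y (z, w) i) holomorphic_on S" for i
      unfolding y_def by (cases "i = j") (auto intro!: holomorphic_intros)
  qed
  have "\<exists>n z. z \<in> ball 0 (e/2) \<and> peval F (y (z, u n)) = 0"
  proof (rule ccontr)
    assume no: "\<not> ?thesis"
    \<comment> \<open>By Hurwitz, a nonconstant limit of functions without zeros has no zeros. The
      limit \<open>g\<close> takes different values at 0 and at 1, so by the identity theorem it is
      not constant near 0; but it vanishes at 0.\<close>
    have "g 0 \<noteq> 0"
    proof (rule Hurwitz_no_zeros[of "ball 0 (e/2)" "\<lambda>n z. peval F (y (z, u n))" g])
      show "(\<lambda>z. peval F (y (z, u n))) holomorphic_on ball 0 (e/2)" for n by (rule hol)
      show "g holomorphic_on ball 0 (e/2)" unfolding g_def by (rule hol)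
      show "uniform_limit K (\<lambda>n z. peval F (y (z, u n))) g sequentially" if K: "compact K" for K
      proof (rule uniform_limitI)
        fix r :: real assume r: "0 < r"
        have "uniformly_continuous_on (K \<times> cball 0 (e/2)) (\<lambda>p. peval F (y p))"
          using K by (intro compact_uniformly_continuous continuous_on_subset[OF cF] compact_Times) auto
        then obtain d where d: "d > 0" "\<And>p p'. p \<in> K \<times> cball 0 (e/2) \<Longrightarrow> p' \<in> K \<times> cball 0 (e/2) \<Longrightarrow>
            dist p' p < d \<Longrightarrow> dist (peval F (y p')) (peval F (y p)) < r"
          using r unfolding uniformly_continuous_on_def by metis
        have "\<forall>\<^sub>F n in sequentially. norm (u n) < d"
          using ulim d(1) by (auto simp: tendsto_iff)
        then show "\<forall>\<^sub>F n in sequentially. \<forall>z\<in>K. dist (peval F (y (z, u n))) (g z) < r"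
        proof eventually_elim
          case (elim n)
          show ?case unfolding g_def
          proof
            fix z assume "z \<in> K"
            then show "dist (peval F (y (z, u n))) (peval F (y (z, 0))) < r"
              using u(2)[of n] elim e(1) by (intro d(2)) (auto simp: dist_Pair_Pair less_imp_le)
          qed
        qed
      qed
      show "\<not> g constant_on ball 0 (e/2)"
      proof
        assume "g constant_on ball 0 (e/2)"
        then have c: "g z = g 0" if "z \<in> ball 0 (e/2)" for z
          using that e(1) unfolding constant_on_def by (metis centre_in_ball half_gt_zero_iff)
        have "g holomorphic_on UNIV" unfolding g_def by (rule hol)
        then have "g 1 = g 0"
          by (intro analytic_continuation_open[of "ball 0 (e/2)" UNIV g "\<lambda>_. g 0" 1] c) (use e(1) in auto)
        then show False using Fx Fv y0 y1 by (simp add: g_def)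
      qed
      show "peval F (y (z, u n)) \<noteq> 0" if "z \<in> ball 0 (e/2)" for n z using no that by blast
    qed (use e(1) in auto)
    then show False using Fx y0 by (simp add: g_def)
  qed
  then obtain n z where z: "norm z < e / 2" "peval F (y (z, u n)) = 0" by auto
  then show ?thesis using near[OF z(1) u(2)[of n]] u(1)[of n]
    by (intro exI[of _ "y (z, u n)"]) (auto simp: y_def)
qed

text \<open>One link of a codimension chain: the condition x_i = 0 is released. The point
  \<open>v\<close> guarantees that \<open>F\<close> does not vanish on the coordinate subspace, so
  zeros of \<open>F\<close> in it deform to zeros with x_i nonzero.\<close>

lemma larger_irreducible_hypersurface:
  assumes F: "whomogeneous N a d F" and I: "I \<subseteq> {..N}" "i \<le> N" "i \<notin> I"
    and v: "peval F v \<noteq> 0" "\<And>s. s \<in> insert i I \<Longrightarrow> v s = 0"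
    and Z: "irreducible_closed (zariski N a) Z" "Z \<subseteq> zero_locus N a F"
      "\<And>s. s \<in> insert i I \<Longrightarrow> Z \<subseteq> zero_locus N a (Var s)"
  shows "\<exists>Y. irreducible_closed (zariski N a) Y \<and> Z \<subset> Y \<and> Y \<subseteq> zero_locus N a F \<inter> (\<Inter>s\<in>I. zero_locus N a (Var s))"
proof -
  let ?T = "\<Inter>(insert (zero_locus N a F) ((\<lambda>s. zero_locus N a (Var s)) ` I))"
  have "\<exists>Y. irreducible_closed (zariski N a) Y \<and> Z \<subset> Y \<and> Y \<subseteq> ?T"
  proof (rule larger_irreducible[OF _ Z(1) _ whomogeneous_Var[OF I(2)]])
    show "closedin (zariski N a) ?T"
      using I(1) by (intro closedin_Inter) (auto intro!: closedin_zero_locus[OF F] closedin_zero_locus[OF whomogeneous_Var])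
    show "Z \<subseteq> ?T" "Z \<subseteq> zero_locus N a (Var i)" using Z by auto
    fix P x j h assume P: "P \<in> Z" and x: "x \<in> P" and h: "whomogeneous N a j h" "peval h x \<noteq> 0"
    have Pw: "P \<in> wproj N a" using P Z(2) zero_locus_subset by blast
    have xN: "x s = 0" if "s > N" for s using wproj_mem_punctured[OF Pw x] that by (auto simp: punctured_space_def)
    have Fx: "peval F x = 0" using P Z(2) x by (auto simp: zero_locus_def)
    have xs: "x s = 0" if "s \<in> insert i I" for s using P x Z(3)[OF that] by (auto simp: zero_locus_def)
    \<comment> \<open>Cutting off the coordinates of \<open>v\<close> beyond \<open>N\<close> keeps
      the deformed point in the punctured space.\<close>
    define w where "w = (\<lambda>s. if s \<le> N then v s else 0)"
    have Fw: "peval F w \<noteq> 0" using v(1) whomogeneous_peval_cong[OF F, of w v] by (simp add: w_def)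
    have wi: "w i = 0" using v(2) by (simp add: w_def)
    obtain y where y: "peval F y = 0" "peval h y \<noteq> 0" "y i \<noteq> 0" "\<forall>s. s \<noteq> i \<longrightarrow> x s = 0 \<longrightarrow> w s = 0 \<longrightarrow> y s = 0"
      using nearby_zero[OF Fx h(2) Fw, of i] xs[of i] wi by (metis insertI1)
    have yp: "y \<in> punctured_space N"
      using y(3,4) I(2) xN by (auto simp: punctured_space_def w_def)
    have ys: "y s = 0" if "s \<in> I" for s
    proof -
      have "s \<noteq> i" "x s = 0" "w s = 0" using that I(3) xs v(2) by (auto simp: w_def)
      then show ?thesis using y(4) by blast
    qed
    have "orbit_of N a y \<in> ?T"
      using y(1) ys I(1) orbit_zero_locus_iff[OF F yp] orbit_zero_locus_iff[OF whomogeneous_Var yp] by auto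
    then show "\<exists>Q\<in>?T. \<exists>y\<in>Q. peval h y \<noteq> 0 \<and> peval (Var i) y \<noteq> 0"
      using orbit_of_mem[OF yp] y(2,3) by (intro bexI[of _ "orbit_of N a y"] bexI[of _ y]) auto
  qed
  then show ?thesis by auto
qed

text \<open>By the criterion for nonsingular points, the weights of the nonzero coordinates of a
  singular point share a prime factor. So coordinate subspaces attached to the finitely many primes
  dividing a weight cover the singular locus.\<close>

lemma singular_point_prime:
  assumes a: "\<And>i. i \<le> N \<Longrightarrow> a i > 0" and P: "P \<in> singular_locus N a"
  shows "\<exists>q. prime q \<and> (\<exists>k\<le>N. q dvd a k) \<and> (\<forall>x\<in>P. \<forall>i\<le>N. \<not> q dvd a i \<longrightarrow> x i = 0)"
proof -
  have Pw: "P \<in> wproj N a" using P by (simp add: singular_locus_def)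
  then obtain x where x: "x \<in> P" using wproj_nonempty by blast
  have "Gcd (a ` {i. i \<le> N \<and> x i \<noteq> 0}) \<noteq> 1"
    using nonsingular_pointI[OF a Pw x] P by (auto simp: singular_locus_def)
  then obtain q where q: "prime q" "q dvd Gcd (a ` {i. i \<le> N \<and> x i \<noteq> 0})"
    using prime_factor_nat by metis
  then have qd: "q dvd a i" if "i \<le> N" "x i \<noteq> 0" for i
  proof -
    have "Gcd (a ` {i. i \<le> N \<and> x i \<noteq> 0}) dvd a i" using that by (intro Gcd_dvd_nat imageI) simp
    then show ?thesis using q(2) dvd_trans by blast
  qed
  obtain k where k: "k \<le> N" "x k \<noteq> 0"
    using wproj_mem_punctured[OF Pw x] unfolding punctured_space_def by (simp) (metis not_le)
  have "y i = 0" if "y \<in> P" "i \<le> N" "\<not> q dvd a i" for y i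
  proof -
    have "x i = 0" using qd that by blast
    moreover obtain t where "\<forall>i\<le>N. y i = t ^ a i * x i" using wproj_same_point[OF Pw x \<open>y \<in> P\<close>] by blast
    ultimately show ?thesis using that(2) by simp
  qed
  then show ?thesis using q(1) k qd by blast
qed

text \<open>An irreducible set of singular points lies in the subspace \<open>L q\<close> of one
  prime \<open>q\<close>, as only finitely many primes matter. Two weights prime to \<open>q\<close>
  give two conditions x_i = x_j = 0 on it; releasing x_j and then x_i yields a chain of length two
  inside V(F).\<close>

lemma two_le_codim_singular:
  assumes a: "\<And>i. i \<le> N \<Longrightarrow> a i > 0" and F: "whomogeneous N a d F"
    and q: "\<And>q k. prime q \<Longrightarrow> k \<le> N \<Longrightarrow> q dvd a k \<Longrightarrow> \<exists>i\<le>N. \<exists>j\<le>N. i \<noteq> j \<and> \<not> q dvd a i \<and> \<not> q dvd a j \<and>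
      (\<exists>v. v i = 0 \<and> v j = 0 \<and> peval F v \<noteq> 0)"
  shows "2 \<le> codim (zariski_on N a (zero_locus N a F)) (zero_locus N a F \<inter> singular_locus N a)"
  unfolding codim_def
proof (rule INF_greatest)
  let ?X = "zero_locus N a F"
  have irr: "irreducible_closed (zariski_on N a ?X) Z \<longleftrightarrow> irreducible_closed (zariski N a) Z \<and> Z \<subseteq> ?X" for Z
    by (rule irreducible_closed_subtopology[OF closedin_zero_locus[OF F]])
  fix Z assume "Z \<in> {Z'. irreducible_closed (zariski_on N a ?X) Z' \<and> Z' \<subseteq> ?X \<inter> singular_locus N a}"
  then have Z: "irreducible_closed (zariski N a) Z" "Z \<subseteq> ?X" "Z \<subseteq> singular_locus N a" by (auto simp: irr)
  define L where "L q = wproj N a \<inter> (\<Inter>i\<in>{i. i \<le> N \<and> \<not> q dvd a i}. zero_locus N a (Var i))" for q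
  define Q where "Q = (\<Union>k\<in>{..N}. {q. prime q \<and> q dvd a k})"
  have finQ: "finite Q" unfolding Q_def
  proof (intro finite_UN_I finite_atMost)
    fix k assume "k \<in> {..N}"
    then have "a k > 0" using a by simp
    then have "{q. prime q \<and> q dvd a k} \<subseteq> {..a k}" using dvd_imp_le by auto
    then show "finite {q. prime q \<and> q dvd a k}" by (rule finite_subset) simp
  qed
  have Lc: "closedin (zariski N a) (L q)" for q
  proof -
    have "closedin (zariski N a) (\<Inter>(insert (wproj N a) ((\<lambda>i. zero_locus N a (Var i)) ` {i. i \<le> N \<and> \<not> q dvd a i})))"
      using closedin_topspace[of "zariski N a"]
      by (intro closedin_Inter) (auto intro!: closedin_zero_locus[OF whomogeneous_Var] simp: topspace_zariski)
    then show ?thesis by (simp add: L_def)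
  qed
  have "Z \<subseteq> \<Union>(L ` Q)"
  proof
    fix P assume P: "P \<in> Z"
    then have Pw: "P \<in> wproj N a" using Z(2) zero_locus_subset by blast
    obtain q k where q: "prime q" "k \<le> N" "q dvd a k" "\<forall>x\<in>P. \<forall>i\<le>N. \<not> q dvd a i \<longrightarrow> x i = 0"
      using singular_point_prime[of N a P, OF a] P Z(3) by blast
    then have "P \<in> L q" using Pw by (auto simp: L_def zero_locus_def)
    then show "P \<in> \<Union>(L ` Q)" using q by (auto simp: Q_def)
  qed
  then obtain q where q1: "q \<in> Q" "Z \<subseteq> L q"
    using irreducible_closed_Union[OF Z(1), of "L ` Q"] finQ Lc by auto
  then obtain k where k: "prime q" "k \<le> N" "q dvd a k" by (auto simp: Q_def)
  obtain i j v where ij: "i \<le> N" "j \<le> N" "i \<noteq> j" "\<not> q dvd a i" "\<not> q dvd a j" "v i = 0" "v j = 0" "peval F v \<noteq> 0"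
    using q[OF k] by blast
  have Zij: "Z \<subseteq> zero_locus N a (Var i)" "Z \<subseteq> zero_locus N a (Var j)"
    using q1(2) ij by (auto simp: L_def)
  obtain Y1 where Y1: "irreducible_closed (zariski N a) Y1" "Z \<subset> Y1" "Y1 \<subseteq> ?X \<inter> (\<Inter>s\<in>{i}. zero_locus N a (Var s))"
    using larger_irreducible_hypersurface[OF F _ ij(2) _ ij(8) _ Z(1,2), of "{i}"] ij Zij by auto
  obtain Y2 where Y2: "irreducible_closed (zariski N a) Y2" "Y1 \<subset> Y2" "Y2 \<subseteq> ?X"
    using larger_irreducible_hypersurface[OF F, of "{}" i v Y1] ij Y1 by auto
  have "enat 2 \<le> irreducible_codim (zariski_on N a ?X) Z"
    unfolding irreducible_codim_def
  proof (rule SUP_upper, rule CollectI, rule exI[of _ "\<lambda>k. if k = 0 then Z else if k = 1 then Y1 else Y2"], intro conjI allI impI)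
    fix k :: nat assume "k < 2"
    then have "k = 0 \<or> k = 1" by auto
    then show "(if k = 0 then Z else if k = 1 then Y1 else Y2) \<subset> (if Suc k = 0 then Z else if Suc k = 1 then Y1 else Y2)"
      using Y1(2) Y2(2) by auto
  qed (use Z Y1 Y2 irr in auto)
  then show "2 \<le> irreducible_codim (zariski_on N a ?X) Z" by (simp add: numeral_eq_enat)
qed

text \<open>If at most one weight escaped \<open>q\<close>, all the others would share the factor
  \<open>q\<close>.\<close>

lemma well_formed_two_nondivisible:
  assumes "well_formed_space N a" "prime q"
  shows "\<exists>i\<le>N. \<exists>j\<le>N. i \<noteq> j \<and> \<not> q dvd a i \<and> \<not> q dvd (a j :: nat)"
proof (rule ccontr)
  assume no: "\<not> ?thesis"
  obtain i where i: "i \<le> N" "\<forall>j\<le>N. j \<noteq> i \<longrightarrow> q dvd a j"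
  proof (cases "\<exists>i\<le>N. \<not> q dvd a i")
    case True
    then show ?thesis using no that by metis
  next
    case False
    then show ?thesis using that[of 0] by auto
  qed
  have "q dvd Gcd (a ` ({..N} - {i}))" using i by (intro Gcd_greatest) auto
  then show False using assms i(1) by (auto simp: well_formed_space_def)
qed

section \<open>Irreducibility of quasi-smooth hypersurfaces\<close>

text \<open>Zeros in the plane are not isolated: if the origin were the only one, then for each t
  \<noteq> 0 the polynomial in s would have no root and be constant, so its values at s = 0 and s =
  1 would agree for all t, also at t = 0, making (1, 0) a zero.\<close>

lemma bivariate_nonorigin_zero:
  fixes r :: "complex poly poly"
  assumes "poly (poly r 0) 0 = 0"
  shows "\<exists>s t. (s \<noteq> 0 \<or> t \<noteq> 0) \<and> poly (poly r [:t:]) s = 0"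
proof (rule ccontr)
  assume no: "\<not> ?thesis"
  define p where "p s = map_poly (\<lambda>c. poly c s) r" for s :: complex
  have p: "poly (p s) t = poly (poly r [:t:]) s" for s t
    unfolding p_def by (induction r) (auto simp: map_poly_pCons)
  have "poly (p 1 - p 0) t = 0" if "t \<noteq> 0" for t
  proof -
    have "\<nexists>s. poly (poly r [:t:]) s = 0" using no that by blast
    then have "degree (poly r [:t:]) = 0"
      using Fundamental_Theorem_Algebra.fundamental_theorem_of_algebra_alt constant_degree
        alg_closed_imp_poly_has_root[of "poly r [:t:]"] by (metis gr0I)
    then show ?thesis by (metis degree_eq_zeroE diff_self p poly_const_conv poly_diff poly_pCons mult_zero_right add.right_neutral poly_0)
  qed
  then have "p 1 - p 0 = 0" using nonzero_poly_nonroot by blast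
  then have "poly (p 1) 0 = poly (p 0) 0" by simp
  then have "poly (poly r [:0:]) 1 = 0" using assms unfolding p by simp
  then show False using no by (metis one_neq_zero)
qed

lemma whomogeneous_at_0:
  assumes "whomogeneous N a e G" "e > 0"
  shows "peval G (\<lambda>_. 0) = 0"
  using whomogeneous_scale[OF assms(1), of "\<lambda>_. 0" 1 "\<lambda>_. 0"] assms
  unfolding peval_mono_val mono_val_eq_0_iff
  by (intro sum.neutral ballI) (auto simp: whomogeneous_iff mono_val_eq_0_iff wdegree_def)

context
  fixes i j k :: nat
  assumes ijk: "i \<noteq> j" "i \<noteq> k" "j \<noteq> k"
begin

definition pt3 :: "complex \<Rightarrow> complex \<Rightarrow> complex \<Rightarrow> nat \<Rightarrow> complex" where
  "pt3 s t z = (\<lambda>l. if l = i then s else if l = j then t else if l = k then z else 0)"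

text \<open>The restriction of \<open>G\<close> to the space of the coordinates i, j, k, with x_k as
  outermost variable, so that a resultant eliminates x_k.\<close>

definition poly3 :: "cpoly \<Rightarrow> complex poly poly poly" where
  "poly3 G = (\<Sum>m\<in>{m\<in>Poly_Mapping.keys G. Poly_Mapping.keys m \<subseteq> {i, j, k}}.
     monom (monom (monom (Poly_Mapping.lookup G m) (Poly_Mapping.lookup m i)) (Poly_Mapping.lookup m j)) (Poly_Mapping.lookup m k))"

definition ev2 :: "complex \<Rightarrow> complex \<Rightarrow> complex poly poly \<Rightarrow> complex" where
  "ev2 s t c = poly (poly c [:t:]) s"

lemma ev2_hom: "comm_ring_hom (ev2 s t)"
  by unfold_locales (auto simp: ev2_def)

lemma poly_map_ev2: "poly (map_poly (ev2 s t) P) z = poly (poly (poly P [:[:z:]:]) [:t:]) s"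
  by (induction P) (auto simp: map_poly_pCons ev2_def)

lemma poly3_eval: "poly (map_poly (ev2 s t) (poly3 G)) z = peval G (pt3 s t z)"
proof -
  let ?S = "{m\<in>Poly_Mapping.keys G. Poly_Mapping.keys m \<subseteq> {i, j, k}}"
  have "peval G (pt3 s t z) = (\<Sum>m\<in>?S. Poly_Mapping.lookup G m * mono_val (pt3 s t z) m)"
    unfolding peval_mono_val
    by (intro sum.mono_neutral_right) (auto simp: mono_val_eq_0_iff pt3_def)
  also have "\<dots> = (\<Sum>m\<in>?S. Poly_Mapping.lookup G m * (s ^ Poly_Mapping.lookup m i * t ^ Poly_Mapping.lookup m j * z ^ Poly_Mapping.lookup m k))"
  proof (intro sum.cong refl)
    fix m assume "m \<in> ?S"
    then have "mono_val (pt3 s t z) m = (\<Prod>l\<in>{i,j,k}. pt3 s t z l ^ Poly_Mapping.lookup m l)"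
      by (intro mono_val_superset) auto
    also have "\<dots> = s ^ Poly_Mapping.lookup m i * t ^ Poly_Mapping.lookup m j * z ^ Poly_Mapping.lookup m k"
      using ijk by (simp add: pt3_def mult.assoc)
    finally show "Poly_Mapping.lookup G m * mono_val (pt3 s t z) m = Poly_Mapping.lookup G m * (s ^ Poly_Mapping.lookup m i * t ^ Poly_Mapping.lookup m j * z ^ Poly_Mapping.lookup m k)"
      by simp
  qed
  also have "\<dots> = poly (map_poly (ev2 s t) (poly3 G)) z"
    unfolding poly_map_ev2 poly3_def by (simp add: poly_sum poly_monom poly_mult mult_ac)
  finally show ?thesis by simp
qed

text \<open>Nonvanishing at the k-th vertex means that \<open>G\<close> contains a pure power of
  x_k. By homogeneity and positivity of the weights no other monomial in the three variables has as
  high an exponent of x_k.\<close>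

lemma poly3_lead:
  assumes G: "whomogeneous N a e G" "e > 0" "a i > 0" "a j > 0" "a k > 0" "peval G (pt3 0 0 1) \<noteq> 0"
  shows "\<exists>c. c \<noteq> 0 \<and> degree (poly3 G) > 0 \<and> lead_coeff (poly3 G) = [:[:c:]:]"
proof -
  let ?S = "{m\<in>Poly_Mapping.keys G. Poly_Mapping.keys m \<subseteq> {i, j, k}}"
  have w: "a i * Poly_Mapping.lookup m i + a j * Poly_Mapping.lookup m j + a k * Poly_Mapping.lookup m k = e" if "m \<in> ?S" for m
  proof -
    have "wdegree a m = (\<Sum>l\<in>{i,j,k}. a l * Poly_Mapping.lookup m l)"
      using that by (intro wdegree_superset) auto
    then show ?thesis using that G(1) ijk by (auto simp: whomogeneous_iff)
  qed
  have "\<exists>m\<in>Poly_Mapping.keys G. mono_val (pt3 0 0 1) m \<noteq> 0"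
    using G(6) unfolding peval_mono_val by (metis (no_types, lifting) mult_zero_right sum.neutral)
  then obtain m0 where m0: "m0 \<in> Poly_Mapping.keys G" "\<And>l. l \<in> Poly_Mapping.keys m0 \<Longrightarrow> pt3 0 0 1 l \<noteq> 0"
    by (auto simp: mono_val_eq_0_iff)
  have "l = k" if "l \<in> Poly_Mapping.keys m0" for l
    using m0(2)[OF that] by (auto simp: pt3_def split: if_splits)
  then have k0: "Poly_Mapping.keys m0 \<subseteq> {k}" by blast
  define n where "n = Poly_Mapping.lookup m0 k"
  have m0S: "m0 \<in> ?S" using m0 k0 by auto
  have l0: "Poly_Mapping.lookup m0 i = 0" "Poly_Mapping.lookup m0 j = 0" using k0 ijk by (auto simp: in_keys_iff subset_iff)
  have e: "a k * n = e" using w[OF m0S] l0 by (simp add: n_def)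
  have le: "Poly_Mapping.lookup m k \<le> n" if "m \<in> ?S" for m
  proof -
    have "a k * Poly_Mapping.lookup m k \<le> a k * n" using w[OF that] e by linarith
    then show ?thesis using G(5) by simp
  qed
  have uniq: "m = m0" if "m \<in> ?S" "Poly_Mapping.lookup m k = n" for m
  proof (rule poly_mapping_eqI)
    fix l
    have "a i * Poly_Mapping.lookup m i + a j * Poly_Mapping.lookup m j = 0" using w[OF that(1)] that(2) e by simp
    then have "Poly_Mapping.lookup m i = 0" "Poly_Mapping.lookup m j = 0" using G(3,4) by auto
    moreover have "l \<notin> {i, j, k} \<Longrightarrow> l \<notin> Poly_Mapping.keys m \<and> l \<notin> Poly_Mapping.keys m0"
      using that(1) k0 by auto
    ultimately show "Poly_Mapping.lookup m l = Poly_Mapping.lookup m0 l"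
      using that(2) l0 unfolding n_def by (cases "l \<in> {i,j,k}") (auto simp: not_in_keys_iff_lookup_eq_zero)
  qed
  define c where "c = Poly_Mapping.lookup G m0"
  have coeff: "coeff (poly3 G) l = (\<Sum>m\<in>?S. if Poly_Mapping.lookup m k = l then monom (monom (Poly_Mapping.lookup G m) (Poly_Mapping.lookup m i)) (Poly_Mapping.lookup m j) else 0)" for l
    unfolding poly3_def by (simp add: coeff_sum cong: if_cong)
  have "coeff (poly3 G) n = (\<Sum>m\<in>?S. if m = m0 then [:[:c:]:] else 0)"
    unfolding coeff by (intro sum.cong refl) (use uniq in \<open>auto simp: n_def l0 c_def monom_0\<close>)
  then have cn: "coeff (poly3 G) n = [:[:c:]:]" using m0S by simp
  have c0: "c \<noteq> 0" using m0(1) by (simp add: c_def in_keys_iff)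
  have "degree (poly3 G) \<le> n"
  proof (rule degree_le, intro allI impI)
    fix l assume "n < l"
    then show "coeff (poly3 G) l = 0" unfolding coeff using le by (intro sum.neutral) force
  qed
  moreover have "n \<le> degree (poly3 G)" using cn c0 by (intro le_degree) auto
  ultimately have d: "degree (poly3 G) = n" by simp
  have "n > 0" using e G(2) by (cases n) auto
  then show ?thesis using d cn c0 by auto
qed

text \<open>Adding a multiple of \<open>G\<close> to \<open>H\<close> makes both leading coefficients constant, so that the resultant
  commutes with specialization.\<close>

lemma common_zero_aux:
  assumes G: "whomogeneous N a e G" "e > 0" and H: "whomogeneous N a f H" "f > 0"
    and a: "a i > 0" "a j > 0" "a k > 0" and Gk: "peval G (pt3 0 0 1) \<noteq> 0"
  shows "\<exists>s t z. (s \<noteq> 0 \<or> t \<noteq> 0 \<or> z \<noteq> 0) \<and> peval G (pt3 s t z) = 0 \<and> peval H (pt3 s t z) = 0"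
proof -
  let ?g = "poly3 G"
  obtain c where c: "c \<noteq> 0" "degree ?g > 0" "lead_coeff ?g = [:[:c:]:]" using poly3_lead[OF G a Gk] by blast
  \<comment> \<open>Large enough for the leading term of \<open>monom 1 K * ?g\<close> to dominate
    \<open>poly3 H\<close>; the common zeros with \<open>G\<close> do not change.\<close>
  define K where "K = Suc (degree (poly3 H))"
  define h where "h = monom 1 K * ?g + poly3 H"
  have g0: "?g \<noteq> 0" using c by auto
  have dKg: "degree (monom 1 K * ?g) = K + degree ?g"
    using g0 by (simp add: degree_mult_eq monom_eq_0_iff degree_monom_eq)
  then have dh: "degree h = K + degree ?g" unfolding h_def using K_def by (simp add: degree_add_eq_left)
  have lh: "lead_coeff h = [:[:c:]:]"
    unfolding dh unfolding h_def using K_def c(3) by (simp add: coeff_monom_mult coeff_eq_0)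
  have hz: "poly (map_poly (ev2 s t) h) z = z ^ K * peval G (pt3 s t z) + peval H (pt3 s t z)" for s t z
    unfolding poly3_eval[symmetric] poly_map_ev2 h_def by (simp add: poly_monom)
  let ?r = "resultant ?g h"
  have dmap: "degree (map_poly (ev2 s t) P) = degree P" if "lead_coeff P = [:[:c:]:]" for P s t
  proof (rule antisym)
    show "degree (map_poly (ev2 s t) P) \<le> degree P" by (rule degree_map_poly_le)
    have "coeff (map_poly (ev2 s t) P) (degree P) = c" using that by (simp add: coeff_map_poly ev2_def)
    then show "degree P \<le> degree (map_poly (ev2 s t) P)" using c(1) by (intro le_degree) simp
  qed
  have res: "ev2 s t ?r = 0 \<longleftrightarrow> (\<exists>z. peval G (pt3 s t z) = 0 \<and> peval H (pt3 s t z) = 0)" for s t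
  proof -
    let ?mg = "map_poly (ev2 s t) ?g" and ?mh = "map_poly (ev2 s t) h"
    have "ev2 s t ?r = resultant ?mg ?mh"
      by (rule comm_ring_hom.resultant_map_poly[OF ev2_hom, symmetric]) (use dmap c(3) lh in auto)
    then have "ev2 s t ?r = 0 \<longleftrightarrow> degree (gcd ?mg ?mh) \<noteq> 0" using resultant_0_gcd[of ?mg ?mh] by simp
    also have "\<dots> \<longleftrightarrow> (\<exists>z. poly ?mg z = 0 \<and> poly ?mh z = 0)"
    proof
      assume "degree (gcd ?mg ?mh) \<noteq> 0"
      then obtain z where "poly (gcd ?mg ?mh) z = 0"
        using alg_closed_imp_poly_has_root[of "gcd ?mg ?mh"] by blast
      then show "\<exists>z. poly ?mg z = 0 \<and> poly ?mh z = 0"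
        by (metis dvd_trans gcd_dvd1 gcd_dvd2 poly_eq_0_iff_dvd)
    next
      assume "\<exists>z. poly ?mg z = 0 \<and> poly ?mh z = 0"
      then obtain z where "[:-z, 1:] dvd ?mg" "[:-z, 1:] dvd ?mh" by (auto simp: poly_eq_0_iff_dvd)
      then have "[:-z, 1:] dvd gcd ?mg ?mh" by simp
      moreover have "?mg \<noteq> 0" using dmap[OF c(3)] c(2) by (metis degree_0 less_irrefl)
      ultimately have "degree [:-z, 1:] \<le> degree (gcd ?mg ?mh)" by (intro dvd_imp_degree_le) auto
      then show "degree (gcd ?mg ?mh) \<noteq> 0" by simp
    qed
    also have "\<dots> \<longleftrightarrow> (\<exists>z. peval G (pt3 s t z) = 0 \<and> peval H (pt3 s t z) = 0)"
      by (auto simp: hz poly3_eval)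
    finally show ?thesis .
  qed
  \<comment> \<open>Both polynomials vanish at the origin, so the resultant vanishes at (0, 0) and
    therefore at another point, over which a common zero lies.\<close>
  have "pt3 0 0 0 = (\<lambda>_. 0)" by (auto simp: pt3_def)
  then have "ev2 0 0 ?r = 0" using res whomogeneous_at_0[OF G] whomogeneous_at_0[OF H] by metis
  then obtain s t where st: "s \<noteq> 0 \<or> t \<noteq> 0" "ev2 s t ?r = 0"
    using bivariate_nonorigin_zero[of ?r] by (auto simp: ev2_def)
  then show ?thesis using res by blast
qed

text \<open>Two curves in a weighted projective plane meet. If both pass through the k-th vertex,
  that point will do; otherwise the one that misses it plays the first role in the resultant
  argument.\<close>

lemma common_zero:
  assumes G: "whomogeneous N a e G" "e > 0" and H: "whomogeneous N a f H" "f > 0"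
    and a: "a i > 0" "a j > 0" "a k > 0" and N: "i \<le> N" "j \<le> N" "k \<le> N"
  shows "\<exists>x\<in>punctured_space N. (\<forall>l. l \<notin> {i, j, k} \<longrightarrow> x l = 0) \<and> peval G x = 0 \<and> peval H x = 0"
proof -
  have "\<exists>s t z. (s \<noteq> 0 \<or> t \<noteq> 0 \<or> z \<noteq> 0) \<and> peval G (pt3 s t z) = 0 \<and> peval H (pt3 s t z) = 0"
  proof -
    consider "peval G (pt3 0 0 1) \<noteq> 0" | "peval H (pt3 0 0 1) \<noteq> 0"
      | "peval G (pt3 0 0 1) = 0" "peval H (pt3 0 0 1) = 0" by blast
    then show ?thesis
    proof cases
      case 1
      then show ?thesis using common_zero_aux[OF G H a] by blast
    next
      case 2
      then show ?thesis using common_zero_aux[OF H G a] by blast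
    next
      case 3
      then show ?thesis by (intro exI[of _ 0] exI[of _ 1]) simp
    qed
  qed
  then obtain s t z where stz: "s \<noteq> 0 \<or> t \<noteq> 0 \<or> z \<noteq> 0" "peval G (pt3 s t z) = 0" "peval H (pt3 s t z) = 0" by blast
  have "\<exists>l. pt3 s t z l \<noteq> 0"
    using stz(1) ijk by (metis pt3_def)
  then have "pt3 s t z \<in> punctured_space N" using N by (auto simp: punctured_space_def pt3_def)
  moreover have "\<forall>l. l \<notin> {i, j, k} \<longrightarrow> pt3 s t z l = 0" by (auto simp: pt3_def)
  ultimately show ?thesis using stz by blast
qed

end

section \<open>Factors of homogeneous polynomials\<close>

definition graded_part :: "(nat \<Rightarrow> nat) \<Rightarrow> nat \<Rightarrow> cpoly \<Rightarrow> cpoly" where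
  "graded_part w k F = (\<Sum>m\<in>{m\<in>Poly_Mapping.keys F. wdegree w m = k}. Poly_Mapping.single m (Poly_Mapping.lookup F m))"

lemma lookup_graded_part: "Poly_Mapping.lookup (graded_part w k F) m = (if wdegree w m = k then Poly_Mapping.lookup F m else 0)"
proof -
  have "Poly_Mapping.lookup (graded_part w k F) m =
    (\<Sum>m'\<in>{m\<in>Poly_Mapping.keys F. wdegree w m = k}. if m' = m then Poly_Mapping.lookup F m' else 0)"
    unfolding graded_part_def by (auto simp: lookup_sum lookup_single when_def intro!: sum.cong)
  also have "\<dots> = (if wdegree w m = k then Poly_Mapping.lookup F m else 0)"
    by (auto simp: in_keys_iff)
  finally show ?thesis .
qed

lemma keys_graded_part: "Poly_Mapping.keys (graded_part w k F) = {m\<in>Poly_Mapping.keys F. wdegree w m = k}"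
  by (auto simp: in_keys_iff lookup_graded_part split: if_splits)

text \<open>\<open>F\<close> along the curve t -> (t^(w i) x_i), a polynomial in t whose
  coefficients are the graded parts of \<open>F\<close> at \<open>x\<close>.\<close>

definition scale_poly :: "(nat \<Rightarrow> nat) \<Rightarrow> cpoly \<Rightarrow> (nat \<Rightarrow> complex) \<Rightarrow> complex poly" where
  "scale_poly w F x = (\<Sum>m\<in>Poly_Mapping.keys F. monom (Poly_Mapping.lookup F m * mono_val x m) (wdegree w m))"

lemma poly_scale_poly: "poly (scale_poly w F x) t = peval F (\<lambda>i. t ^ w i * x i)"
  unfolding scale_poly_def peval_mono_val mono_val_times mono_val_scale
  by (simp add: poly_sum poly_monom mult_ac)

lemma coeff_scale_poly: "coeff (scale_poly w F x) k = peval (graded_part w k F) x"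
proof -
  have "coeff (scale_poly w F x) k = (\<Sum>m\<in>Poly_Mapping.keys F. if wdegree w m = k then Poly_Mapping.lookup F m * mono_val x m else 0)"
    unfolding scale_poly_def coeff_sum by (intro sum.cong) auto
  also have "\<dots> = peval (graded_part w k F) x"
    by (simp add: graded_part_def peval_sum sum.If_cases Int_def)
  finally show ?thesis .
qed

text \<open>If \<open>G\<close> had parts of two degrees, it would vanish somewhere on a generic
  curve t -> (t^(w i) x_i) with t nonzero; but the product is only multiplied by t^d along this
  curve and stays nonzero. The weights \<open>w\<close> are arbitrary, so exponents of a single
  variable are covered too.\<close>

lemma homogeneous_factor:
  fixes G H :: cpoly
  assumes hom: "\<And>m. m \<in> Poly_Mapping.keys (G * H) \<Longrightarrow> wdegree w m = d" and nz: "G * H \<noteq> 0"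
    and m: "m \<in> Poly_Mapping.keys G" "m' \<in> Poly_Mapping.keys G"
  shows "wdegree w m = wdegree w m'"
proof (rule ccontr)
  assume ne: "wdegree w m \<noteq> wdegree w m'"
  let ?p = "\<lambda>m. graded_part w (wdegree w m) G"
  have "?p m \<noteq> 0" "?p m' \<noteq> 0" using m keys_graded_part[of w _ G] by (auto simp flip: keys_eq_empty)
  then obtain x where x: "\<forall>i. x i \<noteq> 0" "peval (?p m * ?p m' * (G * H)) x \<noteq> 0"
    using nonzero_on_torus[of "?p m * ?p m' * (G * H)"] nz by auto
  then obtain t where t: "t \<noteq> 0" "poly (scale_poly w G x) t = 0"
    using poly_root_nonzero[of "scale_poly w G x" "wdegree w m" "wdegree w m'"] ne by (auto simp: coeff_scale_poly)
  have "peval (G * H) (\<lambda>i. t ^ w i * x i) = t ^ d * peval (G * H) x"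
    unfolding peval_mono_val mono_val_times mono_val_scale sum_distrib_left
    using hom by (intro sum.cong) auto
  then have "peval G (\<lambda>i. t ^ w i * x i) * peval H (\<lambda>i. t ^ w i * x i) \<noteq> 0" using t(1) x(2) by auto
  then show False using t(2) by (simp add: poly_scale_poly)
qed

text \<open>Besides the degree, variables beyond \<open>N\<close> have to be excluded from the
  factor. Grading by the exponent of such an x_i, every monomial of \<open>G\<close> would contain
  x_i; the product would vanish for x_i = 0, hence everywhere, as it does not involve x_i.\<close>

lemma whomogeneous_factor:
  assumes GH: "whomogeneous N a d (G * H)" and nz: "G * H \<noteq> 0"
  shows "\<exists>e. whomogeneous N a e G"
proof -
  obtain m0 where m0: "m0 \<in> Poly_Mapping.keys G" using nz by (metis equals0I keys_eq_empty mult_zero_left)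
  obtain p0 where p0: "p0 \<in> Poly_Mapping.keys H" using nz by (metis equals0I keys_eq_empty mult_zero_right)
  have deg: "wdegree a m = wdegree a m0" if "m \<in> Poly_Mapping.keys G" for m
    using homogeneous_factor[OF _ nz that m0, of a d] GH by (auto simp: whomogeneous_iff)
  have "i \<le> N" if m: "m \<in> Poly_Mapping.keys G" and i: "i \<in> Poly_Mapping.keys m" for m i
  proof (rule ccontr)
    assume iN: "\<not> i \<le> N"
    define w where "w = (\<lambda>l. if l = i then 1 else 0 :: nat)"
    have w: "wdegree w m = Poly_Mapping.lookup m i" for m
    proof -
      have "wdegree w m = (\<Sum>l\<in>insert i (Poly_Mapping.keys m). w l * Poly_Mapping.lookup m l)"
        by (rule wdegree_superset) auto
      also have "\<dots> = (\<Sum>l\<in>insert i (Poly_Mapping.keys m). if l = i then Poly_Mapping.lookup m l else 0)"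
        by (intro sum.cong) (auto simp: w_def)
      finally show ?thesis by simp
    qed
    have w0: "wdegree w m = 0" if "m \<in> Poly_Mapping.keys (G * H)" for m
      using that GH iN unfolding w whomogeneous_iff by (auto simp: in_keys_iff subset_iff)
    have Gpos: "i \<in> Poly_Mapping.keys m'" if "m' \<in> Poly_Mapping.keys G" for m'
      using homogeneous_factor[OF w0 nz that m] i by (simp add: w in_keys_iff)
    have "peval (G * H) x = 0" if "x i = 0" for x
    proof -
      have "peval G x = 0" unfolding peval_mono_val
        using Gpos that by (intro sum.neutral) (auto simp: mono_val_eq_0_iff)
      then show ?thesis by simp
    qed
    then have "peval (G * H) x = 0" for x
      using whomogeneous_peval_cong[OF GH, of x "x(i := 0)"] iN by (metis fun_upd_apply fun_upd_same)
    then show False using nz nonzero_on_torus by blast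
  qed
  then show ?thesis using deg by (auto simp: whomogeneous_iff)
qed

lemma whomogeneous_degree_0_unit:
  assumes "whomogeneous N a 0 G" "G \<noteq> 0" "\<And>i. i \<le> N \<Longrightarrow> a i > 0"
  shows "G dvd 1"
proof -
  have "m = 0" if "m \<in> Poly_Mapping.keys G" for m
  proof -
    have "\<forall>i\<in>Poly_Mapping.keys m. i \<le> N \<and> a i * Poly_Mapping.lookup m i = 0"
      using assms(1) that by (auto simp: whomogeneous_iff wdegree_def)
    then have "Poly_Mapping.keys m = {}" using assms(3) by (fastforce simp: in_keys_iff)
    then show ?thesis by simp
  qed
  then have "Poly_Mapping.keys G = {0}" using assms(2) by (metis equals0I insertI1 keys_eq_empty singletonD subsetI subset_antisym)
  then have G: "G = Const (Poly_Mapping.lookup G 0)" "Poly_Mapping.lookup G 0 \<noteq> 0"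
    using poly_mapping_sum_single[of G] by (auto simp: in_keys_iff[symmetric])
  have "Const (Poly_Mapping.lookup G 0) * Const (inverse (Poly_Mapping.lookup G 0)) = 1"
    using G(2) by (simp add: mult_single)
  then show ?thesis using G(1) by (metis dvdI)
qed

lemma quasi_smooth_nonzero: "quasi_smooth N F \<Longrightarrow> F \<noteq> 0"
proof
  assume qs: "quasi_smooth N F" and F: "F = 0"
  have "(\<lambda>i. if i = 0 then 1 else 0) \<in> punctured_space N"
    by (auto simp: punctured_space_def)
  then show False using qs unfolding quasi_smooth_def F by (force simp: partial_deriv_def)
qed

text \<open>By the product rule a common zero of two factors is a critical zero of \<open>F\<close>.
  Nonunit factors are homogeneous of positive degree, and \<open>N \<ge> 2\<close> provides three
  coordinates in which to find the common zero.\<close>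

lemma quasi_smooth_irreducible:
  assumes F: "whomogeneous N a d F" "d > 0" "quasi_smooth N F" and N: "2 \<le> N"
    and a: "\<And>i. i \<le> N \<Longrightarrow> a i > 0"
  shows "Factorial_Ring.irreducible F"
proof (rule Factorial_Ring.irreducibleI)
  show F0: "F \<noteq> 0" using F(3) by (rule quasi_smooth_nonzero)
  show "\<not> F dvd 1" using peval_unit whomogeneous_at_0[OF F(1,2)] by blast
  fix G H assume GH: "F = G * H"
  obtain e where e: "whomogeneous N a e G" using whomogeneous_factor[of N a d G H] F(1) F0 GH by blast
  obtain f where f: "whomogeneous N a f H" using whomogeneous_factor[of N a d H G] F(1) F0 GH by (metis mult.commute)
  show "G dvd 1 \<or> H dvd 1"
  proof (rule ccontr)
    assume no: "\<not> ?thesis"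
    have "\<not> whomogeneous N a 0 G" "\<not> whomogeneous N a 0 H"
      using no whomogeneous_degree_0_unit[of N a G] whomogeneous_degree_0_unit[of N a H] a F0 GH by auto
    then have pos: "e > 0" "f > 0" using e f gr0I by metis+
    have "0 \<le> N" "1 \<le> N" "a 0 > 0" "a 1 > 0" "a 2 > 0" using a N by simp_all
    then obtain x where x: "x \<in> punctured_space N" "peval G x = 0" "peval H x = 0"
      using common_zero[OF _ _ _ e pos(1) f pos(2), of 0 1 2] N by auto
    then have "peval F x = 0" "\<And>i. peval (partial_deriv i F) x = 0"
      by (simp_all add: GH partial_deriv_mult)
    then show False using F(3) x(1) by (auto simp: quasi_smooth_def)
  qed
qed

text \<open>Otherwise the two partial derivatives transversal to the coordinate subspace have a common zero on it.\<close>

lemma quasi_smooth_no_coordinate_subspace: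
  assumes F: "whomogeneous N a d F" "quasi_smooth N F" and N: "4 \<le> N"
    and a: "\<And>i. i \<le> N \<Longrightarrow> a i > 0" and ij: "i \<le> N" "j \<le> N" "i \<noteq> j" "a i < d" "a j < d"
  shows "\<exists>v. v i = 0 \<and> v j = 0 \<and> peval F v \<noteq> 0"
proof (rule ccontr)
  assume no: "\<not> ?thesis"
  \<comment> \<open>The bound on \<open>N\<close> enters here: three coordinates remain on the
    subspace, enough for a common zero of two polynomials.\<close>
  have "card ({..4} - {i, j}) \<ge> 3"
    using diff_card_le_card_Diff[of "{i, j}" "{..4}"] ij(3) by simp
  then obtain T where T: "T \<subseteq> {..4} - {i, j}" "card T = 3" by (metis obtain_subset_with_card_n)
  then obtain k l m where klm: "T = {k, l, m}" "k \<noteq> l" "k \<noteq> m" "l \<noteq> m" by (auto simp: card_3_iff)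
  have le: "k \<le> N" "l \<le> N" "m \<le> N" using T(1) klm(1) N by auto
  obtain x where x: "x \<in> punctured_space N" "\<forall>s. s \<notin> {k, l, m} \<longrightarrow> x s = 0"
      "peval (partial_deriv i F) x = 0" "peval (partial_deriv j F) x = 0"
    using common_zero[OF klm(2-4) whomogeneous_partial_deriv[OF F(1), of i] _ whomogeneous_partial_deriv[OF F(1), of j]] a le ij
    by auto
  have xij: "x i = 0" "x j = 0" using x(2) T(1) klm(1) by auto
  have "peval (partial_deriv s F) x = 0" for s
  \<comment> \<open>In the directions inside the subspace the derivatives vanish because
    \<open>F\<close> is identically zero on it.\<close>
  proof (cases "s = i \<or> s = j")
    case False
    then have "peval F (x(s := t)) = 0" for t using no xij by auto
    then have "((\<lambda>t. peval F (x(s := t))) has_field_derivative 0) (at (x s))" by simp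
    then show ?thesis by (rule peval_partial_derivI)
  qed (use x in auto)
  moreover have "peval F x = 0" using no xij by auto
  ultimately show False using F(2) x(1) by (auto simp: quasi_smooth_def)
qed

section \<open>Elimination of a variable\<close>

lemma comm_ring_hom_eval:
  fixes h :: "'a::comm_ring_1 \<Rightarrow> 'b::comm_ring_1"
  assumes "comm_ring_hom h"
  shows "comm_ring_hom (\<lambda>p. poly (map_poly h p) x)"
proof -
  interpret comm_ring_hom h by (rule assms)
  interpret m: map_poly_comm_ring_hom h ..
  show ?thesis by unfold_locales (simp_all add: m.hom_add m.hom_mult)
qed

lemma
  fixes h :: "'a::comm_ring_1 \<Rightarrow> 'b::comm_ring_1"
  assumes "comm_ring_hom h"
  shows hom_0: "h 0 = 0" and hom_1: "h 1 = 1"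
    and hom_add: "h (x + y) = h x + h y" and hom_mult: "h (x * y) = h x * h y"
proof -
  interpret h: comm_ring_hom h by fact
  show "h 0 = 0" by (rule h.hom_zero)
  show "h 1 = 1" by (rule h.hom_one)
  show "h (x + y) = h x + h y" by (rule h.hom_add)
  show "h (x * y) = h x * h y" by (rule h.hom_mult)
qed

lemma comm_ring_hom_Const: "comm_ring_hom Const"
  by unfold_locales (auto simp: single_add mult_single)

text \<open>Let \<open>H\<close> have least degree in the ideal generated by \<open>F\<close> and
  \<open>G\<close>. Up to constants it divides both, say \<open>c F = H Q\<close>. If
  \<open>H\<close> were not constant, primality of \<open>F\<close> would give \<open>F\<close>
  dividing \<open>H\<close>, hence \<open>G\<close> up to a constant, or \<open>F\<close> dividing
  \<open>Q\<close>, which makes \<open>H\<close> a divisor of a constant; both are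
  impossible.\<close>

lemma prime_elem_elimination:
  fixes F G :: "'a::idom poly"
  assumes F: "prime_elem F" and G: "\<not> F dvd G"
  shows "\<exists>u v r. r \<noteq> 0 \<and> u * F + v * G = [:r:]"
proof -
  define I where "I = {u * F + v * G | u v. True} - {0}"
  have "F = 1 * F + 0 * G" by simp
  moreover have F0: "F \<noteq> 0" using F by auto
  ultimately have FI: "F \<in> I" unfolding I_def by blast
  obtain H where H: "H \<in> I" "\<And>K. K \<in> I \<Longrightarrow> degree H \<le> degree K"
    using ex_has_least_nat[of "\<lambda>H. H \<in> I" F degree] FI by blast
  then obtain u v where uv: "H = u * F + v * G" and H0: "H \<noteq> 0" by (auto simp: I_def)
  \<comment> \<open>Pseudo-division by \<open>H\<close>: the remainder lies in the ideal and has
    smaller degree, so it vanishes.\<close>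
  have div: "\<exists>c Q. c \<noteq> 0 \<and> smult c K = H * Q" if "K = u' * F + v' * G" for K u' v'
  proof -
    obtain Q R where QR: "pseudo_divmod K H = (Q, R)" by (cases "pseudo_divmod K H")
    let ?c = "coeff H (degree H) ^ (Suc (degree K) - degree H)"
    have *: "smult ?c K = H * Q + R" "R = 0 \<or> degree R < degree H"
      using pseudo_divmod[OF H0 QR] by auto
    have "R = [:?c:] * K - H * Q" using *(1) by simp
    also have "\<dots> = ([:?c:] * u' - Q * u) * F + ([:?c:] * v' - Q * v) * G"
      unfolding that uv by (simp only: algebra_simps)
    finally have "R = 0 \<or> R \<in> I" unfolding I_def by blast
    then have "R = 0" using *(2) H(2)[of R] by auto
    moreover have "?c \<noteq> 0" using H0 by simp
    ultimately show ?thesis using *(1) by (intro exI[of _ ?c] exI[of _ Q]) simp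
  qed
  show ?thesis
  proof (cases "degree H = 0")
    case True
    then obtain r where "H = [:r:]" by (rule degree_eq_zeroE)
    then show ?thesis using uv H0 by (intro exI[of _ u] exI[of _ v] exI[of _ r]) auto
  next
    case False
    obtain c Q where c: "c \<noteq> 0" "smult c F = H * Q" using div[of F 1 0] by auto
    obtain c' Q' where c': "c' \<noteq> 0" "smult c' G = H * Q'" using div[of G 0 1] by auto
    have "F dvd H * Q" unfolding c(2)[symmetric] by (simp add: dvd_smult)
    then have "F dvd H \<or> F dvd Q" using F by (rule prime_elem_dvd_multD[rotated])
    then show ?thesis
    proof
      assume "F dvd H"
      then have "F dvd [:c':] * G" using c'(2) by simp
      then have "F dvd [:c':]" using prime_elem_dvd_multD[OF F] G by blast
      then have "degree F \<le> 0" using c'(1) dvd_imp_degree_le[of F "[:c':]"] by simp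
      then show ?thesis using H(2)[OF FI] False by simp
    next
      assume "F dvd Q"
      then obtain Q'' where "Q = F * Q''" by (rule dvdE)
      then have "F * [:c:] = F * (H * Q'')" using c(2) by simp
      then have "[:c:] = H * Q''" using F0 mult_left_cancel by blast
      then have "H dvd [:c:]" by simp
      then have "degree H \<le> 0" using c(1) dvd_imp_degree_le[of H "[:c:]"] by simp
      then show ?thesis using False by simp
    qed
  qed
qed

context
  fixes i j k m :: nat
  assumes ijkm: "i \<noteq> j" "i \<noteq> k" "i \<noteq> m" "j \<noteq> k" "j \<noteq> m" "k \<noteq> m"
begin

text \<open>The isomorphism of \<open>C[x_i, x_j, x_k, x_m]\<close> with the iterated polynomial ring, which is known to be
  factorial.\<close>

definition to_nested :: "cpoly \<Rightarrow> complex poly poly poly poly" where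
  "to_nested = ring_eval (\<lambda>c. [:[:[:[:c:]:]:]:])
     (\<lambda>l. if l = i then [:[:[:[:0, 1:]:]:]:] else if l = k then [:[:[:0, 1:]:]:] else if l = m then [:[:0, 1:]:]
          else if l = j then [:0, 1:] else 0)"

text \<open>The inverse isomorphism is evaluated from the inside out. The innermost variable is x_i,
  followed by x_k and x_m; x_j, which is to be eliminated, is outermost.\<close>

definition of_nested1 :: "complex poly \<Rightarrow> cpoly" where
  "of_nested1 = (\<lambda>p. poly (map_poly Const p) (Var i))"
definition of_nested2 :: "complex poly poly \<Rightarrow> cpoly" where
  "of_nested2 = (\<lambda>p. poly (map_poly of_nested1 p) (Var k))"
definition of_nested3 :: "complex poly poly poly \<Rightarrow> cpoly" where
  "of_nested3 = (\<lambda>p. poly (map_poly of_nested2 p) (Var m))"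
definition of_nested :: "complex poly poly poly poly \<Rightarrow> cpoly" where
  "of_nested = (\<lambda>p. poly (map_poly of_nested3 p) (Var j))"

lemma of_nested_homs: "comm_ring_hom of_nested1" "comm_ring_hom of_nested2" "comm_ring_hom of_nested3" "comm_ring_hom of_nested"
proof -
  show 1: "comm_ring_hom of_nested1" unfolding of_nested1_def by (rule comm_ring_hom_eval[OF comm_ring_hom_Const])
  show 2: "comm_ring_hom of_nested2" unfolding of_nested2_def by (rule comm_ring_hom_eval[OF 1])
  show 3: "comm_ring_hom of_nested3" unfolding of_nested3_def by (rule comm_ring_hom_eval[OF 2])
  show "comm_ring_hom of_nested" unfolding of_nested_def by (rule comm_ring_hom_eval[OF 3])
qed

lemma comm_ring_hom_const4: "comm_ring_hom (\<lambda>c::complex. [:[:[:[:c:]:]:]:])"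
  by unfold_locales auto

lemma to_nested_hom: "comm_ring_hom to_nested"
proof -
  interpret comm_ring_hom "\<lambda>c::complex. [:[:[:[:c:]:]:]:]" by (rule comm_ring_hom_const4)
  show ?thesis unfolding to_nested_def
    by unfold_locales (simp_all only: ring_eval_0 ring_eval_1 ring_eval_add ring_eval_mult)
qed

lemma to_nested_simps:
  "to_nested (Const c) = [:[:[:[:c:]:]:]:]"
  "to_nested (Var i) = [:[:[:[:0, 1:]:]:]:]"
  "to_nested (Var k) = [:[:[:0, 1:]:]:]"
  "to_nested (Var m) = [:[:0, 1:]:]"
  "to_nested (Var j) = [:0, 1:]"
  unfolding to_nested_def using ijkm
  by (simp_all add: comm_ring_hom.ring_eval_single[OF comm_ring_hom_const4] )

lemma of_nested_simps:
  "of_nested1 (pCons c p) = Const c + Var i * of_nested1 p" "of_nested1 0 = 0"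
  "of_nested2 (pCons c' p') = of_nested1 c' + Var k * of_nested2 p'" "of_nested2 0 = 0"
  "of_nested3 (pCons c'' p'') = of_nested2 c'' + Var m * of_nested3 p''" "of_nested3 0 = 0"
  "of_nested (pCons c3 p3) = of_nested3 c3 + Var j * of_nested p3" "of_nested 0 = 0"
proof -
  note h = of_nested_homs[THEN hom_0]
  show "of_nested1 0 = 0" "of_nested2 0 = 0" "of_nested3 0 = 0" "of_nested 0 = 0" by (rule h)+
  show "of_nested1 (pCons c p) = Const c + Var i * of_nested1 p"
    unfolding of_nested1_def by (simp add: Polynomial.map_poly_pCons h)
  show "of_nested2 (pCons c' p') = of_nested1 c' + Var k * of_nested2 p'"
    unfolding of_nested2_def by (simp add: Polynomial.map_poly_pCons h)
  show "of_nested3 (pCons c'' p'') = of_nested2 c'' + Var m * of_nested3 p''"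
    unfolding of_nested3_def by (simp add: Polynomial.map_poly_pCons h)
  show "of_nested (pCons c3 p3) = of_nested3 c3 + Var j * of_nested p3"
    unfolding of_nested_def by (simp add: Polynomial.map_poly_pCons h)
qed

lemmas to_nested_hom_simps = hom_0[OF to_nested_hom] hom_add[OF to_nested_hom] hom_mult[OF to_nested_hom]

lemma to_of_nested:
  "to_nested (of_nested1 p1) = [:[:[:p1:]:]:]" "to_nested (of_nested2 p2) = [:[:p2:]:]"
  "to_nested (of_nested3 p3) = [:p3:]" "to_nested (of_nested p4) = p4"
proof -
  show 1: "to_nested (of_nested1 p1) = [:[:[:p1:]:]:]" for p1
    by (induction p1) (simp_all add: of_nested_simps to_nested_hom_simps to_nested_simps)
  show 2: "to_nested (of_nested2 p2) = [:[:p2:]:]" for p2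
    by (induction p2) (simp_all add: of_nested_simps to_nested_hom_simps to_nested_simps 1)
  show 3: "to_nested (of_nested3 p3) = [:p3:]" for p3
    by (induction p3) (simp_all add: of_nested_simps to_nested_hom_simps to_nested_simps 2)
  show "to_nested (of_nested p4) = p4"
    by (induction p4) (simp_all add: of_nested_simps to_nested_hom_simps to_nested_simps 3)
qed

lemma of_to_nested:
  assumes "vars F \<subseteq> {i, j, k, m}"
  shows "of_nested (to_nested F) = F"
  using assms
proof (induction F rule: cpoly_induct)
  case (Const c)
  show ?case by (simp add: to_nested_simps of_nested_simps)
next
  case (Var l)
  have Vars: "of_nested (to_nested (Var i)) = Var i" "of_nested (to_nested (Var j)) = Var j"
    "of_nested (to_nested (Var k)) = Var k" "of_nested (to_nested (Var m)) = Var m"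
    by (simp_all add: to_nested_simps of_nested_simps hom_1[OF of_nested_homs(1)] hom_1[OF of_nested_homs(2)] hom_1[OF of_nested_homs(3)] hom_1[OF of_nested_homs(4)])
  then show ?case using Var by auto
qed (simp_all add: hom_add[OF to_nested_hom] hom_mult[OF to_nested_hom] hom_add[OF of_nested_homs(4)] hom_mult[OF of_nested_homs(4)])

lemma vars_of_nested3: "vars (of_nested3 p3) \<subseteq> {i, k, m}"
proof -
  have V: "vars (Var l) = {l}" for l by (simp add: vars_def)
  have C: "vars (Const c) = {}" for c by (simp add: vars_def)
  have step: "vars (F + Var l * G) \<subseteq> A" if "vars F \<subseteq> A" "vars G \<subseteq> A" "l \<in> A" for F G l A
  proof -
    have "vars (Var l * G) \<subseteq> A" using vars_mult[of "Var l" G] that(2,3) unfolding V by auto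
    then show ?thesis using vars_add[of F "Var l * G"] that(1) by auto
  qed
  have Z: "vars 0 = {}" by (simp add: vars_def)
  have 1: "vars (of_nested1 p1) \<subseteq> {i, k, m}" for p1
  proof (induction p1)
    case 0
    show ?case by (simp add: of_nested_simps Z)
  next
    case (pCons c p)
    show ?case unfolding of_nested_simps by (rule step) (use pCons C in auto)
  qed
  have 2: "vars (of_nested2 p2) \<subseteq> {i, k, m}" for p2
  proof (induction p2)
    case 0
    show ?case by (simp add: of_nested_simps Z)
  next
    case (pCons c p)
    show ?case unfolding of_nested_simps by (rule step) (use pCons 1 in auto)
  qed
  show ?thesis
  proof (induction p3)
    case 0
    show ?case by (simp add: of_nested_simps Z)
  next
    case (pCons c p)
    show ?case unfolding of_nested_simps by (rule step) (use pCons 2 in auto)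
  qed
qed

text \<open>In a factorial ring an irreducible \<open>F\<close> is prime, so the ideal of
  \<open>F\<close> and \<open>G\<close> contains a nonzero element without x_j, and all common zeros
  of \<open>F\<close> and \<open>G\<close> are zeros of it.\<close>

lemma eliminate_variable:
  assumes F: "Factorial_Ring.irreducible F" "vars F \<subseteq> {i, j, k, m}" and G: "vars G \<subseteq> {i, j, k, m}" "\<not> F dvd G"
  shows "\<exists>R. R \<noteq> 0 \<and> vars R \<subseteq> {i, k, m} \<and> (\<forall>x. peval F x = 0 \<longrightarrow> peval G x = 0 \<longrightarrow> peval R x = 0)"
proof -
  have dvdF: "to_nested F dvd to_nested K \<Longrightarrow> F dvd K" if "vars K \<subseteq> {i, j, k, m}" for K
    using of_to_nested[OF F(2)] of_to_nested[OF that] hom_mult[OF of_nested_homs(4)] by (metis dvd_def)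
  have unit: "p dvd 1" if u: "of_nested p dvd 1" for p
  proof -
    obtain q where "1 = of_nested p * q" using u by (rule dvdE)
    then have "1 = p * to_nested q" using hom_mult[OF to_nested_hom] hom_1[OF to_nested_hom] to_of_nested(4) by metis
    then show ?thesis by (rule dvdI)
  qed
  have "Factorial_Ring.irreducible (to_nested F)"
  proof (rule Factorial_Ring.irreducibleI)
    show "to_nested F \<noteq> 0"
      using of_to_nested[OF F(2)] F(1) of_nested_simps(8) by (metis Factorial_Ring.not_irreducible_zero)
    show "\<not> to_nested F dvd 1"
    proof
      assume "to_nested F dvd 1"
      then obtain q where "1 = to_nested F * q" by (rule dvdE)
      then have "1 = F * of_nested q"
        using hom_mult[OF of_nested_homs(4)] hom_1[OF of_nested_homs(4)] of_to_nested[OF F(2)] by metis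
      then show False using F(1) by (metis Factorial_Ring.irreducible_not_unit dvdI)
    qed
    fix a b assume "to_nested F = a * b"
    then have "F = of_nested a * of_nested b" using hom_mult[OF of_nested_homs(4)] of_to_nested[OF F(2)] by metis
    then show "a dvd 1 \<or> b dvd 1" using Factorial_Ring.irreducibleD[OF F(1)] unit by blast
  qed
  then have "prime_elem (to_nested F)" by (rule irreducible_imp_prime_elem)
  moreover have "\<not> to_nested F dvd to_nested G" using dvdF[OF G(1)] G(2) by blast
  ultimately obtain u v r where uvr: "r \<noteq> 0" "u * to_nested F + v * to_nested G = [:r:]"
    using prime_elem_elimination by blast
  have R: "of_nested3 r = of_nested u * F + of_nested v * G"
    using arg_cong[OF uvr(2), of of_nested]
    by (simp add: hom_add[OF of_nested_homs(4)] hom_mult[OF of_nested_homs(4)] of_to_nested F(2) G(1) of_nested_simps)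
  moreover have "of_nested3 r \<noteq> 0"
    using to_of_nested(3)[of r] uvr(1) hom_0[OF to_nested_hom] by (metis pCons_eq_0_iff)
  ultimately show ?thesis
    using vars_of_nested3[of r] by (intro exI[of _ "of_nested3 r"]) auto
qed

end

section \<open>Curves in quasi-smooth surfaces\<close>

definition restrict_vars :: "nat set \<Rightarrow> cpoly \<Rightarrow> cpoly" where
  "restrict_vars A F = (\<Sum>m\<in>{m\<in>Poly_Mapping.keys F. Poly_Mapping.keys m \<subseteq> A}. Poly_Mapping.single m (Poly_Mapping.lookup F m))"

lemma peval_restrict_vars: "peval (restrict_vars A F) x = peval F (\<lambda>l. if l \<in> A then x l else 0)"
proof -
  have "peval F (\<lambda>l. if l \<in> A then x l else 0) =
    (\<Sum>m\<in>{m\<in>Poly_Mapping.keys F. Poly_Mapping.keys m \<subseteq> A}. Poly_Mapping.lookup F m * mono_val (\<lambda>l. if l \<in> A then x l else 0) m)"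
    unfolding peval_mono_val by (intro sum.mono_neutral_right) (auto simp: mono_val_eq_0_iff)
  also have "\<dots> = peval (restrict_vars A F) x"
    unfolding restrict_vars_def peval_sum peval_single
    by (intro sum.cong refl arg_cong2[of _ _ _ _ "(*)"] mono_val_cong) auto
  finally show ?thesis by simp
qed

lemma restrict_vars_nonzero:
  "peval F x \<noteq> 0 \<Longrightarrow> (\<And>l. l \<notin> A \<Longrightarrow> x l = 0) \<Longrightarrow> restrict_vars A F \<noteq> 0"
proof
  assume *: "peval F x \<noteq> 0" "\<And>l. l \<notin> A \<Longrightarrow> x l = 0" "restrict_vars A F = 0"
  have "x = (\<lambda>l. if l \<in> A then x l else 0)" using *(2) by auto
  then have "peval F x = peval (restrict_vars A F) x" by (simp add: peval_restrict_vars)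
  then show False using * by simp
qed

definition coordinate_subspace :: "nat \<Rightarrow> (nat \<Rightarrow> nat) \<Rightarrow> nat set \<Rightarrow> wpoint set" where
  "coordinate_subspace N a A = {P \<in> wproj N a. \<forall>x\<in>P. \<forall>l. l \<notin> A \<longrightarrow> x l = 0}"

lemma coordinate_subspace_closed:
  assumes "A \<subseteq> {..N}"
  shows "closedin (zariski N a) (coordinate_subspace N a A)"
proof -
  have "P \<in> coordinate_subspace N a A \<longleftrightarrow> P \<in> \<Inter>(insert (wproj N a) ((\<lambda>i. zero_locus N a (Var i)) ` ({..N} - A)))" for P
  proof (cases "P \<in> wproj N a")
    case True
    have "x l = 0" if "x \<in> P" "\<not> l \<le> N" for x l
      using wproj_mem_punctured[OF True that(1)] that(2) by (auto simp: punctured_space_def)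
    then show ?thesis using True by (force simp: coordinate_subspace_def zero_locus_def)
  qed (auto simp: coordinate_subspace_def)
  then have "coordinate_subspace N a A = \<Inter>(insert (wproj N a) ((\<lambda>i. zero_locus N a (Var i)) ` ({..N} - A)))" by blast
  then show ?thesis
    using closedin_topspace[of "zariski N a"]
    by (simp only:, intro closedin_Inter) (auto intro!: closedin_zero_locus[OF whomogeneous_Var] simp: topspace_zariski)
qed

text \<open>Two polynomials that do not vanish identically on the subspace have restrictions with
  nonzero product, hence are both nonzero at one point whose coordinates in \<open>A\<close> are all
  nonzero.\<close>

lemma coordinate_subspace_irreducible:
  assumes A: "A \<subseteq> {..N}" "A \<noteq> {}"
  shows "irreducible_closed (zariski N a) (coordinate_subspace N a A)"
  unfolding irreducible_closed_def
proof (intro conjI allI impI)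
  let ?L = "coordinate_subspace N a A"
  have pt: "(\<lambda>l. if l \<in> A then x l else 0) \<in> punctured_space N \<and> orbit_of N a (\<lambda>l. if l \<in> A then x l else 0) \<in> ?L"
    if "\<forall>l. x l \<noteq> 0" for x
  proof -
    let ?y = "\<lambda>l. if l \<in> A then x l else (0::complex)"
    have y: "?y \<in> punctured_space N" using that A by (auto simp: punctured_space_def)
    have "z l = 0" if "z \<in> orbit_of N a ?y" "l \<notin> A" for z l
    proof (cases "l \<le> N")
      case True
      obtain t where "\<forall>i\<le>N. z i = t ^ a i * ?y i"
        using wproj_same_point[OF orbit_of_in_wproj[OF y] orbit_of_mem[OF y] \<open>z \<in> _\<close>] by blast
      then show ?thesis using True \<open>l \<notin> A\<close> by simp
    next
      case False
      then show ?thesis using wproj_mem_punctured[OF orbit_of_in_wproj[OF y] \<open>z \<in> _\<close>] by (auto simp: punctured_space_def)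
    qed
    then show ?thesis using y orbit_of_in_wproj[OF y, of a] by (auto simp: coordinate_subspace_def)
  qed
  show "closedin (zariski N a) ?L" by (rule coordinate_subspace_closed[OF A(1)])
  show "?L \<noteq> {}" using pt[of "\<lambda>_. 1"] by auto
  fix C D assume CD: "closedin (zariski N a) C \<and> closedin (zariski N a) D \<and> ?L \<subseteq> C \<union> D"
  show "?L \<subseteq> C \<or> ?L \<subseteq> D"
  proof (rule ccontr)
    assume "\<not> ?thesis"
    then obtain P Q where P: "P \<in> ?L" "P \<notin> C" and Q: "Q \<in> ?L" "Q \<notin> D" by blast
    have w: "P \<in> wproj N a" "Q \<in> wproj N a" using P(1) Q(1) by (auto simp: coordinate_subspace_def)
    obtain e f where f: "whomogeneous N a e f" "C \<subseteq> zero_locus N a f" "P \<notin> zero_locus N a f"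
      using CD P(2) w unfolding closedin_zariski_iff by blast
    obtain e' f' where f': "whomogeneous N a e' f'" "D \<subseteq> zero_locus N a f'" "Q \<notin> zero_locus N a f'"
      using CD Q(2) w unfolding closedin_zariski_iff by blast
    obtain x where x: "x \<in> P" "peval f x \<noteq> 0" using f(3) w by (auto simp: zero_locus_def)
    obtain y where y: "y \<in> Q" "peval f' y \<noteq> 0" using f'(3) w by (auto simp: zero_locus_def)
    have "restrict_vars A f \<noteq> 0" using x P(1) by (intro restrict_vars_nonzero[of f x]) (auto simp: coordinate_subspace_def)
    moreover have "restrict_vars A f' \<noteq> 0" using y Q(1) by (intro restrict_vars_nonzero[of f' y]) (auto simp: coordinate_subspace_def)
    ultimately obtain z where z: "\<forall>l. z l \<noteq> 0" "peval (restrict_vars A f * restrict_vars A f') z \<noteq> 0"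
      using nonzero_on_torus[of "restrict_vars A f * restrict_vars A f'"] by auto
    let ?z = "\<lambda>l. if l \<in> A then z l else 0"
    have "peval f ?z \<noteq> 0" "peval f' ?z \<noteq> 0" using z(2) by (auto simp: peval_restrict_vars)
    then have "orbit_of N a ?z \<notin> C \<union> D"
      using f(2) f'(2) orbit_zero_locus_iff[OF f(1)] orbit_zero_locus_iff[OF f'(1)] pt[OF z(1)] by blast
    then show False using pt[OF z(1)] CD by blast
  qed
qed

text \<open>\<open>s\<close> is the least exponent of x_i in \<open>R\<close>; a monomial attaining
  it survives division by x_i^s as a monomial free of x_i.\<close>

lemma extract_power:
  assumes R: "R \<noteq> 0" "whomogeneous N a e R"
  shows "\<exists>s e' R'. R = Var i ^ s * R' \<and> whomogeneous N a e' R' \<and> vars R' \<subseteq> vars R \<and> coeff_in i 0 R' \<noteq> 0"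
proof -
  obtain m0 where m0: "m0 \<in> Poly_Mapping.keys R" "\<And>m. m \<in> Poly_Mapping.keys R \<Longrightarrow> Poly_Mapping.lookup m0 i \<le> Poly_Mapping.lookup m i"
    using ex_has_least_nat[of "\<lambda>m. m \<in> Poly_Mapping.keys R" _ "\<lambda>m. Poly_Mapping.lookup m i"] R(1)
    by (metis equals0I keys_eq_empty)
  define s where "s = Poly_Mapping.lookup m0 i"
  define R' where "R' = (\<Sum>m\<in>Poly_Mapping.keys R. Poly_Mapping.single (m - Poly_Mapping.single i s) (Poly_Mapping.lookup R m))"
  have split: "m = Poly_Mapping.single i s + (m - Poly_Mapping.single i s)" if "m \<in> Poly_Mapping.keys R" for m
    using m0(2)[OF that] unfolding s_def
    by (intro poly_mapping_eqI) (auto simp: lookup_add lookup_minus lookup_single when_def)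
  have pow: "Var i ^ s = Poly_Mapping.single (Poly_Mapping.single i s) 1"
    by (induction s) (simp_all add: mult_single single_add[symmetric])
  have "Var i ^ s * R' = (\<Sum>m\<in>Poly_Mapping.keys R. Poly_Mapping.single (Poly_Mapping.single i s + (m - Poly_Mapping.single i s)) (Poly_Mapping.lookup R m))"
    unfolding R'_def pow sum_distrib_left mult_single by simp
  also have "\<dots> = (\<Sum>m\<in>Poly_Mapping.keys R. Poly_Mapping.single m (Poly_Mapping.lookup R m))"
    using split by (intro sum.cong) auto
  finally have eq: "R = Var i ^ s * R'" by (simp flip: poly_mapping_sum_single)
  have keys': "\<exists>m'\<in>Poly_Mapping.keys R. m = m' - Poly_Mapping.single i s" if "m \<in> Poly_Mapping.keys R'" for m
    using that keys_sum[of "\<lambda>m. Poly_Mapping.single (m - Poly_Mapping.single i s) (Poly_Mapping.lookup R m)" "Poly_Mapping.keys R"]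
    unfolding R'_def by (auto split: if_splits)
  have sub: "Poly_Mapping.keys (m - Poly_Mapping.single i s) \<subseteq> Poly_Mapping.keys m" for m
    by (auto simp: in_keys_iff lookup_minus)
  have "whomogeneous N a (e - a i * s) R'"
    unfolding R'_def
  proof (intro whomogeneous_sum whomogeneous_single)
    fix m assume m: "m \<in> Poly_Mapping.keys R"
    show "Poly_Mapping.keys (m - Poly_Mapping.single i s) \<subseteq> {..N}" using sub[of m] R(2) m by (auto simp: whomogeneous_iff)
    have "wdegree a m = a i * s + wdegree a (m - Poly_Mapping.single i s)"
      by (subst split[OF m], subst wdegree_add) simp
    then show "wdegree a (m - Poly_Mapping.single i s) = e - a i * s" using R(2) m by (simp add: whomogeneous_iff)
  qed
  moreover have "vars R' \<subseteq> vars R" unfolding vars_def using keys' sub by blast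
  moreover have "coeff_in i 0 R' \<noteq> 0"
  proof
    assume 0: "coeff_in i 0 R' = 0"
    have pos: "Poly_Mapping.lookup m i \<noteq> 0" if "m \<in> Poly_Mapping.keys R'" for m
      using coeff_in_nonzero[OF that, of i] 0 by metis
    let ?m = "m0 - Poly_Mapping.single i s"
    have "Poly_Mapping.lookup R' ?m = Poly_Mapping.lookup R m0"
    proof -
      have "Poly_Mapping.lookup R' ?m = (\<Sum>m\<in>Poly_Mapping.keys R. if m = m0 then Poly_Mapping.lookup R m else 0)"
        unfolding R'_def lookup_sum lookup_single when_def
      proof (intro sum.cong refl)
        fix m assume m: "m \<in> Poly_Mapping.keys R"
        have "m - Poly_Mapping.single i s = ?m \<longleftrightarrow> m = m0"
          using split[OF m] split[OF m0(1)] by auto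
        then show "(if m - Poly_Mapping.single i s = ?m then Poly_Mapping.lookup R m else 0) = (if m = m0 then Poly_Mapping.lookup R m else 0)"
          by simp
      qed
      then show ?thesis using m0(1) by simp
    qed
    then have "?m \<in> Poly_Mapping.keys R'" using m0(1) by (simp add: in_keys_iff)
    then show False using pos[of ?m] by (simp add: lookup_minus s_def)
  qed
  ultimately show ?thesis using eq by blast
qed

lemma vars_graded_part: "vars (graded_part w e R) \<subseteq> vars R"
  by (auto simp: vars_def keys_graded_part)

text \<open>A curve of the form \<open>L\<close> in an irreducible surface \<open>V(F)\<close> is not contained in any larger proper closed
  irreducible subset: projecting from \<open>x_j\<close>, such a subset would be a plane curve containing a line.\<close>

lemma no_curve_above_line:
  assumes A: "{i, j, k, m} = {..3::nat}" "i \<noteq> j" "i \<noteq> k" "i \<noteq> m" "j \<noteq> k" "j \<noteq> m" "k \<noteq> m"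
    and F: "whomogeneous 3 a d F" "Factorial_Ring.irreducible F"
    and Y1: "irreducible_closed (zariski 3 a) Y1" "coordinate_subspace 3 a {k, m} \<subseteq> Y1"
    and Y2: "Y1 \<subset> Y2" "Y2 \<subseteq> zero_locus 3 a F"
    and Yi: "\<not> Y1 \<subseteq> zero_locus 3 a (Var i)"
  shows False
proof -
  obtain P where P: "P \<in> Y2" "P \<notin> Y1" using Y2 by blast
  have Pw: "P \<in> wproj 3 a" using P(1) Y2(2) zero_locus_subset by blast
  \<comment> \<open>\<open>P\<close> is a zero of \<open>F\<close> but not of \<open>G\<close>, so
    \<open>F\<close> does not divide \<open>G\<close> and x_j can be eliminated from the
    two.\<close>
  obtain e G where G: "whomogeneous 3 a e G" "Y1 \<subseteq> zero_locus 3 a G" "P \<notin> zero_locus 3 a G"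
  proof -
    have "closedin (zariski 3 a) Y1" using Y1(1) by (simp add: irreducible_closed_def)
    then have "\<exists>e G. whomogeneous 3 a e G \<and> Y1 \<subseteq> zero_locus 3 a G \<and> P \<notin> zero_locus 3 a G"
      using Pw P(2) by (simp add: closedin_zariski_iff)
    then show thesis using that by blast
  qed
  have "\<not> F dvd G"
  proof
    assume "F dvd G"
    then obtain H where "G = F * H" by (rule dvdE)
    then show False using P(1) Y2(2) G(3) Pw by (force simp: zero_locus_def)
  qed
  then obtain R where R: "R \<noteq> 0" "vars R \<subseteq> {i, k, m}" "\<And>x. peval F x = 0 \<Longrightarrow> peval G x = 0 \<Longrightarrow> peval R x = 0"
    using eliminate_variable[of i j k m F G] A F(2) whomogeneous_vars[OF F(1)] whomogeneous_vars[OF G(1)] by auto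
  \<comment> \<open>The eliminant \<open>R\<close> need not be homogeneous. Since \<open>F\<close>
    and \<open>G\<close> vanish along whole orbits, so does \<open>R\<close>, and hence each of its
    graded parts vanishes on \<open>Y1\<close>.\<close>
  obtain m0 where m0: "m0 \<in> Poly_Mapping.keys R" using R(1) by (metis equals0I keys_eq_empty)
  let ?e = "wdegree a m0"
  let ?R = "graded_part a ?e R"
  have R0: "?R \<noteq> 0" using m0 keys_graded_part[of a ?e R] by (auto simp flip: keys_eq_empty)
  have Rvars: "vars ?R \<subseteq> {i, k, m}" using vars_graded_part R(2) by blast
  have Rw: "whomogeneous 3 a ?e ?R"
    using Rvars A(1) by (auto simp: whomogeneous_def polys_in_def keys_graded_part)
  have Y1R: "Y1 \<subseteq> zero_locus 3 a ?R"
  proof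
    fix Q assume Q: "Q \<in> Y1"
    then have QF: "Q \<in> zero_locus 3 a F" "Q \<in> zero_locus 3 a G" using Y2 G(2) by blast+
    have Qw: "Q \<in> wproj 3 a" using QF(1) zero_locus_subset by blast
    obtain x where x: "x \<in> Q" using wproj_nonempty[OF Qw] by blast
    have FG: "peval F x = 0" "peval G x = 0" using QF x by (auto simp: zero_locus_def)
    have "poly (scale_poly a R x) t = 0" for t
      unfolding poly_scale_poly
      by (rule R(3)) (use whomogeneous_scale[OF F(1), of _ t x] whomogeneous_scale[OF G(1), of _ t x] FG in auto)
    then have "scale_poly a R x = 0" using poly_all_0_iff_0 by blast
    then have "peval ?R x = 0" by (metis coeff_0 coeff_scale_poly)
    then show "Q \<in> zero_locus 3 a ?R" using zero_locus_iff[OF Rw Qw x] by simp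
  qed
  obtain s e' R' where R': "?R = Var i ^ s * R'" "whomogeneous 3 a e' R'" "vars R' \<subseteq> vars ?R" "coeff_in i 0 R' \<noteq> 0"
    using extract_power[OF R0 Rw] by blast
  have i3: "i \<le> 3" using A(1) by auto
  \<comment> \<open>\<open>Y1\<close> is irreducible and leaves x_i = 0, so the factor x_i^s may be
    dropped. The cofactor \<open>R'\<close> then vanishes on the line, although its part free of x_i
    is a nonzero polynomial in x_k and x_m.\<close>
  have "\<not> Y1 \<subseteq> zero_locus 3 a (Var i ^ s)"
  proof -
    obtain Q where Q: "Q \<in> Y1" "Q \<notin> zero_locus 3 a (Var i)" using Yi by blast
    have "Q \<in> wproj 3 a" using Q(1) Y2 zero_locus_subset by blast
    then show ?thesis using Q by (auto simp: zero_locus_def)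
  qed
  then have "Y1 \<subseteq> zero_locus 3 a R'"
    using irreducible_zero_locus[OF Y1(1) whomogeneous_power[OF whomogeneous_Var[OF i3]] R'(2)] Y1R R'(1) by metis
  then have LR: "coordinate_subspace 3 a {k, m} \<subseteq> zero_locus 3 a R'" using Y1(2) by blast
  obtain x where x: "\<forall>l. x l \<noteq> 0" "peval (coeff_in i 0 R') x \<noteq> 0" using nonzero_on_torus[OF R'(4)] by blast
  let ?y = "\<lambda>l. if l \<in> {k, m} then x l else 0"
  have "peval R' (x(i := 0)) \<noteq> 0"
    using x(2) coeff_upoly[of i R' x 0] by (simp add: poly_0_coeff_0[symmetric] poly_upoly)
  also have "peval R' (x(i := 0)) = peval R' ?y"
    using R'(3) Rvars A by (intro peval_cong) auto
  finally have Ry: "peval R' ?y \<noteq> 0" .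
  have km: "k \<le> 3" "m \<le> 3" using A(1) by auto
  have yp: "?y \<in> punctured_space 3" using x(1) km by (auto simp: punctured_space_def)
  have "orbit_of 3 a ?y \<in> coordinate_subspace 3 a {k, m}"
  proof -
    have "z l = 0" if "z \<in> orbit_of 3 a ?y" "l \<notin> {k, m}" for z l
    proof (cases "l \<le> 3")
      case True
      obtain t where "\<forall>i\<le>3. z i = t ^ a i * ?y i"
        using wproj_same_point[OF orbit_of_in_wproj[OF yp] orbit_of_mem[OF yp] \<open>z \<in> _\<close>] by blast
      then show ?thesis using True \<open>l \<notin> _\<close> by simp
    next
      case False
      then show ?thesis using wproj_mem_punctured[OF orbit_of_in_wproj[OF yp] \<open>z \<in> _\<close>] by (auto simp: punctured_space_def)
    qed
    then show ?thesis using orbit_of_in_wproj[OF yp, of a] by (auto simp: coordinate_subspace_def)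
  qed
  then show False using LR Ry orbit_zero_locus_iff[OF R'(2) yp] by blast
qed

section \<open>Point derivations and singular points\<close>

text \<open>Gaussian elimination: an equation with a nonzero coefficient at \<open>p\<close> is
  solved for \<open>c p\<close> and substituted into the others, which lowers both counts by
  one.\<close>

lemma underdetermined_system:
  fixes A :: "'b \<Rightarrow> 'l \<Rightarrow> complex"
  assumes "finite L" "finite B" "card L < card B"
  shows "\<exists>c. (\<exists>b\<in>B. c b \<noteq> 0) \<and> (\<forall>l\<in>L. (\<Sum>b\<in>B. c b * A b l) = 0)"
  using assms
proof (induction L arbitrary: B A rule: finite_induct)
  case empty
  then obtain b where "b \<in> B" by fastforce
  then show ?case by (intro exI[of _ "\<lambda>_. 1"]) auto
next
  case (insert l L)
  show ?case
  proof (cases "\<forall>b\<in>B. A b l = 0")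
    case True
    have "card L < card B" using insert by simp
    then obtain c where "\<exists>b\<in>B. c b \<noteq> 0" "\<forall>s\<in>L. (\<Sum>b\<in>B. c b * A b s) = 0" using insert.IH[of B A] insert.prems by blast
    then show ?thesis using True by (intro exI[of _ c]) auto
  next
    case False
    then obtain p where p: "p \<in> B" "A p l \<noteq> 0" by blast
    let ?B = "B - {p}"
    define A' where "A' b s = A b s - A b l / A p l * A p s" for b s
    have "finite ?B" "card L < card ?B" using insert p by auto
    then obtain c where c: "\<exists>b\<in>?B. c b \<noteq> 0" "\<forall>s\<in>L. (\<Sum>b\<in>?B. c b * A' b s) = 0" using insert.IH[of ?B A'] by blast
    define c' where "c' b = (if b = p then - (\<Sum>b\<in>?B. c b * A b l) / A p l else c b)" for b
    have sum: "(\<Sum>b\<in>B. c' b * A b s) = c' p * A p s + (\<Sum>b\<in>?B. c b * A b s)" for s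
      using p(1) insert.prems(1) by (simp add: sum.remove[of B p] c'_def)
    have "(\<Sum>b\<in>B. c' b * A b l) = 0" unfolding sum using p(2) by (simp add: c'_def)
    moreover have "(\<Sum>b\<in>B. c' b * A b s) = 0" if "s \<in> L" for s
    proof -
      have "0 = (\<Sum>b\<in>?B. c b * A b s) - (\<Sum>b\<in>?B. c b * A b l) / A p l * A p s"
        using c(2) that unfolding A'_def
        by (simp add: right_diff_distrib sum_subtractf sum_distrib_right sum_divide_distrib mult.assoc)
      then show ?thesis unfolding sum by (simp add: c'_def)
    qed
    moreover have "\<exists>b\<in>B. c' b \<noteq> 0" using c(1) by (auto simp: c'_def)
    ultimately show ?thesis by (intro exI[of _ c']) auto
  qed
qed

lemma quotient_rule_add:
  fixes h h' :: complex
  assumes "h \<noteq> 0" "h' \<noteq> 0"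
  shows "((dg * h' + g * dh' + (dh * g' + h * dg')) * (h * h') - (g * h' + h * g') * (dh * h' + h * dh')) / (h * h')\<^sup>2
    = (dg * h - g * dh) / h\<^sup>2 + (dg' * h' - g' * dh') / h'\<^sup>2"
proof -
  have "(dg * h' + g * dh' + (dh * g' + h * dg')) * (h * h') - (g * h' + h * g') * (dh * h' + h * dh')
    = (dg * h - g * dh) * h'\<^sup>2 + (dg' * h' - g' * dh') * h\<^sup>2" by (simp add: algebra_simps power2_eq_square)
  then show ?thesis using assms by (simp add: add_frac_eq power_mult_distrib)
qed

lemma quotient_rule_mult:
  fixes h h' :: complex
  assumes "h \<noteq> 0" "h' \<noteq> 0"
  shows "((dg * g' + g * dg') * (h * h') - (g * g') * (dh * h' + h * dh')) / (h * h')\<^sup>2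
    = (dg * h - g * dh) / h\<^sup>2 * (g' / h') + g / h * ((dg' * h' - g' * dh') / h'\<^sup>2)"
proof -
  have "((dg * g' + g * dg') * (h * h') - (g * g') * (dh * h' + h * dh')) * (h\<^sup>2 * h' * (h * h'\<^sup>2))
    = ((dg * h - g * dh) * g' * (h * h'\<^sup>2) + g * (dg' * h' - g' * dh') * (h\<^sup>2 * h')) * (h * h')\<^sup>2" by (simp add: algebra_simps power2_eq_square)
  then show ?thesis using assms by (simp add: add_frac_eq frac_eq_eq)
qed

lemma vanish_on_punctured_space:
  assumes "vars F \<subseteq> {..N}" "\<And>y. y \<in> punctured_space N \<Longrightarrow> peval F y = 0"
  shows "F = 0"
proof (rule peval_eq_0)
  fix x :: "nat \<Rightarrow> complex" assume x: "\<forall>i. x i \<noteq> 0"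
  let ?y = "\<lambda>i. if i \<le> N then x i else 0"
  have "?y \<in> punctured_space N" using x by (auto simp: punctured_space_def intro!: exI[of _ 0])
  moreover have "peval F x = peval F ?y" using assms(1) by (intro peval_cong) auto
  ultimately show "peval F x = 0" using assms(2) by simp
qed

context
  fixes N M :: nat and a :: "nat \<Rightarrow> nat" and P :: wpoint and x :: "nat \<Rightarrow> complex"
  assumes M: "M > 0" and P: "P \<in> wproj N a" and x: "x \<in> P"
begin

text \<open>Fractions of degree divisible by \<open>M\<close> are no restriction: expand \<open>g / h\<close> by \<open>h ^ (M - 1)\<close>.\<close>

definition germ :: "(wpoint \<Rightarrow> complex) \<Rightarrow> cpoly \<Rightarrow> cpoly \<Rightarrow> bool" where
  "germ f g h \<longleftrightarrow> (\<exists>W k. openin (zariski N a) W \<and> P \<in> W \<and> whomogeneous N a (M * k) g \<and> whomogeneous N a (M * k) h \<and>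
     (\<forall>Q\<in>W. \<forall>y\<in>Q. peval h y \<noteq> 0 \<and> f Q = peval g y / peval h y))"

lemma germ_exists:
  assumes "regular N a U f" "P \<in> U"
  shows "\<exists>g h. germ f g h"
proof -
  obtain W k g h where W: "openin (zariski N a) W" "P \<in> W" "W \<subseteq> U"
    "whomogeneous N a k g" "whomogeneous N a k h"
    "\<forall>Q\<in>W. \<forall>y\<in>Q. peval h y \<noteq> 0" "\<forall>Q\<in>W. \<forall>y\<in>Q. f Q = peval g y / peval h y"
    using regularE[OF assms] by blast
  have M': "M = Suc (M - 1)" using M by simp
  have deg: "k + (M - 1) * k = M * k" by (subst (2) M') simp
  have "whomogeneous N a (M * k) (g * h ^ (M - 1))"
    using whomogeneous_mult[OF W(4) whomogeneous_power[OF W(5), of "M - 1"]] unfolding deg .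
  moreover have "whomogeneous N a (M * k) (h ^ M)" using whomogeneous_power[OF W(5), of M] .
  moreover have "peval (h ^ M) y \<noteq> 0 \<and> f Q = peval (g * h ^ (M - 1)) y / peval (h ^ M) y" if Q: "Q \<in> W" "y \<in> Q" for Q y
  proof -
    have h: "peval h y \<noteq> 0" using W(6) Q by blast
    have "peval (h ^ M) y = peval h y * peval h y ^ (M - 1)" by (subst M') simp
    then show ?thesis using h W(7) Q by simp
  qed
  ultimately have "germ f (g * h ^ (M - 1)) (h ^ M)" unfolding germ_def using W(1,2) by blast
  then show ?thesis by blast
qed

text \<open>The fractions agree on a nonempty basic open set D_+(w), so (g h' - g' h) w vanishes on
  the whole punctured space and is zero; \<open>w\<close> can be cancelled in the polynomial
  ring.\<close>

lemma germ_unique: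
  assumes "germ f g h" "germ f' g' h'" and V: "openin (zariski N a) V" "P \<in> V" "\<And>Q. Q \<in> V \<Longrightarrow> f Q = f' Q"
  shows "g * h' = g' * h"
proof -
  obtain W k where W: "openin (zariski N a) W" "P \<in> W" "whomogeneous N a (M * k) g" "whomogeneous N a (M * k) h"
    "\<forall>Q\<in>W. \<forall>y\<in>Q. peval h y \<noteq> 0 \<and> f Q = peval g y / peval h y" using assms(1) unfolding germ_def by blast
  obtain W' k' where W': "openin (zariski N a) W'" "P \<in> W'" "whomogeneous N a (M * k') g'" "whomogeneous N a (M * k') h'"
    "\<forall>Q\<in>W'. \<forall>y\<in>Q. peval h' y \<noteq> 0 \<and> f' Q = peval g' y / peval h' y" using assms(2) unfolding germ_def by blast
  have "openin (zariski N a) (W \<inter> W' \<inter> V)" "P \<in> W \<inter> W' \<inter> V" using W W' V by auto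
  then obtain e w where w: "whomogeneous N a e w" "P \<in> basic_open N a w" "basic_open N a w \<subseteq> W \<inter> W' \<inter> V"
    unfolding openin_zariski_iff by blast
  let ?D = "(g * h' - g' * h) * w"
  have "?D = 0"
  proof (rule vanish_on_punctured_space)
    have "vars (g * h' - g' * h) \<subseteq> {..N}"
      using vars_diff[of "g * h'" "g' * h"] vars_mult[of g h'] vars_mult[of g' h]
        whomogeneous_vars[OF W(3)] whomogeneous_vars[OF W(4)] whomogeneous_vars[OF W'(3)] whomogeneous_vars[OF W'(4)] by blast
    then show "vars ?D \<subseteq> {..N}"
      using vars_mult[of "g * h' - g' * h" w] whomogeneous_vars[OF w(1)] by blast
    fix y assume y: "y \<in> punctured_space N"
    show "peval ?D y = 0"
    proof (cases "peval w y = 0")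
      case False
      have "orbit_of N a y \<in> basic_open N a w"
        using basic_open_iff[OF w(1) orbit_of_in_wproj[OF y] orbit_of_mem[OF y]] False by simp
      then have Q: "orbit_of N a y \<in> W \<inter> W' \<inter> V" using w(3) by blast
      then have "peval h y \<noteq> 0" "peval h' y \<noteq> 0" "peval g y / peval h y = peval g' y / peval h' y"
        using W(5) W'(5) V(3) orbit_of_mem[OF y, of a] by (force, force, metis IntD1 IntD2)
      then show ?thesis by (simp add: field_simps)
    qed simp
  qed
  moreover have "w \<noteq> 0" using w(2) x by (auto simp: basic_open_def)
  ultimately show ?thesis by simp
qed

lemma germ_value: "germ f g h \<Longrightarrow> peval h x \<noteq> 0 \<and> f P = peval g x / peval h x"
  unfolding germ_def using x by blast

lemma
  assumes "germ f g h" "germ f' g' h'"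
  shows germ_add: "germ (\<lambda>Q. f Q + f' Q) (g * h' + h * g') (h * h')"
    and germ_mult: "germ (\<lambda>Q. f Q * f' Q) (g * g') (h * h')"
proof -
  obtain W k where W: "openin (zariski N a) W" "P \<in> W" "whomogeneous N a (M * k) g" "whomogeneous N a (M * k) h"
    "\<forall>Q\<in>W. \<forall>y\<in>Q. peval h y \<noteq> 0 \<and> f Q = peval g y / peval h y" using assms(1) unfolding germ_def by blast
  obtain W' k' where W': "openin (zariski N a) W'" "P \<in> W'" "whomogeneous N a (M * k') g'" "whomogeneous N a (M * k') h'"
    "\<forall>Q\<in>W'. \<forall>y\<in>Q. peval h' y \<noteq> 0 \<and> f' Q = peval g' y / peval h' y" using assms(2) unfolding germ_def by blast
  have o: "openin (zariski N a) (W \<inter> W')" "P \<in> W \<inter> W'" using W W' by auto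
  have d: "M * k + M * k' = M * (k + k')" by (simp add: distrib_left)
  have hh: "whomogeneous N a (M * (k + k')) (h * h')" using whomogeneous_mult[OF W(4) W'(4)] unfolding d .
  have gg: "whomogeneous N a (M * (k + k')) (g * g')" using whomogeneous_mult[OF W(3) W'(3)] unfolding d .
  have gh: "whomogeneous N a (M * (k + k')) (g * h' + h * g')"
    using whomogeneous_add[OF whomogeneous_mult[OF W(3) W'(4)] whomogeneous_mult[OF W(4) W'(3)]] unfolding d .
  have v: "peval h y \<noteq> 0" "peval h' y \<noteq> 0" "f Q = peval g y / peval h y" "f' Q = peval g' y / peval h' y"
    if "Q \<in> W \<inter> W'" "y \<in> Q" for Q y using that W(5) W'(5) by blast+
  have "\<forall>Q\<in>W \<inter> W'. \<forall>y\<in>Q. peval (h * h') y \<noteq> 0 \<and> f Q + f' Q = peval (g * h' + h * g') y / peval (h * h') y"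
  proof (intro ballI)
    fix Q y assume "Q \<in> W \<inter> W'" "y \<in> Q"
    note v = v[OF this]
    show "peval (h * h') y \<noteq> 0 \<and> f Q + f' Q = peval (g * h' + h * g') y / peval (h * h') y"
      unfolding v(3,4) using v(1,2) by (simp add: add_frac_eq mult.commute)
  qed
  then show "germ (\<lambda>Q. f Q + f' Q) (g * h' + h * g') (h * h')"
    unfolding germ_def using o hh gh by blast
  have "\<forall>Q\<in>W \<inter> W'. \<forall>y\<in>Q. peval (h * h') y \<noteq> 0 \<and> f Q * f' Q = peval (g * g') y / peval (h * h') y"
  proof (intro ballI)
    fix Q y assume "Q \<in> W \<inter> W'" "y \<in> Q"
    note v = v[OF this]
    show "peval (h * h') y \<noteq> 0 \<and> f Q * f' Q = peval (g * g') y / peval (h * h') y"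
      unfolding v(3,4) using v(1,2) by simp
  qed
  then show "germ (\<lambda>Q. f Q * f' Q) (g * g') (h * h')"
    unfolding germ_def using o hh gg by blast
qed

lemma germ_0: "germ (\<lambda>_. 0) 0 1"
  unfolding germ_def using P whomogeneous_1[of N a] openin_topspace[of "zariski N a"]
  by (intro exI[of _ "wproj N a"] exI[of _ 0]) (auto simp: topspace_zariski)

context
  fixes D :: "cpoly \<Rightarrow> complex"
  assumes D_add: "\<And>F G. D (F + G) = D F + D G"
    and D_mult: "\<And>F G k l. whomogeneous N a (M * k) F \<Longrightarrow> whomogeneous N a (M * l) G \<Longrightarrow>
      D (F * G) = D F * peval G x + peval F x * D G"
begin

definition quot_deriv :: "cpoly \<Rightarrow> cpoly \<Rightarrow> complex" where
  "quot_deriv g h = (D g * peval h x - peval g x * D h) / peval h x ^ 2"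

text \<open>The extension of \<open>D\<close> to germs by the quotient rule; \<open>SOME\<close>
  picks a representing fraction, and the value does not depend on it because fractions of the same
  germ satisfy g h' = g' h.\<close>

definition germ_deriv :: "(wpoint \<Rightarrow> complex) \<Rightarrow> complex" where
  "germ_deriv f = (SOME c. \<exists>g h. germ f g h \<and> c = quot_deriv g h)"

lemma germ_homogeneous: "germ f g h \<Longrightarrow> \<exists>k. whomogeneous N a (M * k) g \<and> whomogeneous N a (M * k) h"
  unfolding germ_def by blast

lemma germ_mult_deriv:
  assumes "germ f g h" "germ f' g' h'"
  shows "D (g * h') = D g * peval h' x + peval g x * D h'" "D (g * g') = D g * peval g' x + peval g x * D g'"
    "D (h * h') = D h * peval h' x + peval h x * D h'" "D (h * g') = D h * peval g' x + peval h x * D g'"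
  using germ_homogeneous[OF assms(1)] germ_homogeneous[OF assms(2)] D_mult by blast+

lemma quot_deriv_unique:
  assumes "germ f g h" "germ f' g' h'" "openin (zariski N a) V" "P \<in> V" "\<And>Q. Q \<in> V \<Longrightarrow> f Q = f' Q"
  shows "quot_deriv g h = quot_deriv g' h'"
proof -
  have "g * h' = g' * h" by (rule germ_unique[OF assms])
  then have e: "D g * peval h' x + peval g x * D h' = D g' * peval h x + peval g' x * D h"
    "peval g x * peval h' x = peval g' x * peval h x"
    using germ_mult_deriv[OF assms(1,2)] germ_mult_deriv[OF assms(2,1)] by (metis, metis peval_mult)
  have nz: "peval h x \<noteq> 0" "peval h' x \<noteq> 0" using germ_value assms by blast+
  \<comment> \<open>With the common value \<open>r\<close> of both fractions, the quotient rule
    becomes linear in the derivatives, and applying \<open>D\<close> to g h' = g' h gives the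
    claim.\<close>
  define r where "r = peval g x / peval h x"
  have r: "peval g x = r * peval h x" "peval g' x = r * peval h' x"
    using e(2) nz by (simp_all add: r_def field_simps)
  have q: "quot_deriv g h = (D g - r * D h) / peval h x" "quot_deriv g' h' = (D g' - r * D h') / peval h' x"
    unfolding quot_deriv_def r using nz by (simp_all add: field_simps power2_eq_square)
  have "(D g - r * D h) * peval h' x = (D g' - r * D h') * peval h x"
    using e(1) unfolding r by (simp add: algebra_simps)
  then show ?thesis unfolding q using nz by (simp add: field_simps)
qed

lemma germ_deriv_eq: "germ f g h \<Longrightarrow> germ_deriv f = quot_deriv g h"
proof -
  assume g: "germ f g h"
  have "\<exists>g h. germ f g h \<and> germ_deriv f = quot_deriv g h"
    unfolding germ_deriv_def by (rule someI_ex) (use g in blast)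
  then obtain g' h' where "germ f g' h'" "germ_deriv f = quot_deriv g' h'" by blast
  then show ?thesis
    using quot_deriv_unique[OF \<open>germ f g' h'\<close> g openin_topspace] P by (simp add: topspace_zariski)
qed

lemma germ_deriv_cong:
  assumes "germ f g h" "germ f' g' h'" "openin (zariski N a) V" "P \<in> V" "\<And>Q. Q \<in> V \<Longrightarrow> f Q = f' Q"
  shows "germ_deriv f = germ_deriv f'"
  using quot_deriv_unique[OF assms] germ_deriv_eq assms by metis

lemma germ_deriv_add:
  assumes "germ f g h" "germ f' g' h'"
  shows "germ_deriv (\<lambda>Q. f Q + f' Q) = germ_deriv f + germ_deriv f'"
proof -
  have nz: "peval h x \<noteq> 0" "peval h' x \<noteq> 0" using germ_value assms by blast+
  show ?thesis
    unfolding germ_deriv_eq[OF germ_add[OF assms]] germ_deriv_eq[OF assms(1)] germ_deriv_eq[OF assms(2)]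
      quot_deriv_def D_add germ_mult_deriv[OF assms] peval_add peval_mult
    by (rule quotient_rule_add[OF nz])
qed

lemma germ_deriv_mult:
  assumes "germ f g h" "germ f' g' h'"
  shows "germ_deriv (\<lambda>Q. f Q * f' Q) = germ_deriv f * f' P + f P * germ_deriv f'"
proof -
  have nz: "peval h x \<noteq> 0" "peval h' x \<noteq> 0" and v: "f P = peval g x / peval h x" "f' P = peval g' x / peval h' x"
    using germ_value assms by blast+
  show ?thesis
    unfolding germ_deriv_eq[OF germ_mult[OF assms]] germ_deriv_eq[OF assms(1)] germ_deriv_eq[OF assms(2)]
      quot_deriv_def germ_mult_deriv[OF assms] v peval_mult
    by (rule quotient_rule_mult[OF nz])
qed

lemma germ_deriv_sum:
  assumes "finite S" "\<And>s. s \<in> S \<Longrightarrow> \<exists>g h. germ (f s) g h"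
  shows "(\<exists>g h. germ (\<lambda>Q. \<Sum>s\<in>S. f s Q) g h) \<and> germ_deriv (\<lambda>Q. \<Sum>s\<in>S. f s Q) = (\<Sum>s\<in>S. germ_deriv (f s))"
  using assms
proof (induction S rule: finite_induct)
  case empty
  have "D 0 = 0" using D_add[of 0 0] by simp
  then show ?case using germ_0 germ_deriv_eq[OF germ_0] by (auto simp: quot_deriv_def)
next
  case (insert s S)
  obtain g h where g: "germ (f s) g h" using insert.prems by blast
  obtain g' h' where g': "germ (\<lambda>Q. \<Sum>s\<in>S. f s Q) g' h'" using insert by blast
  have IH: "germ_deriv (\<lambda>Q. \<Sum>s\<in>S. f s Q) = (\<Sum>s\<in>S. germ_deriv (f s))" using insert by blast
  show ?case using germ_add[OF g g'] germ_deriv_add[OF g g'] IH insert.hyps by auto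
qed

end

text \<open>A regular local ring of dimension \<open>N\<close> has at most \<open>N\<close> linearly independent point derivations.\<close>

lemma singular_pointI:
  fixes D :: "'b \<Rightarrow> cpoly \<Rightarrow> complex"
  assumes B: "finite B" "N < card B"
    and D_add: "\<And>b F G. b \<in> B \<Longrightarrow> D b (F + G) = D b F + D b G"
    and D_mult: "\<And>b F G k l. b \<in> B \<Longrightarrow> whomogeneous N a (M * k) F \<Longrightarrow> whomogeneous N a (M * l) G \<Longrightarrow>
      D b (F * G) = D b F * peval G x + peval F x * D b G"
    and E: "\<And>b. b \<in> B \<Longrightarrow> whomogeneous N a (M * k b) (E b)" "\<And>b. b \<in> B \<Longrightarrow> whomogeneous N a (M * k b) (E' b)"
      "\<And>b. b \<in> B \<Longrightarrow> peval (E b) x = 0" "\<And>b. b \<in> B \<Longrightarrow> peval (E' b) x \<noteq> 0"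
    and DE: "\<And>b. b \<in> B \<Longrightarrow> D b (E b) \<noteq> 0" "\<And>b c. b \<in> B \<Longrightarrow> c \<in> B \<Longrightarrow> b \<noteq> c \<Longrightarrow> D c (E b) = 0"
  shows "\<not> nonsingular_point N a P"
proof
  assume "nonsingular_point N a P"
  then obtain U t where U: "P \<in> U" "\<forall>i<N. regular N a U (t i) \<and> t i P = 0" "openin (zariski N a) U"
    and gen: "\<forall>V f. P \<in> V \<and> regular N a V f \<and> f P = 0 \<longrightarrow>
      (\<exists>W u. P \<in> W \<and> W \<subseteq> U \<inter> V \<and> openin (zariski N a) W \<and> (\<forall>i<N. regular N a W (u i)) \<and>
        (\<forall>Q\<in>W. f Q = (\<Sum>i<N. u i Q * t i Q)))"
    unfolding nonsingular_point_def by (elim exE conjE) (rule that; assumption)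
  \<comment> \<open>Numerator and denominator have the same degree, so the quotient does not depend
    on the representative picked by \<open>SOME\<close>.\<close>
  define f where "f b Q = peval (E b) (SOME y. y \<in> Q) / peval (E' b) (SOME y. y \<in> Q)" for b Q
  have fval: "f b Q = peval (E b) y / peval (E' b) y" if b: "b \<in> B" and Q: "Q \<in> wproj N a" "y \<in> Q" for b Q y
  proof -
    have "(SOME y. y \<in> Q) \<in> Q" using someI[of "\<lambda>y. y \<in> Q" y] Q(2) by simp
    then obtain s where s: "s \<noteq> 0" "\<forall>i\<le>N. y i = s ^ a i * (SOME y. y \<in> Q) i"
      using wproj_same_point[OF Q(1) _ Q(2)] by blast
    then show ?thesis
      using whomogeneous_scale[OF E(1)[OF b], of y s "SOME y. y \<in> Q"] whomogeneous_scale[OF E(2)[OF b], of y s "SOME y. y \<in> Q"]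
      by (simp add: f_def)
  qed
  have Vb: "openin (zariski N a) (basic_open N a (E' b))" "P \<in> basic_open N a (E' b)" if "b \<in> B" for b
    using openin_basic_open[OF E(2)[OF that]] basic_open_iff[OF E(2)[OF that] P x] E(4)[OF that] by auto
  have reg: "regular N a (basic_open N a (E' b)) (f b)" if "b \<in> B" for b
    using fval[OF that] by (intro regular_quotient[OF Vb(1)[OF that] E(1)[OF that] E(2)[OF that]]) (auto simp: basic_open_def)
  have gf: "germ (f b) (E b) (E' b)" if "b \<in> B" for b
    unfolding germ_def using Vb[OF that] E(1,2)[OF that] fval[OF that]
    by (intro exI[of _ "basic_open N a (E' b)"] exI[of _ "k b"]) (auto simp: basic_open_def)
  have "\<exists>W u. P \<in> W \<and> W \<subseteq> U \<and> openin (zariski N a) W \<and> (\<forall>i<N. regular N a W (u i)) \<and>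
        (\<forall>Q\<in>W. f b Q = (\<Sum>i<N. u i Q * t i Q))" if "b \<in> B" for b
      proof -
    have "P \<in> basic_open N a (E' b) \<and> regular N a (basic_open N a (E' b)) (f b) \<and> f b P = 0"
      using Vb(2)[OF that] reg[OF that] fval[OF that P x] E(3)[OF that] by simp
    then show ?thesis using gen[rule_format, of "basic_open N a (E' b)" "f b"] by blast
  qed
  then have "\<forall>b\<in>B. \<exists>W u. P \<in> W \<and> W \<subseteq> U \<and> openin (zariski N a) W \<and> (\<forall>i<N. regular N a W (u i)) \<and>
        (\<forall>Q\<in>W. f b Q = (\<Sum>i<N. u i Q * t i Q))" by blast
  from bchoice[OF this] obtain W where "\<forall>b\<in>B. \<exists>u. P \<in> W b \<and> W b \<subseteq> U \<and> openin (zariski N a) (W b) \<and>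
      (\<forall>i<N. regular N a (W b) (u i)) \<and> (\<forall>Q\<in>W b. f b Q = (\<Sum>i<N. u i Q * t i Q))" ..
  from bchoice[OF this] obtain u where Wu: "\<forall>b\<in>B. P \<in> W b \<and> W b \<subseteq> U \<and> openin (zariski N a) (W b) \<and>
      (\<forall>i<N. regular N a (W b) (u b i)) \<and> (\<forall>Q\<in>W b. f b Q = (\<Sum>i<N. u b i Q * t i Q))" ..
  have W: "\<And>b. b \<in> B \<Longrightarrow> P \<in> W b" "\<And>b. b \<in> B \<Longrightarrow> W b \<subseteq> U" "\<And>b. b \<in> B \<Longrightarrow> openin (zariski N a) (W b)"
    "\<And>b i. b \<in> B \<Longrightarrow> i < N \<Longrightarrow> regular N a (W b) (u b i)"
    "\<And>b Q. b \<in> B \<Longrightarrow> Q \<in> W b \<Longrightarrow> f b Q = (\<Sum>i<N. u b i Q * t i Q)"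
    using Wu by blast+
  \<comment> \<open>Apply the derivation \<open>D c\<close> to the equation expressing
    \<open>f b\<close> through the parameters: \<open>t i\<close> vanishes at \<open>P\<close>, so
    only the values of the coefficients and the derivatives of \<open>t i\<close> remain.\<close>
  have rel: "D c (E b) = peval (E' b) x * (\<Sum>i<N. u b i P * germ_deriv (D c) (t i))" if b: "b \<in> B" and c: "c \<in> B" for b c
  proof -
    note add = D_add[OF c] and mult = D_mult[OF c]
    have gu: "\<exists>g h. germ (u b i) g h" "\<exists>g h. germ (t i) g h" if "i < N" for i
      using germ_exists[OF W(4)[OF b that] W(1)[OF b]] germ_exists[of U "t i"] U that by auto
    have gut: "\<exists>g h. germ (\<lambda>Q. u b i Q * t i Q) g h" if "i < N" for i
      using gu[OF that] germ_mult by blast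
    have gd: "germ_deriv (D c) (\<lambda>Q. u b i Q * t i Q) = u b i P * germ_deriv (D c) (t i)" if i: "i < N" for i
    proof -
      obtain g h g' h' where gm: "germ (u b i) g h" "germ (t i) g' h'" using gu[OF i] by blast
      show ?thesis using germ_deriv_mult[OF add mult gm] U(2) i by simp
    qed
    have S: "\<exists>g h. germ (\<lambda>Q. \<Sum>i<N. u b i Q * t i Q) g h"
      "germ_deriv (D c) (\<lambda>Q. \<Sum>i<N. u b i Q * t i Q) = (\<Sum>i<N. germ_deriv (D c) (\<lambda>Q. u b i Q * t i Q))"
      using germ_deriv_sum[OF add mult, where S = "{..<N}" and f = "\<lambda>i Q. u b i Q * t i Q"] gut by auto
    obtain g h where gS: "germ (\<lambda>Q. \<Sum>i<N. u b i Q * t i Q) g h" using S(1) by blast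
    have "germ_deriv (D c) (f b) = germ_deriv (D c) (\<lambda>Q. \<Sum>i<N. u b i Q * t i Q)"
      by (rule germ_deriv_cong[OF add mult gf[OF b] gS W(3)[OF b] W(1)[OF b] W(5)[OF b]])
    also have "\<dots> = (\<Sum>i<N. u b i P * germ_deriv (D c) (t i))"
      unfolding S(2) using gd by (intro sum.cong) auto
    finally have "quot_deriv (D c) (E b) (E' b) = (\<Sum>i<N. u b i P * germ_deriv (D c) (t i))"
      using germ_deriv_eq[OF add mult gf[OF b]] by simp
    then show ?thesis using E(3,4)[OF b] by (simp add: quot_deriv_def[OF add mult] power2_eq_square field_simps)
  qed
  \<comment> \<open>There are more functions \<open>f b\<close> than parameters, so a nontrivial
    combination of their coefficient vectors at \<open>P\<close> vanishes. The dual family of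
    derivations shows that each coefficient \<open>c e\<close> is zero.\<close>
  obtain c where c: "\<exists>b\<in>B. c b \<noteq> 0" "\<forall>l\<in>{..<N}. (\<Sum>b\<in>B. c b * u b l P) = 0"
    using underdetermined_system[of "{..<N}" B "\<lambda>b l. u b l P"] B by auto
  have "c e = 0" if e: "e \<in> B" for e
  proof -
    have "(\<Sum>b\<in>B. c b * (D e (E b) / peval (E' b) x)) = (\<Sum>b\<in>B. \<Sum>i<N. c b * u b i P * germ_deriv (D e) (t i))"
    proof (intro sum.cong refl)
      fix b assume b: "b \<in> B"
      have "D e (E b) / peval (E' b) x = (\<Sum>i<N. u b i P * germ_deriv (D e) (t i))"
        unfolding rel[OF b e] using E(4)[OF b] by simp
      then show "c b * (D e (E b) / peval (E' b) x) = (\<Sum>i<N. c b * u b i P * germ_deriv (D e) (t i))"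
        by (simp add: sum_distrib_left mult.assoc)
    qed
    also have "\<dots> = (\<Sum>i<N. (\<Sum>b\<in>B. c b * u b i P) * germ_deriv (D e) (t i))"
      by (subst sum.swap) (simp add: sum_distrib_right)
    also have "\<dots> = 0" using c(2) by simp
    finally have "(\<Sum>b\<in>B. c b * (D e (E b) / peval (E' b) x)) = 0" .
    moreover have "(\<Sum>b\<in>B. c b * (D e (E b) / peval (E' b) x)) = (\<Sum>b\<in>B. if b = e then c e * (D e (E e) / peval (E' e) x) else 0)"
      using DE(2) e by (intro sum.cong) auto
    ultimately have "c e * (D e (E e) / peval (E' e) x) = 0" using B(1) e by simp
    then show ?thesis using DE(1)[OF e] E(4)[OF e] by simp
  qed
  then show False using c(1) by blast
qed

end

section \<open>Expansion coefficients along a coordinate subspace\<close>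

text \<open>Variables in \<open>T\<close> stay free, the others are frozen at \<open>x\<close>. When
  \<open>x\<close> vanishes on \<open>T\<close>, the coefficients are the Taylor coefficients at
  \<open>x\<close> transversal to the subspace where the variables of \<open>T\<close>
  vanish.\<close>

definition expand :: "nat set \<Rightarrow> (nat \<Rightarrow> complex) \<Rightarrow> cpoly \<Rightarrow> cpoly" where
  "expand T x = ring_eval Const (\<lambda>s. if s \<in> T then Var s else Const (x s))"

lemma expand_simps:
  "expand T x (F + G) = expand T x F + expand T x G" "expand T x (F * G) = expand T x F * expand T x G"
  "expand T x (Poly_Mapping.single m c) = Const c * mono_val (\<lambda>s. if s \<in> T then Var s else Const (x s)) m"
  unfolding expand_def
  by (simp_all only: comm_ring_hom.ring_eval_add[OF comm_ring_hom_Const] comm_ring_hom.ring_eval_mult[OF comm_ring_hom_Const]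
    comm_ring_hom.ring_eval_single[OF comm_ring_hom_Const])

lemma peval_expand: "peval (expand T x F) y = peval F (\<lambda>s. if s \<in> T then y s else x s)"
proof -
  have "vars F \<subseteq> UNIV" by simp
  then show ?thesis
    by (induction F rule: cpoly_induct) (simp_all add: expand_simps)
qed

lemma peval_zero_vector: "peval F (\<lambda>_. 0) = Poly_Mapping.lookup F 0"
proof -
  have "peval F (\<lambda>_. 0) = (\<Sum>m\<in>Poly_Mapping.keys F. if m = 0 then Poly_Mapping.lookup F m else 0)"
    unfolding peval_mono_val by (intro sum.cong refl) (auto simp: mono_val_eq_0_iff)
  then show ?thesis by (simp add: in_keys_iff)
qed

lemma lookup_expand_0: "(\<And>t. t \<in> T \<Longrightarrow> x t = 0) \<Longrightarrow> Poly_Mapping.lookup (expand T x F) 0 = peval F x"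
  unfolding peval_zero_vector[symmetric] peval_expand by (rule arg_cong[of _ _ "peval F"]) auto

text \<open>Freezing a variable removes its weight from the degree; a nonzero value is allowed only
  at weights divisible by \<open>g\<close>, and a zero value removes the monomial. Degrees thus
  survive modulo \<open>g\<close>.\<close>

lemma expand_keys:
  assumes G: "whomogeneous N b e G" and g: "\<And>s. s \<le> N \<Longrightarrow> s \<notin> T \<Longrightarrow> x s \<noteq> 0 \<Longrightarrow> g dvd b s"
    and \<beta>: "\<beta> \<in> Poly_Mapping.keys (expand T x G)"
  shows "wdegree b \<beta> mod g = e mod g"
proof -
  define H where "H e F \<longleftrightarrow> (\<forall>\<beta>\<in>Poly_Mapping.keys F. wdegree b \<beta> mod g = e mod g)" for e and F :: cpoly
  have H_mult: "H (e + f) (F * G)" if h: "H e F" "H f G" for e f F G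
    unfolding H_def
  proof
    fix \<beta> assume "\<beta> \<in> Poly_Mapping.keys (F * G)"
    then obtain p q where "\<beta> = p + q" "p \<in> Poly_Mapping.keys F" "q \<in> Poly_Mapping.keys G"
      using keys_mult[of F G] by blast
    then show "wdegree b \<beta> mod g = (e + f) mod g"
      using h unfolding H_def by (auto simp: wdegree_add intro: mod_add_cong)
  qed
  have H_1: "H 0 1" by (simp add: H_def)
  have H_pow: "H (l * e) (F ^ l)" if "H e F" for e F l
    by (induction l) (auto intro: H_mult H_1 that)
  have H_prod: "(\<And>s. s \<in> S \<Longrightarrow> H (d s) (f s)) \<Longrightarrow> H (sum d S) (prod f S)" for S :: "nat set" and d f
    by (induction S rule: infinite_finite_induct) (auto intro: H_mult H_1)
  let ?Y = "\<lambda>s. if s \<in> T then Var s else Const (x s)"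
  have HY: "H (b s) (?Y s)" if "s \<le> N" for s
    using g[OF that] by (auto simp: H_def)
  have Hm: "H e (Const c * mono_val ?Y m)" if m: "m \<in> Poly_Mapping.keys G" for m c
  proof -
    have "H (\<Sum>s\<in>Poly_Mapping.keys m. Poly_Mapping.lookup m s * b s) (mono_val ?Y m)"
      unfolding mono_val_def using G m by (intro H_prod H_pow HY) (auto simp: whomogeneous_iff)
    moreover have "(\<Sum>s\<in>Poly_Mapping.keys m. Poly_Mapping.lookup m s * b s) = e"
      using G m by (simp add: whomogeneous_iff wdegree_def mult.commute)
    moreover have "H 0 (Const c)" by (simp add: H_def)
    ultimately show ?thesis using H_mult[of 0 "Const c" e] by simp
  qed
  have "expand T x G = (\<Sum>m\<in>Poly_Mapping.keys G. Const (Poly_Mapping.lookup G m) * mono_val ?Y m)"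
    unfolding expand_def ring_eval_def ..
  then have "\<beta> \<in> (\<Union>m\<in>Poly_Mapping.keys G. Poly_Mapping.keys (Const (Poly_Mapping.lookup G m) * mono_val ?Y m))"
    using \<beta> keys_sum[of "\<lambda>m. Const (Poly_Mapping.lookup G m) * mono_val ?Y m" "Poly_Mapping.keys G"] by auto
  then show ?thesis using Hm unfolding H_def by blast
qed

lemma mono_val_Var: "mono_val Var m = Poly_Mapping.single m 1"
  using single_eq_prod_Var[of m 1] by (simp add: mono_val_def)

lemma expand_monomial:
  assumes "Poly_Mapping.keys \<beta> \<subseteq> T" "s \<notin> T"
  shows "expand T x (Poly_Mapping.single (\<beta> + Poly_Mapping.single s c) 1) = Poly_Mapping.single \<beta> (x s ^ c)"
proof -
  have pow: "Const z ^ c = Const (z ^ c)" for z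
    by (induction c) (simp_all add: mult_single)
  have "mono_val (\<lambda>s. if s \<in> T then Var s else Const (x s)) \<beta> = mono_val Var \<beta>"
    using assms(1) by (intro mono_val_cong) auto
  then show ?thesis using assms(2) by (simp add: expand_simps mono_val_add mono_val_Var pow mult_single)
qed

text \<open>In the convolution sum only the two decompositions with a zero part contribute; what
  remains has the shape of the product rule at a point.\<close>

lemma lookup_mult_indecomposable:
  assumes \<alpha>: "\<alpha> \<noteq> 0" and ind: "\<And>\<beta> \<gamma>. \<beta> \<in> Poly_Mapping.keys p \<Longrightarrow> \<gamma> \<in> Poly_Mapping.keys q \<Longrightarrow> \<beta> + \<gamma> = \<alpha> \<Longrightarrow> \<beta> = 0 \<or> \<gamma> = 0"
  shows "Poly_Mapping.lookup (p * q) \<alpha> =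
    Poly_Mapping.lookup p \<alpha> * Poly_Mapping.lookup q 0 + Poly_Mapping.lookup p 0 * Poly_Mapping.lookup (q :: cpoly) \<alpha>"
proof -
  let ?l = "Poly_Mapping.lookup"
  let ?K = "Poly_Mapping.keys p \<times> Poly_Mapping.keys q"
  let ?f = "\<lambda>(\<beta>, \<gamma>). if \<beta> + \<gamma> = \<alpha> then ?l p \<beta> * ?l q \<gamma> else 0"
  have "p * q = (\<Sum>\<beta>\<in>Poly_Mapping.keys p. \<Sum>\<gamma>\<in>Poly_Mapping.keys q. Poly_Mapping.single \<beta> (?l p \<beta>) * Poly_Mapping.single \<gamma> (?l q \<gamma>))"
    by (subst poly_mapping_sum_single[of p], subst poly_mapping_sum_single[of q]) (simp add: sum_product)
  then have "?l (p * q) \<alpha> = (\<Sum>\<beta>\<in>Poly_Mapping.keys p. \<Sum>\<gamma>\<in>Poly_Mapping.keys q. ?f (\<beta>, \<gamma>))"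
    by (simp add: lookup_sum mult_single lookup_single when_def)
  also have "\<dots> = (\<Sum>z\<in>?K. ?f z)" by (simp add: sum.cartesian_product)
  also have "\<dots> = (\<Sum>z\<in>?K \<union> {(\<alpha>, 0), (0, \<alpha>)}. ?f z)"
    by (intro sum.mono_neutral_left) (auto simp: in_keys_iff)
  also have "\<dots> = (\<Sum>z\<in>{(\<alpha>, 0), (0, \<alpha>)}. ?f z)"
  proof (rule sum.mono_neutral_right)
    show "\<forall>z\<in>?K \<union> {(\<alpha>, 0), (0, \<alpha>)} - {(\<alpha>, 0), (0, \<alpha>)}. ?f z = 0"
    proof
      fix z assume z: "z \<in> ?K \<union> {(\<alpha>, 0), (0, \<alpha>)} - {(\<alpha>, 0), (0, \<alpha>)}"
      obtain \<beta> \<gamma> where zz: "z = (\<beta>, \<gamma>)" by (cases z)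
      then show "?f z = 0" using z ind[of \<beta> \<gamma>] by auto
    qed
  qed auto
  also have "\<dots> = ?l p \<alpha> * ?l q 0 + ?l p 0 * ?l q \<alpha>" using \<alpha> by simp
  finally show ?thesis .
qed

text \<open>The minimal generators of the monoid of exponents of degree divisible by
  \<open>M\<close>, i.e. of the monomials invariant under the \<open>M\<close>-th roots of unity
  acting with weights \<open>b\<close>. They index the cotangent directions of the quotient.\<close>

definition indecomposable :: "nat \<Rightarrow> (nat \<Rightarrow> nat) \<Rightarrow> (nat \<Rightarrow>\<^sub>0 nat) \<Rightarrow> bool" where
  "indecomposable M b \<alpha> \<longleftrightarrow> \<alpha> \<noteq> 0 \<and> M dvd wdegree b \<alpha> \<and>
     (\<forall>\<beta> \<gamma>. \<beta> + \<gamma> = \<alpha> \<longrightarrow> M dvd wdegree b \<beta> \<longrightarrow> M dvd wdegree b \<gamma> \<longrightarrow> \<beta> = 0 \<or> \<gamma> = 0)"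

lemma indecomposable_derivation:
  assumes \<alpha>: "indecomposable g b \<alpha>" and g: "\<And>s. s \<le> N \<Longrightarrow> s \<notin> T \<Longrightarrow> x s \<noteq> 0 \<Longrightarrow> g dvd b s"
    and x: "\<And>t. t \<in> T \<Longrightarrow> x t = 0" and FG: "whomogeneous N b e F" "whomogeneous N b f G" "g dvd e" "g dvd f"
  shows "Poly_Mapping.lookup (expand T x (F * G)) \<alpha> =
    Poly_Mapping.lookup (expand T x F) \<alpha> * peval G x + peval F x * Poly_Mapping.lookup (expand T x G) \<alpha>"
proof -
  have "g dvd wdegree b \<beta>" if "\<beta> \<in> Poly_Mapping.keys (expand T x F)" for \<beta>
    using expand_keys[OF FG(1) g that] FG(3) by (simp add: dvd_eq_mod_eq_0)
  moreover have "g dvd wdegree b \<beta>" if "\<beta> \<in> Poly_Mapping.keys (expand T x G)" for \<beta>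
    using expand_keys[OF FG(2) g that] FG(4) by (simp add: dvd_eq_mod_eq_0)
  ultimately show ?thesis
    unfolding expand_simps(2)
    using lookup_mult_indecomposable[of \<alpha> "expand T x F" "expand T x G"] \<alpha> lookup_expand_0[of T x] x
    unfolding indecomposable_def by metis
qed

text \<open>The least positive power of x_t of degree divisible by \<open>M\<close>; the exponent
  \<open>M\<close> itself shows that there is one.\<close>

lemma indecomposable_pure:
  assumes "M > 0"
  shows "\<exists>l>0. indecomposable M b (Poly_Mapping.single t l)"
proof -
  obtain l where l: "l > 0 \<and> M dvd b t * l" "\<And>l'. l' > 0 \<and> M dvd b t * l' \<Longrightarrow> l \<le> l'"
    using ex_has_least_nat[of "\<lambda>l. l > 0 \<and> M dvd b t * l" M "\<lambda>l. l"] assms by auto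
  have "\<beta> = 0 \<or> \<gamma> = 0" if h: "\<beta> + \<gamma> = Poly_Mapping.single t l" "M dvd wdegree b \<beta>" for \<beta> \<gamma>
  proof -
    have lk: "Poly_Mapping.lookup \<beta> s + Poly_Mapping.lookup \<gamma> s = (l when t = s)" for s
      using arg_cong[OF h(1), of "\<lambda>p. Poly_Mapping.lookup p s"] by (simp add: lookup_add lookup_single)
    have b: "\<beta> = Poly_Mapping.single t (Poly_Mapping.lookup \<beta> t)" and c: "\<gamma> = Poly_Mapping.single t (Poly_Mapping.lookup \<gamma> t)"
      using lk by (auto intro!: poly_mapping_eqI simp: lookup_single when_def) (metis add_is_0)+
    have "M dvd b t * Poly_Mapping.lookup \<beta> t" using h(2) by (subst (asm) b) simp
    then have "Poly_Mapping.lookup \<beta> t = 0 \<or> l \<le> Poly_Mapping.lookup \<beta> t" using l(2) by (metis gr0I)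
    then have "Poly_Mapping.lookup \<beta> t = 0 \<or> Poly_Mapping.lookup \<gamma> t = 0" using lk[of t] by auto
    then show ?thesis using b c by (metis single_zero)
  qed
  then have "indecomposable M b (Poly_Mapping.single t l)"
    unfolding indecomposable_def using l(1) by (auto simp: lookup_single poly_mapping_eq_iff fun_eq_iff when_def)
  then show ?thesis using l(1) by blast
qed

text \<open>Take an exponent on x_i, x_j of degree divisible by \<open>M\<close> whose x_j-part
  alone is not, with least total exponent. In a decomposition one summand has the same property, so
  the other one is 0. That both variables occur is forced by the condition on the x_j-part.\<close>

lemma indecomposable_mixed:
  assumes ij: "i \<noteq> j" and M: "M > 0" "g dvd M" and cop: "coprime g (b i)" and g: "\<not> g dvd b j"
  shows "\<exists>\<alpha>. indecomposable M b \<alpha> \<and> Poly_Mapping.keys \<alpha> = {i, j}"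
proof -
  have g0: "g > 0" using M by (auto intro: gr0I)
  obtain y where y: "[b i * y = 1] (mod g)" using cong_solve_coprime_nat[of "b i" g] cop by (auto simp: coprime_commute)
  \<comment> \<open>A solution of b_i u = - b_j modulo \<open>g\<close>, with \<open>g - 1\<close>
    in place of -1; multiplying exponents by M / g turns divisibility by \<open>g\<close> into
    divisibility by \<open>M\<close>.\<close>
  define u where "u = y * ((g - 1) * b j)"
  have "[b i * u + b j = 1 * ((g - 1) * b j) + b j] (mod g)"
    unfolding u_def mult.assoc[symmetric] using y by (intro cong_add cong_mult cong_refl) (simp add: cong_refl)
  moreover have "1 * ((g - 1) * b j) + b j = g * b j" using g0 by (cases g) simp_all
  ultimately have gd: "g dvd b i * u + b j" using cong_dvd_iff by (metis dvd_triv_left)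
  obtain M' where M': "M = M' * g" using M(2) by (metis dvd_def mult.commute)
  define good where "good \<alpha> \<longleftrightarrow> Poly_Mapping.keys \<alpha> \<subseteq> {i, j} \<and> M dvd wdegree b \<alpha> \<and> \<not> M dvd b j * Poly_Mapping.lookup \<alpha> j" for \<alpha>
  have "good (Poly_Mapping.single i (M' * u) + Poly_Mapping.single j M')"
    unfolding good_def
  proof (intro conjI)
    show "Poly_Mapping.keys (Poly_Mapping.single i (M' * u) + Poly_Mapping.single j M') \<subseteq> {i, j}"
      using Poly_Mapping.keys_add[of "Poly_Mapping.single i (M' * u)" "Poly_Mapping.single j M'"] by (auto split: if_splits)
    have "wdegree b (Poly_Mapping.single i (M' * u) + Poly_Mapping.single j M') = M' * (b i * u + b j)"
      by (simp add: wdegree_add algebra_simps)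
    then show "M dvd wdegree b (Poly_Mapping.single i (M' * u) + Poly_Mapping.single j M')"
      unfolding M' using gd by (simp add: mult_dvd_mono)
    show "\<not> M dvd b j * Poly_Mapping.lookup (Poly_Mapping.single i (M' * u) + Poly_Mapping.single j M') j"
      using ij g M(1) unfolding M' by (simp add: lookup_add lookup_single mult.commute[of "b j"])
  qed
  then obtain \<alpha> where \<alpha>: "good \<alpha>" "\<And>\<beta>. good \<beta> \<Longrightarrow>
      Poly_Mapping.lookup \<alpha> i + Poly_Mapping.lookup \<alpha> j \<le> Poly_Mapping.lookup \<beta> i + Poly_Mapping.lookup \<beta> j"
    using ex_has_least_nat[of good _ "\<lambda>\<alpha>. Poly_Mapping.lookup \<alpha> i + Poly_Mapping.lookup \<alpha> j"] by blast
  have sub: "\<gamma> = 0" if h: "\<beta> + \<gamma> = \<alpha>" "M dvd wdegree b \<beta>" "\<not> M dvd b j * Poly_Mapping.lookup \<beta> j" for \<beta> \<gamma>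
  proof -
    have kk: "Poly_Mapping.keys \<beta> \<subseteq> {i, j}" "Poly_Mapping.keys \<gamma> \<subseteq> {i, j}"
    proof -
      have "Poly_Mapping.keys \<beta> \<subseteq> Poly_Mapping.keys \<alpha>" "Poly_Mapping.keys \<gamma> \<subseteq> Poly_Mapping.keys \<alpha>"
        unfolding h(1)[symmetric] by (auto simp: in_keys_iff lookup_add)
      then show "Poly_Mapping.keys \<beta> \<subseteq> {i, j}" "Poly_Mapping.keys \<gamma> \<subseteq> {i, j}"
        using \<alpha>(1) unfolding good_def by blast+
    qed
    then have "good \<beta>" using h by (simp add: good_def)
    then have "Poly_Mapping.lookup \<gamma> i = 0" "Poly_Mapping.lookup \<gamma> j = 0"
      using \<alpha>(2)[of \<beta>] unfolding h(1)[symmetric] by (auto simp: lookup_add)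
    then have "Poly_Mapping.lookup \<gamma> s = 0" for s
      using kk(2) by (metis in_keys_iff insertE singletonD subsetD)
    then show ?thesis by (intro poly_mapping_eqI) simp
  qed
  have "\<beta> = 0 \<or> \<gamma> = 0" if h: "\<beta> + \<gamma> = \<alpha>" "M dvd wdegree b \<beta>" "M dvd wdegree b \<gamma>" for \<beta> \<gamma>
  proof -
    have "b j * Poly_Mapping.lookup \<alpha> j = b j * Poly_Mapping.lookup \<beta> j + b j * Poly_Mapping.lookup \<gamma> j"
      unfolding h(1)[symmetric] by (simp add: lookup_add distrib_left)
    then have "\<not> M dvd b j * Poly_Mapping.lookup \<beta> j \<or> \<not> M dvd b j * Poly_Mapping.lookup \<gamma> j"
      using \<alpha>(1) unfolding good_def by (metis dvd_add)
    moreover have "\<gamma> + \<beta> = \<alpha>" using h(1) by (simp add: add.commute)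
    ultimately show ?thesis using sub[OF h(1,2)] sub[OF _ h(3)] by blast
  qed
  moreover have aj: "Poly_Mapping.lookup \<alpha> j \<noteq> 0" using \<alpha>(1) unfolding good_def by (metis dvd_0_right mult_0_right)
  moreover have "Poly_Mapping.lookup \<alpha> i \<noteq> 0"
  proof
    assume "Poly_Mapping.lookup \<alpha> i = 0"
    then have "wdegree b \<alpha> = b j * Poly_Mapping.lookup \<alpha> j"
      using wdegree_superset[of "{i, j}" \<alpha> b] \<alpha>(1) ij by (simp add: good_def)
    then show False using \<alpha>(1) by (simp add: good_def)
  qed
  ultimately have "indecomposable M b \<alpha>" "i \<in> Poly_Mapping.keys \<alpha>" "j \<in> Poly_Mapping.keys \<alpha>"
    using \<alpha>(1) unfolding good_def indecomposable_def in_keys_iff by auto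
  then show ?thesis using \<alpha>(1) unfolding good_def by blast
qed

lemma Var_power: "Var k ^ e = Poly_Mapping.single (Poly_Mapping.single k e) 1"
  by (induction e) (simp_all add: mult_single single_add[symmetric])

text \<open>Solves the congruence m c = - w modulo k, with \<open>k - 1\<close> in place of -1. A
  power of x_m can thus complete a degree to a multiple of the weight of x_k.\<close>

lemma exists_complement_multiple:
  assumes "k > 0" "m > 0" "gcd k m dvd (w::nat)"
  shows "\<exists>c. k dvd w + m * c"
proof -
  obtain x y where xy: "m * x = k * y + gcd m k" using bezout_nat[of m k] assms(2) by auto
  obtain w' where w: "w = gcd k m * w'" using assms(3) by (rule dvdE)
  have k: "k = Suc (k - 1)" using assms(1) by simp
  have "w + m * (x * w' * (k - 1)) = w + (k * y + gcd m k) * w' * (k - 1)"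
    using xy by (simp add: mult.assoc[symmetric])
  also have "\<dots> = k * (y * w' * (k - 1)) + (w + w * (k - 1))"
    by (simp add: w gcd.commute algebra_simps)
  also have "w + w * (k - 1) = k * w" by (subst (2) k) simp
  finally have "w + m * (x * w' * (k - 1)) = k * (y * w' * (k - 1) + w)" by (simp add: distrib_left)
  then show ?thesis by (metis dvd_triv_left)
qed

lemma whomogeneous_Var_power: "k \<le> N \<Longrightarrow> whomogeneous N b (b k * e) (Var k ^ e)"
  using whomogeneous_power[OF whomogeneous_Var, of k N b e] by (simp add: mult.commute)

lemma single_ne_single: "i \<noteq> j \<Longrightarrow> l > 0 \<Longrightarrow> Poly_Mapping.single i l \<noteq> Poly_Mapping.single j (l' :: nat)"
  by (metis lookup_single_eq lookup_single_not_eq less_irrefl)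

section \<open>Singularity of coordinate lines whose two weights have a common factor\<close>

context
  fixes b :: "nat \<Rightarrow> nat" and i j k m :: nat
  assumes idx: "{i, j, k, m} = {..3}" "i \<noteq> j" "i \<noteq> k" "i \<noteq> m" "j \<noteq> k" "j \<noteq> m" "k \<noteq> m"
    and b: "\<And>l. l \<le> 3 \<Longrightarrow> b l > 0"
    and cop: "coprime (gcd (b k) (b m)) (b i)" "coprime (gcd (b k) (b m)) (b j)" and g1: "gcd (b k) (b m) > 1"
begin

text \<open>Near a general point of the line \<open>L\<close>: one derivation along \<open>L\<close>, and three transversal ones.\<close>

lemma line_singular_general:
  assumes P: "P \<in> wproj 3 b" and x: "x \<in> P" "x i = 0" "x j = 0" "x k \<noteq> 0" "x m \<noteq> 0"
  shows "\<not> nonsingular_point 3 b P"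
proof -
  let ?g = "gcd (b k) (b m)"
  have le: "i \<le> 3" "j \<le> 3" "k \<le> 3" "m \<le> 3" using idx(1) by auto
  have pos: "b k > 0" "b m > 0" "?g > 0" using b le g1 by simp_all
  have gj: "\<not> ?g dvd b j" using g1 coprime_common_divisor_nat[OF cop(2) dvd_refl] by auto
  obtain l1 l2 \<alpha> where l: "l1 > 0" "indecomposable ?g b (Poly_Mapping.single i l1)"
      "l2 > 0" "indecomposable ?g b (Poly_Mapping.single j l2)"
      "indecomposable ?g b \<alpha>" "Poly_Mapping.keys \<alpha> = {i, j}"
  proof -
    obtain l1 where "l1 > 0" "indecomposable ?g b (Poly_Mapping.single i l1)" using indecomposable_pure[OF pos(3), of b i] by blast
    moreover obtain l2 where "l2 > 0" "indecomposable ?g b (Poly_Mapping.single j l2)" using indecomposable_pure[OF pos(3), of b j] by blast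
    moreover obtain \<alpha> where "indecomposable ?g b \<alpha>" "Poly_Mapping.keys \<alpha> = {i, j}"
      using indecomposable_mixed[where b = b and g = ?g, OF idx(2) pos(3) dvd_refl cop(1) gj] by blast
    ultimately show thesis by (rule that)
  qed
  let ?T = "{i, j}"
  \<comment> \<open>The element 0 is a label for the derivation along the line; the other three are
    transversal exponents of degree divisible by gcd(b_k, b_m).\<close>
  define B where "B = {0, Poly_Mapping.single i l1, Poly_Mapping.single j l2, \<alpha>}"
  have ind: "indecomposable ?g b \<beta> \<and> Poly_Mapping.keys \<beta> \<subseteq> ?T \<and> \<beta> \<noteq> 0" if \<beta>: "\<beta> \<in> B" "\<beta> \<noteq> 0" for \<beta>
  proof -
    consider "\<beta> = Poly_Mapping.single i l1" | "\<beta> = Poly_Mapping.single j l2" | "\<beta> = \<alpha>"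
      using \<beta> unfolding B_def by blast
    then show ?thesis by cases (use l \<open>\<beta> \<noteq> 0\<close> in simp_all)
  qed
  have "\<alpha> \<noteq> Poly_Mapping.single i l1" "\<alpha> \<noteq> Poly_Mapping.single j l2" "\<alpha> \<noteq> 0"
    using l(6) idx(2) by (auto simp: set_eq_iff split: if_splits)
  moreover have "Poly_Mapping.single i l1 \<noteq> 0" "Poly_Mapping.single j l2 \<noteq> 0" using l(2,4) by (auto simp: indecomposable_def)
  ultimately have card: "card B = 4" "finite B" using single_ne_single[OF idx(2) l(1), of l2] unfolding B_def by auto
  have "\<exists>c. b k dvd wdegree b \<beta> + b m * c" if "\<beta> \<in> B" for \<beta>
  proof (cases "\<beta> = 0")
    case False
    then show ?thesis using ind[OF that] pos by (intro exists_complement_multiple) (auto simp: indecomposable_def)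
  qed (simp add: exI[of _ 0])
  \<comment> \<open>Multiplication by x_m^c, which is nonzero at \<open>x\<close>, makes the degree
    a multiple of b_k, so that division by a power of x_k gives a function.\<close>
  then obtain c where c: "\<And>\<beta>. \<beta> \<in> B \<Longrightarrow> b k dvd wdegree b \<beta> + b m * c \<beta>" by metis
  define D where "D \<beta> = (if \<beta> = 0 then (\<lambda>G. peval (partial_deriv m G) x) else (\<lambda>G. Poly_Mapping.lookup (expand ?T x G) \<beta>))" for \<beta>
  \<comment> \<open>For the label 0, two pure powers of degree b_k b_m are combined so that the
    difference vanishes at \<open>x\<close> while its derivative in x_m does not. It is constant in
    x_i and x_j, so the transversal derivations annihilate it.\<close>
  define E where "E \<beta> = (if \<beta> = 0 then Const (x k ^ b m) * Var m ^ b k - Const (x m ^ b k) * Var k ^ b m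
      else Poly_Mapping.single (\<beta> + Poly_Mapping.single m (c \<beta>)) 1)" for \<beta>
  define K where "K \<beta> = (if \<beta> = 0 then b m else (wdegree b \<beta> + b m * c \<beta>) div b k)" for \<beta>
  define E' where "E' \<beta> = Var k ^ K \<beta>" for \<beta>
  have vk: "g dvd b s" if "s \<le> 3" "s \<notin> ?T" "g = ?g" for s g
    using that idx(1) by (metis atMost_iff gcd_dvd1 gcd_dvd2 insertE insertI1 singletonD insert_commute)
  have Dhom: "D \<beta> (F + G) = D \<beta> F + D \<beta> G" for \<beta> F G
    by (simp add: D_def partial_deriv_add expand_simps lookup_add)
  have xT: "x t = 0" if "t \<in> ?T" for t using that x by auto
  show ?thesis
  proof (rule singular_pointI[where B = B and D = D and E = E and E' = E' and k = K, OF pos(1) P x(1)])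
    show "finite B" "3 < card B" using card by simp_all
    show "D \<beta> (F + G) = D \<beta> F + D \<beta> G" for \<beta> F G by (rule Dhom)
    fix \<beta> F G e f assume \<beta>: "\<beta> \<in> B"
    show "D \<beta> (F * G) = D \<beta> F * peval G x + peval F x * D \<beta> G"
      if FG: "whomogeneous 3 b (b k * e) F" "whomogeneous 3 b (b k * f) G"
    proof (cases "\<beta> = 0")
      case False
      have "?g dvd b k * e" "?g dvd b k * f" by simp_all
      then show ?thesis
        using indecomposable_derivation[where N = 3 and T = ?T and x = x, OF _ _ xT FG, of ?g \<beta>] ind[OF \<beta> False] vk False
        by (simp add: D_def)
    qed (simp add: D_def partial_deriv_mult)
  next
    fix \<beta> assume \<beta>: "\<beta> \<in> B"
    have deg: "b k * K \<beta> = wdegree b \<beta> + b m * c \<beta>" if "\<beta> \<noteq> 0" using c[OF \<beta>] that by (simp add: K_def)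
    show "whomogeneous 3 b (b k * K \<beta>) (E' \<beta>)" unfolding E'_def by (rule whomogeneous_Var_power[OF le(3)])
    show "peval (E' \<beta>) x \<noteq> 0" using x(4) by (simp add: E'_def)
    show "whomogeneous 3 b (b k * K \<beta>) (E \<beta>)"
    proof (cases "\<beta> = 0")
      case True
      have "whomogeneous 3 b (0 + b m * b k) (Const (x k ^ b m) * Var m ^ b k)" "whomogeneous 3 b (0 + b k * b m) (Const (x m ^ b k) * Var k ^ b m)"
        by (intro whomogeneous_mult whomogeneous_Const whomogeneous_Var_power le)+
      then show ?thesis using True whomogeneous_diff by (simp add: E_def K_def mult.commute)
    next
      case False
      have "Poly_Mapping.keys (\<beta> + Poly_Mapping.single m (c \<beta>)) \<subseteq> {..3}"
        using Poly_Mapping.keys_add[of \<beta> "Poly_Mapping.single m (c \<beta>)"] ind[OF \<beta> False] le by (auto split: if_splits)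
      then show ?thesis using False deg by (auto simp: E_def wdegree_add intro!: whomogeneous_single)
    qed
    show "peval (E \<beta>) x = 0"
    proof (cases "\<beta> = 0")
      case False
      have "mono_val x \<beta> = 0" using ind[OF \<beta> False] xT unfolding mono_val_eq_0_iff by (metis all_not_in_conv keys_eq_empty subsetD)
      then show ?thesis using False by (simp add: E_def mono_val_add)
    qed (simp add: E_def)
    have ex0: "expand ?T x (E 0) = Const (x k ^ b m * x m ^ b k - x m ^ b k * x k ^ b m)"
    proof -
      have pow: "Const z ^ e = Const (z ^ e)" for z e by (induction e) (simp_all add: mult_single)
      have "E 0 = Const (x k ^ b m) * Var m ^ b k + Const (- (x m ^ b k)) * Var k ^ b m"
        by (simp add: E_def single_uminus)
      then show ?thesis using idx by (simp add: expand_simps Var_power pow mult_single single_add[symmetric])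
    qed
    have exm: "expand ?T x (E \<gamma>) = Poly_Mapping.single \<gamma> (x m ^ c \<gamma>)" if "\<gamma> \<in> B" "\<gamma> \<noteq> 0" for \<gamma>
      unfolding E_def using expand_monomial[of \<gamma> ?T m x "c \<gamma>"] ind[OF that] that idx by simp
    show "D \<beta> (E \<beta>) \<noteq> 0"
    proof (cases "\<beta> = 0")
      case True
      have "peval (partial_deriv m (E 0)) x * x m = of_nat (b k) * x k ^ b m * x m ^ b k"
      proof -
        have "E 0 = Poly_Mapping.single (Poly_Mapping.single m (b k)) (x k ^ b m) + Poly_Mapping.single (Poly_Mapping.single k (b m)) (- (x m ^ b k))"
          by (simp add: E_def Var_power mult_single single_uminus)
        then have "peval (partial_deriv m (E 0)) x * x m =
          peval (partial_deriv m (Poly_Mapping.single (Poly_Mapping.single m (b k)) (x k ^ b m))) x * x m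
          + peval (partial_deriv m (Poly_Mapping.single (Poly_Mapping.single k (b m)) (- (x m ^ b k)))) x * x m"
          by (simp add: partial_deriv_add distrib_right)
        then show ?thesis unfolding partial_deriv_monomial using idx by (simp add: lookup_single)
      qed
      then show ?thesis using True x pos by (auto simp: D_def)
    next
      case False
      then show ?thesis using exm[OF \<beta>] x by (simp add: D_def)
    qed
    fix \<gamma> assume \<gamma>: "\<gamma> \<in> B" "\<beta> \<noteq> \<gamma>"
    show "D \<gamma> (E \<beta>) = 0"
    proof (cases "\<gamma> = 0")
      case True
      then have "\<beta> \<noteq> 0" using \<gamma> by simp
      have "mono_val x \<beta> = 0" using ind[OF \<beta> \<open>\<beta> \<noteq> 0\<close>] xT unfolding mono_val_eq_0_iff by (metis all_not_in_conv keys_eq_empty subsetD)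
      then have "peval (partial_deriv m (E \<beta>)) x * x m = 0"
        using \<open>\<beta> \<noteq> 0\<close> by (simp add: E_def partial_deriv_monomial mono_val_add)
      then show ?thesis using True x by (simp add: D_def)
    next
      case False
      show ?thesis
      proof (cases "\<beta> = 0")
        case True
        then show ?thesis using False ex0 by (simp add: D_def lookup_single)
      next
        case False
        then show ?thesis using exm[OF \<beta>] \<open>\<gamma> \<noteq> 0\<close> \<gamma> by (simp add: D_def lookup_single)
      qed
    qed
  qed
qed

text \<open>At a vertex of \<open>L\<close> the three transversal pure powers are joined by a mixed monomial.\<close>

lemma line_singular_vertex:
  assumes P: "P \<in> wproj 3 b" and x: "x \<in> P" "x i = 0" "x j = 0" "x k \<noteq> 0" "x m = 0"
  shows "\<not> nonsingular_point 3 b P"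
proof -
  let ?g = "gcd (b k) (b m)"
  have le: "i \<le> 3" "j \<le> 3" "k \<le> 3" "m \<le> 3" using idx(1) by auto
  have pos: "b k > 0" "b m > 0" "?g > 0" using b le g1 by simp_all
  have gj: "\<not> ?g dvd b j" using g1 coprime_common_divisor_nat[OF cop(2) dvd_refl] by auto
  obtain l1 l2 l3 \<alpha> where l: "l1 > 0" "indecomposable (b k) b (Poly_Mapping.single i l1)"
      "l2 > 0" "indecomposable (b k) b (Poly_Mapping.single j l2)"
      "l3 > 0" "indecomposable (b k) b (Poly_Mapping.single m l3)"
      "indecomposable (b k) b \<alpha>" "Poly_Mapping.keys \<alpha> = {i, j}"
  proof -
    obtain l1 where "l1 > 0" "indecomposable (b k) b (Poly_Mapping.single i l1)" using indecomposable_pure[OF pos(1), of b i] by blast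
    moreover obtain l2 where "l2 > 0" "indecomposable (b k) b (Poly_Mapping.single j l2)" using indecomposable_pure[OF pos(1), of b j] by blast
    moreover obtain l3 where "l3 > 0" "indecomposable (b k) b (Poly_Mapping.single m l3)" using indecomposable_pure[OF pos(1), of b m] by blast
    moreover obtain \<alpha> where "indecomposable (b k) b \<alpha>" "Poly_Mapping.keys \<alpha> = {i, j}"
      using indecomposable_mixed[where b = b and g = ?g, OF idx(2) pos(1) gcd_dvd1 cop(1) gj] by blast
    ultimately show thesis by (rule that)
  qed
  \<comment> \<open>At the vertex x_m vanishes as well: the relevant roots of unity are now the
    b_k-th ones, and a power of x_m replaces the derivation along the line.\<close>
  let ?T = "{i, j, m}"
  define B where "B = {Poly_Mapping.single i l1, Poly_Mapping.single j l2, Poly_Mapping.single m l3, \<alpha>}"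
  have ind: "indecomposable (b k) b \<beta> \<and> Poly_Mapping.keys \<beta> \<subseteq> ?T \<and> \<beta> \<noteq> 0" if \<beta>: "\<beta> \<in> B" for \<beta>
  proof -
    consider "\<beta> = Poly_Mapping.single i l1" | "\<beta> = Poly_Mapping.single j l2" | "\<beta> = Poly_Mapping.single m l3" | "\<beta> = \<alpha>"
      using \<beta> unfolding B_def by blast
    then have "indecomposable (b k) b \<beta> \<and> Poly_Mapping.keys \<beta> \<subseteq> ?T" by cases (use l in auto)
    then show ?thesis by (simp add: indecomposable_def)
  qed
  have "\<alpha> \<noteq> Poly_Mapping.single i l1" "\<alpha> \<noteq> Poly_Mapping.single j l2" "\<alpha> \<noteq> Poly_Mapping.single m l3"
    using l(8) idx by (auto simp: set_eq_iff split: if_splits)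
  then have card: "card B = 4" "finite B"
    using single_ne_single[OF idx(2) l(1), of l2] single_ne_single[OF idx(4) l(1), of l3] single_ne_single[OF idx(6) l(3), of l3]
    unfolding B_def by auto
  define D where "D \<beta> = (\<lambda>G. Poly_Mapping.lookup (expand ?T x G) \<beta>)" for \<beta>
  define E where "E \<beta> = (Poly_Mapping.single \<beta> 1 :: cpoly)" for \<beta>
  define K where "K \<beta> = wdegree b \<beta> div b k" for \<beta>
  define E' where "E' \<beta> = Var k ^ K \<beta>" for \<beta>
  have vk: "b k dvd b s" if "s \<le> 3" "s \<notin> ?T" for s
    using that idx(1) by (metis atMost_iff dvd_refl insert_iff singletonD)
  have xT: "x t = 0" if "t \<in> ?T" for t using that x by auto
  show ?thesis
  proof (rule singular_pointI[where B = B and D = D and E = E and E' = E' and k = K, OF pos(1) P x(1)])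
    show "finite B" "3 < card B" using card by simp_all
    show "D \<beta> (F + G) = D \<beta> F + D \<beta> G" for \<beta> F G by (simp add: D_def expand_simps lookup_add)
    fix \<beta> F G e f assume \<beta>: "\<beta> \<in> B"
    show "D \<beta> (F * G) = D \<beta> F * peval G x + peval F x * D \<beta> G"
      if FG: "whomogeneous 3 b (b k * e) F" "whomogeneous 3 b (b k * f) G"
      using indecomposable_derivation[where N = 3 and T = ?T and x = x, OF _ _ xT FG, of "b k" \<beta>] ind[OF \<beta>] vk
      by (simp add: D_def)
  next
    fix \<beta> assume \<beta>: "\<beta> \<in> B"
    have deg: "b k * K \<beta> = wdegree b \<beta>" using ind[OF \<beta>] by (simp add: K_def indecomposable_def)
    show "whomogeneous 3 b (b k * K \<beta>) (E' \<beta>)" unfolding E'_def by (rule whomogeneous_Var_power[OF le(3)])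
    show "peval (E' \<beta>) x \<noteq> 0" using x(4) by (simp add: E'_def)
    show "whomogeneous 3 b (b k * K \<beta>) (E \<beta>)"
      unfolding E_def using ind[OF \<beta>] le deg by (intro whomogeneous_single) auto
    have "mono_val x \<beta> = 0" using ind[OF \<beta>] xT unfolding mono_val_eq_0_iff by (metis all_not_in_conv keys_eq_empty subsetD)
    then show "peval (E \<beta>) x = 0" by (simp add: E_def)
    have exm: "expand ?T x (E \<gamma>) = Poly_Mapping.single \<gamma> 1" if "\<gamma> \<in> B" for \<gamma>
      unfolding E_def using expand_monomial[of \<gamma> ?T k x 0] ind[OF that] idx by simp
    show "D \<beta> (E \<beta>) \<noteq> 0" using exm[OF \<beta>] by (simp add: D_def)
    fix \<gamma> assume \<gamma>: "\<gamma> \<in> B" "\<beta> \<noteq> \<gamma>"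
    show "D \<gamma> (E \<beta>) = 0" using exm[OF \<beta>] \<gamma> by (simp add: D_def lookup_single)
  qed
qed

end

lemma line_singular:
  assumes idx: "{i, j, k, m} = {..3::nat}" "i \<noteq> j" "i \<noteq> k" "i \<noteq> m" "j \<noteq> k" "j \<noteq> m" "k \<noteq> m"
    and b: "\<And>l. l \<le> 3 \<Longrightarrow> b l > 0"
    and cop: "coprime (gcd (b k) (b m)) (b i)" "coprime (gcd (b k) (b m)) (b j)" and g1: "gcd (b k) (b m) > 1"
  shows "coordinate_subspace 3 b {k, m} \<subseteq> singular_locus 3 b"
proof
  fix P assume P: "P \<in> coordinate_subspace 3 b {k, m}"
  have Pw: "P \<in> wproj 3 b" using P by (simp add: coordinate_subspace_def)
  obtain x where x: "x \<in> P" using wproj_nonempty[OF Pw] by blast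
  have x0: "x l = 0" if "l \<notin> {k, m}" for l using P x that by (auto simp: coordinate_subspace_def)
  have xi: "x i = 0" "x j = 0" using x0 idx by auto
  obtain l where "x l \<noteq> 0" using wproj_mem_punctured[OF Pw x] by (auto simp: punctured_space_def)
  then have "l = k \<or> l = m" using x0[of l] by auto
  then have "x k \<noteq> 0 \<or> x m \<noteq> 0" using \<open>x l \<noteq> 0\<close> by auto
  then consider "x k \<noteq> 0" "x m \<noteq> 0" | "x k \<noteq> 0" "x m = 0" | "x m \<noteq> 0" "x k = 0" by blast
  then have "\<not> nonsingular_point 3 b P"
  proof cases
    case 1
    show ?thesis by (rule line_singular_general[OF idx b cop g1 Pw x xi 1])
  next
    case 2
    show ?thesis by (rule line_singular_vertex[OF idx b cop g1 Pw x xi 2])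
  next
    case 3
    have idx': "{i, j, m, k} = {..3}" using idx(1) by auto
    show ?thesis
      by (rule line_singular_vertex[OF idx' idx(2,4,3,6,5) idx(7)[symmetric] b _ _ _ Pw x xi 3])
        (use cop g1 in \<open>simp_all add: gcd.commute\<close>)
  qed
  then show "P \<in> singular_locus 3 b" using Pw by (simp add: singular_locus_def)
qed

section \<open>A divisibility condition forced by well-formedness of a surface\<close>

lemma irreducible_codimD:
  assumes "2 \<le> irreducible_codim T Z"
  shows "\<exists>Y1 Y2. irreducible_closed T Y1 \<and> irreducible_closed T Y2 \<and> Z \<subset> Y1 \<and> Y1 \<subset> Y2"
proof (rule ccontr)
  assume no: "\<not> ?thesis"
  have "irreducible_codim T Z \<le> enat 1"
    unfolding irreducible_codim_def
  proof (rule SUP_least)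
    fix k assume "k \<in> {k. \<exists>c. c 0 = Z \<and> (\<forall>i\<le>k. irreducible_closed T (c i)) \<and> (\<forall>i<k. c i \<subset> c (Suc i))}"
    then obtain c where c: "c 0 = Z" "\<forall>i\<le>k. irreducible_closed T (c i)" "\<forall>i<k. c i \<subset> c (Suc i)" by blast
    have "k \<le> 1"
    proof (rule ccontr)
      assume "\<not> k \<le> 1"
      then have "c 0 \<subset> c (Suc 0)" "c (Suc 0) \<subset> c (Suc (Suc 0))" "irreducible_closed T (c (Suc 0))" "irreducible_closed T (c (Suc (Suc 0)))"
        using c(2,3) by auto
      then show False using no c(1) by blast
    qed
    then show "enat k \<le> enat 1" by simp
  qed
  with assms have "(2::enat) \<le> enat 1" by (rule order_trans)
  then show False by (simp add: numeral_eq_enat)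
qed

text \<open>Otherwise no monomial of degree \<open>d\<close> involves only x_k and x_m, so the line
  \<open>?L\<close> lies in V(F); it also lies in the singular locus. Well-formedness then demands a
  chain of two larger irreducible sets in V(F), which elimination excludes.\<close>

lemma well_formed_surface_gcd:
  assumes F: "wf_qs_hypersurface 3 b d F" and b: "\<And>l. l \<le> 3 \<Longrightarrow> b l > 0"
    and km: "k \<le> 3" "m \<le> 3" "k \<noteq> m"
  shows "gcd (b k) (b m) dvd d"
proof (rule ccontr)
  assume nd: "\<not> gcd (b k) (b m) dvd d"
  let ?g = "gcd (b k) (b m)"
  have hom: "whomogeneous 3 b d F" and irr: "Factorial_Ring.irreducible F" and wf: "well_formed_space 3 b"
    and codim: "2 \<le> codim (zariski_on 3 b (zero_locus 3 b F)) (zero_locus 3 b F \<inter> singular_locus 3 b)"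
    using F by (auto simp: wf_qs_hypersurface_def hypersurface_eq_def well_formed_hypersurface_def)
  have g1: "?g > 1"
  proof -
    have "?g \<noteq> 1" using nd by auto
    moreover have "?g > 0" using b[OF km(1)] by simp
    ultimately show ?thesis by linarith
  qed
  have "card ({..3} - {k, m}) = 2"
    using km by (subst card_Diff_subset) auto
  then obtain i j where ij: "{..3} - {k, m} = {i, j}" "i \<noteq> j" by (auto simp: card_2_iff)
  have idx: "{i, j, k, m} = {..3}" "i \<noteq> k" "i \<noteq> m" "j \<noteq> k" "j \<noteq> m" "k \<noteq> m"
    using ij km by auto
  \<comment> \<open>A common factor of b_k, b_m and a third weight would divide the gcd of three of
    the four weights.\<close>
  have cop: "coprime ?g (b s)" if s: "{..3} = {s, s', k, m}" "s' \<notin> {s, k, m}" for s s'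
  proof (rule coprimeI)
    fix c assume c: "c dvd ?g" "c dvd b s"
    have "s' \<le> 3" using s(1) by auto
    have "{..3} - {s'} = {s, k, m}" using s by auto
    then have "c dvd Gcd (b ` ({..3} - {s'}))" using c by (intro Gcd_greatest) auto
    then show "is_unit c" using wf \<open>s' \<le> 3\<close> by (auto simp: well_formed_space_def)
  qed
  have copi: "coprime ?g (b i)" using idx ij(2) by (intro cop[of i j]) auto
  have copj: "coprime ?g (b j)" using idx ij(2) by (intro cop[of j i]) auto
  let ?L = "coordinate_subspace 3 b {k, m}"
  have Lirr: "irreducible_closed (zariski 3 b) ?L" using km by (intro coordinate_subspace_irreducible) auto
  have LX: "?L \<subseteq> zero_locus 3 b F"
  proof
    fix P assume P: "P \<in> ?L"
    have "peval F x = 0" if x: "x \<in> P" for x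
    proof -
      have "mono_val x \<mu> = 0" if \<mu>: "\<mu> \<in> Poly_Mapping.keys F" for \<mu>
      proof (rule ccontr)
        assume "mono_val x \<mu> \<noteq> 0"
        then have "Poly_Mapping.keys \<mu> \<subseteq> {k, m}" using P x by (auto simp: mono_val_eq_0_iff coordinate_subspace_def)
        then have "wdegree b \<mu> = b k * Poly_Mapping.lookup \<mu> k + b m * Poly_Mapping.lookup \<mu> m"
          using wdegree_superset[of "{k, m}" \<mu> b] km(3) by simp
        then have "?g dvd d" using hom \<mu> by (auto simp: whomogeneous_iff)
        then show False using nd by simp
      qed
      then show ?thesis by (simp add: peval_mono_val)
    qed
    then show "P \<in> zero_locus 3 b F" using P by (auto simp: zero_locus_def coordinate_subspace_def)
  qed
  have LS: "?L \<subseteq> singular_locus 3 b"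
    by (rule line_singular[OF idx(1) ij(2) idx(2-6) b copi copj g1])
  note sub = irreducible_closed_subtopology[OF closedin_zero_locus[OF hom]]
  have "2 \<le> irreducible_codim (zariski_on 3 b (zero_locus 3 b F)) ?L"
    using codim unfolding codim_def le_INF_iff using Lirr LX LS by (auto simp: sub)
  then obtain Y1 Y2 where Y: "irreducible_closed (zariski 3 b) Y1" "?L \<subset> Y1" "Y1 \<subset> Y2" "Y2 \<subseteq> zero_locus 3 b F"
    using irreducible_codimD sub by metis
  \<comment> \<open>\<open>Y1\<close> is larger than the line, so it leaves x_i = 0 or x_j = 0; in
    either case the other of the two variables is the one eliminated.\<close>
  obtain P x where P: "P \<in> Y1" "x \<in> P" "P \<in> wproj 3 b" "x i \<noteq> 0 \<or> x j \<noteq> 0"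
  proof -
    obtain P where P: "P \<in> Y1" "P \<notin> ?L" using Y(2) by blast
    then have Pw: "P \<in> wproj 3 b" using Y zero_locus_subset by blast
    then obtain x l where x: "x \<in> P" "l \<notin> {k, m}" "x l \<noteq> 0" using P(2) by (auto simp: coordinate_subspace_def)
    have "l \<le> 3" using wproj_mem_punctured[OF Pw x(1)] x(3) by (auto simp: punctured_space_def not_less[symmetric])
    then have "l = i \<or> l = j" using x(2) idx(1) by blast
    then show thesis using that[OF P(1) x(1) Pw] x(3) by blast
  qed
  from P(4) show False
  proof
    assume "x i \<noteq> 0"
    then have "\<not> Y1 \<subseteq> zero_locus 3 b (Var i)" using P by (auto simp: zero_locus_def)
    then show False using no_curve_above_line[OF idx(1) ij(2) idx(2-6) hom irr Y(1) _ Y(3,4)] Y(2) by blast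
  next
    assume "x j \<noteq> 0"
    then have "\<not> Y1 \<subseteq> zero_locus 3 b (Var j)" using P by (auto simp: zero_locus_def)
    moreover have "{j, i, k, m} = {..3}" using idx(1) by auto
    ultimately show False
      using no_curve_above_line[of j i k m, OF _ _ idx(4,5,2,3,6) hom irr Y(1) _ Y(3,4)] ij(2) Y(2) by blast
  qed
qed

section \<open>Diagonal automorphisms\<close>

definition diag_act :: "(nat \<Rightarrow> complex) \<Rightarrow> wpoint \<Rightarrow> wpoint" where
  "diag_act u P = (\<lambda>x i. u i * x i) ` P"

lemma diag_act_orbit:
  assumes u: "\<And>i. u i \<noteq> 0" and P: "P \<in> wproj N a" "x \<in> P"
  shows "diag_act u P = orbit_of N a (\<lambda>i. u i * x i)"
proof -
  let ?y = "\<lambda>i. u i * x i"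
  have y: "?y \<in> punctured_space N"
    using wproj_mem_punctured[OF P] u by (auto simp: punctured_space_def)
  note o = orbit_of_in_wproj[OF y, of a] orbit_of_mem[OF y, of a]
  show ?thesis
  proof
    show "diag_act u P \<subseteq> orbit_of N a ?y"
    proof
      fix z assume "z \<in> diag_act u P"
      then obtain w where w: "w \<in> P" "z = (\<lambda>i. u i * w i)" by (auto simp: diag_act_def)
      obtain t where t: "t \<noteq> 0" "\<forall>i\<le>N. w i = t ^ a i * x i" using wproj_same_point[OF P w(1)] by blast
      show "z \<in> orbit_of N a ?y"
        by (rule orbit_of_memI[OF o t(1)])
          (use t wproj_mem_punctured[OF P(1) w(1)] in \<open>auto simp: w(2) punctured_space_def\<close>)
    qed
    show "orbit_of N a ?y \<subseteq> diag_act u P"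
    proof
      fix z assume z: "z \<in> orbit_of N a ?y"
      obtain t where t: "t \<noteq> 0" "\<forall>i\<le>N. z i = t ^ a i * ?y i" using wproj_same_point[OF o z] by blast
      have "(\<lambda>i. z i / u i) \<in> P"
        by (rule orbit_of_memI[OF P t(1)])
          (use t u wproj_mem_punctured[OF o(1) z] in \<open>auto simp: punctured_space_def\<close>)
      moreover have "z = (\<lambda>i. u i * (z i / u i))" using u by auto
      ultimately show "z \<in> diag_act u P" unfolding diag_act_def by (intro image_eqI[where x = "\<lambda>i. z i / u i"])
    qed
  qed
qed

lemma diag_act_wproj: "(\<And>i. u i \<noteq> 0) \<Longrightarrow> P \<in> wproj N a \<Longrightarrow> diag_act u P \<in> wproj N a"
proof -
  assume u: "\<And>i. u i \<noteq> 0" and P: "P \<in> wproj N a"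
  obtain x where x: "x \<in> P" using wproj_nonempty[OF P] by blast
  have "(\<lambda>i. u i * x i) \<in> punctured_space N"
    using wproj_mem_punctured[OF P x] u by (auto simp: punctured_space_def)
  then show ?thesis using diag_act_orbit[OF u P x] orbit_of_in_wproj by simp
qed

lemma diag_act_comp: "diag_act u (diag_act v P) = diag_act (\<lambda>i. u i * v i) P"
  by (simp add: diag_act_def image_image mult.assoc)

lemma diag_act_1 [simp]: "diag_act (\<lambda>_. 1) P = P"
  by (simp add: diag_act_def)

lemma peval_diag_act:
  "(\<forall>y\<in>diag_act u P. Q (peval f y)) \<longleftrightarrow> (\<forall>x\<in>P. Q (peval (twist u f) x))"
  by (simp add: diag_act_def peval_twist)

lemma diag_act_basic_open:
  "(\<And>i. u i \<noteq> 0) \<Longrightarrow> P \<in> wproj N a \<Longrightarrow> diag_act u P \<in> basic_open N a f \<longleftrightarrow> P \<in> basic_open N a (twist u f)"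
  using diag_act_wproj[of u P N a] peval_diag_act[of u P "\<lambda>z. z \<noteq> 0" f] by (auto simp: basic_open_def)

lemma diag_act_zero_locus:
  "(\<And>i. u i \<noteq> 0) \<Longrightarrow> P \<in> wproj N a \<Longrightarrow> diag_act u P \<in> zero_locus N a f \<longleftrightarrow> P \<in> zero_locus N a (twist u f)"
  using diag_act_wproj[of u P N a] peval_diag_act[of u P "\<lambda>z. z = 0" f] by (auto simp: zero_locus_def)

lemma openin_diag_act:
  assumes u: "\<And>i. u i \<noteq> 0" and U: "openin (zariski N a) U"
  shows "openin (zariski N a) {P \<in> wproj N a. diag_act u P \<in> U}"
  unfolding openin_zariski_iff
proof (intro conjI ballI)
  fix P assume P: "P \<in> {P \<in> wproj N a. diag_act u P \<in> U}"
  then obtain k f where f: "whomogeneous N a k f" "diag_act u P \<in> basic_open N a f" "basic_open N a f \<subseteq> U"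
    using U unfolding openin_zariski_iff by blast
  have "P \<in> basic_open N a (twist u f)" using P f(2) diag_act_basic_open[of u, OF u] by blast
  moreover have "basic_open N a (twist u f) \<subseteq> {P \<in> wproj N a. diag_act u P \<in> U}"
    using f(3) diag_act_basic_open[of u _ N a f, OF u] basic_open_subset[of N a "twist u f"] by blast
  ultimately show "\<exists>k f. whomogeneous N a k f \<and> P \<in> basic_open N a f \<and> basic_open N a f \<subseteq> {P \<in> wproj N a. diag_act u P \<in> U}"
    using whomogeneous_twist[OF f(1), of u] by blast
qed auto

text \<open>Pulling back a local fraction twists numerator and denominator, which keeps them
  homogeneous of equal degree.\<close>

lemma var_morphism_diag_act:
  assumes u: "\<And>i. u i \<noteq> 0" and X: "X \<subseteq> wproj N a" "\<And>P. P \<in> X \<Longrightarrow> diag_act u P \<in> X"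
  shows "var_morphism N a X X (diag_act u)"
proof -
  have pre: "openin (zariski_on N a X) {P \<in> X. diag_act u P \<in> V}" if V: "openin (zariski_on N a X) V" for V
  proof -
    obtain U where U: "openin (zariski N a) U" "V = U \<inter> X" using V by (auto simp: openin_subtopology)
    have "{P \<in> X. diag_act u P \<in> V} = {P \<in> wproj N a. diag_act u P \<in> U} \<inter> X" using U(2) X by auto
    then show ?thesis using openin_diag_act[of u, OF u U(1)] by (auto simp: openin_subtopology)
  qed
  have top: "topspace (zariski_on N a X) = X" using X(1) by (auto simp: topspace_zariski)
  show ?thesis unfolding var_morphism_def
  proof (intro conjI allI impI)
    show "diag_act u \<in> X \<rightarrow> X" using X(2) by blast
    show "continuous_map (zariski_on N a X) (zariski_on N a X) (diag_act u)"
      unfolding continuous_map_def top using X(2) pre by blast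
    fix V f assume reg: "regular_on N a X V f"
    show "regular_on N a X {P \<in> X. diag_act u P \<in> V} (f \<circ> diag_act u)"
      unfolding regular_on_def
    proof (intro conjI ballI)
      show "openin (zariski_on N a X) {P \<in> X. diag_act u P \<in> V}" using reg by (intro pre) (simp add: regular_on_def)
      fix P assume P: "P \<in> {P \<in> X. diag_act u P \<in> V}"
      then obtain W k g h where W: "openin (zariski_on N a X) W" "diag_act u P \<in> W" "W \<subseteq> V"
        "whomogeneous N a k g" "whomogeneous N a k h"
        "\<forall>Q\<in>W. \<forall>x\<in>Q. peval h x \<noteq> 0 \<and> f Q = peval g x / peval h x"
        using reg unfolding regular_on_def by blast
      have "peval (twist u h) x \<noteq> 0 \<and> (f \<circ> diag_act u) Q = peval (twist u g) x / peval (twist u h) x"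
        if "Q \<in> {P \<in> X. diag_act u P \<in> W}" "x \<in> Q" for Q x
      proof -
        have "(\<lambda>i. u i * x i) \<in> diag_act u Q" using that(2) by (auto simp: diag_act_def)
        moreover have "diag_act u Q \<in> W" using that(1) by simp
        ultimately have "peval h (\<lambda>i. u i * x i) \<noteq> 0 \<and> f (diag_act u Q) = peval g (\<lambda>i. u i * x i) / peval h (\<lambda>i. u i * x i)"
          using W(6) by blast
        then show ?thesis by (simp add: peval_twist)
      qed
      then show "\<exists>W k g h. openin (zariski_on N a X) W \<and> P \<in> W \<and> W \<subseteq> {P \<in> X. diag_act u P \<in> V} \<and>
         whomogeneous N a k g \<and> whomogeneous N a k h \<and>
         (\<forall>Q\<in>W. \<forall>x\<in>Q. peval h x \<noteq> 0 \<and> (f \<circ> diag_act u) Q = peval g x / peval h x)"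
        using pre[OF W(1)] whomogeneous_twist[OF W(4), of u] whomogeneous_twist[OF W(5), of u] P W(2,3)
        by (intro exI[of _ "{P \<in> X. diag_act u P \<in> W}"] exI[of _ k] exI[of _ "twist u g"] exI[of _ "twist u h"]) auto
    qed
  qed
qed

lemma bij_betw_diag_act:
  assumes u: "\<And>i. u i \<noteq> 0" and X: "\<And>P. P \<in> X \<Longrightarrow> diag_act u P \<in> X" "\<And>P. P \<in> X \<Longrightarrow> diag_act (\<lambda>i. inverse (u i)) P \<in> X"
  shows "bij_betw (diag_act u) X X"
proof -
  have i: "diag_act (\<lambda>i. inverse (u i)) (diag_act u P) = P" "diag_act u (diag_act (\<lambda>i. inverse (u i)) P) = P" for P
    using u by (simp_all add: diag_act_comp)
  show "bij_betw (diag_act u) X X"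
    by (rule bij_betw_byWitness[where f' = "diag_act (\<lambda>i. inverse (u i))"]) (use X i in auto)
qed

lemma diag_act_in_Aut:
  assumes u: "\<And>i. u i \<noteq> 0" and X: "X \<subseteq> wproj N a"
    "\<And>P. P \<in> X \<Longrightarrow> diag_act u P \<in> X" "\<And>P. P \<in> X \<Longrightarrow> diag_act (\<lambda>i. inverse (u i)) P \<in> X"
  shows "restrict (diag_act u) X \<in> carrier (var_Aut N a X)"
proof -
  have b: "bij_betw (diag_act u) X X" by (rule bij_betw_diag_act[OF u X(2,3)])
  have B: "restrict (diag_act u) X \<in> Bij X"
    using b by (auto simp: Bij_def bij_betw_cong[of X "restrict (diag_act u) X" "diag_act u"])
  have inv: "inv_into X (restrict (diag_act u) X) P = diag_act (\<lambda>i. inverse (u i)) P" if P: "P \<in> X" for P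
  proof -
    have "restrict (diag_act u) X (diag_act (\<lambda>i. inverse (u i)) P) = P"
      using X(3)[OF P] u by (simp add: diag_act_comp)
    then show ?thesis using B X(3)[OF P] by (intro inv_into_f_eq) (auto simp: Bij_def bij_betw_def)
  qed
  have m1: "var_morphism N a X X (diag_act u)" by (rule var_morphism_diag_act[OF u X(1,2)])
  have m2: "var_morphism N a X X (diag_act (\<lambda>i. inverse (u i)))"
    by (rule var_morphism_diag_act) (use u X in auto)
  have "var_morphism N a X X (restrict (diag_act u) X)" by (rule var_morphism_cong[OF m1]) simp
  moreover have "var_morphism N a X X (inv_into X (restrict (diag_act u) X))"
    by (rule var_morphism_cong[OF m2]) (simp add: inv)
  ultimately show ?thesis using B by (simp add: var_Aut_def)
qed

text \<open>Stability of \<open>X\<close> is assumed for all diagonal maps fixing the monomials of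
  \<open>F\<close>, so that it applies at once to the powers of \<open>u\<close> and their
  inverses.\<close>

lemma diag_act_pow:
  assumes u: "\<And>i. u i \<noteq> 0" and X: "X \<subseteq> wproj N a"
    "\<And>v P. (\<And>i. v i \<noteq> 0) \<Longrightarrow> (\<And>m. m \<in> Poly_Mapping.keys F \<Longrightarrow> mono_val v m = 1) \<Longrightarrow> P \<in> X \<Longrightarrow> diag_act v P \<in> X"
    and inv: "\<And>m. m \<in> Poly_Mapping.keys F \<Longrightarrow> mono_val u m = 1"
  shows "restrict (diag_act u) X [^]\<^bsub>var_Aut N a X\<^esub> (n::nat) = restrict (diag_act (\<lambda>i. u i ^ n)) X"
proof (induction n)
  case 0
  interpret group "var_Aut N a X" by (rule group_var_Aut)
  show ?case by (simp add: var_Aut_def BijGroup_def restrict_def)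
next
  case (Suc n)
  interpret group "var_Aut N a X" by (rule group_var_Aut)
  have mv_pow: "mono_val (\<lambda>i. u i ^ k) m = mono_val u m ^ k" for k m
    by (induction k) (simp_all add: mono_val_times mono_val_def[of "\<lambda>_. 1"])
  have mv_inv_pow: "mono_val (\<lambda>i. inverse (u i ^ k)) m = inverse (mono_val u m) ^ k" for k m
    by (simp add: mono_val_def prod_inversef[symmetric] power_inverse prod_power_distrib power_mult[symmetric] mult.commute)
  have pres: "diag_act (\<lambda>i. u i ^ k) P \<in> X" "diag_act (\<lambda>i. inverse (u i ^ k)) P \<in> X" if "P \<in> X" for k P
    by (rule X(2)[OF _ _ that]; simp add: u mv_pow inv mv_inv_pow)+
  have B: "restrict (diag_act (\<lambda>i. u i ^ k)) X \<in> Bij X" for k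
    using diag_act_in_Aut[of "\<lambda>i. u i ^ k" X N a] u X(1) pres by (simp add: var_Aut_def)
  have "restrict (diag_act u) X [^]\<^bsub>var_Aut N a X\<^esub> Suc n =
      restrict (diag_act (\<lambda>i. u i ^ n)) X \<otimes>\<^bsub>var_Aut N a X\<^esub> restrict (diag_act u) X"
    unfolding nat_pow_Suc Suc ..
  also have "\<dots> = compose X (restrict (diag_act (\<lambda>i. u i ^ n)) X) (restrict (diag_act u) X)"
    using B[of n] B[of 1] by (simp add: var_Aut_def BijGroup_def)
  also have "\<dots> = restrict (diag_act (\<lambda>i. u i ^ Suc n)) X"
    using pres[of _ 1] by (auto simp: compose_def fun_eq_iff diag_act_comp mult.commute)
  finally show ?case .
qed

lemma power_gcd_eq_1:
  assumes "t ^ m = 1" "t ^ n = (1::complex)"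
  shows "t ^ gcd m n = 1"
proof (cases "m = 0")
  case False
  then obtain x y where "m * x = n * y + gcd m n" using bezout_nat by blast
  then have "(t ^ m) ^ x = (t ^ n) ^ y * t ^ gcd m n" by (metis power_add power_mult)
  then show ?thesis using assms by simp
qed (use assms in simp)

lemma power_Gcd_eq_1:
  assumes "finite S" "\<And>i. i \<in> S \<Longrightarrow> t ^ a i = (1::complex)"
  shows "t ^ Gcd (a ` S) = 1"
  using assms by (induction S rule: finite_induct) (auto intro: power_gcd_eq_1)

text \<open>A scalar \<open>t\<close> realizing the trivial action on a point with nonzero coordinates satisfies
  \<open>t ^ p = 1\<close> and \<open>t ^ d = 1\<close>, hence \<open>t = 1\<close>.\<close>

lemma diagonal_automorphism_order:
  fixes u :: "nat \<Rightarrow> complex"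
  assumes F: "whomogeneous N a d F" "F \<noteq> 0" and p: "prime p" "r > 0" "\<not> p dvd d"
    and a: "Gcd (a ` {..N}) = 1"
    and u: "\<And>i. u i ^ (p ^ r) = 1" "\<And>m. m \<in> Poly_Mapping.keys F \<Longrightarrow> mono_val u m = 1"
      "i0 \<le> N" "u i0 ^ (p ^ (r - 1)) \<noteq> 1"
    and x: "\<forall>i. x i \<noteq> 0" "peval F x = 0"
  shows "\<exists>\<phi>\<in>carrier (var_Aut N a (zero_locus N a F)). group.ord (var_Aut N a (zero_locus N a F)) \<phi> = p ^ r"
proof -
  let ?X = "zero_locus N a F" and ?q = "p ^ (r - 1)"
  let ?\<phi> = "restrict (diag_act u) ?X"
  have p0: "p > 0" using p(1) prime_gt_0_nat by blast
  have u0: "u i \<noteq> 0" for i using u(1)[of i] p0 by (metis power_eq_0_iff zero_neq_one zero_power zero_less_power)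
  have X: "?X \<subseteq> wproj N a" by (rule zero_locus_subset)
  have pres: "diag_act v P \<in> ?X" if v: "\<And>i. v i \<noteq> 0" "\<And>m. m \<in> Poly_Mapping.keys F \<Longrightarrow> mono_val v m = 1" and P: "P \<in> ?X" for v P
  proof -
    have "peval (twist v F) y = peval F y" for y
      unfolding peval_twist peval_mono_val[of F] mono_val_times using v(2) by (intro sum.cong) auto
    then show ?thesis using P diag_act_zero_locus[of v P N a F, OF v(1)] by (auto simp: zero_locus_def)
  qed
  have mv_inv: "mono_val (\<lambda>i. inverse (u i)) m = inverse (mono_val u m)" for m
    by (simp add: mono_val_def prod_inversef[symmetric] power_inverse)
  have \<phi>: "?\<phi> \<in> carrier (var_Aut N a ?X)"
    by (rule diag_act_in_Aut[OF u0 X]) (auto intro!: pres simp: u0 u(2) mv_inv)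
  interpret G: group "var_Aut N a ?X" by (rule group_var_Aut)
  have pow: "?\<phi> [^]\<^bsub>var_Aut N a ?X\<^esub> n = restrict (diag_act (\<lambda>i. u i ^ n)) ?X" for n :: nat
    by (rule diag_act_pow[OF u0 X pres u(2)])
  have one: "\<one>\<^bsub>var_Aut N a ?X\<^esub> = restrict (\<lambda>P. P) ?X" by (simp add: var_Aut_def BijGroup_def)
  have "?\<phi> [^]\<^bsub>var_Aut N a ?X\<^esub> (p ^ r) = \<one>\<^bsub>var_Aut N a ?X\<^esub>" unfolding pow one u(1) by (intro ext) simp
  then have "G.ord ?\<phi> dvd p ^ r" using G.pow_eq_id[OF \<phi>] by blast
  \<comment> \<open>The order is a power of \<open>p\<close> at most p^r, so it suffices that it
    does not divide p^(r - 1).\<close>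
  then obtain j where j: "j \<le> r" "G.ord ?\<phi> = p ^ j" using divides_primepow_nat[OF p(1)] by blast
  have "\<not> G.ord ?\<phi> dvd ?q"
  proof
    assume "G.ord ?\<phi> dvd ?q"
    then have triv: "restrict (diag_act (\<lambda>i. u i ^ ?q)) ?X = restrict (\<lambda>P. P) ?X"
      using G.pow_eq_id[OF \<phi>] pow one by metis
    let ?x = "\<lambda>i. if i \<le> N then x i else 0"
    have xp: "?x \<in> punctured_space N" using x(1) by (auto simp: punctured_space_def intro!: exI[of _ 0])
    let ?P = "orbit_of N a ?x"
    have "peval F ?x = 0" using whomogeneous_peval_cong[OF F(1), of ?x x] x(2) by simp
    then have PX: "?P \<in> ?X" using orbit_zero_locus_iff[OF F(1) xp] by simp
    have "diag_act (\<lambda>i. u i ^ ?q) ?P = ?P" using fun_cong[OF triv, of ?P] PX by simp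
    moreover have "(\<lambda>i. u i ^ ?q * ?x i) \<in> diag_act (\<lambda>i. u i ^ ?q) ?P"
      unfolding diag_act_def by (rule imageI) (rule orbit_of_mem[OF xp])
    ultimately have "(\<lambda>i. u i ^ ?q * ?x i) \<in> ?P" by simp
    then obtain t where t: "t \<noteq> 0" "\<forall>i\<le>N. u i ^ ?q * ?x i = t ^ a i * ?x i"
    proof -
      have "\<exists>t. t \<noteq> 0 \<and> (\<forall>i\<le>N. u i ^ ?q * ?x i = t ^ a i * ?x i)"
        by (rule wproj_same_point[OF orbit_of_in_wproj[OF xp, of a] orbit_of_mem[OF xp]]) fact
      then show thesis using that by blast
    qed
    have ut: "u i ^ ?q = t ^ a i" if "i \<le> N" for i using t(2) that x(1) by simp
    have qp: "p ^ r = ?q * p" using p(2) by (cases r) simp_all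
    have "(t ^ p) ^ a i = 1" if "i \<le> N" for i
    proof -
      have "(t ^ p) ^ a i = (t ^ a i) ^ p" by (metis mult.commute power_mult)
      also have "\<dots> = u i ^ (p ^ r)" unfolding ut[OF that, symmetric] qp by (simp add: power_mult)
      finally show ?thesis using u(1) by simp
    qed
    then have tp: "t ^ p = 1" using power_Gcd_eq_1[of "{..N}" "t ^ p" a] a by simp
    obtain m where m: "m \<in> Poly_Mapping.keys F" using F(2) by (metis equals0I keys_eq_empty)
    have "t ^ d = mono_val (\<lambda>i. t ^ a i) m" using F(1) m by (simp add: mono_val_scale whomogeneous_iff)
    also have "\<dots> = mono_val (\<lambda>i. u i ^ ?q) m"
      using F(1) m ut by (intro mono_val_cong) (auto simp: whomogeneous_iff subset_iff)
    also have "\<dots> = mono_val u m ^ ?q"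
      by (simp add: mono_val_def prod_power_distrib power_mult[symmetric] mult.commute)
    finally have td: "t ^ d = 1" using u(2)[OF m] by simp
    have "gcd p d = 1" using p(1,3) by (metis coprime_iff_gcd_eq_1 prime_imp_coprime_nat)
    then have "t = 1" using power_gcd_eq_1[OF tp td] by simp
    then show False using ut[OF u(3)] u(4) by simp
  qed
  then have "\<not> p ^ j dvd p ^ (r - 1)" using j by simp
  then have "\<not> j \<le> r - 1" by (metis le_imp_power_dvd)
  then have "j = r" using j(1) by simp
  then show ?thesis using \<phi> j(2) by blast
qed

section \<open>Monomials at the vertices\<close>

lemma partial_deriv_nonzero_key:
  assumes "peval (partial_deriv l F) x \<noteq> 0"
  shows "\<exists>m\<in>Poly_Mapping.keys F. Poly_Mapping.lookup m l \<noteq> 0 \<and> mono_val x (m - Poly_Mapping.single l 1) \<noteq> 0"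
proof (rule ccontr)
  assume "\<not> ?thesis"
  then have "peval (partial_deriv l F) x = 0"
    unfolding partial_deriv_def peval_sum by (intro sum.neutral) auto
  with assms show False by simp
qed

text \<open>At the i-th vertex either \<open>F\<close> or one of its partial derivatives is nonzero,
  and only a monomial x_l x_i^s can be responsible; the case l = i covers the pure powers.\<close>

lemma quasi_smooth_vertex:
  assumes F: "whomogeneous N a d F" "quasi_smooth N F" and i: "i \<le> N" and d: "d > 0"
  shows "\<exists>l\<le>N. \<exists>s. Poly_Mapping.single l 1 + Poly_Mapping.single i s \<in> Poly_Mapping.keys F"
proof -
  define e where "e = (\<lambda>l. if l = i then 1 else 0 :: complex)"
  have ep: "e \<in> punctured_space N" using i by (auto simp: punctured_space_def e_def)
  have keys: "m = Poly_Mapping.single i (Poly_Mapping.lookup m i)" if "mono_val e m \<noteq> 0" for m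
  proof (rule poly_mapping_eqI)
    fix s
    have "\<forall>s\<in>Poly_Mapping.keys m. s = i" using that unfolding mono_val_eq_0_iff e_def by metis
    then show "Poly_Mapping.lookup m s = Poly_Mapping.lookup (Poly_Mapping.single i (Poly_Mapping.lookup m i)) s"
      by (auto simp: lookup_single when_def in_keys_iff)
  qed
  have *: ?thesis if m: "m \<in> Poly_Mapping.keys F" "Poly_Mapping.lookup m l \<noteq> 0" "mono_val e (m - Poly_Mapping.single l 1) \<noteq> 0" for m l
  proof -
    have "m = Poly_Mapping.single l 1 + (m - Poly_Mapping.single l 1)"
      using m(2) by (intro poly_mapping_eqI) (auto simp: lookup_add lookup_minus lookup_single when_def)
    then have "m = Poly_Mapping.single l 1 + Poly_Mapping.single i (Poly_Mapping.lookup (m - Poly_Mapping.single l 1) i)"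
      using keys[OF m(3)] by metis
    moreover have "l \<le> N" using F(1) m(1,2) by (auto simp: whomogeneous_iff in_keys_iff subset_iff)
    ultimately show ?thesis using m(1) by metis
  qed
  show ?thesis
  proof (cases "peval F e = 0")
    case True
    then obtain l where "peval (partial_deriv l F) e \<noteq> 0" using F(2) ep by (auto simp: quasi_smooth_def)
    then show ?thesis using partial_deriv_nonzero_key * by blast
  next
    case False
    then obtain m where m: "m \<in> Poly_Mapping.keys F" "mono_val e m \<noteq> 0"
      unfolding peval_mono_val by (metis (no_types, lifting) mult_zero_right sum.neutral)
    show ?thesis
    proof (cases "Poly_Mapping.lookup m i = 0")
      case True
      then have "m = 0" using keys[OF m(2)] by simp
      then show ?thesis using F(1) m(1) d by (auto simp: whomogeneous_iff)
    next
      case False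
      have "mono_val e (m - Poly_Mapping.single i 1) \<noteq> 0"
        using m(2) by (auto simp: mono_val_eq_0_iff in_keys_iff lookup_minus lookup_single when_def split: if_splits)
      then show ?thesis using * m(1) False by blast
    qed
  qed
qed

section \<open>Cyclic polynomials\<close>

lemma partial_deriv_two_var:
  assumes "\<alpha> \<noteq> \<beta>"
  shows "peval (partial_deriv \<gamma> (Poly_Mapping.single (Poly_Mapping.single \<alpha> e + Poly_Mapping.single \<beta> 1) 1)) x =
    (if \<gamma> = \<alpha> then of_nat e * x \<alpha> ^ (e - 1) * x \<beta> else if \<gamma> = \<beta> then x \<alpha> ^ e else 0)"
proof (rule peval_partial_derivI)
  have eq: "peval (Poly_Mapping.single (Poly_Mapping.single \<alpha> e + Poly_Mapping.single \<beta> 1) 1) y = y \<alpha> ^ e * y \<beta>" for y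
    by (simp add: mono_val_add)
  consider "\<gamma> = \<alpha>" | "\<gamma> = \<beta>" | "\<gamma> \<noteq> \<alpha>" "\<gamma> \<noteq> \<beta>" by blast
  then show "((\<lambda>t. peval (Poly_Mapping.single (Poly_Mapping.single \<alpha> e + Poly_Mapping.single \<beta> 1) 1) (x(\<gamma> := t)))
    has_field_derivative (if \<gamma> = \<alpha> then of_nat e * x \<alpha> ^ (e - 1) * x \<beta> else if \<gamma> = \<beta> then x \<alpha> ^ e else 0)) (at (x \<gamma>))"
    unfolding eq using assms by cases (auto intro!: derivative_eq_intros)
qed

text \<open>The critical points of \<open>\<Sum>t<L. Y_t ^ M_t Y_{t+1}\<close> (cyclic indices): the products
  \<open>Y_t ^ M_t Y_{t+1}\<close> vanish by going once around the cycle, and a nonzero \<open>Y_s\<close> then forces zero and nonzero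
  values to alternate with all exponents equal to one.\<close>

lemma cyclic_no_critical_point:
  fixes Y :: "nat \<Rightarrow> complex" and M B :: "nat \<Rightarrow> nat"
  assumes L: "L > 0" and per: "\<And>k. Y (k + L) = Y k" "\<And>k. M (k + L) = M k" "\<And>k. B (k + L) = B k"
    and pos: "\<And>k. M k > 0" "\<And>k. B k > 0" and deg: "\<And>k. M k * B k + B (Suc k) = d"
    and crit: "\<And>k. of_nat (M (Suc k)) * Y (Suc k) ^ (M (Suc k) - 1) * Y (Suc (Suc k)) + Y k ^ M k = 0"
    and good: "\<not> (even L \<and> (\<forall>k. M k = 1))"
  shows "Y k = 0"
proof (rule ccontr)
  assume Yk: "Y k \<noteq> 0"
  have per_mult: "Y (j + c * L) = Y j \<and> M (j + c * L) = M j \<and> B (j + c * L) = B j" for j c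
  proof (induction c)
    case (Suc c)
    have e: "j + Suc c * L = (j + c * L) + L" by simp
    show ?case unfolding e per by (rule Suc)
  qed simp
  \<comment> \<open>Multiplying the k-th critical equation by \<open>Y (Suc k)\<close> gives T_k = -
    M_(k+1) T_(k+1).\<close>
  define T where "T j = Y j ^ M j * Y (Suc j)" for j
  have Tstep: "T j = - of_nat (M (Suc j)) * T (Suc j)" for j
  proof -
    have "Y (Suc j) ^ M (Suc j) = Y (Suc j) * Y (Suc j) ^ (M (Suc j) - 1)"
      using pos(1)[of "Suc j"] by (metis Suc_pred' power_Suc)
    then have "T j + of_nat (M (Suc j)) * T (Suc j)
      = (of_nat (M (Suc j)) * Y (Suc j) ^ (M (Suc j) - 1) * Y (Suc (Suc j)) + Y j ^ M j) * Y (Suc j)"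
      by (simp add: T_def algebra_simps)
    then show ?thesis using crit[of j] by (simp add: eq_neg_iff_add_eq_0)
  qed
  have Titer: "T j = (\<Prod>i<c. - of_nat (M (Suc (j + i)))) * T (j + c)" for j c
    by (induction c) (simp_all add: Tstep[of "j + _"] mult_ac)
  have step: "Y (Suc j) = 0 \<and> M (Suc j) = 1 \<and> Y (Suc (Suc j)) \<noteq> 0" if "Y j \<noteq> 0" "\<forall>i. T i = 0" for j
  proof -
    have Y1: "Y (Suc j) = 0" using that by (auto simp: T_def)
    have "of_nat (M (Suc j)) * Y (Suc j) ^ (M (Suc j) - 1) * Y (Suc (Suc j)) \<noteq> 0"
    proof
      assume "of_nat (M (Suc j)) * Y (Suc j) ^ (M (Suc j) - 1) * Y (Suc (Suc j)) = 0"
      then have "Y j ^ M j = 0" using crit[of j] by (simp only: add_0)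
      then show False using that(1) by simp
    qed
    then have "0 ^ (M (Suc j) - 1) \<noteq> (0::complex)" "Y (Suc (Suc j)) \<noteq> 0" using Y1 by auto
    then have "M (Suc j) - 1 = 0" "Y (Suc (Suc j)) \<noteq> 0" using zero_power by blast+
    then show ?thesis using Y1 pos(1)[of "Suc j"] by simp
  qed
  \<comment> \<open>Around the cycle a nonzero T_j is multiplied by (-1)^L times the product of all
    exponents. This must be 1, so L is even and all exponents are 1, which is excluded.\<close>
  have T0: "\<forall>i. T i = 0"
  proof (rule ccontr)
    assume "\<not> ?thesis"
    then obtain j where j: "T j \<noteq> 0" by blast
    have TL: "T (j + L) = T j" using per[of j] per[of "Suc j"] by (simp add: T_def)
    then have one: "(\<Prod>i<L. - of_nat (M (Suc (j + i)))) = (1::complex)" using Titer[of j L] j by simp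
    have "(\<Prod>i<L. - of_nat (M (Suc (j + i)))) = (- 1) ^ L * (of_nat (\<Prod>i<L. M (Suc (j + i))) :: complex)"
      by (simp add: prod_uminus)
    then have eq: "(- 1) ^ L * (of_nat (\<Prod>i<L. M (Suc (j + i))) :: complex) = 1" using one by simp
    have "even L"
    proof (rule ccontr)
      assume "odd L"
      then have "of_nat (\<Prod>i<L. M (Suc (j + i))) = (- 1 :: complex)" using eq by (simp add: minus_equation_iff)
      then have "of_nat (Suc (\<Prod>i<L. M (Suc (j + i)))) = (0 :: complex)" by simp
      then show False by (metis of_nat_eq_0_iff nat.distinct(1))
    qed
    then have "of_nat (\<Prod>i<L. M (Suc (j + i))) = (1 :: complex)" using eq by simp
    then have "(\<Prod>i<L. M (Suc (j + i))) = 1" by (metis of_nat_eq_1_iff)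
    then have M1: "M (Suc (j + i)) = 1" if "i < L" for i
      using dvd_prodI[of "{..<L}" i "\<lambda>i. M (Suc (j + i))"] that by simp
    have "M i = 1" for i
    proof -
      define c where "c = Suc j"
      have e: "c \<le> i + c * L" using L by (cases L) auto
      define i' where "i' = (i + c * L - c) mod L"
      have "i + c * L = Suc (j + i') + ((i + c * L - c) div L) * L"
        using e div_mult_mod_eq[of "i + c * L - c" L] by (simp add: i'_def c_def)
      then have "M (i + c * L) = M (Suc (j + i'))" using per_mult by metis
      then show ?thesis using per_mult[of i c] M1[of i'] L by (simp add: i'_def)
    qed
    then show False using good \<open>even L\<close> by blast
  qed
  have alt: "Y (k + 2 * i) \<noteq> 0" for i
    by (induction i) (use Yk step T0 in \<open>auto simp: numeral_2_eq_2\<close>)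
  have M1: "M (Suc (k + 2 * i)) = 1" "Y (Suc (k + 2 * i)) = 0" for i using step[OF alt T0] by blast+
  \<comment> \<open>Two consecutive degree equations, the second with exponent 1, give B_(k+2i+2) =
    M_(k+2i) B_(k+2i). The weights never decrease along even steps and return after 2 L steps, so
    these exponents are 1 too.\<close>
  have B: "B (k + 2 * Suc i) = M (k + 2 * i) * B (k + 2 * i)" for i
    using deg[of "k + 2 * i"] deg[of "Suc (k + 2 * i)"] M1(1)[of i] by simp
  have Ble: "B (k + 2 * i) \<le> B (k + 2 * (i + c))" for i c
  proof (induction c)
    case (Suc c)
    note Suc
    also have "B (k + 2 * (i + c)) \<le> M (k + 2 * (i + c)) * B (k + 2 * (i + c))" using pos(1)[of "k + 2 * (i + c)"] by simp
    also have "\<dots> = B (k + 2 * Suc (i + c))" by (rule B[symmetric])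
    finally show ?case by simp
  qed simp
  have "M (k + 2 * i) = 1" for i
  proof -
    have "B (k + 2 * i + 2 * L) = B (k + 2 * i)" using per_mult[of "k + 2 * i" 2] by simp
    then have "B (k + 2 * (Suc i + (L - 1))) = B (k + 2 * i)" using L by (simp add: algebra_simps)
    then have "M (k + 2 * i) * B (k + 2 * i) \<le> B (k + 2 * i)" using Ble[of "Suc i" "L - 1"] B[of i] by simp
    then show ?thesis using pos[of "k + 2 * i"] by (cases "M (k + 2 * i)") auto
  qed
  then have Mk: "M (k + i) = 1" for i
    using M1(1) by (cases "even i") (auto elim!: evenE oddE)
  have "M i = 1" for i
  proof -
    have "k \<le> i + k * L" using L by (cases L) auto
    then have "M (i + k * L) = 1" using Mk[of "i + k * L - k"] by simp
    then show ?thesis using per_mult[of i k] by simp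
  qed
  \<comment> \<open>Zeros sit at odd distance from \<open>k\<close>, so an odd period would place
    one at \<open>k + L\<close>, where the value is \<open>Y k\<close>.\<close>
  moreover have "even L"
  proof (rule ccontr)
    assume "odd L"
    then obtain c where "L = 2 * c + 1" by (rule oddE)
    then have "Y (k + L) = 0" using M1(2)[of c] by simp
    then show False using per(1)[of k] Yk by simp
  qed
  ultimately show False using good by blast
qed

lemma exists_primitive_root:
  assumes "prime (p::nat)" "r > 0"
  shows "\<exists>\<zeta>::complex. \<zeta> ^ (p ^ r) = 1 \<and> \<zeta> ^ (p ^ (r - 1)) \<noteq> 1"
proof -
  let ?q = "p ^ r"
  have q: "?q \<noteq> 0" "1 \<le> ?q" using assms(1) prime_gt_0_nat[of p] by auto
  define \<zeta> where "\<zeta> = exp (2 * of_real pi * \<i> * of_nat 1 / of_nat ?q)"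
  have "\<zeta> ^ k = exp (2 * of_real pi * \<i> * of_nat k / of_nat ?q)" for k
    unfolding \<zeta>_def exp_of_nat_mult[symmetric] by (simp add: mult_ac)
  then have "\<zeta> ^ (p ^ (r - 1)) = 1 \<longleftrightarrow> [p ^ (r - 1) = 0] (mod ?q)"
    using complex_root_unity_eq[OF q(2), of "p ^ (r - 1)" 0] by (simp add: cong_0_iff dvd_eq_mod_eq_0)
  moreover have "\<not> [p ^ (r - 1) = 0] (mod ?q)"
  proof
    assume "[p ^ (r - 1) = 0] (mod ?q)"
    then have "p ^ r dvd p ^ (r - 1)" by (simp add: cong_0_iff)
    then have "r \<le> r - 1" using assms(1) prime_gt_1_nat[of p] by (meson power_dvd_imp_le)
    then show False using assms(2) by simp
  qed
  moreover have "\<zeta> ^ ?q = 1" unfolding \<zeta>_def by (rule complex_root_unity[OF q(1)])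
  ultimately show ?thesis by blast
qed

definition monomial_sum :: "nat set \<Rightarrow> (nat \<Rightarrow> (nat \<Rightarrow>\<^sub>0 nat)) \<Rightarrow> cpoly" where
  "monomial_sum I \<mu> = (\<Sum>t\<in>I. Poly_Mapping.single (\<mu> t) 1)"

lemma keys_monomial_sum: "Poly_Mapping.keys (monomial_sum I \<mu>) \<subseteq> \<mu> ` I"
  unfolding monomial_sum_def using keys_sum[of "\<lambda>t. Poly_Mapping.single (\<mu> t) (1::complex)" I] by auto

lemma partial_deriv_sum: "peval (partial_deriv i (sum f S)) x = (\<Sum>s\<in>S. peval (partial_deriv i (f s)) x)"
  by (induction S rule: infinite_finite_induct) (simp_all add: partial_deriv_add, simp_all add: partial_deriv_def)

text \<open>If all exponents are one and \<open>L\<close> is even, the cyclic polynomial is degenerate for \<open>L > 2\<close>, and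
  \<open>\<Sum> x_{2s} x_{2s+1}\<close> is used instead.\<close>

lemma exists_cyclic_polynomial:
  fixes \<sigma> m a :: "nat \<Rightarrow> nat"
  assumes L: "L \<ge> 2" and \<sigma>: "inj_on \<sigma> {..<L}" and a: "\<And>t. t < L \<Longrightarrow> a (\<sigma> t) > 0" and m: "\<And>t. t < L \<Longrightarrow> m t > 0"
    and deg: "\<And>t. t < L \<Longrightarrow> m t * a (\<sigma> t) + a (\<sigma> (Suc t mod L)) = d"
    and p: "prime p" "r > 0" and prod: "[(- 1) ^ L * (\<Prod>t<L. int (m t)) = 1] (mod int (p ^ r))"
  shows "\<exists>K u. (\<forall>\<mu>\<in>Poly_Mapping.keys K. Poly_Mapping.keys \<mu> \<subseteq> \<sigma> ` {..<L} \<and> wdegree a \<mu> = d) \<and>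
    (\<forall>x. (\<forall>t<L. peval (partial_deriv (\<sigma> t) K) x = 0) \<longrightarrow> (\<forall>t<L. x (\<sigma> t) = 0)) \<and>
    (\<forall>i. u i ^ (p ^ r) = (1::complex)) \<and> (\<forall>i. i \<notin> \<sigma> ` {..<L} \<longrightarrow> u i = 1) \<and>
    (\<forall>\<mu>\<in>Poly_Mapping.keys K. mono_val u \<mu> = 1) \<and> u (\<sigma> 0) ^ (p ^ (r - 1)) \<noteq> 1"
proof -
  let ?q = "p ^ r"
  have q0: "?q > 0" using p(1) prime_gt_0_nat[of p] by simp
  obtain \<zeta> :: complex where \<zeta>: "\<zeta> ^ ?q = 1" "\<zeta> ^ (p ^ (r - 1)) \<noteq> 1" using exists_primitive_root[OF p] by blast
  have \<sigma>eq: "\<sigma> s = \<sigma> t \<longleftrightarrow> s = t" if "s < L" "t < L" for s t using \<sigma> that by (auto simp: inj_on_def)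
  have torus: "\<exists>u. (\<forall>i. u i ^ ?q = (1::complex)) \<and> (\<forall>i. i \<notin> \<sigma> ` {..<L} \<longrightarrow> u i = 1) \<and> (\<forall>t<L. u (\<sigma> t) = \<zeta> ^ w t)" for w :: "nat \<Rightarrow> nat"
  proof -
    define u where "u i = (if i \<in> \<sigma> ` {..<L} then \<zeta> ^ w (the_inv_into {..<L} \<sigma> i) else 1)" for i
    have "(\<zeta> ^ n) ^ ?q = 1" for n using \<zeta>(1) by (metis mult.commute power_mult power_one)
    then have "\<forall>i. u i ^ ?q = 1" by (simp add: u_def)
    moreover have "\<forall>t<L. u (\<sigma> t) = \<zeta> ^ w t" by (simp add: u_def the_inv_into_f_f[OF \<sigma>])
    moreover have "\<forall>i. i \<notin> \<sigma> ` {..<L} \<longrightarrow> u i = 1" by (simp add: u_def)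
    ultimately show ?thesis by blast
  qed
  have zpow: "\<zeta> ^ n = 1" if "?q dvd n" for n using that \<zeta>(1) by (metis dvdE power_mult power_one)
  have kmu: "Poly_Mapping.keys (Poly_Mapping.single i e + Poly_Mapping.single j (1::nat)) \<subseteq> {i, j}" for i j e
    using Poly_Mapping.keys_add[of "Poly_Mapping.single i e" "Poly_Mapping.single j (1::nat)"] by (auto split: if_splits)
  show ?thesis
  proof (cases "even L \<and> (\<forall>t<L. m t = 1)")
    case False
    define \<mu> where "\<mu> t = Poly_Mapping.single (\<sigma> t) (m t) + Poly_Mapping.single (\<sigma> (Suc t mod L)) 1" for t
    let ?K = "monomial_sum {..<L} \<mu>"
    have sL: "Suc t mod L < L" for t using L by simp
    have ne: "Suc t mod L \<noteq> t" if "t < L" for t using L that by (cases "Suc t = L") auto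
    have key: "\<exists>t<L. \<nu> = \<mu> t" if "\<nu> \<in> Poly_Mapping.keys ?K" for \<nu> using that keys_monomial_sum[of "{..<L}" \<mu>] by auto
    have K1: "Poly_Mapping.keys (\<mu> t) \<subseteq> \<sigma> ` {..<L} \<and> wdegree a (\<mu> t) = d" if "t < L" for t
    proof
      show "Poly_Mapping.keys (\<mu> t) \<subseteq> \<sigma> ` {..<L}" using kmu[of "\<sigma> t" "m t" "\<sigma> (Suc t mod L)"] that sL[of t] unfolding \<mu>_def by auto
      show "wdegree a (\<mu> t) = d" using deg[OF that] by (simp add: \<mu>_def wdegree_add mult.commute)
    qed
    have K2: "x (\<sigma> t) = 0" if crit: "\<forall>t<L. peval (partial_deriv (\<sigma> t) ?K) x = 0" and t: "t < L" for x t
    proof -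
      define Y where "Y k = x (\<sigma> (k mod L))" for k
      define M where "M k = m (k mod L)" for k
      define B where "B k = a (\<sigma> (k mod L))" for k
      have mm: "k mod L < L" for k using L by simp
      \<comment> \<open>This is the derivative in the variable at position k + 1, which occurs in
        exactly two monomials: its own and that of its predecessor.\<close>
      have "of_nat (M (Suc k)) * Y (Suc k) ^ (M (Suc k) - 1) * Y (Suc (Suc k)) + Y k ^ M k = 0" for k
      proof -
        let ?g = "Suc k mod L" and ?h = "k mod L"
        have gh: "?g = Suc ?h mod L" by (simp add: mod_Suc_eq)
        have gne: "?g \<noteq> ?h" using ne[OF mm[of k]] gh by simp
        have pre: "Suc s mod L = ?g \<longleftrightarrow> s = ?h" if "s < L" for s
        proof
          assume "Suc s mod L = ?g"
          then have "Suc s mod L = Suc ?h mod L" using gh by simp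
          then show "s = ?h" using that mm[of k] by (auto simp: mod_Suc split: if_splits)
        qed (simp add: gh)
        have "0 = peval (partial_deriv (\<sigma> ?g) ?K) x" using crit mm by simp
        also have "\<dots> = (\<Sum>s<L. if \<sigma> ?g = \<sigma> s then of_nat (m s) * x (\<sigma> s) ^ (m s - 1) * x (\<sigma> (Suc s mod L))
            else if \<sigma> ?g = \<sigma> (Suc s mod L) then x (\<sigma> s) ^ m s else 0)"
          unfolding monomial_sum_def partial_deriv_sum \<mu>_def
        proof (intro sum.cong refl partial_deriv_two_var)
          fix s assume "s \<in> {..<L}"
          then have s: "s < L" by simp
          show "\<sigma> s \<noteq> \<sigma> (Suc s mod L)" using \<sigma>eq[OF s sL[of s]] ne[OF s] by simp
        qed
        also have "\<dots> = (\<Sum>s<L. (if s = ?g then of_nat (m s) * x (\<sigma> s) ^ (m s - 1) * x (\<sigma> (Suc s mod L)) else 0)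
            + (if s = ?h then x (\<sigma> s) ^ m s else 0))"
        proof (intro sum.cong refl)
          fix s assume "s \<in> {..<L}"
          then have s: "s < L" by simp
          have e1: "\<sigma> ?g = \<sigma> s \<longleftrightarrow> s = ?g" using \<sigma>eq[OF mm s] by auto
          have e2: "\<sigma> ?g = \<sigma> (Suc s mod L) \<longleftrightarrow> s = ?h" using \<sigma>eq[OF mm sL] pre[OF s] by metis
          show "(if \<sigma> ?g = \<sigma> s then of_nat (m s) * x (\<sigma> s) ^ (m s - 1) * x (\<sigma> (Suc s mod L))
            else if \<sigma> ?g = \<sigma> (Suc s mod L) then x (\<sigma> s) ^ m s else 0) =
            (if s = ?g then of_nat (m s) * x (\<sigma> s) ^ (m s - 1) * x (\<sigma> (Suc s mod L)) else 0)
            + (if s = ?h then x (\<sigma> s) ^ m s else 0)"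
            unfolding e1 e2 using gne by auto
        qed
        also have "\<dots> = of_nat (m ?g) * x (\<sigma> ?g) ^ (m ?g - 1) * x (\<sigma> (Suc ?g mod L)) + x (\<sigma> ?h) ^ m ?h"
          using mm by (simp add: sum.distrib)
        finally show ?thesis by (simp add: Y_def M_def mod_Suc_eq)
      qed
      moreover have "M k > 0" "B k > 0" "M k * B k + B (Suc k) = d" for k
        using m[OF mm] a[OF mm] deg[OF mm, of k] by (simp_all add: M_def B_def mod_Suc_eq)
      moreover have "\<not> (even L \<and> (\<forall>k. M k = 1))"
        using False unfolding M_def by (metis mod_less)
      ultimately have "Y t = 0"
        using L by (intro cyclic_no_critical_point[of L Y M B d]) (simp_all add: Y_def M_def B_def)
      then show ?thesis using t by (simp add: Y_def)
    qed
    \<comment> \<open>The exponents e_0 = 1 and e_(t+1) = - m_t e_t modulo p^r, with p^r - 1 in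
      place of -1 so that they stay natural numbers.\<close>
    define w where "w = rec_nat (1::nat) (\<lambda>t v. v * m t * (?q - 1))"
    have w: "w 0 = 1" "w (Suc t) = w t * m t * (?q - 1)" for t by (simp_all add: w_def)
    obtain u where u: "\<forall>i. u i ^ ?q = (1::complex)" "\<forall>i. i \<notin> \<sigma> ` {..<L} \<longrightarrow> u i = 1" "\<forall>t<L. u (\<sigma> t) = \<zeta> ^ w t"
      using torus[of w] by blast
    have wint: "[int (w t) = (- 1) ^ t * (\<Prod>s<t. int (m s))] (mod int ?q)" for t
    proof (induction t)
      case (Suc t)
      have "int (n - 1) = int n - 1" if "n > 0" for n using that by simp
      from this[OF q0] have "int (?q - 1) = int ?q - 1" .
      moreover have "[int ?q - 1 = - 1] (mod int ?q)" by (simp add: cong_iff_dvd_diff)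
      ultimately have "[int (w t) * int (m t) * int (?q - 1) = ((- 1) ^ t * (\<Prod>s<t. int (m s))) * int (m t) * (- 1)] (mod int ?q)"
        using Suc by (intro cong_mult cong_refl) auto
      then show ?case by (simp add: w mult_ac)
    qed (simp add: w)
    have K3: "mono_val u (\<mu> t) = 1" if t: "t < L" for t
    proof -
      have "mono_val u (\<mu> t) = \<zeta> ^ (w t * m t + w (Suc t mod L))"
        using u(3) t sL[of t] by (simp add: \<mu>_def mono_val_add power_add power_mult)
      also have "?q dvd w t * m t + w (Suc t mod L)"
      proof (cases "Suc t = L")
        case False
        then have "Suc t mod L = Suc t" using t by simp
        then have "w t * m t + w (Suc t mod L) = w t * m t * (1 + (?q - 1))" by (simp add: w)
        also have "1 + (?q - 1) = ?q" using q0 by simp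
        finally show ?thesis by simp
      next
        \<comment> \<open>The last monomial closes the cycle and meets \<open>w 0 = 1\<close>
          instead of the recursion; its invariance is the congruence on the product of all
          exponents.\<close>
        case True
        have "[int (w t) * int (m t) = ((- 1) ^ t * (\<Prod>s<t. int (m s))) * int (m t)] (mod int ?q)"
          using wint by (intro cong_mult cong_refl)
        also have "((- 1) ^ t * (\<Prod>s<t. int (m s))) * int (m t) = - ((- 1) ^ L * (\<Prod>s<L. int (m s)))"
          using True by (simp flip: True)
        also have "[- ((- 1) ^ L * (\<Prod>s<L. int (m s))) = - 1] (mod int ?q)" using prod by (simp add: cong_minus_minus_iff)
        finally have "int ?q dvd int (w t) * int (m t) + 1" by (simp add: cong_iff_dvd_diff)
        then have "int ?q dvd int (w t * m t + 1)" by (simp add: add.commute)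
        then have "?q dvd w t * m t + 1" by (simp only: int_dvd_int_iff)
        then show ?thesis using True by (simp add: w)
      qed
      then have "\<zeta> ^ (w t * m t + w (Suc t mod L)) = 1" by (rule zpow)
      finally show ?thesis .
    qed
    have "u (\<sigma> 0) ^ (p ^ (r - 1)) \<noteq> 1" using u(3) L w(1) \<zeta>(2) by simp
    then show ?thesis
      using key K1 K2 K3 u(1,2) by (intro exI[of _ ?K] exI[of _ u]) metis
  next
    \<comment> \<open>For L = 4 the cyclic form would be (x_0 + x_2)(x_1 + x_3), which is singular.
      With all exponents 1, neighbouring weights add up to \<open>d\<close>, so a perfect pairing of
      the variables has degree \<open>d\<close>, and its gradient permutes the coordinates.\<close>
    case True
    define \<mu> where "\<mu> s = Poly_Mapping.single (\<sigma> (2 * s)) 1 + Poly_Mapping.single (\<sigma> (2 * s + 1)) (1::nat)" for s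
    let ?I = "{..<L div 2}" and ?K = "monomial_sum {..<L div 2} \<mu>"
    have lt: "2 * s < L" "2 * s + 1 < L" if "s < L div 2" for s using that by linarith+
    have key: "\<exists>s<L div 2. \<nu> = \<mu> s" if "\<nu> \<in> Poly_Mapping.keys ?K" for \<nu> using that keys_monomial_sum[of ?I \<mu>] by auto
    have K1: "Poly_Mapping.keys (\<mu> s) \<subseteq> \<sigma> ` {..<L} \<and> wdegree a (\<mu> s) = d" if "s < L div 2" for s
    proof
      show "Poly_Mapping.keys (\<mu> s) \<subseteq> \<sigma> ` {..<L}"
        using kmu[of "\<sigma> (2 * s)" 1 "\<sigma> (2 * s + 1)"] lt[OF that] unfolding \<mu>_def by auto
      show "wdegree a (\<mu> s) = d" using deg[OF lt(1)[OF that]] True lt[OF that] by (simp add: \<mu>_def wdegree_add)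
    qed
    have der: "peval (partial_deriv (\<sigma> t) ?K) x = x (\<sigma> (if even t then t + 1 else t - 1))" if t: "t < L" for x t
    proof -
      have tdiv: "t div 2 < L div 2" using t True by (auto elim!: evenE)
      have "peval (partial_deriv (\<sigma> t) ?K) x = (\<Sum>s\<in>?I. if \<sigma> t = \<sigma> (2 * s) then of_nat 1 * x (\<sigma> (2 * s)) ^ (1 - 1) * x (\<sigma> (2 * s + 1))
          else if \<sigma> t = \<sigma> (2 * s + 1) then x (\<sigma> (2 * s)) ^ 1 else 0)"
        unfolding monomial_sum_def partial_deriv_sum \<mu>_def
      proof (intro sum.cong refl partial_deriv_two_var)
        fix s assume "s \<in> ?I"
        then show "\<sigma> (2 * s) \<noteq> \<sigma> (2 * s + 1)" using \<sigma>eq lt[of s] by simp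
      qed
      also have "\<dots> = (\<Sum>s\<in>?I. if s = t div 2 then x (\<sigma> (if even t then t + 1 else t - 1)) else 0)"
      proof (intro sum.cong refl)
        fix s assume "s \<in> ?I"
        then have l: "2 * s < L" "2 * s + 1 < L" using lt[of s] by auto
        have "\<sigma> t = \<sigma> (2 * s) \<longleftrightarrow> t = 2 * s" "\<sigma> t = \<sigma> (2 * s + 1) \<longleftrightarrow> t = 2 * s + 1" using \<sigma>eq t l by auto
        then show "(if \<sigma> t = \<sigma> (2 * s) then of_nat 1 * x (\<sigma> (2 * s)) ^ (1 - 1) * x (\<sigma> (2 * s + 1))
          else if \<sigma> t = \<sigma> (2 * s + 1) then x (\<sigma> (2 * s)) ^ 1 else 0) =
          (if s = t div 2 then x (\<sigma> (if even t then t + 1 else t - 1)) else 0)"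
          by auto
      qed
      also have "\<dots> = x (\<sigma> (if even t then t + 1 else t - 1))" using tdiv by simp
      finally show ?thesis .
    qed
    have K2: "x (\<sigma> t) = 0" if crit: "\<forall>t<L. peval (partial_deriv (\<sigma> t) ?K) x = 0" and t: "t < L" for x t
    proof (cases "even t")
      case e: True
      have t1: "t + 1 < L" using t e True by (auto elim!: evenE)
      show ?thesis using crit der[OF t1, of x] t1 e by simp
    next
      case o: False
      then have "t - 1 < L" "even (t - 1)" "t - 1 + 1 = t" using t by (auto elim!: oddE)
      then show ?thesis using crit der[of "t - 1" x] by simp
    qed
    \<comment> \<open>The exponents alternate between 1 and -1, the latter written as p^r - 1, and
      cancel in each pair.\<close>
    obtain u where u: "\<forall>i. u i ^ ?q = (1::complex)" "\<forall>i. i \<notin> \<sigma> ` {..<L} \<longrightarrow> u i = 1"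
        "\<forall>t<L. u (\<sigma> t) = \<zeta> ^ (if even t then 1 else ?q - 1)"
      using torus[of "\<lambda>t. if even t then 1 else ?q - 1"] by blast
    have K3: "mono_val u (\<mu> s) = 1" if "s < L div 2" for s
    proof -
      have "mono_val u (\<mu> s) = \<zeta> * \<zeta> ^ (?q - 1)" using u(3) lt[OF that] by (simp add: \<mu>_def mono_val_add)
      also have "\<dots> = \<zeta> ^ ?q" using q0 by (metis Suc_pred' power_Suc)
      finally show ?thesis using \<zeta>(1) by simp
    qed
    have "u (\<sigma> 0) ^ (p ^ (r - 1)) \<noteq> 1" using u(3) L \<zeta>(2) by simp
    then show ?thesis
      using key K1 K2 K3 u(1,2) by (intro exI[of _ ?K] exI[of _ u]) metis
  qed
qed

section \<open>Renaming variables and splitting off a summand\<close>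

definition rename :: "(nat \<Rightarrow> nat) \<Rightarrow> cpoly \<Rightarrow> cpoly" where
  "rename \<sigma> = ring_eval Const (\<lambda>i. Var (\<sigma> i))"

lemma rename_simps:
  "rename \<sigma> (F + G) = rename \<sigma> F + rename \<sigma> G" "rename \<sigma> (F * G) = rename \<sigma> F * rename \<sigma> G"
  "rename \<sigma> (Poly_Mapping.single m c) = Const c * mono_val (\<lambda>i. Var (\<sigma> i)) m"
  unfolding rename_def
  by (simp_all only: comm_ring_hom.ring_eval_add[OF comm_ring_hom_Const] comm_ring_hom.ring_eval_mult[OF comm_ring_hom_Const]
    comm_ring_hom.ring_eval_single[OF comm_ring_hom_Const])

lemma peval_rename: "peval (rename \<sigma> F) x = peval F (\<lambda>i. x (\<sigma> i))"
proof -
  have "vars F \<subseteq> UNIV" by simp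
  then show ?thesis by (induction F rule: cpoly_induct) (simp_all add: rename_simps)
qed

lemma vars_rename: "vars F \<subseteq> I \<Longrightarrow> vars (rename \<sigma> F) \<subseteq> \<sigma> ` I"
proof (induction F rule: cpoly_induct)
  case (add F G)
  then show ?case using vars_add[of "rename \<sigma> F" "rename \<sigma> G"] unfolding rename_simps by blast
next
  case (mult F G)
  then show ?case using vars_mult[of "rename \<sigma> F" "rename \<sigma> G"] unfolding rename_simps by blast
qed (auto simp: rename_simps vars_def)

lemma whomogeneous_rename:
  assumes F: "whomogeneous N (a \<circ> \<sigma>) d F" and \<sigma>: "\<And>i. i \<le> N \<Longrightarrow> \<sigma> i \<le> N"
  shows "whomogeneous N a d (rename \<sigma> F)"
  unfolding rename_def ring_eval_def
proof (rule whomogeneous_sum)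
  fix m assume m: "m \<in> Poly_Mapping.keys F"
  have "whomogeneous N a (\<Sum>i\<in>Poly_Mapping.keys m. Poly_Mapping.lookup m i * a (\<sigma> i)) (mono_val (\<lambda>i. Var (\<sigma> i)) m)"
    unfolding mono_val_def using F m \<sigma>
    by (intro whomogeneous_prod whomogeneous_power whomogeneous_Var) (auto simp: whomogeneous_iff subset_iff)
  moreover have "(\<Sum>i\<in>Poly_Mapping.keys m. Poly_Mapping.lookup m i * a (\<sigma> i)) = d"
    using F m by (auto simp: whomogeneous_iff wdegree_def mult.commute)
  ultimately show "whomogeneous N a d (Const (Poly_Mapping.lookup F m) * mono_val (\<lambda>i. Var (\<sigma> i)) m)"
    using whomogeneous_mult[OF whomogeneous_Const] by fastforce
qed

lemma partial_deriv_rename: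
  assumes "inj \<sigma>"
  shows "peval (partial_deriv (\<sigma> i) (rename \<sigma> F)) x = peval (partial_deriv i F) (\<lambda>i. x (\<sigma> i))"
proof (rule peval_partial_derivI)
  have "(\<lambda>j. (x(\<sigma> i := t)) (\<sigma> j)) = (\<lambda>j. x (\<sigma> j))(i := t)" for t
    using assms by (auto simp: fun_eq_iff inj_def)
  then show "((\<lambda>t. peval (rename \<sigma> F) (x(\<sigma> i := t))) has_field_derivative peval (partial_deriv i F) (\<lambda>i. x (\<sigma> i))) (at (x (\<sigma> i)))"
    unfolding peval_rename using peval_partial_deriv[of F "\<lambda>i. x (\<sigma> i)" i] by simp
qed

lemma vars_partial_deriv: "vars (partial_deriv i F) \<subseteq> vars F"
proof
  fix s assume "s \<in> vars (partial_deriv i F)"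
  then obtain m where m: "m \<in> Poly_Mapping.keys (partial_deriv i F)" "s \<in> Poly_Mapping.keys m" by (auto simp: vars_def)
  then obtain m' where m': "m' \<in> Poly_Mapping.keys F" "m = m' - Poly_Mapping.single i 1"
    using keys_sum[of "\<lambda>m. Poly_Mapping.single (m - Poly_Mapping.single i 1) (of_nat (Poly_Mapping.lookup m i) * Poly_Mapping.lookup F m)" "Poly_Mapping.keys F"]
    unfolding partial_deriv_def by (auto split: if_splits)
  have "s \<in> Poly_Mapping.keys m'" using m(2) unfolding m'(2) in_keys_iff lookup_minus by simp
  then show "s \<in> vars F" using m'(1) by (auto simp: vars_def)
qed

text \<open>\<open>F1\<close> and \<open>F2\<close> may contain opposite constants, so \<open>F2\<close> is normalized to have none.\<close>

lemma split_summand: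
  assumes F: "whomogeneous N b d F" "quasi_smooth N F" and d: "d > 0" and b: "\<And>i. i \<le> N \<Longrightarrow> b i < d"
    and split: "F = F1 + F2" "vars F1 \<subseteq> {0..l}" "vars F2 \<subseteq> {l+1..N}"
  shows "\<exists>G. whomogeneous N b d G \<and> vars G \<subseteq> {l+1..N} \<and>
    (\<forall>y. peval G y = 0 \<longrightarrow> (\<forall>s\<in>{l+1..N}. peval (partial_deriv s G) y = 0) \<longrightarrow> (\<forall>s\<in>{l+1..N}. y s = 0))"
proof -
  define G where "G = F2 - Const (Poly_Mapping.lookup F2 0)"
  define H where "H = F - G"
  have H: "H = F1 + Const (Poly_Mapping.lookup F2 0)" by (simp add: H_def G_def split(1))
  have lG: "Poly_Mapping.lookup G m = (if m = 0 then 0 else Poly_Mapping.lookup F2 m)" for m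
    by (simp add: G_def lookup_minus lookup_single when_def)
  have C: "vars (Const c) = {}" for c by (simp add: vars_def)
  have vG: "vars G \<subseteq> {l+1..N}" using vars_diff[of F2 "Const (Poly_Mapping.lookup F2 0)"] split(3) C unfolding G_def by auto
  have vH: "vars H \<subseteq> {0..l}" using vars_add[of F1 "Const (Poly_Mapping.lookup F2 0)"] split(2) C unfolding H by auto
  have wG: "whomogeneous N b d G" unfolding whomogeneous_iff
  proof
    fix m assume m: "m \<in> Poly_Mapping.keys G"
    then have m0: "m \<noteq> 0" and m2: "m \<in> Poly_Mapping.keys F2" by (auto simp: in_keys_iff lG split: if_splits)
    have "m \<notin> Poly_Mapping.keys F1"
    proof
      assume "m \<in> Poly_Mapping.keys F1"
      then have "Poly_Mapping.keys m \<subseteq> vars F1 \<inter> vars F2" using m2 by (auto simp: vars_def)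
      then have "Poly_Mapping.keys m \<subseteq> {0..l} \<inter> {l+1..N}" using split(2,3) by blast
      then have "Poly_Mapping.keys m = {}" by auto
      then show False using m0 by simp
    qed
    then have "m \<in> Poly_Mapping.keys F" using m2 by (simp add: split(1) in_keys_iff lookup_add)
    then show "Poly_Mapping.keys m \<subseteq> {..N} \<and> wdegree b m = d" using F(1) by (auto simp: whomogeneous_iff)
  qed
  have wH: "whomogeneous N b d H" unfolding H_def by (rule whomogeneous_diff[OF F(1) wG])
  have FHG: "F = H + G" by (simp add: H_def)
  have "y s = 0" if y: "peval G y = 0" "\<forall>s\<in>{l+1..N}. peval (partial_deriv s G) y = 0" and s: "s \<in> {l+1..N}" for y s
  proof (rule ccontr)
    assume ys: "y s \<noteq> 0"
    \<comment> \<open>Extending by zero kills \<open>H\<close> and its partial derivatives, which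
      are homogeneous of positive degree since every weight is less than \<open>d\<close>. A bad
      point of \<open>G\<close> thus becomes a singular point of \<open>F\<close>.\<close>
    define x where "x = (\<lambda>s. if s \<in> {l+1..N} then y s else 0)"
    have xp: "x \<in> punctured_space N" using ys s by (auto simp: punctured_space_def x_def intro!: exI[of _ s])
    have zeroH: "peval K x = 0" if "vars K \<subseteq> vars H" "whomogeneous N b e K" "e > 0" for K e
    proof -
      have "peval K x = peval K (\<lambda>_. 0)" using that(1) vH by (intro peval_cong) (auto simp: x_def)
      then show ?thesis using whomogeneous_at_0[OF that(2,3)] by simp
    qed
    have eqG: "peval K x = peval K y" if "vars K \<subseteq> vars G" for K
      using that vG by (intro peval_cong) (auto simp: x_def)
    have "peval F x = 0" unfolding FHG using zeroH[OF order_refl wH d] eqG[OF order_refl] y(1) by simp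
    then obtain i where i: "i \<le> N" "peval (partial_deriv i F) x \<noteq> 0" using F(2) xp by (auto simp: quasi_smooth_def)
    have "peval (partial_deriv i H) x = 0"
      by (rule zeroH[OF vars_partial_deriv whomogeneous_partial_deriv[OF wH]]) (use b i in auto)
    moreover have "peval (partial_deriv i G) x = 0"
    proof (cases "i \<in> {l+1..N}")
      case True
      then show ?thesis using eqG[OF vars_partial_deriv] y(2) by simp
    next
      case False
      then show ?thesis using vG by (intro partial_deriv_notin) auto
    qed
    ultimately show False using i(2) unfolding FHG by (simp add: partial_deriv_add)
  qed
  then show ?thesis using wG vG by blast
qed

section \<open>Well-formed quasi-smooth surfaces\<close>

text \<open>In the monomial x_l x_i^s at the i-th vertex, s = 0 would mean b_l = d, a linear cone.
  Hence b_i \<le> b_i s \<le> d, and equality with \<open>d\<close> is excluded again.\<close>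

lemma quasi_smooth_weight_less:
  assumes F: "whomogeneous N b d F" "quasi_smooth N F" and d: "d > 0" "\<And>i. i \<le> N \<Longrightarrow> b i \<noteq> d" and i: "i \<le> N"
  shows "b i < d"
proof -
  obtain l s where l: "l \<le> N" "Poly_Mapping.single l 1 + Poly_Mapping.single i s \<in> Poly_Mapping.keys F"
    using quasi_smooth_vertex[OF F i d(1)] by blast
  have "wdegree b (Poly_Mapping.single l 1 + Poly_Mapping.single i s) = d"
    using F(1) l(2) unfolding whomogeneous_iff by blast
  then have e: "b l + b i * s = d" by (simp add: wdegree_add)
  have "s \<noteq> 0" using e d(2)[OF l(1)] by (intro notI) simp
  then have "b i \<le> b i * s" by simp
  then show ?thesis using e d(2)[OF i] by linarith
qed

lemma key_avoiding:
  assumes "\<kappa> \<in> Poly_Mapping.keys F" "i \<notin> Poly_Mapping.keys \<kappa>" "j \<notin> Poly_Mapping.keys \<kappa>"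
  shows "\<exists>v. v i = 0 \<and> v j = 0 \<and> peval F v \<noteq> 0"
proof -
  let ?S = "{m \<in> Poly_Mapping.keys F. Poly_Mapping.keys m \<subseteq> - {i, j}}"
  have "Poly_Mapping.lookup (restrict_vars (- {i, j}) F) \<kappa> = (\<Sum>m\<in>?S. if m = \<kappa> then Poly_Mapping.lookup F m else 0)"
    unfolding restrict_vars_def lookup_sum lookup_single when_def ..
  also have "\<dots> = Poly_Mapping.lookup F \<kappa>"
  proof -
    have "\<kappa> \<in> ?S" using assms by blast
    then show ?thesis by simp
  qed
  also have "\<dots> \<noteq> 0" using assms(1) by (simp add: in_keys_iff)
  finally have "restrict_vars (- {i, j}) F \<noteq> 0" by auto
  then obtain x where "peval (restrict_vars (- {i, j}) F) x \<noteq> 0" using nonzero_on_torus by blast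
  then show ?thesis unfolding peval_restrict_vars by (intro exI[of _ "\<lambda>l. if l \<in> - {i, j} then x l else 0"]) auto
qed

text \<open>For \<open>q\<close> dividing a_k, the vertex monomial x_l x_k^s should avoid two
  variables with weights prime to \<open>q\<close>; only x_l can interfere. If it must, the
  remaining weight a_m is divisible by \<open>q\<close> as well, so \<open>q\<close> divides
  gcd(a_k, a_m), hence \<open>d\<close> and then a_l, a contradiction.\<close>

lemma two_le_codim_surface:
  assumes a: "\<And>i. i \<le> 3 \<Longrightarrow> a i > 0" and wf: "well_formed_space 3 a"
    and F: "whomogeneous 3 a d F" "quasi_smooth 3 F" and d: "d > 0"
    and g: "\<And>k m. k \<le> 3 \<Longrightarrow> m \<le> 3 \<Longrightarrow> k \<noteq> m \<Longrightarrow> gcd (a k) (a m) dvd d"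
  shows "2 \<le> codim (zariski_on 3 a (zero_locus 3 a F)) (zero_locus 3 a F \<inter> singular_locus 3 a)"
proof (rule two_le_codim_singular[OF a F(1)])
  fix q k assume q: "prime q" and k: "k \<le> 3" "q dvd a k"
  obtain l s where l: "l \<le> 3" "Poly_Mapping.single l 1 + Poly_Mapping.single k s \<in> Poly_Mapping.keys F"
    using quasi_smooth_vertex[OF F k(1) d] by blast
  let ?\<kappa> = "Poly_Mapping.single l 1 + Poly_Mapping.single k s"
  have "wdegree a ?\<kappa> = d" using F(1) l(2) unfolding whomogeneous_iff by blast
  then have deg: "a l + a k * s = d" by (simp add: wdegree_add)
  have keys: "Poly_Mapping.keys ?\<kappa> \<subseteq> {l, k}"
    using Poly_Mapping.keys_add[of "Poly_Mapping.single l (1::nat)" "Poly_Mapping.single k s"] by (auto split: if_splits)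
  have "\<exists>i\<le>3. \<exists>j\<le>3. i \<noteq> j \<and> \<not> q dvd a i \<and> \<not> q dvd a j \<and> i \<noteq> l \<and> j \<noteq> l"
  proof (rule ccontr)
    assume no: "\<not> ?thesis"
    obtain i j where ij: "i \<le> 3" "j \<le> 3" "i \<noteq> j" "\<not> q dvd a i" "\<not> q dvd a j"
      using well_formed_two_nondivisible[OF wf q] by blast
    then have l_ij: "l = i \<or> l = j" using no by blast
    have only: "q dvd a h" if "h \<le> 3" "h \<noteq> i" "h \<noteq> j" for h using no ij l_ij that by metis
    have "card {i, j, k} \<le> 3" by (simp add: card_insert_if)
    then have "card ({..3} - {i, j, k}) \<ge> 1" using diff_card_le_card_Diff[of "{i, j, k}" "{..3}"] by simp
    then have "{..3} - {i, j, k} \<noteq> {}" by (metis card.empty not_one_le_zero)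
    then obtain m where m: "m \<le> 3" "m \<noteq> i" "m \<noteq> j" "m \<noteq> k" by blast
    have "q dvd gcd (a k) (a m)" using only[OF m(1-3)] k(2) by simp
    then have "q dvd d" using g[OF k(1) m(1)] m(4) dvd_trans by blast
    then have "q dvd a l" using deg k(2) by (metis dvd_add_left_iff dvd_mult2)
    then show False using l_ij ij by blast
  qed
  then obtain i j where ij: "i \<le> 3" "j \<le> 3" "i \<noteq> j" "\<not> q dvd a i" "\<not> q dvd a j" "i \<noteq> l" "j \<noteq> l" by blast
  have "i \<noteq> k" "j \<noteq> k" using ij k(2) by auto
  then have "\<exists>v. v i = 0 \<and> v j = 0 \<and> peval F v \<noteq> 0" using keys ij by (intro key_avoiding[OF l(2)]) auto
  then show "\<exists>i\<le>3. \<exists>j\<le>3. i \<noteq> j \<and> \<not> q dvd a i \<and> \<not> q dvd a j \<and> (\<exists>v. v i = 0 \<and> v j = 0 \<and> peval F v \<noteq> 0)"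
    using ij by blast
qed

text \<open>The vertex monomial contains x_i because no weight equals \<open>d\<close>. Another
  monomial is free of x_i: otherwise x_i divides the irreducible \<open>F\<close>, which is then a
  constant times x_i and has degree a_i. Two exponents of x_i give a zero on the torus.\<close>

lemma quasi_smooth_torus_point:
  assumes F: "whomogeneous N a d F" "quasi_smooth N F" "Factorial_Ring.irreducible F" and d: "d > 0"
    and a: "\<And>i. i \<le> N \<Longrightarrow> a i < d" and i: "i \<le> N"
  shows "\<exists>x. (\<forall>i. x i \<noteq> 0) \<and> peval F x = 0"
proof -
  have F0: "F \<noteq> 0" by (rule quasi_smooth_nonzero[OF F(2)])
  obtain l s where l: "l \<le> N" "Poly_Mapping.single l 1 + Poly_Mapping.single i s \<in> Poly_Mapping.keys F"
    using quasi_smooth_vertex[OF F(1,2) i d] by blast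
  have "wdegree a (Poly_Mapping.single l 1 + Poly_Mapping.single i s) = d" using F(1) l(2) unfolding whomogeneous_iff by blast
  then have "a l + a i * s = d" by (simp add: wdegree_add)
  then have "s \<noteq> 0" using a[OF l(1)] by (intro notI) simp
  then have k1: "Poly_Mapping.lookup (Poly_Mapping.single l 1 + Poly_Mapping.single i s) i \<noteq> 0" by (simp add: lookup_add)
  obtain e f R where R: "F = Var i ^ e * R" "whomogeneous N a f R" "coeff_in i 0 R \<noteq> 0"
    using extract_power[OF F0 F(1), of i] by blast
  have "e = 0"
  proof (rule ccontr)
    assume "e \<noteq> 0"
    then have e: "F = Var i * (Var i ^ (e - 1) * R)" using R(1) by (metis Suc_pred' gr0I mult.assoc power_Suc)
    have w: "whomogeneous N a ((e - 1) * a i + f) (Var i ^ (e - 1) * R)"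
      by (intro whomogeneous_mult whomogeneous_power whomogeneous_Var i R(2))
    have "\<not> Var i dvd 1" using peval_unit[of "Var i" "\<lambda>_. 0"] by auto
    then have "Var i ^ (e - 1) * R dvd 1" using Factorial_Ring.irreducibleD[OF F(3) e] by blast
    then have "(e - 1) * a i + f = 0" using whomogeneous_at_0[OF w] peval_unit by (metis gr0I)
    then have "whomogeneous N a (a i + 0) F" using whomogeneous_mult[OF whomogeneous_Var[OF i] w] e by metis
    moreover obtain \<kappa> where "\<kappa> \<in> Poly_Mapping.keys F" using F0 by (metis equals0I keys_eq_empty)
    ultimately have "d = a i" using F(1) unfolding whomogeneous_iff by auto
    then show False using a[OF i] by simp
  qed
  then have "coeff_in i 0 F \<noteq> 0" using R by simp
  then obtain \<kappa> where "\<kappa> \<in> Poly_Mapping.keys (coeff_in i 0 F)" by (metis equals0I keys_eq_empty)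
  then have "\<kappa> \<in> Poly_Mapping.keys F" "Poly_Mapping.lookup \<kappa> i = 0" using keys_coeff_in[of \<kappa> i 0 F] by simp_all
  then show ?thesis using torus_point[OF l(2), of \<kappa> i] k1 by simp
qed

lemma cyclic_shift_bij: "L > 0 \<Longrightarrow> bij_betw (\<lambda>t. Suc t mod L) {..<L} {..<L}"
proof -
  assume L: "L > 0"
  have inj: "inj_on (\<lambda>t. Suc t mod L) {..<L}"
    by (auto simp: inj_on_def mod_Suc split: if_splits)
  moreover have "(\<lambda>t. Suc t mod L) ` {..<L} = {..<L}"
    using L by (intro endo_inj_surj inj) auto
  ultimately show ?thesis by (simp add: bij_betw_def)
qed

text \<open>At a critical zero, the derivatives in the first block see only \<open>K\<close> and
  force its coordinates to be 0. Then \<open>K\<close> itself vanishes there, so \<open>G\<close>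
  and its derivatives vanish too, which forces the second block to be 0.\<close>

lemma quasi_smooth_sum:
  assumes \<sigma>: "\<sigma> permutes {..N}" and l: "l \<le> N" and d: "d > 0"
    and K: "whomogeneous N a d K" "vars K \<subseteq> \<sigma> ` {..<Suc l}"
      "\<And>x. (\<forall>t<Suc l. peval (partial_deriv (\<sigma> t) K) x = 0) \<Longrightarrow> \<forall>t<Suc l. x (\<sigma> t) = 0"
    and G: "vars G \<subseteq> {l+1..N}"
      "\<And>y. peval G y = 0 \<Longrightarrow> \<forall>s\<in>{l+1..N}. peval (partial_deriv s G) y = 0 \<Longrightarrow> \<forall>s\<in>{l+1..N}. y s = 0"
  shows "quasi_smooth N (K + rename \<sigma> G)"
  unfolding quasi_smooth_def
proof (intro ballI impI, rule ccontr)
  let ?G = "rename \<sigma> G"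
  fix x assume x: "x \<in> punctured_space N" "peval (K + ?G) x = 0" "\<not> (\<exists>i\<le>N. peval (partial_deriv i (K + ?G)) x \<noteq> 0)"
  have \<sigma>N: "\<sigma> i \<le> N" if "i \<le> N" for i using permutes_in_image[OF \<sigma>, of i] that by simp
  have inj: "inj \<sigma>" by (rule permutes_inj[OF \<sigma>])
  have vG: "vars ?G \<subseteq> \<sigma> ` {l+1..N}" by (rule vars_rename[OF G(1)])
  have sum0: "peval (partial_deriv (\<sigma> t) K) x + peval (partial_deriv (\<sigma> t) ?G) x = 0" if "t \<le> N" for t
    using x(3) \<sigma>N[OF that] by (simp add: partial_deriv_add)
  have dK: "peval (partial_deriv (\<sigma> t) K) x = 0" if "t < Suc l" for t
  proof -
    have "\<sigma> t \<notin> \<sigma> ` {l+1..N}" using that by (simp add: inj_image_mem_iff[OF inj])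
    then have "\<sigma> t \<notin> vars ?G" by (rule contra_subsetD[OF vG])
    then show ?thesis using sum0[of t] partial_deriv_notin[of "\<sigma> t" ?G x] that l by auto
  qed
  have x0: "\<forall>t<Suc l. x (\<sigma> t) = 0" by (rule K(3)[of x]) (simp add: dK)
  have "peval K x = peval K (\<lambda>_. 0)" using K(2) x0 by (intro peval_cong) auto
  then have G0: "peval G (\<lambda>i. x (\<sigma> i)) = 0" using x(2) whomogeneous_at_0[OF K(1) d] by (simp add: peval_rename)
  have dG: "peval (partial_deriv s G) (\<lambda>i. x (\<sigma> i)) = 0" if "s \<in> {l+1..N}" for s
  proof -
    have "\<sigma> s \<notin> \<sigma> ` {..<Suc l}" using that by (simp add: inj_image_mem_iff[OF inj])
    then have "\<sigma> s \<notin> vars K" by (rule contra_subsetD[OF K(2)])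
    then have "peval (partial_deriv (\<sigma> s) K) x = 0" by (rule partial_deriv_notin)
    then show ?thesis using sum0[of s] that partial_deriv_rename[OF inj, of s G x] by simp
  qed
  have x1: "\<forall>s\<in>{l+1..N}. x (\<sigma> s) = 0"
    by (rule G(2)[of "\<lambda>i. x (\<sigma> i)", OF G0]) (intro ballI dG)
  have xs: "x (\<sigma> s) = 0" if "s \<le> N" for s
  proof (cases "s < Suc l")
    case True
    then show ?thesis by (rule x0[rule_format])
  next
    case False
    then have "s \<in> {l+1..N}" using that by simp
    then show ?thesis by (rule x1[rule_format])
  qed
  obtain i where i: "x i \<noteq> 0" using x(1) by (auto simp: punctured_space_def)
  have "i \<le> N" using x(1) i by (auto simp: punctured_space_def not_less[symmetric])
  then have "i \<in> \<sigma> ` {..N}" using permutes_image[OF \<sigma>] by simp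
  then obtain s where "s \<le> N" "i = \<sigma> s" by auto
  then show False using xs[of s] i by simp
qed

section \<open>Construction of the hypersurface \<open>K + rename \<sigma> G\<close> and its
  diagonal automorphism\<close>

theorem proposition2p5:
  fixes n d p r :: nat and a :: "nat \<Rightarrow> nat"
  assumes "n > 0" and "d > 0" and "r > 0" and "prime p" and "d \<ge> 3"
    and "\<forall>i\<le>n+1. a i > 0"
    and "Gcd (a ` {..n+1}) = 1"
    and "well_formed_space (n+1) a"
    and "\<forall>i\<le>n+1. a i \<noteq> d"
    and "\<not> p dvd d"
    and "\<forall>i\<le>n+1. \<forall>j\<le>n+1. i \<noteq> j \<longrightarrow> \<not> int (a i * p) dvd (int d - int (a j))"
    and "n \<ge> 3 \<or> (n = 2 \<and> a 0 + a 1 + a 2 + a 3 \<noteq> d)"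
    and "\<exists>\<sigma> b l. \<sigma> permutes {..n+1} \<and> b = a \<circ> \<sigma> \<and> l \<in> {1..n+1} \<and>
           [d = b 0] (mod b l) \<and> (\<forall>i<l. [d = b (i+1)] (mod b i)) \<and>
           (\<exists>c::int. (of_int c :: rat) =
                (-1) ^ (l+1) * (\<Prod>t=0..l. (of_nat d - of_nat (b t)) / of_nat (b t)) \<and>
              [c = 1] (mod int (p ^ r))) \<and>
           (\<exists>F F1 F2. wf_qs_hypersurface (n+1) b d F \<and> F = F1 + F2 \<and>
              F1 \<in> polys_in {0..l} \<and> F2 \<in> polys_in {l+1..n+1} \<and>
              (l = n+1 \<longrightarrow> F2 = 0))"
  shows "\<exists>F \<phi>. wf_qs_hypersurface (n+1) a d F \<and>
           \<phi> \<in> carrier (var_Aut (n+1) a (zero_locus (n+1) a F)) \<and>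
           group.ord (var_Aut (n+1) a (zero_locus (n+1) a F)) \<phi> = p ^ r"
proof -
  let ?N = "n + 1"
  obtain \<sigma> b l where H: "\<sigma> permutes {..n+1} \<and> b = a \<circ> \<sigma> \<and> l \<in> {1..n+1} \<and>
           [d = b 0] (mod b l) \<and> (\<forall>i<l. [d = b (i+1)] (mod b i)) \<and>
           (\<exists>c::int. (of_int c :: rat) =
                (-1) ^ (l+1) * (\<Prod>t=0..l. (of_nat d - of_nat (b t)) / of_nat (b t)) \<and>
              [c = 1] (mod int (p ^ r))) \<and>
           (\<exists>F F1 F2. wf_qs_hypersurface (n+1) b d F \<and> F = F1 + F2 \<and>
              F1 \<in> polys_in {0..l} \<and> F2 \<in> polys_in {l+1..n+1} \<and>
              (l = n+1 \<longrightarrow> F2 = 0))"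
    using assms(13) by (elim exE) (rule that)
  note \<sigma> = H[THEN conjunct1] and b = H[THEN conjunct2, THEN conjunct1]
    and l0 = H[THEN conjunct2, THEN conjunct2, THEN conjunct1]
  note H' = H[THEN conjunct2, THEN conjunct2, THEN conjunct2]
  note cong = H'[THEN conjunct1] H'[THEN conjunct2, THEN conjunct1]
    and c_ex = H'[THEN conjunct2, THEN conjunct2, THEN conjunct1]
    and F_ex = H'[THEN conjunct2, THEN conjunct2, THEN conjunct2]
  have l: "1 \<le> l" "l \<le> ?N" using l0 by simp_all
  obtain c :: int where c: "(of_int c :: rat) = (-1) ^ (l+1) * (\<Prod>t=0..l. (of_nat d - of_nat (b t)) / of_nat (b t))"
    "[c = 1] (mod int (p ^ r))" using c_ex by blast
  obtain F F1 F2 where F: "wf_qs_hypersurface ?N b d F" "F = F1 + F2" "F1 \<in> polys_in {0..l}" "F2 \<in> polys_in {l+1..?N}"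
    using F_ex by blast
  have hom: "whomogeneous ?N b d F" and qs: "quasi_smooth ?N F"
    using F(1) by (auto simp: wf_qs_hypersurface_def hypersurface_eq_def)
  have \<sigma>N: "\<sigma> i \<le> ?N" if "i \<le> ?N" for i using permutes_in_image[OF \<sigma>, of i] that by simp
  have inj: "inj \<sigma>" by (rule permutes_inj[OF \<sigma>])
  have surj: "\<exists>t\<le>?N. \<sigma> t = s" if "s \<le> ?N" for s
  proof -
    have "s \<in> \<sigma> ` {..?N}" using permutes_image[OF \<sigma>] that by simp
    then show ?thesis by auto
  qed
  have apos: "a i > 0" if "i \<le> ?N" for i using assms(6) that by blast
  have bpos: "b i > 0" if "i \<le> ?N" for i using apos[OF \<sigma>N[OF that]] by (simp add: b)
  have bd: "b i < d" if "i \<le> ?N" for i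
    by (rule quasi_smooth_weight_less[OF hom qs assms(2) _ that]) (use assms(9) \<sigma>N in \<open>auto simp: b\<close>)
  have ad: "a i < d" if "i \<le> ?N" for i using surj[OF that] bd by (auto simp: b)
  define L where "L = Suc l"
  \<comment> \<open>By condition (i), read cyclically with the last index returning to 0, this
    division is exact.\<close>
  define m where "m t = (d - b (Suc t mod L)) div b t" for t
  have LN: "t \<le> ?N" if "t < L" for t using that l by (simp add: L_def)
  have sL: "Suc t mod L < L" for t by (simp add: L_def)
  have deg: "m t * b t = d - b (Suc t mod L)" if t: "t < L" for t
  proof -
    have "[d = b (Suc t mod L)] (mod b t)"
    proof (cases "t = l")
      case False
      then have "t < l" using t by (simp add: L_def)
      then show ?thesis using cong(2) by (simp add: L_def)
    qed (use cong(1) in \<open>simp add: L_def\<close>)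
    then have "b t dvd d - b (Suc t mod L)"
      using bd[OF LN[OF sL[of t]]] by (simp add: cong_altdef_nat less_imp_le)
    then show ?thesis by (simp add: m_def)
  qed
  have mpos: "m t > 0" if "t < L" for t using deg[OF that] bd[OF LN[OF sL[of t]]] by (intro gr0I) simp
  have deg': "m t * a (\<sigma> t) + a (\<sigma> (Suc t mod L)) = d" if "t < L" for t
    using deg[OF that] bd[OF LN[OF sL[of t]]] by (simp add: b)
  \<comment> \<open>The numerators are those of condition (ii) shifted by one step; reindexing along
    the cycle turns that condition into the congruence for the exponents.\<close>
  have prod: "[(- 1) ^ L * (\<Prod>t<L. int (m t)) = 1] (mod int (p ^ r))"
  proof -
    have "(of_nat (m t) :: rat) = (of_nat d - of_nat (b (Suc t mod L))) / of_nat (b t)" if t: "t < L" for t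
    proof -
      have "m t * b t + b (Suc t mod L) = d" using deg'[OF t] by (simp add: b)
      then have "of_nat (m t) * of_nat (b t) + of_nat (b (Suc t mod L)) = (of_nat d :: rat)"
        by (metis of_nat_add of_nat_mult)
      then show ?thesis using bpos[OF LN[OF t]] by (simp add: field_simps)
    qed
    then have "(\<Prod>t<L. (of_nat (m t) :: rat)) = (\<Prod>t<L. of_nat d - of_nat (b (Suc t mod L))) / (\<Prod>t<L. of_nat (b t))"
      by (simp add: prod_dividef)
    also have "(\<Prod>t<L. of_nat d - of_nat (b (Suc t mod L))) = (\<Prod>t<L. (of_nat d - of_nat (b t) :: rat))"
      using prod.reindex_bij_betw[OF cyclic_shift_bij, of L "\<lambda>t. of_nat d - of_nat (b t) :: rat"] by (simp add: L_def)
    also have "\<dots> / (\<Prod>t<L. of_nat (b t)) = (\<Prod>t=0..l. (of_nat d - of_nat (b t)) / of_nat (b t))"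
      unfolding L_def lessThan_Suc_atMost atMost_atLeast0 by (simp add: prod_dividef)
    finally have "(of_int c :: rat) = of_int ((- 1) ^ L * (\<Prod>t<L. int (m t)))"
      using c(1) by (simp add: L_def)
    then have "c = (- 1) ^ L * (\<Prod>t<L. int (m t))" by (simp only: of_int_eq_iff)
    then show ?thesis using c(2) by simp
  qed
  obtain K u where K: "\<forall>\<mu>\<in>Poly_Mapping.keys K. Poly_Mapping.keys \<mu> \<subseteq> \<sigma> ` {..<L} \<and> wdegree a \<mu> = d"
    "\<forall>x. (\<forall>t<L. peval (partial_deriv (\<sigma> t) K) x = 0) \<longrightarrow> (\<forall>t<L. x (\<sigma> t) = 0)"
    and u: "\<forall>i. u i ^ (p ^ r) = (1::complex)" "\<forall>i. i \<notin> \<sigma> ` {..<L} \<longrightarrow> u i = 1"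
      "\<forall>\<mu>\<in>Poly_Mapping.keys K. mono_val u \<mu> = 1" "u (\<sigma> 0) ^ (p ^ (r - 1)) \<noteq> 1"
  proof -
    have "inj_on \<sigma> {..<L}" using inj by (rule inj_on_subset) simp
    moreover have "a (\<sigma> t) > 0" if "t < L" for t using apos \<sigma>N LN that by blast
    ultimately show thesis
      using exists_cyclic_polynomial[of L \<sigma> a m d p r, OF _ _ _ mpos deg' assms(4,3) prod] l that by (auto simp: L_def)
  qed
  \<comment> \<open>From the given polynomial only the part in the variables after \<open>l\<close>
    is retained; the other summand is replaced by \<open>K\<close>.\<close>
  obtain G where G: "whomogeneous ?N b d G" "vars G \<subseteq> {l+1..?N}"
    "\<forall>y. peval G y = 0 \<longrightarrow> (\<forall>s\<in>{l+1..?N}. peval (partial_deriv s G) y = 0) \<longrightarrow> (\<forall>s\<in>{l+1..?N}. y s = 0)"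
    using split_summand[OF hom qs assms(2) bd F(2), of l] F(3,4) by (auto simp: polys_in_def)
  let ?G = "rename \<sigma> G"
  let ?F = "K + ?G"
  have Kw: "whomogeneous ?N a d K" unfolding whomogeneous_iff using K(1) \<sigma>N LN by fastforce
  have Kv: "vars K \<subseteq> \<sigma> ` {..<L}" using K(1) by (auto simp: vars_def)
  have Gw: "whomogeneous ?N a d ?G" using whomogeneous_rename[of ?N a \<sigma> d G] G(1) \<sigma>N by (simp add: b)
  have Gv: "vars ?G \<subseteq> \<sigma> ` {l+1..?N}" by (rule vars_rename[OF G(2)])
  have Fw: "whomogeneous ?N a d ?F" by (rule whomogeneous_add[OF Kw Gw])
  have Fqs: "quasi_smooth ?N ?F"
    using K(2) Kv G(2,3) unfolding L_def by (intro quasi_smooth_sum[OF \<sigma> l(2) assms(2) Kw]) blast+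
  have irr: "Factorial_Ring.irreducible ?F"
    using assms(12) by (intro quasi_smooth_irreducible[OF Fw assms(2) Fqs _ apos]) auto
  have codim: "2 \<le> codim (zariski_on ?N a (zero_locus ?N a ?F)) (zero_locus ?N a ?F \<inter> singular_locus ?N a)"
  proof (cases "n \<ge> 3")
    case True
    show ?thesis
    proof (rule two_le_codim_singular[OF apos Fw])
      fix q k :: nat assume "prime q"
      then obtain i j where ij: "i \<le> ?N" "j \<le> ?N" "i \<noteq> j" "\<not> q dvd a i" "\<not> q dvd a j"
        using well_formed_two_nondivisible[OF assms(8)] by blast
      then show "\<exists>i\<le>?N. \<exists>j\<le>?N. i \<noteq> j \<and> \<not> q dvd a i \<and> \<not> q dvd a j \<and> (\<exists>v. v i = 0 \<and> v j = 0 \<and> peval ?F v \<noteq> 0)"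
        using quasi_smooth_no_coordinate_subspace[OF Fw Fqs _ apos ij(1-3) ad[OF ij(1)] ad[OF ij(2)]] True by auto
    qed
  next
    case False
    then have N3: "?N = 3" using assms(12) by simp
    \<comment> \<open>The given hypersurface has the reordered weights \<open>b\<close>; its
      pairwise divisibility conditions are carried back along the permutation.\<close>
    have gcd: "gcd (a k) (a m) dvd d" if km: "k \<le> 3" "m \<le> 3" "k \<noteq> m" for k m
    proof -
      obtain k' m' where k': "k' \<le> 3" "\<sigma> k' = k" and m': "m' \<le> 3" "\<sigma> m' = m"
        using surj km(1,2) unfolding N3 by metis
      have "gcd (b k') (b m') dvd d"
        using well_formed_surface_gcd[of b d F k' m'] F(1) bpos k' m' km(3) unfolding N3 by auto
      then show ?thesis using k' m' by (simp add: b)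
    qed
    show ?thesis
      using two_le_codim_surface[of a d ?F] apos assms(2,8) Fw Fqs gcd unfolding N3 by blast
  qed
  have wf: "wf_qs_hypersurface ?N a d ?F"
    using Fw irr Fqs assms(8) codim
    by (simp add: wf_qs_hypersurface_def hypersurface_eq_def well_formed_hypersurface_def)
  \<comment> \<open>Monomials of \<open>K\<close> are invariant by the choice of \<open>u\<close>,
    those of the other summand because \<open>u\<close> is 1 on their variables.\<close>
  have inv: "mono_val u \<mu> = 1" if "\<mu> \<in> Poly_Mapping.keys ?F" for \<mu>
  proof -
    have "\<mu> \<in> Poly_Mapping.keys K \<or> \<mu> \<in> Poly_Mapping.keys ?G" using that Poly_Mapping.keys_add[of K ?G] by blast
    then show ?thesis
    proof
      assume "\<mu> \<in> Poly_Mapping.keys ?G"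
      then have "Poly_Mapping.keys \<mu> \<subseteq> \<sigma> ` {l+1..?N}" using Gv by (auto simp: vars_def)
      moreover have "\<sigma> ` {l+1..?N} \<inter> \<sigma> ` {..<L} = {}"
        unfolding image_Int[OF inj, symmetric] by (auto simp: L_def)
      ultimately have "i \<notin> \<sigma> ` {..<L}" if "i \<in> Poly_Mapping.keys \<mu>" for i
        using that by blast
      then show ?thesis using u(2) by (simp add: mono_val_def)
    qed (use u(3) in blast)
  qed
  obtain x where x: "\<forall>i. x i \<noteq> 0" "peval ?F x = 0"
    using quasi_smooth_torus_point[OF Fw Fqs irr assms(2) ad, of 0] by auto
  have "\<exists>\<phi>\<in>carrier (var_Aut ?N a (zero_locus ?N a ?F)). group.ord (var_Aut ?N a (zero_locus ?N a ?F)) \<phi> = p ^ r"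
    using diagonal_automorphism_order[OF Fw quasi_smooth_nonzero[OF Fqs] assms(4,3,10,7) _ inv \<sigma>N u(4) x] u(1) by simp
  then show ?thesis using wf by blast
qed

end
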